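(* Assume that $c\in(1,30/29)$ and $h\in\mathcal{F}_c$. Let $(X,\mathcal{B}(X),\mu,T)$ be a dynamical system, where $\mu$ is a $\sigma$-finite measure and $T$ is an invertible and measure preserving transformation on $X$. Then for every $1\le p<\infty$ and every $f\in L^p(X,\mu)$, the ergodic averages $$A_{h,N}f(x)=\frac{1}{|\mathbf{N}_h\cap[1,N]|}\sum_{n\in\mathbf{N}_h\cap[1,N]}f(T^nx),\qquad x\in X,$$ converge $\mu$-almost everywhere on $X$ as $N\to\infty$.
   Context: $\mathbb{N}=\{1,2,3,\dots\}$. For $c\in(1,2)$, $\mathcal{F}_c$ is the family of all functions $h:[x_0,\infty)\to[1,\infty)$ (for some $x_0\ge1$) such that: (i) $h\in\mathcal{C}^3([x_0,\infty))$ and $h'(x)>0$, $h''(x)>0$ for every $x\ge x_0$; (ii) there exist a real-valued function $\vartheta\in\mathcal{C}^3([x_0,\infty))$ and a constant $C_h>0$ such that $h(x)=C_hx^c\ell_h(x)$ with $\ell_h(x)=e^{\int_{x_0}^x\frac{\vartheta(t)}{t}dt}$ for every $x\ge x_0$, and $\lim_{x\to\infty}\vartheta(x)=\lim_{x\to\infty}x\vartheta'(x)=\lim_{x\to\infty}x^2\vartheta''(x)=\lim_{x\to\infty}x^3\vartheta'''(x)=0$. $\mathbf{N}_h=\{n\in\mathbb{N}:\ \exists\, m\in\mathbb{N},\ m\ge x_0,\ n=\lfloor h(m)\rfloor\}$; the averages are considered for $N$ large enough that $\mathbf{N}_h\cap[1,N]\neq\emptyset$. *)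

theory Defs
  imports "HOL-Analysis.Analysis"
begin

(* Derivatives are taken within S, hence one-sided at an endpoint of S; values of f outside S
   play no role. *)
definition deriv_on :: "real set \<Rightarrow> (real \<Rightarrow> real) \<Rightarrow> real \<Rightarrow> real" where
  "deriv_on S f x = vector_derivative f (at x within S)"

definition C_on :: "nat \<Rightarrow> real set \<Rightarrow> (real \<Rightarrow> real) \<Rightarrow> bool" where
  "C_on k S f \<longleftrightarrow>
     (\<forall>i<k. (deriv_on S ^^ i) f differentiable_on S) \<and> continuous_on S ((deriv_on S ^^ k) f)"

lemma deriv_on_atLeast_eq:
  assumes "x \<ge> a" and "(f has_real_derivative D) (at x within {a..})"
  shows "deriv_on {a..} f x = D"
proof -
  have "x islimpt {x..x + 1}"
    by (simp add: islimpt_Icc)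
  hence "x islimpt {a..}"
    by (rule islimpt_subset) (use assms(1) in auto)
  hence "at x within {a..} \<noteq> bot"
    by (simp add: trivial_limit_within)
  thus ?thesis
    unfolding deriv_on_def
    using assms(2) by (intro vector_derivative_within)
      (auto simp: has_real_derivative_iff_has_vector_derivative)
qed

(* The left endpoint x0 of the domain of h is carried explicitly; h is a total function
   of which only the restriction to [x0, \<infinity>) matters. *)
definition family_F :: "real \<Rightarrow> real \<Rightarrow> (real \<Rightarrow> real) \<Rightarrow> bool" where
  "family_F c x0 h \<longleftrightarrow>
     x0 \<ge> 1 \<and> (\<forall>x\<ge>x0. h x \<ge> 1) \<and>
     C_on 3 {x0..} h \<and>
     (\<forall>x\<ge>x0. deriv_on {x0..} h x > 0 \<and> (deriv_on {x0..} ^^ 2) h x > 0) \<and>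
     (\<exists>\<theta> C. C_on 3 {x0..} \<theta> \<and> C > 0 \<and>
        (\<forall>x\<ge>x0. h x = C * x powr c * exp (integral {x0..x} (\<lambda>t. \<theta> t / t))) \<and>
        (\<forall>i\<le>3. ((\<lambda>x. x ^ i * (deriv_on {x0..} ^^ i) \<theta> x) \<longlongrightarrow> 0) at_top))"

definition floor_values :: "real \<Rightarrow> (real \<Rightarrow> real) \<Rightarrow> nat set" where
  "floor_values x0 h =
     {n. n \<ge> 1 \<and> (\<exists>m::nat. m \<ge> 1 \<and> real m \<ge> x0 \<and> int n = \<lfloor>h (real m)\<rfloor>)}"

definition invertible_measure_preserving :: "'a measure \<Rightarrow> ('a \<Rightarrow> 'a) \<Rightarrow> bool" where
  "invertible_measure_preserving M T \<longleftrightarrow>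
     bij_betw T (space M) (space M) \<and>
     T \<in> measurable M M \<and> the_inv_into (space M) T \<in> measurable M M \<and>
     (\<forall>A\<in>sets M. emeasure M (T -` A \<inter> space M) = emeasure M A)"

(* L^p as a set of functions (not of classes modulo almost everywhere equality), 0 < p < \<infinity>. *)
definition Lp_functions :: "'a measure \<Rightarrow> real \<Rightarrow> ('a \<Rightarrow> complex) set" where
  "Lp_functions M p =
     {f. f \<in> borel_measurable M \<and> integrable M (\<lambda>x. norm (f x) powr p)}"

(* If E contains no element of [1, N], the value is 0. *)
definition ergodic_average ::
  "nat set \<Rightarrow> ('a \<Rightarrow> 'a) \<Rightarrow> ('a \<Rightarrow> complex) \<Rightarrow> nat \<Rightarrow> 'a \<Rightarrow> complex" where
  "ergodic_average E T f N x =
     (\<Sum>n\<in>E \<inter> {1..N}. f ((T ^^ n) x)) / of_nat (card (E \<inter> {1..N}))"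

end

theory Submission
  imports Defs "HOL-Real_Asymp.Real_Asymp"
begin

text \<open>
  Let \<open>\<phi>\<close> be the inverse of \<open>h\<close> and \<open>d n = \<phi> (n + 1) - \<phi> n\<close>. For large \<open>n\<close> the set contains \<open>n\<close>
  iff \<open>[\<phi> n, \<phi> (n + 1))\<close> contains an integer, so it has density \<open>d n \<approx> n powr (1 / c - 1)\<close> near \<open>n\<close>,
  and \<open>c < 30 / 29\<close> means that \<open>d n\<close> decays more slowly than \<open>n powr (- 1 / 30)\<close>.

  The weak type (1,1) maximal inequality holds on the integers and is transferred to \<open>X\<close> along
  orbits. On the integers the dyadic averages are dominated by convolution with kernels
  \<open>K k n = F (\<phi> n) / 2 ^ k\<close>, where \<open>F\<close> is a Fejer kernel of order about \<open>1 / d\<close>. The autocorrelation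
  of \<open>K k\<close> is a Lipschitz kernel up to a small error and a peak at the origin, by an elementary
  bound for exponential sums with phases \<open>j \<phi> (n) - l \<phi> (n + x)\<close>; an \<open>L\<^sup>2\<close> argument on the bad part
  of a Calderon-Zygmund decomposition then gives the weak type bound.

  For bounded integrable functions, \<open>1\<^sub>E - d\<close> is a difference of sawtooth functions of \<open>\<phi>\<close>. After
  Fejer smoothing of the sawtooth, the same exponential sums control the \<open>L\<^sup>2\<close> norms of the averages
  against \<open>1\<^sub>E - d\<close> over the blocks \<open>[k ^ 6, (k + 1) ^ 6)\<close>, which are square summable; the averages
  weighted by \<open>d\<close> converge by Birkhoff's theorem and summation by parts. The maximal inequality extends
  convergence to \<open>L\<^sup>1\<close>, and \<open>L\<^sup>p\<close> reduces to \<open>L\<^sup>1\<close> because \<open>f\<close> restricted to \<open>\<bar>f\<bar> > \<epsilon>\<close> is integrable.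
\<close>

section \<open>Exponential sums\<close>

text \<open>At p = 1 interpolation is of no help, and \<open>E\<close> is too sparse for its
  averages to be dominated by those over intervals. The obstacle shows in the autocorrelation of a
  normalized block: at the origin it has a peak of height about 1 over the number of points, and the
  usual Calderon-Zygmund argument has no place for it. The remedy is to cut f off at height l times
  the number of points, separately at each scale. The number of points grows geometrically, so both
  the exceptional sets caused by the cutoffs and the square sums that meet the peaks add up over all
  scales to the norm of f in L^1. Away from the peak the arithmetic has to supply very little: an
  error relative to a tent function that is summable over dyadic scales. A majorant of the set is
  enough there, and a Fejer kernel is nonnegative and at the same time a trigonometric polynomial.
  For the dense class positivity is lost, but only bounded functions have to be treated, so the
  smoothing error can be counted pointwise. All losses are powers of 1 / d, which are small powers
  of n; this is what the exponent 1/30 pays for.\<close>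

definition unit_exp :: "real \<Rightarrow> complex" where
  "unit_exp t = cis (2 * pi * t)"

lemma norm_unit_exp [simp]: "norm (unit_exp t) = 1"
  by (simp add: unit_exp_def)

lemma unit_exp_0 [simp]: "unit_exp 0 = 1"
  by (simp add: unit_exp_def)

lemma unit_exp_add: "unit_exp (s + t) = unit_exp s * unit_exp t"
  by (simp add: unit_exp_def cis_mult distrib_left)

lemma cnj_unit_exp: "cnj (unit_exp t) = unit_exp (- t)"
  by (simp add: unit_exp_def cis_cnj)

lemma unit_exp_int [simp]: "unit_exp (of_int k) = 1"
  by (simp add: unit_exp_def)

lemma unit_exp_add_int [simp]: "unit_exp (t + of_int k) = unit_exp t"
  by (simp add: unit_exp_add)

lemma unit_exp_of_nat_mult: "unit_exp (real n * t) = unit_exp t ^ n"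
  unfolding unit_exp_def Complex.DeMoivre by (rule arg_cong[of _ _ cis]) simp

text \<open>Jordan's inequality: sine is concave on this interval and lies above its chord.\<close>

lemma sin_ge_linear:
  assumes "0 \<le> x" "x \<le> pi / 2"
  shows "2 * x / pi \<le> sin x"
proof -
  have cv: "convex_on {0..pi/2} (\<lambda>x. - sin x)"
  proof (rule f''_ge0_imp_convex)
    show "((\<lambda>x. - sin x) has_real_derivative - cos x) (at x)" for x :: real
      by (auto intro!: derivative_eq_intros)
    show "((\<lambda>x. - cos x) has_real_derivative sin x) (at x)" for x :: real
      by (auto intro!: derivative_eq_intros)
    show "0 \<le> sin x" if "x \<in> {0..pi/2}" for x
      using that by (intro sin_ge_zero) auto
  qed auto
  define t where "t = 2 * x / pi"
  have t: "0 \<le> t" "t \<le> 1" using assms by (auto simp: t_def field_simps)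
  have "- sin ((1 - t) *\<^sub>R 0 + t *\<^sub>R (pi / 2)) \<le> (1 - t) * (- sin 0) + t * (- sin (pi / 2))"
    by (rule convex_onD[OF cv]) (use t in auto)
  moreover have "t * (pi / 2) = x" by (simp add: t_def)
  ultimately show ?thesis by (simp add: t_def)
qed

lemma norm_unit_exp_minus_1: "norm (unit_exp t - 1) = 2 * \<bar>sin (pi * t)\<bar>"
proof -
  have "(norm (unit_exp t - 1))\<^sup>2 = (cos (2 * (pi * t)) - 1)\<^sup>2 + (sin (2 * (pi * t)))\<^sup>2"
    by (simp add: unit_exp_def cmod_power2 mult_ac)
  also have "\<dots> = (2 * \<bar>sin (pi * t)\<bar>)\<^sup>2"
    unfolding cos_double_sin sin_double
    using sin_cos_squared_add[of "pi * t"] by (simp only: power_mult_distrib power2_abs) algebra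
  finally show ?thesis by (rule power2_eq_imp_eq) auto
qed

lemma norm_unit_exp_minus_1_ge:
  assumes "\<bar>t\<bar> \<le> 1 / 2"
  shows "4 * \<bar>t\<bar> \<le> norm (unit_exp t - 1)"
proof -
  have "\<bar>sin (pi * t)\<bar> = \<bar>sin (pi * \<bar>t\<bar>)\<bar>" by (cases "t \<ge> 0") auto
  moreover have "2 * \<bar>t\<bar> \<le> sin (pi * \<bar>t\<bar>)"
    using sin_ge_linear[of "pi * \<bar>t\<bar>"] assms by (simp add: field_simps)
  ultimately show ?thesis by (simp add: norm_unit_exp_minus_1)
qed

lemma norm_unit_exp_diff_le: "norm (unit_exp s - unit_exp t) \<le> 2 * pi * \<bar>s - t\<bar>"
proof -
  have "unit_exp s - unit_exp t = unit_exp t * (unit_exp (s - t) - 1)"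
    using unit_exp_add[of t "s - t"] by (simp add: algebra_simps)
  then have "norm (unit_exp s - unit_exp t) = 2 * \<bar>sin (pi * (s - t))\<bar>"
    by (simp add: norm_mult norm_unit_exp_minus_1)
  also have "\<dots> \<le> 2 * \<bar>pi * (s - t)\<bar>" by (intro mult_left_mono abs_sin_x_le_abs_x) auto
  finally show ?thesis by (simp add: abs_mult)
qed

text \<open>The Kusmin-Landau argument: each term is \<open>w n\<close> times a difference of
  successive exponentials, and Abel summation leaves the variation of \<open>w\<close>. It is stated
  with the variation \<open>V\<close> of the increments instead of their monotonicity, because it is
  applied to differences of two monotone sequences.\<close>

lemma exp_sum_bound:
  fixes f :: "nat \<Rightarrow> real"
  defines "\<Delta> \<equiv> \<lambda>n. f (Suc n) - f n"
  assumes "0 < \<mu>" "0 \<le> V"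
    and \<Delta>: "\<And>n. a \<le> n \<Longrightarrow> n < b \<Longrightarrow> \<mu> \<le> \<bar>\<Delta> n\<bar> \<and> \<bar>\<Delta> n\<bar> \<le> 1 / 2"
    and V: "(\<Sum>n\<in>{a..<b-1}. \<bar>\<Delta> (Suc n) - \<Delta> n\<bar>) \<le> V"
  shows "norm (\<Sum>n\<in>{a..<b}. unit_exp (f n)) \<le> 1 / \<mu> + V / \<mu>\<^sup>2"
proof (cases "a < b")
  case False
  then show ?thesis using assms(2,3) by simp
next
  case True
  define u where "u = (\<lambda>n. unit_exp (f n))"
  define w where "w = (\<lambda>n. 1 / (unit_exp (\<Delta> n) - 1))"
  have nz: "4 * \<mu> \<le> norm (unit_exp (\<Delta> n) - 1)" if "a \<le> n" "n < b" for n
    using norm_unit_exp_minus_1_ge[of "\<Delta> n"] \<Delta>[OF that] by linarith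
  have w: "norm (w n) \<le> 1 / (4 * \<mu>)" if "a \<le> n" "n < b" for n
    using nz[OF that] assms(2) by (auto simp: w_def norm_divide intro!: divide_left_mono mult_pos_pos)
  have u: "u n = w n * (u (Suc n) - u n)" if "a \<le> n" "n < b" for n
  proof -
    have "u (Suc n) = u n * unit_exp (\<Delta> n)"
      unfolding u_def \<Delta>_def by (simp flip: unit_exp_add)
    moreover have "unit_exp (\<Delta> n) - 1 \<noteq> 0" using nz[OF that] assms(2) by auto
    ultimately show ?thesis by (simp add: w_def field_simps)
  qed
  have abel: "a < m \<Longrightarrow> (\<Sum>n\<in>{a..<m}. w n * (u (Suc n) - u n)) =
     w (m - 1) * u m - w a * u a - (\<Sum>n\<in>{a..<m-1}. (w (Suc n) - w n) * u (Suc n))" for m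
  proof (induction m)
    case (Suc m)
    show ?case
    proof (cases "a = m")
      case False
      with Suc.prems have am: "a < m" by simp
      then obtain m' where m': "m = Suc m'" "a \<le> m'" by (cases m) auto
      show ?thesis using Suc.IH[OF am] am m' by (simp add: algebra_simps)
    qed (simp add: algebra_simps)
  qed simp
  have dw: "norm (w (Suc n) - w n) \<le> \<bar>\<Delta> (Suc n) - \<Delta> n\<bar> / (2 * \<mu>\<^sup>2)" if n: "a \<le> n" "n < b - 1" for n
  proof -
    have 1: "unit_exp (\<Delta> n) - 1 \<noteq> 0" "unit_exp (\<Delta> (Suc n)) - 1 \<noteq> 0"
      using nz[of n] nz[of "Suc n"] n assms(2) by fastforce+
    have "w (Suc n) - w n = (unit_exp (\<Delta> n) - unit_exp (\<Delta> (Suc n))) * (w n * w (Suc n))"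
      using 1 by (simp add: w_def field_simps)
    then have "norm (w (Suc n) - w n) = norm (unit_exp (\<Delta> n) - unit_exp (\<Delta> (Suc n))) * (norm (w n) * norm (w (Suc n)))"
      by (simp add: norm_mult)
    also have "\<dots> \<le> (2 * pi * \<bar>\<Delta> n - \<Delta> (Suc n)\<bar>) * (1 / (4 * \<mu>) * (1 / (4 * \<mu>)))"
      using n assms(2) by (intro mult_mono norm_unit_exp_diff_le w) auto
    also have "\<dots> = pi * (\<bar>\<Delta> (Suc n) - \<Delta> n\<bar> / (8 * \<mu>\<^sup>2))"
      by (simp add: power2_eq_square abs_minus_commute)
    also have "\<dots> \<le> 4 * (\<bar>\<Delta> (Suc n) - \<Delta> n\<bar> / (8 * \<mu>\<^sup>2))"
      using pi_less_4 by (intro mult_right_mono) auto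
    finally show ?thesis by simp
  qed
  have "(\<Sum>n\<in>{a..<b}. unit_exp (f n)) = (\<Sum>n\<in>{a..<b}. w n * (u (Suc n) - u n))"
    using u by (intro sum.cong) (auto simp: u_def)
  also have "\<dots> = w (b - 1) * u b - w a * u a - (\<Sum>n\<in>{a..<b-1}. (w (Suc n) - w n) * u (Suc n))"
    by (rule abel) fact
  also have "norm \<dots> \<le> norm (w (b - 1) * u b) + norm (w a * u a)
      + norm (\<Sum>n\<in>{a..<b-1}. (w (Suc n) - w n) * u (Suc n))"
    by (meson norm_triangle_ineq4 order_trans add_mono order_refl)
  also have "\<dots> \<le> 1 / (4 * \<mu>) + 1 / (4 * \<mu>) + (\<Sum>n\<in>{a..<b-1}. \<bar>\<Delta> (Suc n) - \<Delta> n\<bar> / (2 * \<mu>\<^sup>2))"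
    using True w[of "b - 1"] w[of a] dw
    by (intro add_mono sum_norm_le) (auto simp: norm_mult u_def)
  also have "\<dots> \<le> 1 / (4 * \<mu>) + 1 / (4 * \<mu>) + V / (2 * \<mu>\<^sup>2)"
    using V by (auto simp flip: sum_divide_distrib intro!: divide_right_mono)
  also have "\<dots> \<le> 1 / \<mu> + V / \<mu>\<^sup>2"
    using assms(2,3) by (intro add_mono) (auto simp: field_simps)
  finally show ?thesis .
qed

lemma geometric_unit_exp_bound:
  assumes "norm (unit_exp u - 1) \<ge> \<delta>" "\<delta> > 0"
  shows "norm (\<Sum>j\<in>{a..<b}. unit_exp (real j * u)) \<le> 2 / \<delta>"
proof (cases "a \<le> b")
  case True
  have "(\<Sum>j\<in>{a..<b}. unit_exp (real j * u)) * (unit_exp u - 1) = unit_exp u ^ b - unit_exp u ^ a"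
  proof -
    have "(\<Sum>j\<in>{a..<b}. unit_exp u ^ j) * (unit_exp u - 1) = (\<Sum>j\<in>{a..<b}. unit_exp u ^ Suc j - unit_exp u ^ j)"
      unfolding sum_distrib_right by (intro sum.cong) (simp_all add: algebra_simps)
    also have "\<dots> = unit_exp u ^ b - unit_exp u ^ a"
      using True by (rule sum_Suc_diff')
    finally show ?thesis by (simp add: unit_exp_of_nat_mult)
  qed
  then have "norm (\<Sum>j\<in>{a..<b}. unit_exp (real j * u)) * norm (unit_exp u - 1) \<le> 2"
    by (metis norm_mult norm_triangle_ineq4 norm_power norm_unit_exp power_one one_add_one)
  moreover have "norm (\<Sum>j\<in>{a..<b}. unit_exp (real j * u)) * \<delta>
      \<le> norm (\<Sum>j\<in>{a..<b}. unit_exp (real j * u)) * norm (unit_exp u - 1)"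
    using assms by (intro mult_left_mono) auto
  ultimately show ?thesis using assms by (simp add: field_simps)
qed (use assms in auto)

text \<open>A monotone sequence comes close to a given value on one interval of indices only; on the
  two outer intervals it keeps its distance. Each of the three may be empty.\<close>

lemma mono_three_intervals:
  fixes r :: "nat \<Rightarrow> real"
  assumes mono: "\<And>n n'. p \<le> n \<Longrightarrow> n \<le> n' \<Longrightarrow> n' < q \<Longrightarrow> r n \<le> r n'"
    and "p \<le> q" "\<alpha> < \<beta>"
  obtains p1 q1 where "p \<le> p1" "p1 \<le> q1" "q1 \<le> q"
    "\<And>n. p \<le> n \<Longrightarrow> n < p1 \<Longrightarrow> r n \<le> \<alpha>"
    "\<And>n. p1 \<le> n \<Longrightarrow> n < q1 \<Longrightarrow> \<alpha> < r n \<and> r n < \<beta>"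
    "\<And>n. q1 \<le> n \<Longrightarrow> n < q \<Longrightarrow> \<beta> \<le> r n"
proof -
  define p1 where "p1 = (LEAST n. p \<le> n \<and> (n < q \<longrightarrow> \<alpha> < r n))"
  define q1 where "q1 = (LEAST n. p1 \<le> n \<and> (n < q \<longrightarrow> \<beta> \<le> r n))"
  have p1: "p \<le> p1 \<and> (p1 < q \<longrightarrow> \<alpha> < r p1)" "p1 \<le> q"
    unfolding p1_def by (rule LeastI[of _ q], use assms(2) in simp) (rule Least_le, use assms(2) in simp)
  have q1: "p1 \<le> q1 \<and> (q1 < q \<longrightarrow> \<beta> \<le> r q1)" "q1 \<le> q"
    unfolding q1_def by (rule LeastI[of _ q], use p1 in simp) (rule Least_le, use p1 in simp)
  show ?thesis
  proof (rule that[of p1 q1])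
    fix n assume n: "p \<le> n" "n < p1"
    then have "\<not> (p \<le> n \<and> (n < q \<longrightarrow> \<alpha> < r n))" unfolding p1_def by (intro not_less_Least)
    then show "r n \<le> \<alpha>" using n by auto
  next
    fix n assume n: "p1 \<le> n" "n < q1"
    then have "\<not> (p1 \<le> n \<and> (n < q \<longrightarrow> \<beta> \<le> r n))" unfolding q1_def by (intro not_less_Least)
    then have 1: "n < q" "r n < \<beta>" using n by auto
    moreover have "r p1 \<le> r n" using p1 n 1 by (intro mono) auto
    ultimately show "\<alpha> < r n \<and> r n < \<beta>" using p1 n by auto
  next
    fix n assume n: "q1 \<le> n" "n < q"
    then have "r q1 \<le> r n" using p1 q1 by (intro mono) auto
    then show "\<beta> \<le> r n" using q1 n by auto
  qed (use p1 q1 in auto)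
qed

text \<open>
  \<open>\<phi>\<close> stands for the inverse of \<open>h\<close> at the integers. The hypothesis \<open>ratio\<close> is a discrete form of
  the lower bound \<open>a x / N\<^sup>2\<close> for the logarithmic derivative of \<open>t \<mapsto> \<phi>' (t + x) / \<phi>' t\<close>.
\<close>

locale regular_floor_set =
  fixes \<phi> :: "nat \<Rightarrow> real" and a :: real and n0 :: nat and E :: "nat set"
  fixes d :: "nat \<Rightarrow> real"
  defines "d \<equiv> \<lambda>n. \<phi> (Suc n) - \<phi> n"
  assumes n0_pos: "1 \<le> n0" and a_pos: "0 < a" and a_le: "a \<le> 1"
    and d_pos: "n \<ge> n0 \<Longrightarrow> 0 < d n"
    and d_le: "n \<ge> n0 \<Longrightarrow> d n \<le> 1 / 8"
    and d_lower: "n \<ge> n0 \<Longrightarrow> real n powr (- (1 / 30)) \<le> d n"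
    and d_doubling: "n0 \<le> N \<Longrightarrow> N \<le> n \<Longrightarrow> n \<le> 4 * N \<Longrightarrow> d N \<le> 2 * d n"
    and dd_lower: "n0 \<le> N \<Longrightarrow> N \<le> n \<Longrightarrow> n \<le> 4 * N \<Longrightarrow> a * d N / N \<le> d n - d (Suc n)"
    and dd_upper: "n0 \<le> N \<Longrightarrow> N \<le> n \<Longrightarrow> n \<le> 4 * N \<Longrightarrow> d n - d (Suc n) \<le> d N / N"
    and ratio: "n0 \<le> N \<Longrightarrow> N \<le> n \<Longrightarrow> n < n' \<Longrightarrow> n' + x \<le> 4 * N \<Longrightarrow>
       d (n + x) / d n * (1 + a * (real n' - real n - 1) * real x / (real N)\<^sup>2) \<le> d (n' + x) / d n'"
    and phi_lower: "n0 \<le> n \<Longrightarrow> real n * d n / 4 \<le> \<phi> n"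
    and phi_upper: "n0 \<le> n \<Longrightarrow> \<phi> n \<le> 2 * real n * d n"
    and mem_E: "n0 \<le> n \<Longrightarrow> n \<in> E \<longleftrightarrow> (\<exists>m::int. \<phi> n \<le> of_int m \<and> of_int m < \<phi> (Suc n))"
begin

section \<open>Increments of the inverse function and exponential sums with its values as
  phases\<close>

lemma phi_Suc: "\<phi> (Suc n) = \<phi> n + d n"
  by (simp add: d_def)

lemma d_antimono:
  assumes "n0 \<le> n" "n \<le> n'"
  shows "d n' \<le> d n"
  using assms(2)
proof (induction n' rule: dec_induct)
  case (step m)
  have "0 \<le> a * d m / m" using a_pos d_pos[of m] step assms(1) by auto
  also have "\<dots> \<le> d m - d (Suc m)" using step assms(1) by (intro dd_lower) auto
  finally show ?case using step by simp
qed simp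

lemma d_diff_bounds:
  assumes "n0 \<le> N" "N \<le> n" "n + x \<le> 4 * N"
  shows "a * real x * d N / N \<le> d n - d (n + x)" "d n - d (n + x) \<le> real x * d N / N"
proof -
  have "a * real x * d N / N \<le> d n - d (n + x) \<and> d n - d (n + x) \<le> real x * d N / N"
    using assms(3)
  proof (induction x)
    case (Suc x)
    have 1: "a * d N / N \<le> d (n + x) - d (Suc (n + x))" using assms Suc.prems by (intro dd_lower) auto
    have 2: "d (n + x) - d (Suc (n + x)) \<le> d N / N" using assms Suc.prems by (intro dd_upper) auto
    have 3: "a * real (Suc x) * d N / N = a * real x * d N / N + a * d N / N"
      "real (Suc x) * d N / N = real x * d N / N + d N / N" by (simp_all add: field_simps add_divide_distrib)
    show ?case unfolding 3 using Suc 1 2 by auto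
  qed simp
  then show "a * real x * d N / N \<le> d n - d (n + x)" "d n - d (n + x) \<le> real x * d N / N" by auto
qed

lemma ratio_mono:
  assumes "n0 \<le> N" "N \<le> n" "n \<le> n'" "n' + x \<le> 4 * N"
  shows "d (n + x) / d n \<le> d (n' + x) / d n'"
proof (cases "n = n'")
  case False
  then have "n < n'" using assms by simp
  have "0 < d (n + x) / d n" using assms d_pos by simp
  moreover have "0 \<le> a * (real n' - real n - 1) * real x / (real N)\<^sup>2"
    using a_pos \<open>n < n'\<close> by (intro divide_nonneg_nonneg mult_nonneg_nonneg) auto
  ultimately have "d (n + x) / d n * 1 \<le> d (n + x) / d n * (1 + a * (real n' - real n - 1) * real x / (real N)\<^sup>2)"
    by (intro mult_left_mono) auto
  also have "\<dots> \<le> d (n' + x) / d n'" using assms \<open>n < n'\<close> by (intro ratio) auto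
  finally show ?thesis by simp
qed simp

text \<open>Convexity of \<open>d\<close>, a consequence of \<open>ratio\<close>: the difference is
  \<open>d m\<close> times one minus \<open>d (m + x) / d m\<close>, and both factors decrease in
  \<open>m\<close>.\<close>

lemma d_diff_antimono:
  assumes "n0 \<le> n" "n \<le> n'" "n' + x \<le> 4 * n"
  shows "d n' - d (n' + x) \<le> d n - d (n + x)"
proof -
  have eq: "d m - d (m + x) = d m * (1 - d (m + x) / d m)" if "n0 \<le> m" for m
    using d_pos[OF that] by (simp add: field_simps)
  have "d n' * (1 - d (n' + x) / d n') \<le> d n * (1 - d (n + x) / d n)"
    using assms d_pos[of n] d_pos[of n'] d_antimono[of n n'] ratio_mono[of n n n' x] d_antimono[of n' "n' + x"]
    by (intro mult_mono) auto
  then show ?thesis using eq assms by simp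
qed

lemma sum_d_diff: 
  assumes "n0 \<le> p"
  shows "(\<Sum>n\<in>{p..<q}. \<bar>d (Suc n) - d n\<bar>) \<le> d p"
proof (cases "p \<le> q")
  case True
  have "(\<Sum>n\<in>{p..<q}. \<bar>d (Suc n) - d n\<bar>) = (\<Sum>n\<in>{p..<q}. (- d (Suc n)) - (- d n))"
  proof (intro sum.cong refl)
    fix n assume "n \<in> {p..<q}"
    then show "\<bar>d (Suc n) - d n\<bar> = - d (Suc n) - - d n"
      using d_antimono[of n "Suc n"] assms by auto
  qed
  also have "\<dots> = d p - d q" using sum_Suc_diff'[OF True, of "\<lambda>n. - d n"] by simp
  finally show ?thesis using d_pos[of q] True assms by simp
qed (use d_pos assms in \<open>simp add: less_imp_le\<close>)

lemma phase_diff: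
  "(h1 * \<phi> (Suc n) - h2 * \<phi> (Suc n + x)) - (h1 * \<phi> n - h2 * \<phi> (n + x)) = h1 * d n - h2 * d (n + x)"
  by (simp add: d_def algebra_simps)

text \<open>Since \<open>d\<close> is monotone and \<open>H * d N\<close> is at most 1/8, the
  increments of the phase stay below 1/2 and their total variation below 1. What remains to be
  supplied is the lower bound \<open>l\<close>.\<close>

lemma phase_sum_bound:
  fixes h1 h2 :: int
  assumes N: "n0 \<le> N" "N \<le> p" 
    and h: "\<bar>h1\<bar> \<le> H" "\<bar>h2\<bar> \<le> H" "real_of_int H * d N \<le> 1 / 8"
    and l: "0 < l" "l \<le> 1" "\<And>n. p \<le> n \<Longrightarrow> n < q \<Longrightarrow> l \<le> \<bar>h1 * d n - h2 * d (n + x)\<bar>"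
  shows "norm (\<Sum>n\<in>{p..<q}. unit_exp (h1 * \<phi> n - h2 * \<phi> (n + x))) \<le> 2 / l\<^sup>2"
proof -
  have H: "\<bar>real_of_int h1\<bar> \<le> real_of_int H" "\<bar>real_of_int h2\<bar> \<le> real_of_int H" using h by linarith+
  have b: "\<bar>k * d m\<bar> \<le> 1 / 8" if "\<bar>k\<bar> \<le> real_of_int H" "N \<le> m" for k m
  proof -
    have "\<bar>k * d m\<bar> \<le> real_of_int H * d N"
      unfolding abs_mult using that N d_antimono[of N m] d_pos[of m] by (intro mult_mono) auto
    then show ?thesis using h by simp
  qed
  have "norm (\<Sum>n\<in>{p..<q}. unit_exp (h1 * \<phi> n - h2 * \<phi> (n + x))) \<le> 1 / l + 1 / l\<^sup>2"
  proof (rule exp_sum_bound, unfold phase_diff)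
    fix n assume n: "p \<le> n" "n < q"
    have "\<bar>h1 * d n\<bar> \<le> 1 / 8" "\<bar>h2 * d (n + x)\<bar> \<le> 1 / 8"
      using b[OF H(1), of n] b[OF H(2), of "n + x"] N n by auto
    then show "l \<le> \<bar>h1 * d n - h2 * d (n + x)\<bar> \<and> \<bar>h1 * d n - h2 * d (n + x)\<bar> \<le> 1 / 2"
      using l(3)[OF n] by linarith
  next
    have "(\<Sum>n = p..<q - 1. \<bar>h1 * d (Suc n) - h2 * d (Suc n + x) - (h1 * d n - h2 * d (n + x))\<bar>)
      \<le> (\<Sum>n = p..<q - 1. real_of_int H * \<bar>d (Suc n) - d n\<bar> + real_of_int H * \<bar>d (Suc (n + x)) - d (n + x)\<bar>)"
    proof (rule sum_mono)
      fix n
      have "\<bar>h1 * d (Suc n) - h2 * d (Suc n + x) - (h1 * d n - h2 * d (n + x))\<bar>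
        \<le> \<bar>h1 * (d (Suc n) - d n)\<bar> + \<bar>h2 * (d (Suc (n + x)) - d (n + x))\<bar>" by (simp add: algebra_simps)
      also have "\<dots> \<le> real_of_int H * \<bar>d (Suc n) - d n\<bar> + real_of_int H * \<bar>d (Suc (n + x)) - d (n + x)\<bar>"
        unfolding abs_mult using H by (intro add_mono mult_right_mono) auto
      finally show "\<bar>h1 * d (Suc n) - h2 * d (Suc n + x) - (h1 * d n - h2 * d (n + x))\<bar>
        \<le> real_of_int H * \<bar>d (Suc n) - d n\<bar> + real_of_int H * \<bar>d (Suc (n + x)) - d (n + x)\<bar>" .
    qed
    also have "\<dots> = real_of_int H * (\<Sum>n = p..<q - 1. \<bar>d (Suc n) - d n\<bar>) + 
       real_of_int H * (\<Sum>n = p..<q - 1. \<bar>d (Suc (n + x)) - d (n + x)\<bar>)"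
      by (simp add: sum.distrib sum_distrib_left)
    also have "(\<Sum>n = p..<q - 1. \<bar>d (Suc (n + x)) - d (n + x)\<bar>) = (\<Sum>n = p+x..<q - 1+x. \<bar>d (Suc n) - d n\<bar>)"
      by (subst sum.shift_bounds_nat_ivl) simp
    also have "real_of_int H * (\<Sum>n = p..<q - 1. \<bar>d (Suc n) - d n\<bar>) + 
       real_of_int H * (\<Sum>n = p+x..<q - 1+x. \<bar>d (Suc n) - d n\<bar>) \<le> real_of_int H * d N + real_of_int H * d N"
    proof (intro add_mono mult_left_mono)
      show "(\<Sum>n = p..<q - 1. \<bar>d (Suc n) - d n\<bar>) \<le> d N"
        using sum_d_diff[of p] d_antimono[of N p] N by (meson order_trans)
      show "(\<Sum>n = p+x..<q - 1+x. \<bar>d (Suc n) - d n\<bar>) \<le> d N"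
        using sum_d_diff[of "p+x"] d_antimono[of N "p+x"] N by (meson order_trans trans_le_add1)
    qed (use H in auto)
    also have "\<dots> \<le> 1" using h by simp
    finally show "(\<Sum>n = p..<q - 1. \<bar>h1 * d (Suc n) - h2 * d (Suc n + x) - (h1 * d n - h2 * d (n + x))\<bar>) \<le> 1" .
  qed (use l in auto)
  also have "1 / l \<le> 1 / l\<^sup>2" using l by (intro divide_left_mono) (auto simp: power2_eq_square mult_left_le)
  finally show ?thesis by simp
qed

text \<open>For a short shift the increment is \<open>(h1 - h2) * d n\<close> up to
  \<open>h2 * (d n - d (n + x))\<close>. The former has size at least \<open>d N / 2\<close>, the
  latter at most half of that because \<open>4 * H * x\<close> does not exceed
  \<open>N\<close>.\<close>

lemma phase_sum_near:
  fixes h1 h2 :: int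
  assumes N: "n0 \<le> N" "N \<le> p" "q + x \<le> 4 * N"
    and h: "\<bar>h1\<bar> \<le> H" "\<bar>h2\<bar> \<le> H" "real_of_int H * d N \<le> 1 / 8" "h1 \<noteq> h2" "4 * H * int x \<le> int N"
  shows "norm (\<Sum>n\<in>{p..<q}. unit_exp (h1 * \<phi> n - h2 * \<phi> (n + x))) \<le> 32 / (d N)\<^sup>2"
proof -
  have dN: "0 < d N" "d N \<le> 1 / 8" using d_pos d_le N by auto
  have "norm (\<Sum>n\<in>{p..<q}. unit_exp (h1 * \<phi> n - h2 * \<phi> (n + x))) \<le> 2 / (d N / 4)\<^sup>2"
  proof (rule phase_sum_bound[OF N(1,2) h(1-3)])
    fix n assume n: "p \<le> n" "n < q"
    have 1: "d N / 2 \<le> d n" using d_doubling[of N n] N n by auto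
    have "1 * d n \<le> \<bar>real_of_int h1 - real_of_int h2\<bar> * d n" using h(4) d_pos[of n] N n by (intro mult_right_mono) auto
    also have "\<dots> = \<bar>(real_of_int h1 - real_of_int h2) * d n\<bar>" using d_pos[of n] N n by (simp add: abs_mult)
    finally have 2: "d N / 2 \<le> \<bar>(real_of_int h1 - real_of_int h2) * d n\<bar>" using 1 by simp
    have "0 \<le> d n - d (n + x)" using d_antimono[of n "n+x"] N n by simp
    then have "\<bar>real_of_int h2 * (d n - d (n + x))\<bar> \<le> real_of_int H * (real x * d N / N)"
      unfolding abs_mult using h(2) d_diff_bounds(2)[of N n x] N n by (intro mult_mono) auto
    also have "\<dots> = (real_of_int H * real x / N) * d N" by simp
    also have "\<dots> \<le> (1 / 4) * d N"
    proof (rule mult_right_mono)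
      have "real_of_int (4 * H * int x) \<le> real_of_int (int N)" using h(5) by linarith
      then show "real_of_int H * real x / N \<le> 1 / 4" using N n0_pos by (simp add: field_simps)
    qed (use dN in auto)
    finally have 3: "\<bar>real_of_int h2 * (d n - d (n + x))\<bar> \<le> d N / 4" by simp
    have "real_of_int h1 * d n - real_of_int h2 * d (n + x) =
      (real_of_int h1 - real_of_int h2) * d n + real_of_int h2 * (d n - d (n + x))" by (simp add: algebra_simps)
    then show "d N / 4 \<le> \<bar>real_of_int h1 * d n - real_of_int h2 * d (n + x)\<bar>" using 2 3 by linarith
  qed (use dN in auto)
  then show ?thesis by (simp add: power_divide)
qed

text \<open>The increment is \<open>(h1 - h2 * r n) * d n\<close> with the increasing ratio
  \<open>r n = d (n + x) / d n\<close>, and it may vanish where \<open>r n\<close> passes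
  \<open>h1 / h2\<close>. The terms with \<open>r n\<close> within \<open>t / \<bar>h2\<bar>\<close>
  of this value are counted trivially; \<open>ratio\<close> makes them few when \<open>x\<close> is
  large. The parameter \<open>t\<close> is left free to balance this count against the sums on the
  two sides.\<close>

lemma phase_sum_far:
  fixes h1 h2 :: int
  assumes N: "n0 \<le> N" "N \<le> p" "p \<le> q" "q + x \<le> 4 * N" "1 \<le> x"
    and h: "\<bar>h1\<bar> \<le> H" "\<bar>h2\<bar> \<le> H" "real_of_int H * d N \<le> 1 / 8" "h1 \<noteq> 0 \<or> h2 \<noteq> 0"
    and t: "0 < t" "t \<le> 1"
  shows "norm (\<Sum>n\<in>{p..<q}. unit_exp (h1 * \<phi> n - h2 * \<phi> (n + x)))
     \<le> 16 / (t\<^sup>2 * (d N)\<^sup>2) + 2 + 4 * t * (real N)\<^sup>2 / (a * real x)"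
proof (cases "h2 = 0")
  case True
  have dN: "0 < d N" "d N \<le> 1 / 8" using d_pos d_le N by auto
  have "norm (\<Sum>n\<in>{p..<q}. unit_exp (h1 * \<phi> n - h2 * \<phi> (n + x))) \<le> 2 / (t * d N / 2)\<^sup>2"
  proof (rule phase_sum_bound[OF N(1,2) h(1-3)])
    fix n assume n: "p \<le> n" "n < q"
    have 1: "d N / 2 \<le> d n" using d_doubling[of N n] N n by auto
    have "t * d N / 2 \<le> 1 * d N / 2" using t dN by (intro divide_right_mono mult_right_mono) auto
    also have "\<dots> \<le> 1 * d n" using 1 by simp
    also have "\<dots> \<le> \<bar>real_of_int h1\<bar> * d n" using h(4) True d_pos[of n] N n by (intro mult_right_mono) auto
    also have "\<dots> = \<bar>real_of_int h1 * d n - real_of_int h2 * d (n + x)\<bar>" 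
      using True d_pos[of n] N n by (simp add: abs_mult)
    finally show "t * d N / 2 \<le> \<bar>real_of_int h1 * d n - real_of_int h2 * d (n + x)\<bar>" .
  next
    have "t * d N \<le> 1 * 1" using t dN by (intro mult_mono) auto
    then show "t * d N / 2 \<le> 1" by simp
  qed (use dN t in auto)
  also have "\<dots> = 8 / (t\<^sup>2 * (d N)\<^sup>2)" by (simp add: power_divide power_mult_distrib)
  also have "\<dots> \<le> 16 / (t\<^sup>2 * (d N)\<^sup>2) + 2 + 4 * t * (real N)\<^sup>2 / (a * real x)"
  proof -
    have "8 / (t\<^sup>2 * (d N)\<^sup>2) \<le> 16 / (t\<^sup>2 * (d N)\<^sup>2)" by (intro divide_right_mono) auto
    moreover have "0 \<le> 4 * t * (real N)\<^sup>2 / (a * real x)" using t a_pos by auto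
    ultimately show ?thesis by linarith
  qed
  finally show ?thesis .
next
  case False
  have dN: "0 < d N" "d N \<le> 1 / 8" using d_pos d_le N by auto
  define r where "r = (\<lambda>n. d (n + x) / d n)"
  define m where "m = real_of_int h1 / real_of_int h2"
  have h2: "1 \<le> \<bar>real_of_int h2\<bar>" using False by auto
  define t' where "t' = t / \<bar>real_of_int h2\<bar>"
  have t': "0 < t'" "t' \<le> t" using t h2 by (auto simp: t'_def field_simps)
  obtain p1 q1 where pq: "p \<le> p1" "p1 \<le> q1" "q1 \<le> q"
    "\<And>n. p \<le> n \<Longrightarrow> n < p1 \<Longrightarrow> r n \<le> m - t'"
    "\<And>n. p1 \<le> n \<Longrightarrow> n < q1 \<Longrightarrow> m - t' < r n \<and> r n < m + t'"
    "\<And>n. q1 \<le> n \<Longrightarrow> n < q \<Longrightarrow> m + t' \<le> r n"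
  proof (rule mono_three_intervals[of p q r "m - t'" "m + t'"])
    show "r n \<le> r n'" if "p \<le> n" "n \<le> n'" "n' < q" for n n'
      unfolding r_def using that N by (intro ratio_mono[of N]) auto
  qed (use t' N in auto)
  have good: "t * d N / 2 \<le> \<bar>real_of_int h1 * d n - real_of_int h2 * d (n + x)\<bar>"
    if n: "p \<le> n" "n < q" "r n \<le> m - t' \<or> m + t' \<le> r n" for n
  proof -
    have dn: "d n > 0" using d_pos N n by auto
    have 1: "d N / 2 \<le> d n" using d_doubling[of N n] N n by auto
    have "t \<le> \<bar>real_of_int h2\<bar> * \<bar>m - r n\<bar>"
    proof -
      have "t' \<le> \<bar>m - r n\<bar>" using n(3) by auto
      then have "\<bar>real_of_int h2\<bar> * t' \<le> \<bar>real_of_int h2\<bar> * \<bar>m - r n\<bar>" by (intro mult_left_mono) auto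
      then show ?thesis using False by (simp add: t'_def)
    qed
    also have "\<dots> = \<bar>real_of_int h1 - real_of_int h2 * r n\<bar>"
    proof -
      have "real_of_int h2 * (m - r n) = real_of_int h1 - real_of_int h2 * r n"
        using False by (simp add: m_def right_diff_distrib)
      then show ?thesis by (simp flip: abs_mult)
    qed
    finally have "t * (d N / 2) \<le> \<bar>real_of_int h1 - real_of_int h2 * r n\<bar> * d n"
      using 1 t dN by (intro mult_mono) auto
    also have "\<dots> = \<bar>(real_of_int h1 - real_of_int h2 * r n) * d n\<bar>" using dn by (simp add: abs_mult)
    also have "(real_of_int h1 - real_of_int h2 * r n) * d n = real_of_int h1 * d n - real_of_int h2 * d (n + x)"
      using dn by (simp add: r_def field_simps)
    finally show ?thesis by simp
  qed
  define F where "F = (\<lambda>n. unit_exp (h1 * \<phi> n - h2 * \<phi> (n + x)))"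
  have l1: "t * d N / 2 \<le> 1"
  proof -
    have "t * d N \<le> 1 * 1" using t dN by (intro mult_mono) auto
    then show "t * d N / 2 \<le> 1" by simp
  qed
  have A: "norm (sum F {p..<p1}) \<le> 2 / (t * d N / 2)\<^sup>2" unfolding F_def
    by (rule phase_sum_bound[OF N(1,2) h(1-3)]) (use dN t l1 pq good in auto)
  have C: "norm (sum F {q1..<q}) \<le> 2 / (t * d N / 2)\<^sup>2" unfolding F_def
    by (rule phase_sum_bound[OF N(1) _ h(1-3)]) (use dN t l1 pq good N in auto)
  \<comment> \<open>\<open>ratio\<close> compares the first and the last index of the middle
    interval and loses 1 in their distance; this loss and intervals with fewer than two points
    account for the summand 2.\<close>
  have B: "norm (sum F {p1..<q1}) \<le> 2 + 4 * t * (real N)\<^sup>2 / (a * real x)"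
  proof (cases "p1 + 1 < q1")
    case True
    define n' where "n' = q1 - 1"
    have n': "p1 < n'" "n' < q1" "real q1 = real n' + 1" using True by (auto simp: n'_def)
    have "norm (sum F {p1..<q1}) \<le> real (card {p1..<q1}) * 1"
      by (rule sum_norm_bound) (simp add: F_def)
    also have "\<dots> = 2 + (real n' - real p1 - 1)" using n' by (simp add: of_nat_diff)
    finally have 1: "norm (sum F {p1..<q1}) \<le> 2 + (real n' - real p1 - 1)" .
    have rp: "1 / 2 \<le> r p1"
      using d_doubling[of N "p1+x"] d_antimono[of N p1] d_pos[of p1] N pq unfolding r_def by (simp add: field_simps)
    define y where "y = a * (real n' - real p1 - 1) * real x / (real N)\<^sup>2"
    have y: "0 \<le> y" using a_pos n' by (auto simp: y_def)
    have "r p1 * (1 + y) \<le> r n'" unfolding r_def y_def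
      using N pq n' by (intro ratio) auto
    moreover have "r n' - r p1 \<le> 2 * t'" using pq(5)[of n'] pq(5)[of p1] n' by auto
    ultimately have "r p1 * y \<le> 2 * t'" by (simp add: algebra_simps)
    moreover have "1 / 2 * y \<le> r p1 * y" using rp y by (rule mult_right_mono)
    ultimately have "y \<le> 4 * t" using t' by simp
    then have "real n' - real p1 - 1 \<le> 4 * t * (real N)\<^sup>2 / (a * real x)"
      using a_pos N n0_pos by (simp add: y_def field_simps)
    with 1 show ?thesis by simp
  next
    case False
    have "norm (sum F {p1..<q1}) \<le> real (card {p1..<q1}) * 1"
      by (rule sum_norm_bound) (simp add: F_def)
    also have "\<dots> \<le> 2" using False by auto
    also have "\<dots> \<le> 2 + 4 * t * (real N)\<^sup>2 / (a * real x)" using a_pos t by simp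
    finally show ?thesis .
  qed
  have "sum F {p..<q} = sum F {p..<p1} + sum F {p1..<q1} + sum F {q1..<q}"
    using pq by (simp add: sum.atLeastLessThan_concat)
  also have "norm \<dots> \<le> norm (sum F {p..<p1}) + norm (sum F {p1..<q1}) + norm (sum F {q1..<q})"
    by (meson norm_triangle_ineq norm_triangle_le order_refl add_mono order_trans)
  also have "\<dots> \<le> 2 / (t * d N / 2)\<^sup>2 + (2 + 4 * t * (real N)\<^sup>2 / (a * real x)) + 2 / (t * d N / 2)\<^sup>2"
    by (intro add_mono A B C)
  also have "\<dots> = 16 / (t\<^sup>2 * (d N)\<^sup>2) + 2 + 4 * t * (real N)\<^sup>2 / (a * real x)"
    by (simp add: power_divide power_mult_distrib)
  finally show ?thesis by (simp add: F_def)
qed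

text \<open>With equal frequencies the increment is \<open>h\<close> times a difference of
  \<open>d\<close>, of order \<open>h * x * d N / N\<close>. It is monotone by
  \<open>d_diff_antimono\<close>, so its variation is no larger than its size, which exceeds the
  lower bound \<open>l\<close> at most by the factor \<open>1 / a\<close>.\<close>

lemma phase_sum_shift:
  assumes N: "n0 \<le> N" "N \<le> p" "q + x \<le> 4 * N" "q \<le> 2 * N" "1 \<le> x" "2 * x \<le> N"
    and h: "1 \<le> h" "h * real x / N \<le> 1 / 2"
  shows "norm (\<Sum>n\<in>{p..<q}. unit_exp (h * (\<phi> (n + x) - \<phi> n))) \<le> 2 * real N / (a\<^sup>2 * h * real x * d N)"
proof (cases "p < q")
  case True
  have dN: "0 < d N" "d N \<le> 1 / 8" using d_pos d_le N by auto
  define l where "l = a * h * real x * d N / N"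
  have l: "l > 0" using a_pos h N dN n0_pos by (auto simp: l_def)
  have eq: "h * (\<phi> (Suc n + x) - \<phi> (Suc n)) - h * (\<phi> (n + x) - \<phi> n) = - (h * (d n - d (n + x)))" for n
    by (simp add: d_def algebra_simps)
  have b: "l \<le> h * (d n - d (n + x)) \<and> h * (d n - d (n + x)) \<le> l / a" if "p \<le> n" "n < q" for n
  proof -
    have "h * (a * real x * d N / N) \<le> h * (d n - d (n + x))" "h * (d n - d (n + x)) \<le> h * (real x * d N / N)"
      by (intro mult_left_mono d_diff_bounds; use N that h in simp)+
    then show ?thesis using a_pos by (simp add: l_def mult_ac)
  qed
  have la: "l / a \<le> 1 / 2"
  proof -
    have "l / a = (h * real x / N) * d N" using a_pos by (simp add: l_def)
    also have "\<dots> \<le> 1 / 2 * 1" using h dN by (intro mult_mono) auto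
    finally show ?thesis by simp
  qed
  have "norm (\<Sum>n\<in>{p..<q}. unit_exp (h * (\<phi> (n + x) - \<phi> n))) \<le> 1 / l + (l / a) / l\<^sup>2"
  proof (rule exp_sum_bound, unfold eq)
    show "l \<le> \<bar>- (h * (d n - d (n + x)))\<bar> \<and> \<bar>- (h * (d n - d (n + x)))\<bar> \<le> 1 / 2" if "p \<le> n" "n < q" for n
      using b[OF that] la l by linarith
    have "(\<Sum>n = p..<q - 1. \<bar>- (h * (d (Suc n) - d (Suc n + x))) - - (h * (d n - d (n + x)))\<bar>) =
      (\<Sum>n = p..<q - 1. - (h * (d (Suc n) - d (Suc n + x))) - - (h * (d n - d (n + x))))"
    proof (intro sum.cong refl abs_of_nonneg)
      fix n assume "n \<in> {p..<q - 1}"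
      then have "d (Suc n) - d (Suc n + x) \<le> d n - d (n + x)"
        using N by (intro d_diff_antimono) auto
      then have "h * (d (Suc n) - d (Suc n + x)) \<le> h * (d n - d (n + x))" using h by (intro mult_left_mono) auto
      then show "0 \<le> - (h * (d (Suc n) - d (Suc n + x))) - - (h * (d n - d (n + x)))" by simp
    qed
    also have "\<dots> = h * (d p - d (p + x)) - h * (d (q - 1) - d (q - 1 + x))"
      using True by (subst sum_Suc_diff') auto
    also have "\<dots> \<le> l / a" using b[of p] b[of "q - 1"] True l by force
    finally show "(\<Sum>n = p..<q - 1. \<bar>- (h * (d (Suc n) - d (Suc n + x))) - - (h * (d n - d (n + x)))\<bar>) \<le> l / a" .
  qed (use l a_pos in auto)
  also have "\<dots> = 1 / l + 1 / (a * l)" using l by (simp add: power2_eq_square)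
  also have "\<dots> \<le> 1 / (a * l) + 1 / (a * l)"
    using l a_pos a_le by (intro add_right_mono divide_left_mono) (auto simp: mult_le_cancel_right1)
  also have "\<dots> = 2 * real N / (a\<^sup>2 * h * real x * d N)"
    by (simp add: l_def power2_eq_square)
  finally show ?thesis .
qed (use a_pos d_pos[of N] h N in \<open>auto simp: field_simps\<close>)

end

section \<open>Fejer kernels and their correlations\<close>

text \<open>Normalized to mean 1 over a period. The squared modulus makes nonnegativity evident and
  presents the frequencies as differences \<open>j - l\<close>.\<close>

definition fejer :: "nat \<Rightarrow> real \<Rightarrow> real" where
  "fejer H t = (norm (\<Sum>j<H. unit_exp (real j * t)))\<^sup>2 / real H"

lemma fejer_nonneg: "0 \<le> fejer H t"
  by (simp add: fejer_def)

lemma fejer_add_int [simp]: "fejer H (t + of_int m) = fejer H t"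
proof -
  have "unit_exp (real j * (t + of_int m)) = unit_exp (real j * t)" for j
    using unit_exp_add_int[of "real j * t" "int j * m"] by (simp add: algebra_simps)
  then show ?thesis by (simp add: fejer_def)
qed

text \<open>Within \<open>1 / (8 * H)\<close> of an integer every term of the sum has argument at
  most \<open>pi / 4\<close> in size, so the real parts add up without cancellation.\<close>

lemma fejer_ge:
  assumes "8 * real H * \<bar>t - of_int m\<bar> \<le> 1"
  shows "real H / 2 \<le> fejer H t"
proof (cases "H = 0")
  case False
  define s where "s = t - of_int m"
  have s: "8 * real H * \<bar>s\<bar> \<le> 1" using assms by (simp add: s_def)
  have "real H * (sqrt 2 / 2) = (\<Sum>j<H. sqrt 2 / 2)" by simp
  also have "\<dots> \<le> (\<Sum>j<H. Re (unit_exp (real j * s)))"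
  proof (rule sum_mono)
    fix j assume "j \<in> {..<H}"
    then have "real j * \<bar>s\<bar> \<le> real H * \<bar>s\<bar>" by (intro mult_right_mono) auto
    then have "2 * pi * (real j * \<bar>s\<bar>) \<le> 2 * pi * (1 / 8)" using s by (intro mult_left_mono) auto
    then have "2 * pi * (real j * \<bar>s\<bar>) \<le> pi / 4" by simp
    then have "cos (pi / 4) \<le> cos \<bar>2 * pi * (real j * s)\<bar>"
      by (intro cos_monotone_0_pi_le) (auto simp: abs_mult)
    then show "sqrt 2 / 2 \<le> Re (unit_exp (real j * s))" by (simp add: unit_exp_def cos_45)
  qed
  also have "\<dots> = Re (\<Sum>j<H. unit_exp (real j * s))" by simp
  also have "\<dots> \<le> norm (\<Sum>j<H. unit_exp (real j * s))" by (rule complex_Re_le_cmod)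
  finally have "(real H * (sqrt 2 / 2))\<^sup>2 \<le> (norm (\<Sum>j<H. unit_exp (real j * s)))\<^sup>2"
    by (intro power_mono) auto
  then have "real H / 2 \<le> fejer H s"
    using False by (simp add: fejer_def power_mult_distrib power_divide field_simps power2_eq_square)
  then show ?thesis using fejer_add_int[of H s m] by (simp add: s_def)
qed (simp add: fejer_nonneg)

lemma of_real_fejer:
  assumes "H > 0"
  shows "complex_of_real (fejer H s) * of_nat H = (\<Sum>(j,l)\<in>{..<H}\<times>{..<H}. unit_exp (real_of_int (int j - int l) * s))"
proof -
  have "complex_of_real (fejer H s) * of_nat H = of_real ((norm (\<Sum>j<H. unit_exp (real j * s)))\<^sup>2)"
    using assms by (simp add: fejer_def)
  also have "\<dots> = (\<Sum>j<H. unit_exp (real j * s)) * (\<Sum>l<H. unit_exp (- (real l * s)))"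
    unfolding complex_norm_square by (simp add: cnj_unit_exp)
  also have "\<dots> = (\<Sum>(j,l)\<in>{..<H}\<times>{..<H}. unit_exp (real j * s) * unit_exp (- (real l * s)))"
    by (simp add: sum_product sum.cartesian_product)
  finally show ?thesis by (simp add: left_diff_distrib flip: unit_exp_add)
qed

text \<open>A quadruple \<open>(j, l, j', l')\<close> stands for the pair of frequencies \<open>(j - l, l' - j')\<close>.\<close>

definition quadruples :: "nat \<Rightarrow> (nat \<times> nat \<times> nat \<times> nat) set" where
  "quadruples H = {..<H} \<times> {..<H} \<times> {..<H} \<times> {..<H}"

definition quad_phase :: "nat \<times> nat \<times> nat \<times> nat \<Rightarrow> real \<Rightarrow> real \<Rightarrow> real" where
  "quad_phase = (\<lambda>(j,l,j',l') s t. real_of_int (int j - int l) * s - real_of_int (int l' - int j') * t)"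

lemma finite_quadruples [simp]: "finite (quadruples H)"
  by (simp add: quadruples_def)

lemma card_quadruples: "card (quadruples H) = H ^ 4"
  by (simp add: quadruples_def card_cartesian_product power4_eq_xxxx mult_ac)

lemma of_real_fejer_mult:
  assumes "H > 0"
  shows "complex_of_real (fejer H s * fejer H t) * (of_nat H)\<^sup>2 = (\<Sum>q\<in>quadruples H. unit_exp (quad_phase q s t))"
proof -
  have "complex_of_real (fejer H s * fejer H t) * (of_nat H)\<^sup>2 = 
    (complex_of_real (fejer H s) * of_nat H) * (complex_of_real (fejer H t) * of_nat H)"
    by (simp add: power2_eq_square)
  also have "\<dots> = (\<Sum>((j,l),(j',l'))\<in>({..<H}\<times>{..<H})\<times>({..<H}\<times>{..<H}). 
      unit_exp (real_of_int (int j - int l) * s) * unit_exp (real_of_int (int j' - int l') * t))"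
    unfolding of_real_fejer[OF assms] by (simp add: sum_product sum.cartesian_product case_prod_unfold)
  also have "\<dots> = (\<Sum>q\<in>quadruples H. unit_exp (quad_phase q s t))"
    unfolding quadruples_def
    by (rule sum.reindex_bij_witness[of _ "\<lambda>(j,l,j',l'). ((j,l),(j',l'))" "\<lambda>((j,l),(j',l')). (j,l,j',l')"])
      (auto simp: quad_phase_def left_diff_distrib simp flip: unit_exp_add intro!: arg_cong[of _ _ unit_exp])
  finally show ?thesis .
qed

text \<open>The two frequencies agree here and the phase is a multiple of \<open>s - t\<close>. For
  \<open>s = \<phi> n\<close> and \<open>t = \<phi> (n + x)\<close> with short \<open>x\<close> it
  hardly moves with \<open>n\<close>, so these quadruples have to be summed before \<open>n\<close>
  is.\<close>

definition diag_quadruples :: "nat \<Rightarrow> (nat \<times> nat \<times> nat \<times> nat) set" where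
  "diag_quadruples H = {(j,l,j',l') \<in> quadruples H. int j - int l = int l' - int j'}"

lemma diag_quadruples_subset: "diag_quadruples H \<subseteq> quadruples H"
  by (auto simp: diag_quadruples_def)

text \<open>The condition reads \<open>j + j' = l + l'\<close>. Once this common sum
  \<open>r\<close> is fixed, \<open>j\<close> and \<open>l\<close> run independently through the
  same interval, the \<open>j < H\<close> with \<open>r - j < H\<close>, and each \<open>r\<close>
  gives a squared modulus.\<close>

lemma diag_quad_sum:
  "(\<Sum>q\<in>diag_quadruples H. unit_exp (quad_phase q s t)) =
     of_real (\<Sum>r<2 * H. (norm (\<Sum>j\<in>{r + 1 - H..<min H (r + 1)}. unit_exp (real j * (t - s))))\<^sup>2)"
proof -
  define J where "J = (\<lambda>r. {r + 1 - H..<min H (r + 1)})"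
  have "of_real (\<Sum>r<2 * H. (norm (\<Sum>j\<in>J r. unit_exp (real j * (t - s))))\<^sup>2) = 
    (\<Sum>r<2 * H. (\<Sum>l\<in>J r. unit_exp (real l * (t - s))) * (\<Sum>j\<in>J r. unit_exp (- (real j * (t - s)))))"
    unfolding of_real_sum complex_norm_square by (simp add: cnj_unit_exp)
  also have "\<dots> = (\<Sum>r<2 * H. \<Sum>(l,j)\<in>J r \<times> J r. unit_exp (real l * (t - s)) * unit_exp (- (real j * (t - s))))"
    by (simp add: sum_product sum.cartesian_product)
  also have "\<dots> = (\<Sum>(r,l,j)\<in>(SIGMA r:{..<2*H}. J r \<times> J r). unit_exp (real l * (t - s)) * unit_exp (- (real j * (t - s))))"
    by (subst sum.Sigma) (auto simp: J_def)
  also have "\<dots> = (\<Sum>q\<in>diag_quadruples H. unit_exp (quad_phase q s t))"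
    unfolding diag_quadruples_def quadruples_def
  proof (rule sum.reindex_bij_witness[of _ "\<lambda>(j,l,j',l'). (j + j', l, j)" "\<lambda>(r,l,j). (j, l, r - j, r - l)"], goal_cases)
    case (5 a)
    obtain r l j where a: "a = (r, l, j)" by (cases a)
    have "int (r - l) = int r - int l" "int (r - j) = int r - int j"
      using 5 by (auto simp: a J_def of_nat_diff)
    then have "quad_phase (j, l, r - j, r - l) s t = real l * (t - s) + - (real j * (t - s))"
      unfolding quad_phase_def prod.case by (simp add: left_diff_distrib right_diff_distrib)
    then show ?case by (simp only: a prod.case unit_exp_add)
  qed (auto simp: J_def)
  finally show ?thesis by (simp add: J_def)
qed

lemma norm_diag_quad_sum_le:
  "norm (\<Sum>q\<in>diag_quadruples H. unit_exp (quad_phase q s t)) \<le> 2 * real H ^ 3"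
proof -
  have "(\<Sum>r<2 * H. (norm (\<Sum>j\<in>{r + 1 - H..<min H (r + 1)}. unit_exp (real j * (t - s))))\<^sup>2)
    \<le> (\<Sum>r<2*H. (real H)\<^sup>2)"
  proof (intro sum_mono power_mono)
    fix r assume "r \<in> {..<2*H}"
    have "norm (\<Sum>j\<in>{r + 1 - H..<min H (r + 1)}. unit_exp (real j * (t - s))) 
      \<le> real (card {r + 1 - H..<min H (r + 1)}) * 1" by (rule sum_norm_bound) simp
    also have "\<dots> \<le> real H" by auto
    finally show "norm (\<Sum>j\<in>{r + 1 - H..<min H (r + 1)}. unit_exp (real j * (t - s))) \<le> real H" .
  qed auto
  then show ?thesis unfolding diag_quad_sum norm_of_real
    by (subst abs_of_nonneg) (auto intro!: sum_nonneg simp: power3_eq_cube power2_eq_square mult_ac)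
qed

lemma norm_diag_quad_sum_le':
  assumes "norm (unit_exp (t - s) - 1) \<ge> \<delta>" "\<delta> > 0"
  shows "norm (\<Sum>q\<in>diag_quadruples H. unit_exp (quad_phase q s t)) \<le> 8 * real H / \<delta>\<^sup>2"
proof -
  have "(\<Sum>r<2 * H. (norm (\<Sum>j\<in>{r + 1 - H..<min H (r + 1)}. unit_exp (real j * (t - s))))\<^sup>2)
    \<le> (\<Sum>r<2*H. (2 / \<delta>)\<^sup>2)"
    by (intro sum_mono power_mono geometric_unit_exp_bound assms) auto
  then show ?thesis unfolding diag_quad_sum norm_of_real
    by (subst abs_of_nonneg) (auto intro!: sum_nonneg simp: power_divide mult_ac)
qed

lemma sum_inverse_squares_le: "(\<Sum>k<K. 1 / (real k + 1)\<^sup>2) \<le> 2"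
proof -
  have "K > 0 \<Longrightarrow> (\<Sum>k<K. 1 / (real k + 1)\<^sup>2) \<le> 2 - 1 / real K"
  proof (induction K)
    case (Suc K)
    show ?case
    proof (cases "K = 0")
      case False
      have "1 / (real K + 1)\<^sup>2 \<le> 1 / real K - 1 / (real K + 1)"
      proof -
        have "1 / (real K + 1)\<^sup>2 \<le> 1 / (real K * (real K + 1))"
          using False by (intro divide_left_mono mult_pos_pos) (auto simp: power2_eq_square algebra_simps add_pos_nonneg)
        also have "\<dots> = 1 / real K - 1 / (real K + 1)" using False by (simp add: field_simps)
        finally show ?thesis .
      qed
      then show ?thesis using Suc False by (simp add: add.commute)
    qed simp
  qed simp
  then show ?thesis by (cases "K = 0") (auto intro: order_trans[of _ "2 - 1 / real K"])
qed

lemma spaced_card_le: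
  fixes u :: "nat \<Rightarrow> real"
  assumes "finite S" "0 < \<eta>" "0 \<le> L"
    and gap: "\<And>n n'. n \<in> S \<Longrightarrow> n' \<in> S \<Longrightarrow> n \<le> n' \<Longrightarrow> \<eta> * (real n' - real n) \<le> u n - u n'"
    and L: "\<And>n n'. n \<in> S \<Longrightarrow> n' \<in> S \<Longrightarrow> u n - u n' \<le> L"
  shows "real (card S) \<le> L / \<eta> + 1"
proof (cases "S = {}")
  case False
  define p q where "p = Min S" and "q = Max S"
  have pq: "p \<in> S" "q \<in> S" "p \<le> q" using assms(1) False by (auto simp: p_def q_def)
  have "S \<subseteq> {p..q}" using assms(1) by (auto simp: p_def q_def)
  then have "card S \<le> card {p..q}" by (intro card_mono) auto
  then have "real (card S) \<le> real q - real p + 1" using pq by (simp add: of_nat_diff)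
  then have "\<eta> * real (card S) \<le> \<eta> * (real q - real p + 1)" using assms(2) by (intro mult_left_mono) auto
  moreover have "\<eta> * (real q - real p) \<le> L" using gap[OF pq] L[OF pq(1,2)] by simp
  ultimately have "\<eta> * real (card S) \<le> L + \<eta>" by (simp add: algebra_simps)
  then show ?thesis using assms(2) by (simp add: field_simps)
qed (use assms in simp)

text \<open>Grouping the points by \<open>\<lfloor>H \<bar>u n - m\<bar>\<rfloor>\<close> avoids a logarithmic loss.\<close>

lemma spaced_kernel_sum_le:
  fixes u :: "nat \<Rightarrow> real" and H :: nat
  assumes "finite S" "0 < \<eta>" "0 < H"
    and gap: "\<And>n n'. n \<in> S \<Longrightarrow> n' \<in> S \<Longrightarrow> n \<le> n' \<Longrightarrow> \<eta> * (real n' - real n) \<le> u n - u n'"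
    and near: "\<And>n. n \<in> S \<Longrightarrow> \<bar>u n - m\<bar> \<le> 1 / 2"
    and g1: "\<And>n. n \<in> S \<Longrightarrow> g n \<le> 2 * real H"
    and g2: "\<And>n. n \<in> S \<Longrightarrow> u n \<noteq> m \<Longrightarrow> g n \<le> 1 / (2 * real H * (u n - m)\<^sup>2)"
  shows "(\<Sum>n\<in>S. g n) \<le> 8 * (1 / \<eta> + real H)"
proof -
  define k where "k = (\<lambda>n. nat \<lfloor>real H * \<bar>u n - m\<bar>\<rfloor>)"
  have kle: "real (k n) \<le> real H * \<bar>u n - m\<bar>" "real H * \<bar>u n - m\<bar> < real (k n) + 1" for n
  proof -
    have "0 \<le> real H * \<bar>u n - m\<bar>" by simp
    then show "real (k n) \<le> real H * \<bar>u n - m\<bar>" "real H * \<bar>u n - m\<bar> < real (k n) + 1"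
      unfolding k_def by linarith+
  qed
  have kH: "k n < H" if "n \<in> S" for n
  proof -
    have "real H * \<bar>u n - m\<bar> \<le> real H * (1 / 2)" using near[OF that] by (intro mult_left_mono) auto
    then have "real (k n) < real H" using kle(1)[of n] assms(3) by linarith
    then show ?thesis by simp
  qed
  have g: "g n \<le> 2 * real H / (real (k n) + 1)\<^sup>2" if "n \<in> S" for n
  proof (cases "k n = 0")
    case False
    then have "0 < real (k n)" by simp
    then have pos: "0 < real H * \<bar>u n - m\<bar>" using kle(1)[of n] by linarith
    then have "u n \<noteq> m" by auto
    then have "g n \<le> 1 / (2 * real H * (u n - m)\<^sup>2)" using g2 that by auto
    also have "\<dots> = real H / (2 * (real H * \<bar>u n - m\<bar>)\<^sup>2)"
      using assms(3) by (simp add: power_mult_distrib power2_eq_square)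
    also have "\<dots> \<le> real H / (2 * (real (k n))\<^sup>2)"
      using False kle(1)[of n] by (intro divide_left_mono mult_left_mono power_mono mult_pos_pos) (use pos assms(3) in auto)
    also have "\<dots> \<le> 2 * real H / (real (k n) + 1)\<^sup>2"
    proof -
      have "(real (k n) + 1)\<^sup>2 \<le> (2 * real (k n))\<^sup>2" using False by (intro power_mono) auto
      then show ?thesis using False by (simp add: field_simps power_mult_distrib mult_left_mono)
    qed
    finally show ?thesis .
  qed (use g1[OF that] in simp)
  have cd: "real (card {n \<in> S. k n = i}) \<le> 2 * (1 / (real H * \<eta>) + 1)" for i
  proof -
    \<comment> \<open>On one side of \<open>m\<close> the values \<open>u n\<close> with the same
      \<open>k n\<close> lie in an interval of length \<open>1 / H\<close>; \<open>Q\<close> selects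
      the side.\<close>
    have c: "real (card {n \<in> S. k n = i \<and> Q n}) \<le> 1 / real H / \<eta> + 1"
      if Q: "(\<forall>n. Q n \<longleftrightarrow> m \<le> u n) \<or> (\<forall>n. Q n \<longleftrightarrow> u n < m)" for Q
    proof (rule spaced_card_le[of _ _ _ u])
      show "finite {n \<in> S. k n = i \<and> Q n}" using assms(1) by simp
      show "0 < \<eta>" "0 \<le> 1 / real H" using assms(2) by simp_all
      show "\<eta> * (real n' - real n) \<le> u n - u n'"
        if "n \<in> {n \<in> S. k n = i \<and> Q n}" "n' \<in> {n \<in> S. k n = i \<and> Q n}" "n \<le> n'" for n n'
        using that by (intro gap) simp_all
    next
      fix n n' assume n: "n \<in> {n \<in> S. k n = i \<and> Q n}" "n' \<in> {n \<in> S. k n = i \<and> Q n}"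
      have i: "real H * \<bar>u n - m\<bar> < real i + 1" "real i \<le> real H * \<bar>u n' - m\<bar>"
         "real H * \<bar>u n' - m\<bar> < real i + 1" "real i \<le> real H * \<bar>u n - m\<bar>" using kle[of n] kle[of n'] n by auto
      have "(m \<le> u n \<and> m \<le> u n') \<or> (u n < m \<and> u n' < m)" using Q n by blast
      then have "u n - u n' = \<bar>u n - m\<bar> - \<bar>u n' - m\<bar> \<or> u n - u n' = \<bar>u n' - m\<bar> - \<bar>u n - m\<bar>" by linarith
      then have "real H * (u n - u n') \<le> 1" using i by (elim disjE; simp only: right_diff_distrib; linarith)
      then show "u n - u n' \<le> 1 / real H" using assms(3) by (simp add: field_simps)
    qed
    have "{n \<in> S. k n = i} = {n \<in> S. k n = i \<and> m \<le> u n} \<union> {n \<in> S. k n = i \<and> u n < m}"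
      by (rule set_eqI) (simp only: Un_iff mem_Collect_eq, metis not_le)
    then have "card {n \<in> S. k n = i} \<le> card {n \<in> S. k n = i \<and> m \<le> u n} + card {n \<in> S. k n = i \<and> u n < m}"
      by (simp only: card_Un_le)
    then show ?thesis using c[of "\<lambda>n. m \<le> u n"] c[of "\<lambda>n. u n < m"] by simp
  qed
  have "(\<Sum>n\<in>S. g n) \<le> (\<Sum>n\<in>S. 2 * real H / (real (k n) + 1)\<^sup>2)" using g by (rule sum_mono)
  also have "\<dots> = (\<Sum>i<H. \<Sum>n | n \<in> S \<and> k n = i. 2 * real H / (real (k n) + 1)\<^sup>2)"
    using assms(1) kH by (intro sum.group[symmetric]) auto
  also have "\<dots> = (\<Sum>i<H. real (card {n \<in> S. k n = i}) * (2 * real H * (1 / (real i + 1)\<^sup>2)))"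
    by (intro sum.cong) auto
  also have "\<dots> \<le> (\<Sum>i<H. 2 * (1 / (real H * \<eta>) + 1) * (2 * real H * (1 / (real i + 1)\<^sup>2)))"
    by (intro sum_mono mult_right_mono cd) auto
  also have "\<dots> = 2 * (1 / (real H * \<eta>) + 1) * (2 * real H) * (\<Sum>i<H. 1 / (real i + 1)\<^sup>2)"
    by (simp add: sum_distrib_left mult_ac)
  also have "\<dots> \<le> 2 * (1 / (real H * \<eta>) + 1) * (2 * real H) * 2"
    using assms by (intro mult_left_mono sum_inverse_squares_le) auto
  also have "\<dots> = 8 * (1 / \<eta> + real H)" using assms by (simp add: field_simps)
  finally show ?thesis .
qed

section \<open>Correlations of the Fejer kernel along the inverse function\<close>

context regular_floor_set
begin

text \<open>The form in which the decay rate of \<open>d\<close> enters all estimates: every factor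
  \<open>1 / d N\<close> costs a power 1/30 of \<open>N\<close>.\<close>

lemma inverse_d_power_le:
  assumes "n0 \<le> N"
  shows "1 / d N ^ k \<le> real N powr (real k / 30)"
proof -
  have N: "0 < real N" using assms n0_pos by simp
  have "real N powr (- (real k / 30)) = (real N powr (- (1 / 30))) ^ k"
    using N by (simp add: powr_power)
  also have "\<dots> \<le> d N ^ k" using d_lower[OF assms] by (intro power_mono) auto
  finally have "1 / d N ^ k \<le> 1 / real N powr (- (real k / 30))"
    using N d_pos[OF assms] by (intro divide_left_mono mult_pos_pos) auto
  then show ?thesis using N by (simp add: powr_minus field_simps)
qed

lemma powr_le_self:
  assumes "n0 \<le> N" "e \<le> 1"
  shows "real N powr e \<le> real N"
  using powr_mono[of e 1 "real N"] assms n0_pos by simp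

text \<open>The reason why the kernel majorizes the set: for a point of \<open>E\<close> there is an
  integer within \<open>d N\<close> of \<open>\<phi> n\<close>, inside the peak of a Fejer kernel of
  order at most \<open>1 / (8 * d N)\<close>.\<close>

lemma fejer_phi_ge:
  assumes "n0 \<le> N" "N \<le> n" "n \<in> E" "real H * d N \<le> 1 / 8"
  shows "real H / 2 \<le> fejer H (\<phi> n)"
proof -
  obtain m :: int where m: "\<phi> n \<le> of_int m" "of_int m < \<phi> (Suc n)" using mem_E[of n] assms by auto
  have "\<bar>\<phi> n - of_int m\<bar> \<le> d N" using m d_antimono[of N n] assms by (simp add: phi_Suc)
  then have "real H * \<bar>\<phi> n - of_int m\<bar> \<le> real H * d N" by (intro mult_left_mono) auto
  then show ?thesis using assms(4) by (intro fejer_ge[of H "\<phi> n" m]) auto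
qed

lemma phi_diff_sum: "\<phi> (n + x) - \<phi> n = (\<Sum>i<x. d (n + i))"
  by (induction x) (simp_all add: phi_Suc)

lemma phi_diff_bounds:
  assumes "n0 \<le> N" "N \<le> n" "n + x \<le> 4 * N"
  shows "real x * d N / 2 \<le> \<phi> (n + x) - \<phi> n" "\<phi> (n + x) - \<phi> n \<le> real x * d N"
proof -
  have "real x * d N / 2 = (\<Sum>i<x. d N / 2)" by simp
  also have "\<dots> \<le> (\<Sum>i<x. d (n + i))" 
  proof (rule sum_mono)
    fix i assume "i \<in> {..<x}"
    then show "d N / 2 \<le> d (n + i)" using d_doubling[OF assms(1), of "n + i"] assms by simp
  qed
  finally show "real x * d N / 2 \<le> \<phi> (n + x) - \<phi> n" by (simp add: phi_diff_sum)
  have "(\<Sum>i<x. d (n + i)) \<le> (\<Sum>i<x. d N)" using d_antimono[of N] assms by (intro sum_mono) simp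
  then show "\<phi> (n + x) - \<phi> n \<le> real x * d N" by (simp add: phi_diff_sum)
qed

lemma corr_expand:
  assumes "1 \<le> H"
  shows "of_real ((real H)\<^sup>2 * (\<Sum>n\<in>{p..<q}. fejer H (\<phi> n) * fejer H (\<phi> (n + x)))) =
    (\<Sum>t\<in>quadruples H. \<Sum>n\<in>{p..<q}. unit_exp (quad_phase t (\<phi> n) (\<phi> (n + x))))"
proof -
  have "of_real ((real H)\<^sup>2 * (\<Sum>n\<in>{p..<q}. fejer H (\<phi> n) * fejer H (\<phi> (n + x)))) =
    (\<Sum>n\<in>{p..<q}. complex_of_real (fejer H (\<phi> n) * fejer H (\<phi> (n + x))) * (of_nat H)\<^sup>2)"
    by (simp add: sum_distrib_left mult_ac)
  also have "\<dots> = (\<Sum>n\<in>{p..<q}. \<Sum>t\<in>quadruples H. unit_exp (quad_phase t (\<phi> n) (\<phi> (n + x))))"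
    using assms by (intro sum.cong of_real_fejer_mult) auto
  finally show ?thesis by (subst (asm) sum.swap)
qed

text \<open>Splits off the quadruples with equal frequencies. The others number at most
  \<open>H ^ 4\<close> and cost \<open>32 / (d N)\<^sup>2\<close> each; after division by
  \<open>H\<^sup>2\<close> they contribute at most \<open>1 / d N ^ 4\<close>, which is far below
  \<open>N\<close>.\<close>

lemma corr_near_aux:
  assumes N: "n0 \<le> N" "N \<le> p" "q + x \<le> 4 * N" "q \<le> 2 * N" "4 * H * x \<le> N"
    and H: "1 \<le> H" "real H * d N \<le> 1 / 8"
    and g: "g = (\<lambda>n. norm (\<Sum>t\<in>diag_quadruples H. unit_exp (quad_phase t (\<phi> n) (\<phi> (n + x)))) / (real H)\<^sup>2)"
  shows "(\<Sum>n\<in>{p..<q}. fejer H (\<phi> n) * fejer H (\<phi> (n + x))) \<le> real N + (\<Sum>n\<in>{p..<q}. g n)"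
proof -
  let ?S = "\<Sum>n\<in>{p..<q}. fejer H (\<phi> n) * fejer H (\<phi> (n + x))"
  let ?e = "\<lambda>t n. unit_exp (quad_phase t (\<phi> n) (\<phi> (n + x)))"
  have dN: "0 < d N" using d_pos N by auto
  have S0: "0 \<le> ?S" by (intro sum_nonneg mult_nonneg_nonneg fejer_nonneg)
  have "(real H)\<^sup>2 * ?S = norm (complex_of_real ((real H)\<^sup>2 * ?S))"
    using S0 by (simp del: of_real_mult of_real_sum add: abs_mult)
  also have "\<dots> = norm ((\<Sum>t\<in>quadruples H - diag_quadruples H. \<Sum>n\<in>{p..<q}. ?e t n) + 
      (\<Sum>n\<in>{p..<q}. \<Sum>t\<in>diag_quadruples H. ?e t n))"
    unfolding corr_expand[OF H(1)] sum.swap[of _ "diag_quadruples H" "{p..<q}"]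
    by (subst sum.subset_diff[OF diag_quadruples_subset]) auto
  also have "\<dots> \<le> norm (\<Sum>t\<in>quadruples H - diag_quadruples H. \<Sum>n\<in>{p..<q}. ?e t n) + 
      norm (\<Sum>n\<in>{p..<q}. \<Sum>t\<in>diag_quadruples H. ?e t n)" by (rule norm_triangle_ineq)
  also have "\<dots> \<le> (\<Sum>t\<in>quadruples H - diag_quadruples H. 32 / (d N)\<^sup>2) + 
      (\<Sum>n\<in>{p..<q}. norm (\<Sum>t\<in>diag_quadruples H. ?e t n))"
  proof (intro add_mono sum_norm_le norm_sum)
    fix t assume t: "t \<in> quadruples H - diag_quadruples H"
    obtain j l j' l' where tt: "t = (j,l,j',l')" by (cases t)
    have b: "j < H" "l < H" "j' < H" "l' < H" "int j - int l \<noteq> int l' - int j'"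
      using t by (auto simp: tt quadruples_def diag_quadruples_def)
    have "4 * int H * int x \<le> int N" using N(5) by (metis of_nat_le_iff of_nat_mult of_nat_numeral)
    then show "norm (\<Sum>n\<in>{p..<q}. ?e t n) \<le> 32 / (d N)\<^sup>2"
      unfolding tt quad_phase_def prod.case
      by (intro phase_sum_near[of N p q x _ "int H"]) (use N H b in auto)
  qed simp
  also have "(\<Sum>t\<in>quadruples H - diag_quadruples H. 32 / (d N)\<^sup>2) \<le> real H ^ 4 * (32 / (d N)\<^sup>2)"
  proof -
    have "card (quadruples H - diag_quadruples H) \<le> H ^ 4"
      by (metis card_mono card_quadruples Diff_subset finite_quadruples)
    then have "real (card (quadruples H - diag_quadruples H)) \<le> real H ^ 4"
      by (metis of_nat_le_iff of_nat_power)
    then show ?thesis by (auto intro!: mult_right_mono divide_right_mono)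
  qed
  also have "(\<Sum>n\<in>{p..<q}. norm (\<Sum>t\<in>diag_quadruples H. ?e t n)) = (real H)\<^sup>2 * (\<Sum>n\<in>{p..<q}. g n)"
    using H by (simp add: g sum_distrib_left)
  finally have "(real H)\<^sup>2 * ?S \<le> (real H)\<^sup>2 * ((real H)\<^sup>2 * (32 / (d N)\<^sup>2) + (\<Sum>n\<in>{p..<q}. g n))"
    by (simp add: algebra_simps power4_eq_xxxx power2_eq_square)
  then have "?S \<le> (real H)\<^sup>2 * (32 / (d N)\<^sup>2) + (\<Sum>n\<in>{p..<q}. g n)"
    by (rule mult_left_le_imp_le) (use H in simp)
  also have "(real H)\<^sup>2 * (32 / (d N)\<^sup>2) \<le> real N"
  proof -
    have "(real H * d N)\<^sup>2 \<le> (1 / 8)\<^sup>2" using H dN by (intro power_mono) auto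
    then have "(real H * d N)\<^sup>2 * 32 / d N ^ 4 \<le> (1 / 8)\<^sup>2 * 32 / d N ^ 4" 
      using dN by (intro divide_right_mono mult_right_mono) auto
    also have "\<dots> \<le> 1 / d N ^ 4" using dN by (intro divide_right_mono) (auto simp: power2_eq_square)
    also have "\<dots> \<le> real N" 
      using inverse_d_power_le[OF N(1), of 4] powr_le_self[OF N(1), of "real 4 / 30"] by simp
    finally show ?thesis using dN by (simp add: power_mult_distrib power4_eq_xxxx power2_eq_square field_simps)
  qed
  finally show ?thesis by simp
qed

text \<open>As a function of \<open>u = \<phi> (n + x) - \<phi> n\<close>, the term
  \<open>g n\<close> is bounded by a kernel of height \<open>2 * H\<close> peaked at the integers.
  For \<open>x = 0\<close> the value \<open>u\<close> is an integer, which produces the peak at the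
  origin. While \<open>x * d N\<close> is at most 1/2, \<open>u\<close> stays between
  \<open>x * d N / 2\<close> and 1/2, and \<open>g\<close> decays like \<open>1 / x\<^sup>2\<close>.
  Beyond that \<open>u\<close> drifts past the integers and \<open>spaced_kernel_sum_le\<close>
  averages the peaks.\<close>

lemma corr_near:
  assumes N: "n0 \<le> N" "N \<le> p" "q + x \<le> 4 * N" "q \<le> 2 * N" "4 * H * x \<le> N"
    and H: "1 \<le> H" "real H * d N \<le> 1 / 8" "1 / 16 \<le> real H * d N"
  shows "(\<Sum>n\<in>{p..<q}. fejer H (\<phi> n) * fejer H (\<phi> (n + x))) \<le> 
     60 / a * real N + 64 * real N / (d N * (1 + (real x)\<^sup>2))"
proof -
  define g where "g = (\<lambda>n. norm (\<Sum>t\<in>diag_quadruples H. unit_exp (quad_phase t (\<phi> n) (\<phi> (n + x)))) / (real H)\<^sup>2)"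
  have dN: "0 < d N" using d_pos N by auto
  have Hpos: "0 < real H" using H by simp
  have g1: "g n \<le> 2 * real H" for n
  proof -
    have "g n \<le> 2 * real H ^ 3 / (real H)\<^sup>2"
      unfolding g_def by (intro divide_right_mono norm_diag_quad_sum_le) auto
    then show ?thesis using H by (simp add: power3_eq_cube power2_eq_square)
  qed
  have g2: "g n \<le> 8 / (real H * \<delta>\<^sup>2)" if "norm (unit_exp (\<phi> (n + x) - \<phi> n) - 1) \<ge> \<delta>" "\<delta> > 0" for n \<delta>
  proof -
    have "g n \<le> (8 * real H / \<delta>\<^sup>2) / (real H)\<^sup>2"
      unfolding g_def by (intro divide_right_mono norm_diag_quad_sum_le' that) auto
    then show ?thesis using H by (simp add: power2_eq_square mult_ac)
  qed
  have cardpq: "real (card {p..<q}) \<le> real N" using N by auto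
  consider "x = 0" | "1 \<le> x" "real x * d N \<le> 1 / 2" | "1 \<le> x" "1 / 2 < real x * d N" by linarith
  then have "(\<Sum>n\<in>{p..<q}. g n) \<le> 58 / a * real N + 64 * real N / (d N * (1 + (real x)\<^sup>2))"
  proof cases
    case 1
    have "(\<Sum>n\<in>{p..<q}. g n) \<le> real (card {p..<q}) * (2 * real H)"
      using g1 by (intro sum_bounded_above) auto
    also have "\<dots> \<le> real N * (1 / (4 * d N))"
      using cardpq H dN by (intro mult_mono) (auto simp: field_simps)
    also have "\<dots> \<le> 64 * real N / (d N * (1 + (real x)\<^sup>2))"
      using 1 dN by (simp add: field_simps)
    finally show ?thesis using a_pos by (simp add: add_increasing)
  next
    case 2
    have "(\<Sum>n\<in>{p..<q}. g n) \<le> real (card {p..<q}) * (8 / (real H * (2 * (real x * d N))\<^sup>2))"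
    proof (intro sum_bounded_above g2)
      fix n assume n: "n \<in> {p..<q}"
      have u: "real x * d N / 2 \<le> \<phi> (n + x) - \<phi> n" "\<phi> (n + x) - \<phi> n \<le> real x * d N"
        using phi_diff_bounds[of N n x] n N by auto
      moreover have "0 \<le> real x * d N" using dN by simp
      ultimately have "4 * \<bar>\<phi> (n + x) - \<phi> n\<bar> \<le> norm (unit_exp (\<phi> (n + x) - \<phi> n) - 1)"
        using 2 by (intro norm_unit_exp_minus_1_ge) auto
      moreover have "2 * (real x * d N) = 4 * (real x * d N / 2)" by simp
      moreover have "4 * (real x * d N / 2) \<le> 4 * \<bar>\<phi> (n + x) - \<phi> n\<bar>" 
        by (intro mult_left_mono order_trans[OF u(1)]) auto
      ultimately show "2 * (real x * d N) \<le> norm (unit_exp (\<phi> (n + x) - \<phi> n) - 1)" by simp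
    qed (use 2 dN in auto)
    also have "\<dots> \<le> real N * (8 / (real H * (2 * (real x * d N))\<^sup>2))"
      using cardpq by (intro mult_right_mono) auto
    also have "real N * (8 / (real H * (2 * (real x * d N))\<^sup>2)) = real N * (2 / ((real H * d N) * (real x)\<^sup>2 * d N))"
      using 2 dN Hpos by (simp add: power_mult_distrib power2_eq_square)
    also have "\<dots> \<le> real N * (2 / ((1 / 16) * (real x)\<^sup>2 * d N))"
      using H 2 dN Hpos by (intro mult_left_mono divide_left_mono mult_right_mono mult_pos_pos) auto
    also have "\<dots> = 64 * real N / (d N * (2 * (real x)\<^sup>2))" using dN 2 by (simp add: field_simps)
    also have "\<dots> \<le> 64 * real N / (d N * (1 + (real x)\<^sup>2))"
    proof (intro divide_left_mono mult_left_mono mult_pos_pos)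
      have "1\<^sup>2 \<le> (real x)\<^sup>2" using 2 by (intro power_mono) auto
      then show "1 + (real x)\<^sup>2 \<le> 2 * (real x)\<^sup>2" by simp
    qed (use 2 dN in \<open>auto simp: add_pos_nonneg\<close>)
    finally show ?thesis using a_pos by (simp add: add_increasing)
  next
    case 3
    define u where "u = (\<lambda>n. \<phi> (n + x) - \<phi> n)"
    define \<eta> where "\<eta> = a * real x * d N / N"
    have \<eta>: "0 < \<eta>" using a_pos 3 dN N n0_pos by (auto simp: \<eta>_def)
    have ub: "0 \<le> u n" "u n \<le> real x * d N" if "n \<in> {p..<q}" for n
      using phi_diff_bounds[of N n x] that N dN 3 by (auto simp: u_def intro: order_trans[rotated])
    have gap: "\<eta> * (real n' - real n) \<le> u n - u n'" if "n \<in> {p..<q}" "n' \<in> {p..<q}" "n \<le> n'" for n n'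
      using that(3,2)
    proof (induction n' rule: dec_induct)
      case (step m)
      have "\<eta> \<le> d m - d (m + x)" unfolding \<eta>_def
        using d_diff_bounds(1)[of N m x] step that N by auto
      also have "\<dots> = u m - u (Suc m)" by (simp add: u_def d_def)
      finally have "\<eta> \<le> u m - u (Suc m)" .
      moreover have "\<eta> * (real m - real n) \<le> u n - u m" using step that(1) by auto
      ultimately show ?case by (simp add: algebra_simps)
    qed simp
    \<comment> \<open>The integers nearest to the values \<open>u n\<close> lie between 0 and
      \<open>M\<close>, and \<open>M + 1\<close> is at most \<open>4 * (x * d N)\<close> because
      \<open>x * d N\<close> exceeds 1/2. Multiplied by \<open>1 / \<eta>\<close> this leaves a
      multiple of \<open>N / a\<close>.\<close>
    define M where "M = nat \<lfloor>real x * d N + 1 / 2\<rfloor>"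
    have M: "real M \<le> real x * d N + 1 / 2" using 3 by (simp add: M_def)
    have rd: "0 \<le> round (u n)" "nat (round (u n)) \<le> M" "\<bar>u n - of_int (round (u n))\<bar> \<le> 1 / 2" if "n \<in> {p..<q}" for n
    proof -
      show 1: "0 \<le> round (u n)" using ub[OF that] by (simp add: round_def)
      have "round (u n) \<le> \<lfloor>real x * d N + 1 / 2\<rfloor>" unfolding round_def using ub[OF that] by (intro floor_mono) auto
      then show "nat (round (u n)) \<le> M" by (simp add: M_def)
      show "\<bar>u n - of_int (round (u n))\<bar> \<le> 1 / 2"
        using of_int_round_abs_le[of "u n"] by (simp add: abs_minus_commute)
    qed
    have "(\<Sum>n\<in>{p..<q}. g n) = (\<Sum>m\<in>{0..M}. \<Sum>n | n \<in> {p..<q} \<and> nat (round (u n)) = m. g n)"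
      using rd by (intro sum.group[symmetric]) auto
    also have "\<dots> \<le> (\<Sum>m\<in>{0..M}. 8 * (1 / \<eta> + real H))"
    proof (intro sum_mono spaced_kernel_sum_le)
      fix m n
      assume n: "n \<in> {n \<in> {p..<q}. nat (round (u n)) = m}"
      have m: "real m = of_int (round (u n))" using rd(1)[of n] n by auto
      show nr: "\<bar>u n - real m\<bar> \<le> 1 / 2" using rd(3)[of n] n m by auto
      show "g n \<le> 1 / (2 * real H * (u n - real m)\<^sup>2)" if ne: "u n \<noteq> real m"
      proof -
        have "unit_exp (u n) = unit_exp (u n - real m)"
          using unit_exp_add_int[of "u n" "- int m"] by simp
        then have "4 * \<bar>u n - real m\<bar> \<le> norm (unit_exp (\<phi> (n + x) - \<phi> n) - 1)"
          using norm_unit_exp_minus_1_ge[OF nr] by (simp add: u_def)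
        from g2[OF this] show ?thesis using ne Hpos by (simp add: power_mult_distrib)
      qed
    qed (use g1 gap \<eta> H in auto)
    also have "\<dots> = (real M + 1) * (8 * (1 / \<eta> + real H))" by simp
    also have "\<dots> \<le> (4 * (real x * d N)) * (8 * (1 / \<eta> + real H))"
      using M 3 \<eta> by (intro mult_right_mono) auto
    also have "\<dots> = 32 * (real N / a) + 32 * real x * (real H * d N)"
      using 3 dN a_pos N n0_pos by (simp add: \<eta>_def field_simps)
    also have "\<dots> \<le> 32 * (real N / a) + 32 * real x * (1 / 8)"
      using H by (intro add_left_mono mult_left_mono) auto
    also have "\<dots> \<le> 32 * (real N / a) + 4 * real N" 
    proof -
      have "1 * x \<le> (4 * H) * x" using H by (intro mult_right_mono) auto
      then have "x \<le> 4 * H * x" by simp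
      from order_trans[OF this N(5)] have "real x \<le> real N" by simp
      then show ?thesis by simp
    qed
    also have "\<dots> \<le> 32 * (real N / a) + 4 * (real N / a)" 
      using a_pos a_le by (simp add: field_simps mult_left_le_one_le)
    also have "\<dots> \<le> 58 / a * real N" using a_pos by (simp add: field_simps)
    finally show ?thesis using dN by (simp add: add_increasing2)
  qed
  moreover have "(\<Sum>n\<in>{p..<q}. fejer H (\<phi> n) * fejer H (\<phi> (n + x))) \<le> real N + (\<Sum>n\<in>{p..<q}. g n)"
    by (rule corr_near_aux[OF N H(1,2) g_def])
  moreover have "real N + 58 / a * real N \<le> 60 / a * real N"
    using mult_left_le_one_le[of "real N" a] a_pos a_le by (simp add: field_simps)
  ultimately show ?thesis by linarith
qed

text \<open>The quadruples with both frequencies zero give the main term, all others oscillate by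
  \<open>phase_sum_far\<close>. The largest exponents are 7/8 from the terms counted trivially there
  and 2/30 from \<open>H\<^sup>2\<close>, together less than 19/20.\<close>

lemma corr_far:
  assumes N: "n0 \<le> N" "N \<le> p" "p \<le> q" "q + x \<le> 4 * N" "q \<le> 2 * N" "real N powr (3/4) \<le> real x"
    and H: "1 \<le> H" "real H * d N \<le> 1 / 8"
  shows "\<bar>(\<Sum>n\<in>{p..<q}. fejer H (\<phi> n) * fejer H (\<phi> (n + x))) - (real q - real p)\<bar> \<le> 2 / a * real N powr (19/20)"
proof -
  let ?S = "\<Sum>n\<in>{p..<q}. fejer H (\<phi> n) * fejer H (\<phi> (n + x))"
  let ?e = "\<lambda>t n. unit_exp (quad_phase t (\<phi> n) (\<phi> (n + x)))"
  have dN: "0 < d N" using d_pos N by auto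
  have N1: "1 \<le> real N" using N n0_pos by simp
  then have "1 \<le> real N powr (3/4)" by (simp add: ge_one_powr_ge_zero)
  then have x1: "1 \<le> x" "0 < real x" using N(6) by linarith+
  \<comment> \<open>Nearly balances the two parts of \<open>phase_sum_far\<close>: with
    \<open>x\<close> at least \<open>N powr (3/4)\<close> they become multiples of
    \<open>N powr (49/60)\<close> and \<open>N powr (7/8)\<close>.\<close>
  define t where "t = real N powr (- (3/8))"
  have t: "0 < t" "t \<le> 1" using N1 by (auto simp: t_def powr_minus_divide ge_one_powr_ge_zero)
  define B where "B = 16 / (t\<^sup>2 * (d N)\<^sup>2) + 2 + 4 * t * (real N)\<^sup>2 / (a * real x)"
  have B0: "0 \<le> B" using t a_pos dN by (auto simp: B_def)
  define Z where "Z = {(j,l,j',l') \<in> quadruples H. j = l \<and> j' = l'}"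
  have Z: "Z \<subseteq> quadruples H" by (auto simp: Z_def)
  have cardZ: "card Z = H\<^sup>2"
  proof -
    have "bij_betw (\<lambda>(j,j'). (j,j,j',j')) ({..<H} \<times> {..<H}) Z"
      by (rule bij_betw_byWitness[of _ "\<lambda>(j,l,j',l'). (j,j')"]) (auto simp: Z_def quadruples_def)
    then show ?thesis by (auto dest!: bij_betw_same_card simp: power2_eq_square)
  qed
  have Zsum: "(\<Sum>t\<in>Z. \<Sum>n\<in>{p..<q}. ?e t n) = (of_nat H)\<^sup>2 * (of_nat q - of_nat p)"
  proof -
    have "(\<Sum>t\<in>Z. \<Sum>n\<in>{p..<q}. ?e t n) = (\<Sum>t\<in>Z. of_nat q - of_nat p)"
      using N(3) by (intro sum.cong) (auto simp: Z_def quad_phase_def of_nat_diff)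
    then show ?thesis by (simp add: cardZ)
  qed
  have "(real H)\<^sup>2 * \<bar>?S - (real q - real p)\<bar> = norm (complex_of_real ((real H)\<^sup>2 * ?S) - (of_nat H)\<^sup>2 * (of_nat q - of_nat p))"
  proof -
    have "complex_of_real ((real H)\<^sup>2 * ?S) - (of_nat H)\<^sup>2 * (of_nat q - of_nat p) = 
       complex_of_real ((real H)\<^sup>2 * (?S - (real q - real p)))" by (simp add: algebra_simps)
    then show ?thesis by (simp only: norm_of_real abs_mult) simp
  qed
  also have "\<dots> = norm (\<Sum>t\<in>quadruples H - Z. \<Sum>n\<in>{p..<q}. ?e t n)"
    unfolding corr_expand[OF H(1)] by (subst sum.subset_diff[OF Z]) (auto simp: Zsum)
  also have "\<dots> \<le> (\<Sum>t\<in>quadruples H - Z. B)"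
  proof (intro sum_norm_le)
    fix s assume t': "s \<in> quadruples H - Z"
    obtain j l j' l' where tt: "s = (j,l,j',l')" by (cases s)
    have b: "j < H" "l < H" "j' < H" "l' < H" "int j - int l \<noteq> 0 \<or> int l' - int j' \<noteq> 0"
      using t' by (auto simp: tt quadruples_def Z_def)
    then show "norm (\<Sum>n\<in>{p..<q}. ?e s n) \<le> B"
      unfolding tt quad_phase_def prod.case B_def
      by (intro phase_sum_far[of N p q x _ "int H"]) (use N H b x1 t in auto)
  qed
  also have "\<dots> \<le> real H ^ 4 * B"
  proof -
    have "card (quadruples H - Z) \<le> H ^ 4"
      by (metis card_mono card_quadruples Diff_subset finite_quadruples)
    then have "real (card (quadruples H - Z)) \<le> real H ^ 4"
      by (metis of_nat_le_iff of_nat_power)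
    then show ?thesis using B0 by (auto intro!: mult_right_mono)
  qed
  finally have "(real H)\<^sup>2 * \<bar>?S - (real q - real p)\<bar> \<le> (real H)\<^sup>2 * ((real H)\<^sup>2 * B)"
    by (simp add: power4_eq_xxxx power2_eq_square mult.assoc)
  then have "\<bar>?S - (real q - real p)\<bar> \<le> (real H)\<^sup>2 * B"
    by (rule mult_left_le_imp_le) (use H in simp)
  also have "\<dots> \<le> (1 / 64 * real N powr (1/15)) * (16 * real N powr (49/60) + 2 + 4 / a * real N powr (7/8))"
  proof (rule mult_mono)
    have "(real H)\<^sup>2 = (real H * d N)\<^sup>2 * (1 / d N ^ 2)" using dN by (simp add: power_mult_distrib)
    also have "\<dots> \<le> (1 / 8)\<^sup>2 * real N powr (real 2 / 30)"
      using H dN inverse_d_power_le[OF N(1), of 2] by (intro mult_mono power_mono) auto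
    finally show "(real H)\<^sup>2 \<le> 1 / 64 * real N powr (1/15)" by (simp add: power2_eq_square)
    have t2: "t\<^sup>2 = real N powr (- (3/4))" using N1 by (simp add: t_def powr_power)
    have "16 / (t\<^sup>2 * (d N)\<^sup>2) = 16 * (1 / t\<^sup>2) * (1 / (d N)\<^sup>2)" by simp
    also have "\<dots> \<le> 16 * real N powr (3/4) * real N powr (real 2 / 30)"
      using inverse_d_power_le[OF N(1), of 2] N1 
      by (intro mult_mono) (auto simp: t2 powr_minus_divide)
    also have "\<dots> = 16 * real N powr (49/60)" by (simp flip: powr_add)
    finally have 1: "16 / (t\<^sup>2 * (d N)\<^sup>2) \<le> 16 * real N powr (49/60)" .
    have "4 * t * (real N)\<^sup>2 / (a * real x) \<le> 4 * t * (real N)\<^sup>2 / (a * real N powr (3/4))"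
      using N1 a_pos N(6) x1 t by (intro divide_left_mono mult_left_mono mult_pos_pos) auto
    also have "\<dots> = 4 / a * (t * real N powr 2 / real N powr (3/4))" using N1 by (simp add: powr_numeral)
    also have "t * real N powr 2 / real N powr (3/4) = real N powr (- (3/8) + 2 - 3/4)"
      unfolding t_def by (simp only: powr_add powr_diff)
    also have "- (3/8) + 2 - 3/4 = (7/8 :: real)" by simp
    finally show "B \<le> 16 * real N powr (49/60) + 2 + 4 / a * real N powr (7/8)" using 1 by (simp add: B_def)
  qed (use B0 in auto)
  also have "\<dots> \<le> (1 / 64 * real N powr (1/15)) * (16 / a * real N powr (7/8) + 2 / a * real N powr (7/8) + 4 / a * real N powr (7/8))"
  proof -
    have "1 \<le> 1 / a" using a_pos a_le by simp
    then have "1 * real N powr (49/60) \<le> 1 / a * real N powr (7/8)"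
      using N1 a_pos by (intro mult_mono powr_mono) auto
    moreover have "1 * 1 \<le> 1 / a * real N powr (7/8)"
      using N1 a_pos \<open>1 \<le> 1 / a\<close> by (intro mult_mono) (auto simp: ge_one_powr_ge_zero)
    ultimately have "16 * real N powr (49/60) + 2 + 4 / a * real N powr (7/8) \<le> 
      16 / a * real N powr (7/8) + 2 / a * real N powr (7/8) + 4 / a * real N powr (7/8)"
      by (simp add: field_simps)
    then show ?thesis by (rule mult_left_mono) simp
  qed
  also have "\<dots> = 22 / 64 / a * (real N powr (1/15) * real N powr (7/8))" by (simp add: field_simps)
  also have "real N powr (1/15) * real N powr (7/8) \<le> real N powr (19/20)"
    using N1 by (simp flip: powr_add add: powr_mono)
  also have "22 / 64 / a * real N powr (19/20) \<le> 2 / a * real N powr (19/20)"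
    using a_pos by (intro mult_right_mono) (auto simp: field_simps)
  finally show ?thesis using a_pos by (simp add: field_simps)
qed

lemma fejer_sum_le:
  assumes N: "n0 \<le> N" "N \<le> p" "q \<le> 2 * N" and H: "1 \<le> H" "real H * d N \<le> 1 / 8"
  shows "(\<Sum>n\<in>{p..<q}. fejer H (\<phi> n)) \<le> 5 * real N"
proof -
  let ?S = "\<Sum>n\<in>{p..<q}. fejer H (\<phi> n)"
  let ?Q = "{..<H} \<times> {..<H}"
  let ?D = "{(j,l)\<in>?Q. j = l}"
  let ?e = "\<lambda>(j,l) n. unit_exp (real_of_int (int j - int l) * \<phi> n)"
  have dN: "0 < d N" using d_pos N by auto
  have "complex_of_real (?S * real H) = (\<Sum>n\<in>{p..<q}. complex_of_real (fejer H (\<phi> n)) * of_nat H)"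
    by (simp add: sum_distrib_right)
  also have "\<dots> = (\<Sum>n\<in>{p..<q}. \<Sum>t\<in>?Q. ?e t n)"
    using H by (intro sum.cong) (auto simp: of_real_fejer case_prod_unfold)
  also have "\<dots> = (\<Sum>t\<in>?Q. \<Sum>n\<in>{p..<q}. ?e t n)" by (rule sum.swap)
  also have "\<dots> = (\<Sum>t\<in>?Q - ?D. \<Sum>n\<in>{p..<q}. ?e t n) + (\<Sum>t\<in>?D. \<Sum>n\<in>{p..<q}. ?e t n)"
    by (rule sum.subset_diff) auto
  finally have eq: "complex_of_real (?S * real H) = \<dots>" .
  have S0: "0 \<le> ?S" by (intro sum_nonneg fejer_nonneg)
  have "?S * real H = norm (complex_of_real (?S * real H))" using S0 by (simp only: norm_of_real) simp
  also have "\<dots> \<le> norm (\<Sum>t\<in>?Q - ?D. \<Sum>n\<in>{p..<q}. ?e t n) + norm (\<Sum>t\<in>?D. \<Sum>n\<in>{p..<q}. ?e t n)"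
    unfolding eq by (rule norm_triangle_ineq)
  also have "\<dots> \<le> (\<Sum>t\<in>?Q - ?D. 32 / (d N)\<^sup>2) + (\<Sum>t\<in>?D. real N)"
  proof (intro add_mono sum_norm_le)
    fix t assume t: "t \<in> ?Q - ?D"
    obtain j l where tt: "t = (j,l)" by (cases t)
    \<comment> \<open>A sum with a single frequency is the case of second frequency 0 and shift
      0.\<close>
    have "norm (\<Sum>n\<in>{p..<q}. unit_exp (real_of_int (int j - int l) * \<phi> n - real_of_int 0 * \<phi> (n + 0))) \<le> 32 / (d N)\<^sup>2"
      by (intro phase_sum_near[of N p q 0 _ "int H"]) (use N H t tt in auto)
    then show "norm (\<Sum>n\<in>{p..<q}. ?e t n) \<le> 32 / (d N)\<^sup>2" by (simp add: tt)
  next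
    fix t assume t: "t \<in> ?D"
    have "norm (\<Sum>n\<in>{p..<q}. ?e t n) \<le> real (card {p..<q}) * 1"
      by (rule sum_norm_bound) (auto simp: case_prod_unfold)
    also have "\<dots> \<le> real N" using N by simp
    finally show "norm (\<Sum>n\<in>{p..<q}. ?e t n) \<le> real N" .
  qed
  also have "\<dots> \<le> (real H)\<^sup>2 * (32 / (d N)\<^sup>2) + real H * real N"
  proof -
    have "card (?Q - ?D) \<le> card ?Q" by (intro card_mono) auto
    also have "card ?Q = H\<^sup>2" by (simp add: power2_eq_square)
    finally have 1: "real (card (?Q - ?D)) \<le> (real H)\<^sup>2" unfolding of_nat_power[symmetric] of_nat_le_iff .
    have "card ?D \<le> card ((\<lambda>j. (j,j)) ` {..<H})" by (intro card_mono) auto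
    also have "\<dots> \<le> card {..<H}" by (rule card_image_le) simp
    finally have 2: "real (card ?D) \<le> real H" by simp
    show ?thesis unfolding sum_constant using 1 2 by (intro add_mono mult_right_mono) auto
  qed
  also have "\<dots> = (real H * (32 / (d N)\<^sup>2) + real N) * real H" by (simp add: algebra_simps power2_eq_square)
  finally have "?S \<le> real H * (32 / (d N)\<^sup>2) + real N" using H by simp
  also have "real H * (32 / (d N)\<^sup>2) = (real H * d N) * 32 * (1 / d N ^ 3)" 
    using dN by (simp add: power3_eq_cube power2_eq_square)
  also have "\<dots> \<le> (1 / 8) * 32 * real N"
    using H dN inverse_d_power_le[OF N(1), of 3] powr_le_self[OF N(1), of "real 3 / 30"]
    by (intro mult_mono) (auto intro: order_trans)
  finally show ?thesis by simp
qed

end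

section \<open>The weak type inequality on the integers\<close>

text \<open>Coded by level and index, so that the interval of level \<open>s\<close> around
  \<open>y\<close> is \<open>(s, y div 2 ^ s)\<close> and larger intervals arise by further
  division; division rounds down, so negative integers fit in.\<close>

definition dyadic :: "nat \<times> int \<Rightarrow> int set" where
  "dyadic = (\<lambda>(s, j). {y. y div 2 ^ s = j})"

lemma mem_dyadic: "y \<in> dyadic q \<longleftrightarrow> y div 2 ^ fst q = snd q"
  by (simp add: dyadic_def case_prod_unfold)

lemma dyadic_eq: "dyadic q = {snd q * 2 ^ fst q..<(snd q + 1) * 2 ^ fst q}"
proof (intro set_eqI)
  fix y
  have "y div 2 ^ fst q = snd q \<longleftrightarrow> snd q * 2 ^ fst q \<le> y \<and> y < (snd q + 1) * 2 ^ fst q"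
  proof
    assume "y div 2 ^ fst q = snd q"
    then have "y = snd q * 2 ^ fst q + y mod 2 ^ fst q" by (metis div_mult_mod_eq)
    moreover have "0 \<le> y mod 2 ^ fst q" "y mod 2 ^ fst q < 2 ^ fst q" by simp_all
    ultimately show "snd q * 2 ^ fst q \<le> y \<and> y < (snd q + 1) * 2 ^ fst q" unfolding distrib_right by linarith
  next
    assume h: "snd q * 2 ^ fst q \<le> y \<and> y < (snd q + 1) * 2 ^ fst q"
    have "y = (y - snd q * 2 ^ fst q) + snd q * 2 ^ fst q" by simp
    then have "y div 2 ^ fst q = snd q + (y - snd q * 2 ^ fst q) div 2 ^ fst q"
      by (metis div_mult_self3 add.commute power_not_zero zero_neq_numeral)
    moreover have "(y - snd q * 2 ^ fst q) div 2 ^ fst q = 0" 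
      using h by (intro div_pos_pos_trivial) (auto simp: algebra_simps)
    ultimately show "y div 2 ^ fst q = snd q" by simp
  qed
  then show "y \<in> dyadic q \<longleftrightarrow> y \<in> {snd q * 2 ^ fst q..<(snd q + 1) * 2 ^ fst q}" by (simp add: mem_dyadic)
qed

lemma finite_dyadic [simp]: "finite (dyadic q)"
  by (simp add: dyadic_eq)

lemma card_dyadic: "card (dyadic q) = 2 ^ fst q"
  by (simp add: dyadic_eq algebra_simps nat_power_eq)

lemma dyadic_diameter:
  assumes "y \<in> dyadic q" "z \<in> dyadic q"
  shows "\<bar>y - z\<bar> < 2 ^ fst q"
  using assms by (simp add: dyadic_eq algebra_simps abs_less_iff)

lemma int_div_power_div: "s \<le> s' \<Longrightarrow> (y::int) div 2 ^ s' = y div 2 ^ s div 2 ^ (s' - s)"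
  by (metis le_add_diff_inverse power_add zdiv_zmult2_eq zero_le_numeral zero_le_power)

text \<open>The largest dyadic intervals with average above \<open>l\<close> are kept. They exist
  because the total mass is finite, so that averages over long intervals are small; the factor 2
  appears because the parent of a kept interval has average at most \<open>l\<close>.\<close>

lemma calderon_zygmund_stopping:
  fixes f :: "int \<Rightarrow> real"
  assumes f: "\<And>y. 0 \<le> f y" "\<And>y. y \<notin> Y \<Longrightarrow> f y = 0" "finite Y" and l: "0 < l"
  obtains Q where "finite Q" 
    "\<And>q q' y. q \<in> Q \<Longrightarrow> q' \<in> Q \<Longrightarrow> y \<in> dyadic q \<Longrightarrow> y \<in> dyadic q' \<Longrightarrow> q = q'"
    "\<And>q. q \<in> Q \<Longrightarrow> l * 2 ^ fst q \<le> sum f (dyadic q)"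
    "\<And>q. q \<in> Q \<Longrightarrow> sum f (dyadic q) \<le> 2 * l * 2 ^ fst q"
    "\<And>y. y \<notin> (\<Union>q\<in>Q. dyadic q) \<Longrightarrow> f y \<le> l"
proof -
  define F where "F = (\<lambda>s y. sum f (dyadic (s, y div 2 ^ s)))"
  \<comment> \<open>Maximality is expressed at a point through all higher levels. It depends on the
    point only through its interval of level \<open>s\<close>, and it forces two kept intervals with
    a common point to have the same level.\<close>
  define P where "P = (\<lambda>s y. l * 2 ^ s < F s y \<and> (\<forall>s'>s. F s' y \<le> l * 2 ^ s'))"
  define Q where "Q = {q. \<exists>y. q = (fst q, y div 2 ^ fst q) \<and> P (fst q) y}"
  have F_le: "F s y \<le> sum f Y" for s y
  proof -
    have "F s y = sum f (dyadic (s, y div 2 ^ s) \<inter> Y)"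
      unfolding F_def using f by (intro sum.mono_neutral_right) auto
    also have "\<dots> \<le> sum f Y" using f by (intro sum_mono2) auto
    finally show ?thesis .
  qed
  obtain S where S: "sum f Y / l < 2 ^ S" using real_arch_pow[of 2] by auto
  have bound: "s < S" if "l * 2 ^ s < F s y" for s y
  proof (rule ccontr)
    assume "\<not> s < S"
    then have "(2::real) ^ S \<le> 2 ^ s" by (intro power_increasing) auto
    then have "sum f Y / l < 2 ^ s" using S by linarith
    then have "sum f Y < l * 2 ^ s" using l by (simp add: field_simps)
    with that F_le[of s y] show False by linarith
  qed
  have F_cong: "F s y = F s z" if "y div 2 ^ s = z div 2 ^ s" for s y z using that by (simp add: F_def)
  have P_cong: "P s z" if "P s y" "z div 2 ^ s = y div 2 ^ s" for s y z
  proof -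
    have "F s' z = F s' y" if "s \<le> s'" for s'
      using that \<open>z div 2 ^ s = y div 2 ^ s\<close> by (intro F_cong) (simp add: int_div_power_div)
    then show ?thesis using that(1) by (auto simp: P_def)
  qed
  have P_mem: "P (fst q) y" if "q \<in> Q" "y \<in> dyadic q" for q y
  proof -
    obtain z where z: "q = (fst q, z div 2 ^ fst q)" "P (fst q) z" using \<open>q \<in> Q\<close> by (auto simp: Q_def)
    then have "snd q = z div 2 ^ fst q" by (metis snd_conv)
    then show ?thesis using z(2) that(2) by (intro P_cong[of "fst q" z y]) (auto simp: mem_dyadic)
  qed
  show ?thesis
  proof (rule that[of Q])
    have "Q \<subseteq> (SIGMA s:{..<S}. (\<lambda>y. y div 2 ^ s) ` Y)"
    proof
      fix q assume "q \<in> Q"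
      then obtain y where y: "q = (fst q, y div 2 ^ fst q)" "P (fst q) y" by (auto simp: Q_def)
      then have 1: "l * 2 ^ fst q < F (fst q) y" by (auto simp: P_def)
      have "0 < F (fst q) y" using 1 l by (smt (verit) mult_pos_pos zero_less_power)
      then have "\<exists>z\<in>dyadic (fst q, y div 2 ^ fst q). f z \<noteq> 0" 
        unfolding F_def by (metis less_irrefl sum.neutral)
      then obtain z where "z \<in> dyadic (fst q, y div 2 ^ fst q)" "z \<in> Y" using f(2) by blast
      then have "snd q \<in> (\<lambda>y. y div 2 ^ fst q) ` Y" using y by (force simp: mem_dyadic)
      then show "q \<in> (SIGMA s:{..<S}. (\<lambda>y. y div 2 ^ s) ` Y)" using bound[OF 1] by (cases q) auto
    qed
    then show "finite Q" by (rule finite_subset) (use f(3) in auto)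
  next
    fix q q' y assume q: "q \<in> Q" "q' \<in> Q" "y \<in> dyadic q" "y \<in> dyadic q'"
    have "P (fst q) y" "P (fst q') y" using P_mem q by auto
    then have "fst q = fst q'" unfolding P_def by (metis linorder_neqE_nat not_less)
    then show "q = q'" using q by (auto simp: mem_dyadic prod_eq_iff)
  next
    fix q assume "q \<in> Q"
    then obtain y where y: "q = (fst q, y div 2 ^ fst q)" "P (fst q) y" by (auto simp: Q_def)
    have eq: "sum f (dyadic q) = F (fst q) y" unfolding F_def using y(1) by simp
    show "l * 2 ^ fst q \<le> sum f (dyadic q)" using y(2) unfolding eq P_def by auto
    have "F (fst q) y \<le> F (Suc (fst q)) y"
      unfolding F_def using f(1) by (intro sum_mono2) (auto simp: mem_dyadic int_div_power_div[of "fst q" "Suc (fst q)"] simp del: power_Suc)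
    also have "\<dots> \<le> l * 2 ^ Suc (fst q)" using y(2) by (auto simp: P_def)
    finally show "sum f (dyadic q) \<le> 2 * l * 2 ^ fst q" by (simp add: eq mult_ac)
  next
    fix y assume y: "y \<notin> (\<Union>q\<in>Q. dyadic q)"
    show "f y \<le> l"
    proof (rule ccontr)
      assume "\<not> f y \<le> l"
      moreover have "dyadic (0, y) = {y}" by (auto simp: mem_dyadic)
      ultimately have 0: "l * 2 ^ 0 < F 0 y" by (simp add: F_def)
      define s where "s = Max {s. l * 2 ^ s < F s y}"
      have fin: "finite {s. l * 2 ^ s < F s y}" by (rule finite_subset[of _ "{..<S}"]) (auto dest: bound)
      have s: "l * 2 ^ s < F s y" using Max_in[OF fin] 0 unfolding s_def by blast
      have "F s' y \<le> l * 2 ^ s'" if "s' > s" for s'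
      proof (rule ccontr)
        assume "\<not> F s' y \<le> l * 2 ^ s'"
        then have "s' \<le> s" unfolding s_def using fin by (intro Max_ge) auto
        with that show False by simp
      qed
      with s have "P s y" by (auto simp: P_def)
      then have "(s, y div 2 ^ s) \<in> Q" by (auto simp: Q_def)
      moreover have "y \<in> dyadic (s, y div 2 ^ s)" by (simp add: mem_dyadic)
      ultimately show False using y by blast
    qed
  qed
qed

section \<open>Auxiliary sums for the quadratic estimate\<close>

lemma sum_inverse_one_plus_square_int:
  assumes "finite (Y :: int set)"
  shows "(\<Sum>y\<in>Y. 1 / (1 + (of_int (y - z))\<^sup>2)) \<le> (8 :: real)"
proof -
  define n where "n = (\<lambda>y. nat \<bar>y - z\<bar>)"
  obtain M where M: "\<And>y. y \<in> Y \<Longrightarrow> n y < M"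
    using finite_nat_bounded[of "n ` Y"] assms by (auto simp: lessThan_def)
  have n: "real (n y) = \<bar>of_int (y - z)\<bar>" for y by (simp add: n_def)
  have "(\<Sum>y\<in>Y. 1 / (1 + (of_int (y - z))\<^sup>2)) \<le> (\<Sum>y\<in>Y. 2 * (1 / (real (n y) + 1)\<^sup>2))"
  proof (rule sum_mono)
    fix y
    have "(real (n y) + 1)\<^sup>2 \<le> 2 * (1 + (real (n y))\<^sup>2)"
      using zero_le_power2[of "real (n y) - 1"] by (simp add: power2_eq_square algebra_simps)
    then show "1 / (1 + (of_int (y - z))\<^sup>2) \<le> 2 * (1 / (real (n y) + 1)\<^sup>2)"
      unfolding n by (simp add: field_simps add_pos_nonneg)
  qed
  also have "\<dots> = (\<Sum>m<M. \<Sum>y | y \<in> Y \<and> n y = m. 2 * (1 / (real (n y) + 1)\<^sup>2))"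
    using assms M by (intro sum.group[symmetric]) auto
  also have "\<dots> = (\<Sum>m<M. real (card {y \<in> Y. n y = m}) * (2 * (1 / (real m + 1)\<^sup>2)))"
    by (intro sum.cong) auto
  also have "\<dots> \<le> (\<Sum>m<M. 2 * (2 * (1 / (real m + 1)\<^sup>2)))"
  proof (intro sum_mono mult_right_mono)
    fix m
    have "card {y \<in> Y. n y = m} \<le> card {z + int m, z - int m}"
      by (intro card_mono) (auto simp: n_def)
    also have "\<dots> \<le> 2" by (simp add: card_insert_if)
    finally show "real (card {y \<in> Y. n y = m}) \<le> 2" by simp
  qed auto
  also have "\<dots> = 4 * (\<Sum>m<M. 1 / (real m + 1)\<^sup>2)" by (simp add: sum_distrib_left)
  also have "\<dots> \<le> 8" using sum_inverse_squares_le[of M] by simp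
  finally show ?thesis .
qed

text \<open>Schur's test for a symmetric nonnegative matrix, by the inequality between the
  arithmetic and the geometric mean.\<close>

lemma sum_weighted_products_le:
  fixes b :: "'p \<Rightarrow> real" and w :: "'p \<Rightarrow> 'p \<Rightarrow> real"
  assumes "finite P" and w: "\<And>p p'. p \<in> P \<Longrightarrow> p' \<in> P \<Longrightarrow> 0 \<le> w p p' \<and> w p p' = w p' p"
    and W: "\<And>p. p \<in> P \<Longrightarrow> (\<Sum>p'\<in>P. w p p') \<le> L"
  shows "(\<Sum>p\<in>P. \<Sum>p'\<in>P. \<bar>b p\<bar> * \<bar>b p'\<bar> * w p p') \<le> L * (\<Sum>p\<in>P. (b p)\<^sup>2)"
proof -
  have "(\<Sum>p\<in>P. \<Sum>p'\<in>P. \<bar>b p\<bar> * \<bar>b p'\<bar> * w p p') \<le> (\<Sum>p\<in>P. \<Sum>p'\<in>P. ((b p)\<^sup>2 / 2 + (b p')\<^sup>2 / 2) * w p p')"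
  proof (intro sum_mono mult_right_mono)
    fix p p'
    show "\<bar>b p\<bar> * \<bar>b p'\<bar> \<le> (b p)\<^sup>2 / 2 + (b p')\<^sup>2 / 2"
      using zero_le_power2[of "\<bar>b p\<bar> - \<bar>b p'\<bar>"] by (simp add: power2_eq_square algebra_simps)
  qed (use w in auto)
  also have "\<dots> = (\<Sum>p\<in>P. \<Sum>p'\<in>P. (b p)\<^sup>2 / 2 * w p p') + (\<Sum>p\<in>P. \<Sum>p'\<in>P. (b p')\<^sup>2 / 2 * w p p')"
    by (simp add: distrib_right sum.distrib)
  also have "(\<Sum>p\<in>P. \<Sum>p'\<in>P. (b p')\<^sup>2 / 2 * w p p') = (\<Sum>p\<in>P. \<Sum>p'\<in>P. (b p)\<^sup>2 / 2 * w p p')"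
    by (subst sum.swap) (intro sum.cong refl, use w in simp)
  also have "(\<Sum>p\<in>P. \<Sum>p'\<in>P. (b p)\<^sup>2 / 2 * w p p') + (\<Sum>p\<in>P. \<Sum>p'\<in>P. (b p)\<^sup>2 / 2 * w p p') =
    (\<Sum>p\<in>P. (b p)\<^sup>2 * (\<Sum>p'\<in>P. w p p'))"
    unfolding sum.distrib[symmetric] sum_distrib_left by (intro sum.cong refl) simp
  also have "\<dots> \<le> (\<Sum>p\<in>P. (b p)\<^sup>2 * L)" using W by (intro sum_mono mult_left_mono) auto
  finally show ?thesis by (simp add: sum_distrib_left mult.commute)
qed

text \<open>Growth by 5/4 lets the extreme term dominate; 5 is \<open>1 / (1 - 4 / 5)\<close>. The
  set \<open>I\<close> of scales may have gaps, so the inductions run over arbitrary finite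
  subsets.\<close>

lemma geometric_tail_sums:
  fixes W :: "nat \<Rightarrow> real"
  assumes W: "\<And>k. k0 \<le> k \<Longrightarrow> 0 < W k" "\<And>k. k0 \<le> k \<Longrightarrow> 5 / 4 * W k \<le> W (Suc k)"
    and I: "finite I" "I \<subseteq> {k0..}" and t: "0 < t"
  shows "(\<Sum>k | k \<in> I \<and> t \<le> W k. 1 / W k) \<le> 5 / t" "(\<Sum>k | k \<in> I \<and> W k < t. W k) \<le> 5 * t"
proof -
  have "finite J \<Longrightarrow> J \<subseteq> {k0..} \<Longrightarrow> (\<And>k. k \<in> J \<Longrightarrow> k < m) \<Longrightarrow> k0 \<le> m \<Longrightarrow> (\<Sum>k\<in>J. W k) \<le> 4 * W m" for J m
  proof (induction m arbitrary: J)
    case (Suc m)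
    show ?case
    proof (cases "k0 \<le> m")
      case True
      have "(\<Sum>k\<in>J. W k) \<le> (\<Sum>k\<in>insert m (J - {m}). W k)" 
        by (rule sum_mono2) (use Suc.prems(1) W(1)[OF True] in auto)
      also have "\<dots> = W m + (\<Sum>k\<in>J - {m}. W k)" using Suc.prems(1) by (subst sum.insert) auto
      also have "(\<Sum>k\<in>J - {m}. W k) \<le> 4 * W m"
      proof (rule Suc.IH)
        show "k < m" if "k \<in> J - {m}" for k using Suc.prems(3)[of k] that by auto
      qed (use Suc.prems(1,2) True in auto)
      finally show ?thesis using W(2)[OF True] by simp
    next
      case False
      then have "J = {}" using Suc.prems(2,3) by force
      then show ?thesis using W(1)[OF Suc.prems(4)] by simp
    qed
  next
    case 0
    then have "J = {}" by auto
    then show ?case using W(1)[OF 0(4)] by simp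
  qed
  note up = this
  show "(\<Sum>k | k \<in> I \<and> W k < t. W k) \<le> 5 * t"
  proof (cases "{k \<in> I. W k < t} = {}")
    case False
    define m where "m = Max {k \<in> I. W k < t}"
    have m: "m \<in> I" "W m < t" using Max_in[OF _ False] I by (auto simp: m_def)
    have "{k \<in> I. W k < t} = insert m {k \<in> I. W k < t \<and> k < m}" 
      using m I by (auto simp: m_def less_le)
    then have "(\<Sum>k | k \<in> I \<and> W k < t. W k) = W m + (\<Sum>k | k \<in> I \<and> W k < t \<and> k < m. W k)"
      using I by simp
    also have "(\<Sum>k | k \<in> I \<and> W k < t \<and> k < m. W k) \<le> 4 * W m" using I m by (intro up) auto
    finally show ?thesis using m by simp
  next
    case True
    then show ?thesis using t by (simp only: sum.empty)
  qed
  have "finite J \<Longrightarrow> (\<And>k. k \<in> J \<Longrightarrow> m \<le> k) \<Longrightarrow> k0 \<le> m \<Longrightarrow> (\<Sum>k\<in>J. 1 / W k) \<le> 5 / W m" for J m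
  proof (induction "card J" arbitrary: J m)
    case (Suc n)
    then have ne: "J \<noteq> {}" by auto
    define i where "i = Min J"
    have i: "i \<in> J" "\<And>k. k \<in> J \<Longrightarrow> i \<le> k" using Suc.prems(1) ne by (auto simp: i_def)
    have mi: "m \<le> i" using i(1) by (rule Suc.prems(2))
    then have mi: "m \<le> i" "k0 \<le> i" using Suc.prems(3) by auto
    have "(\<Sum>k\<in>J. 1 / W k) = 1 / W i + (\<Sum>k\<in>J - {i}. 1 / W k)" using Suc.prems(1) i(1) by (rule sum.remove)
    also have "(\<Sum>k\<in>J - {i}. 1 / W k) \<le> 5 / W (Suc i)"
    proof (rule Suc.hyps(1))
      show "Suc i \<le> k" if "k \<in> J - {i}" for k using i(2)[of k] that by auto
    qed (use Suc.prems(1) Suc.hyps(2) i(1) mi in auto)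
    also have "5 / W (Suc i) \<le> 5 / (5 / 4 * W i)"
      using W(1)[of i] W(2)[of i] W(1)[of "Suc i"] mi by (intro divide_left_mono) auto
    also have "1 / W i + 5 / (5 / 4 * W i) = 5 / W i" using W(1)[of i] mi by (simp add: field_simps)
    also have "W m \<le> W i" using mi(1)
    proof (induction i rule: dec_induct)
      case (step n)
      then show ?case using W(1)[of n] W(2)[of n] Suc.prems(3) by simp
    qed simp
    then have "5 / W i \<le> 5 / W m" using W(1)[of i] W(1)[of m] mi Suc.prems by (intro divide_left_mono) auto
    finally show ?case by simp
  next
    case 0
    then have "J = {}" by simp
    then show ?case using W(1)[OF 0(4)] by simp
  qed
  note down = this
  show "(\<Sum>k | k \<in> I \<and> t \<le> W k. 1 / W k) \<le> 5 / t"
  proof (cases "{k \<in> I. t \<le> W k} = {}")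
    case False
    define m where "m = Min {k \<in> I. t \<le> W k}"
    have m: "m \<in> I" "t \<le> W m" using Min_in[OF _ False] I by (auto simp: m_def)
    have "(\<Sum>k | k \<in> I \<and> t \<le> W k. 1 / W k) \<le> 5 / W m"
      using I m by (intro down) (auto simp: m_def)
    also have "\<dots> \<le> 5 / t" using m t by (intro divide_left_mono) auto
    finally show ?thesis .
  next
    case True
    then show ?thesis using t by (simp only: sum.empty) simp
  qed
qed

text \<open>
  \<open>A k\<close> is the \<open>k\<close>-th dyadic block of the set, \<open>W k\<close> its approximate cardinality, and \<open>K k\<close> a majorant
  of its normalized indicator function, whose autocorrelation \<open>R k\<close> is compared with the smooth
  kernel \<open>G k\<close>.
\<close>

locale sparse_kernels =
  fixes A :: "nat \<Rightarrow> int set" and K :: "nat \<Rightarrow> int \<Rightarrow> real" and W X \<delta> :: "nat \<Rightarrow> real"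
    and G :: "nat \<Rightarrow> int \<Rightarrow> real" and C :: real and k0 :: nat
    and R :: "nat \<Rightarrow> int \<Rightarrow> real"
  defines "R \<equiv> \<lambda>k z. \<Sum>i\<in>{2^k..<2^Suc k}. K k i * K k (i + z)"
  assumes C_ge: "1 \<le> C"
    and K_nonneg: "0 \<le> K k i"
    and K_supp: "i \<notin> {2^k..<2^Suc k} \<Longrightarrow> K k i = 0"
    and A_subset: "A k \<subseteq> {2^k..<2^Suc k}"
    and A_card: "k0 \<le> k \<Longrightarrow> real (card (A k)) \<le> C * W k"
    and K_ge: "k0 \<le> k \<Longrightarrow> i \<in> A k \<Longrightarrow> 1 / W k \<le> K k i"
    and K_sum: "k0 \<le> k \<Longrightarrow> (\<Sum>i\<in>{2^k..<2^Suc k}. K k i) \<le> C"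
    and W_pos: "k0 \<le> k \<Longrightarrow> 0 < W k"
    and W_growth: "k0 \<le> k \<Longrightarrow> 5 / 4 * W k \<le> W (Suc k)"
    and X_ge: "k0 \<le> k \<Longrightarrow> 1 \<le> X k"
    and \<delta>_nonneg: "k0 \<le> k \<Longrightarrow> 0 \<le> \<delta> k"
    and X\<delta>_sum: "finite F \<Longrightarrow> F \<subseteq> {k0..} \<Longrightarrow> (\<Sum>k\<in>F. X k / 2 ^ k + \<delta> k) \<le> C"
    and G_even: "G k (- z) = G k z"
    and G_supp: "2 ^ k \<le> \<bar>z\<bar> \<Longrightarrow> G k z = 0"
    and G_lipschitz: "k0 \<le> k \<Longrightarrow> \<bar>G k z - G k z'\<bar> \<le> C * real_of_int \<bar>z - z'\<bar> / 4 ^ k"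
    and R_approx: "k0 \<le> k \<Longrightarrow> 0 \<le> z \<Longrightarrow> \<bar>R k z - G k z\<bar> \<le> 
       C * (1 / (W k * (1 + (real_of_int z)\<^sup>2)) + of_bool (real_of_int z < X k) / 2 ^ k + of_bool (z < 2 ^ k) * \<delta> k / 2 ^ k)"
begin

lemma R_even: "R k (- z) = R k z"
proof -
  let ?J = "{2^k..<2^Suc k} :: int set"
  have "R k (- z) = (\<Sum>i\<in>?J \<inter> {i. i - z \<in> ?J}. K k i * K k (i + - z))"
    unfolding R_def by (rule sum.mono_neutral_right) (auto simp: K_supp simp del: power_Suc)
  also have "\<dots> = (\<Sum>i\<in>?J \<inter> {i. i + z \<in> ?J}. K k i * K k (i + z))"
    by (rule sum.reindex_bij_witness[of _ "\<lambda>i. i + z" "\<lambda>i. i - z"]) auto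
  also have "\<dots> = R k z"
    unfolding R_def by (rule sum.mono_neutral_left) (auto simp: K_supp simp del: power_Suc)
  finally show ?thesis .
qed

definition U where
  "U k z = C * (1 / (W k * (1 + (real_of_int z)\<^sup>2)) + of_bool (\<bar>real_of_int z\<bar> < X k) / 2 ^ k + of_bool (\<bar>z\<bar> < 2 ^ k) * \<delta> k / 2 ^ k)"

lemma R_approx_abs:
  assumes "k0 \<le> k"
  shows "\<bar>R k z - G k z\<bar> \<le> U k z"
proof (cases "0 \<le> z")
  case True
  then show ?thesis using R_approx[OF assms True] by (simp add: U_def)
next
  case False
  then have "\<bar>R k (- z) - G k (- z)\<bar> \<le> U k (- z)" using R_approx[OF assms, of "- z"] by (simp add: U_def)
  then show ?thesis by (simp add: R_even G_even U_def)
qed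

text \<open>Opening the square turns a convolution into the quadratic form of the autocorrelation.
  Points are indexed by \<open>p\<close> with a position \<open>pos p\<close>, so that the pieces of
  the bad part need not be assembled into one function; \<open>Z\<close> has to contain every place
  where the convolution can be nonzero.\<close>

lemma convolution_square:
  fixes b :: "'p \<Rightarrow> real" and pos :: "'p \<Rightarrow> int"
  assumes "finite Z" "finite P" and Z: "\<And>p i. p \<in> P \<Longrightarrow> i \<in> {2^k..<2^Suc k} \<Longrightarrow> pos p - i \<in> Z"
  shows "(\<Sum>x\<in>Z. (\<Sum>p\<in>P. K k (pos p - x) * b p)\<^sup>2) = (\<Sum>p\<in>P. \<Sum>p'\<in>P. b p * b p' * R k (pos p' - pos p))"
proof -
  have corr: "(\<Sum>x\<in>Z. K k (pos p - x) * K k (pos p' - x)) = R k (pos p' - pos p)" if "p \<in> P" for p p'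
  proof -
    have "(\<Sum>x\<in>Z. K k (pos p - x) * K k (pos p' - x)) = 
        (\<Sum>x\<in>Z \<inter> {x. pos p - x \<in> {2^k..<2^Suc k}}. K k (pos p - x) * K k (pos p' - x))"
      using assms(1) by (intro sum.mono_neutral_right) (auto simp: K_supp simp del: power_Suc)
    also have "\<dots> = R k (pos p' - pos p)" unfolding R_def
      by (rule sum.reindex_bij_witness[of _ "\<lambda>i. pos p - i" "\<lambda>x. pos p - x"])
        (use Z[OF that] in \<open>auto simp: algebra_simps simp del: power_Suc\<close>)
    finally show ?thesis .
  qed
  have "(\<Sum>x\<in>Z. (\<Sum>p\<in>P. K k (pos p - x) * b p)\<^sup>2) = 
    (\<Sum>x\<in>Z. \<Sum>p\<in>P. \<Sum>p'\<in>P. b p * b p' * (K k (pos p - x) * K k (pos p' - x)))"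
    by (simp add: power2_eq_square sum_product mult_ac)
  also have "\<dots> = (\<Sum>p\<in>P. \<Sum>p'\<in>P. \<Sum>x\<in>Z. b p * b p' * (K k (pos p - x) * K k (pos p' - x)))"
    by (subst sum.swap, intro sum.cong refl, rule sum.swap)
  also have "\<dots> = (\<Sum>p\<in>P. \<Sum>p'\<in>P. b p * b p' * R k (pos p' - pos p))"
    by (intro sum.cong refl) (simp add: corr flip: sum_distrib_left)
  finally show ?thesis .
qed

end

lemma sum_Sigma_dyadic:
  assumes "finite Q"
  shows "(\<Sum>p\<in>(SIGMA q:Q. dyadic q). F p) = (\<Sum>q\<in>Q. \<Sum>y\<in>dyadic q. F (q, y))"
  using assms by (simp add: sum.Sigma)

text \<open>Disjoint intervals of length at most \<open>2 ^ s\<close> that meet the window of radius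
  \<open>r\<close> about \<open>y\<close> all lie in the window enlarged by
  \<open>2 ^ s\<close>.\<close>

lemma sum_sizes_of_near_dyadics:
  assumes Q: "finite Q" "\<And>q q' y. q \<in> Q \<Longrightarrow> q' \<in> Q \<Longrightarrow> y \<in> dyadic q \<Longrightarrow> y \<in> dyadic q' \<Longrightarrow> q = q'"
    and near: "\<And>q. q \<in> Q \<Longrightarrow> fst q \<le> s \<and> (\<exists>z\<in>dyadic q. \<bar>z - y\<bar> \<le> r)" and "0 \<le> r"
  shows "(\<Sum>q\<in>Q. 2 ^ fst q :: real) \<le> 2 * real_of_int r + 2 * 2 ^ s + 1"
proof -
  have "(\<Sum>q\<in>Q. card (dyadic q)) = card (\<Union>q\<in>Q. dyadic q)"
    using Q by (intro card_UN_disjoint[symmetric]) auto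
  also have "\<dots> \<le> card {y - r - 2 ^ s..y + r + 2 ^ s}"
  proof (intro card_mono)
    show "(\<Union>q\<in>Q. dyadic q) \<subseteq> {y - r - 2 ^ s..y + r + 2 ^ s}"
    proof
      fix w assume "w \<in> (\<Union>q\<in>Q. dyadic q)"
      then obtain q where q: "q \<in> Q" "w \<in> dyadic q" by auto
      obtain z where z: "z \<in> dyadic q" "\<bar>z - y\<bar> \<le> r" "fst q \<le> s" using near[OF q(1)] by auto
      have "(2::int) ^ fst q \<le> 2 ^ s" using z(3) by (intro power_increasing) auto
      then show "w \<in> {y - r - 2 ^ s..y + r + 2 ^ s}" 
        using dyadic_diameter[OF q(2) z(1)] z(2) unfolding atLeastAtMost_iff by linarith
    qed
  qed auto
  finally have "(\<Sum>q\<in>Q. (2::nat) ^ fst q) \<le> nat (2 * r + 2 * 2 ^ s + 1)"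
    by (simp add: card_dyadic algebra_simps)
  then have "int (\<Sum>q\<in>Q. (2::nat) ^ fst q) \<le> 2 * r + 2 * 2 ^ s + 1" using \<open>0 \<le> r\<close> by (simp add: le_nat_iff)
  then have "real_of_int (int (\<Sum>q\<in>Q. (2::nat) ^ fst q)) \<le> real_of_int (2 * r + 2 * 2 ^ s + 1)"
    by (simp only: of_int_le_iff)
  then show ?thesis by simp
qed

context sparse_kernels
begin

text \<open>
  The bilinear form is split according to which of the two dyadic intervals is larger; the
  cancellation of the function on the smaller one is played against the smooth kernel \<open>G\<close>.
\<close>

lemma bilinear_bound:
  fixes b :: "(nat \<times> int) \<Rightarrow> int \<Rightarrow> real"
  assumes k: "k0 \<le> k" and Q: "finite Q" "\<And>q. q \<in> Q \<Longrightarrow> fst q < k"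
      "\<And>q q' y. q \<in> Q \<Longrightarrow> q' \<in> Q \<Longrightarrow> y \<in> dyadic q \<Longrightarrow> y \<in> dyadic q' \<Longrightarrow> q = q'"
    and b0: "\<And>q. q \<in> Q \<Longrightarrow> (\<Sum>y\<in>dyadic q. b q y) = 0"
    and b1: "\<And>q. q \<in> Q \<Longrightarrow> (\<Sum>y\<in>dyadic q. \<bar>b q y\<bar>) \<le> 4 * l * 2 ^ fst q" and l: "0 < l"
  shows "(\<Sum>q\<in>Q. \<Sum>y\<in>dyadic q. \<Sum>q'\<in>Q. \<Sum>y'\<in>dyadic q'. b q y * b q' y' * R k (y' - y)) \<le>
     16 * C / W k * (\<Sum>q\<in>Q. \<Sum>y\<in>dyadic q. (b q y)\<^sup>2) +
     72 * C * l * (\<Sum>q\<in>Q. (\<Sum>y\<in>dyadic q. \<bar>b q y\<bar>) * (2 ^ fst q / 2 ^ k + X k / 2 ^ k + \<delta> k))"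
proof -
  define \<beta> where "\<beta> = (\<lambda>q q'. \<Sum>y\<in>dyadic q. \<Sum>y'\<in>dyadic q'. b q y * b q' y' * R k (y' - y))"
  \<comment> \<open>\<open>u1\<close> is the peak, \<open>u2\<close> the short shifts and
    \<open>u3\<close> the remaining error of \<open>R k\<close> against \<open>G k\<close>;
    \<open>u4\<close> is what the Lipschitz bound for \<open>G k\<close> leaves when the mean zero
    of the function on the smaller interval is used.\<close>
  define u1 where "u1 = (\<lambda>z::int. 1 / (W k * (1 + (real_of_int z)\<^sup>2)))"
  define u2 where "u2 = (\<lambda>z::int. of_bool (\<bar>real_of_int z\<bar> < X k) / 2 ^ k :: real)"
  define u3 where "u3 = (\<lambda>z::int. of_bool (\<bar>z\<bar> < 2 ^ k) * \<delta> k / 2 ^ k :: real)"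
  define u4 where "u4 = (\<lambda>s (z::int). 2 ^ s / 4 ^ k * of_bool (\<bar>z\<bar> \<le> 2 ^ Suc k) :: real)"
  have Wp: "0 < W k" using W_pos k by auto
  have C0: "0 < C" using C_ge by simp
  have U: "U k z = C * (u1 z + u2 z + u3 z)" for z by (simp add: U_def u1_def u2_def u3_def)
  have inner: "\<bar>\<Sum>y'\<in>dyadic q'. b q' y' * R k (y' - y)\<bar> \<le> 
      (\<Sum>y'\<in>dyadic q'. \<bar>b q' y'\<bar> * (C * (u1 (y' - y) + u2 (y' - y) + u3 (y' - y) + u4 s (y' - y))))"
    if q': "q' \<in> Q" "fst q' \<le> s" for q' y s
  proof -
    have "\<bar>\<Sum>y'\<in>dyadic q'. b q' y' * R k (y' - y)\<bar> = 
       \<bar>(\<Sum>y'\<in>dyadic q'. b q' y' * (R k (y' - y) - G k (y' - y))) + (\<Sum>y'\<in>dyadic q'. b q' y' * G k (y' - y))\<bar>"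
      by (simp add: right_diff_distrib flip: sum.distrib)
    also have "\<dots> \<le> \<bar>\<Sum>y'\<in>dyadic q'. b q' y' * (R k (y' - y) - G k (y' - y))\<bar> + \<bar>\<Sum>y'\<in>dyadic q'. b q' y' * G k (y' - y)\<bar>"
      by (rule abs_triangle_ineq)
    also have "\<bar>\<Sum>y'\<in>dyadic q'. b q' y' * (R k (y' - y) - G k (y' - y))\<bar> \<le> (\<Sum>y'\<in>dyadic q'. \<bar>b q' y'\<bar> * U k (y' - y))"
      using R_approx_abs[OF k] by (intro order_trans[OF sum_abs] sum_mono) (simp add: abs_mult mult_left_mono)
    also have "\<bar>\<Sum>y'\<in>dyadic q'. b q' y' * G k (y' - y)\<bar> \<le> (\<Sum>y'\<in>dyadic q'. \<bar>b q' y'\<bar> * (C * u4 s (y' - y)))"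
    proof (cases "\<exists>w\<in>dyadic q'. \<bar>w - y\<bar> < 2 ^ k")
      case True
      then obtain w where w: "w \<in> dyadic q'" "\<bar>w - y\<bar> < 2 ^ k" by auto
      have "(\<Sum>y'\<in>dyadic q'. b q' y' * G k (y' - y)) = (\<Sum>y'\<in>dyadic q'. b q' y' * (G k (y' - y) - G k (w - y)))"
        using b0[OF q'(1)] by (simp add: right_diff_distrib sum_subtractf flip: sum_distrib_right)
      also have "\<bar>\<dots>\<bar> \<le> (\<Sum>y'\<in>dyadic q'. \<bar>b q' y'\<bar> * (C * u4 s (y' - y)))"
      proof (intro order_trans[OF sum_abs] sum_mono)
        fix y' assume y': "y' \<in> dyadic q'"
        have dw: "\<bar>y' - w\<bar> < 2 ^ fst q'" using dyadic_diameter[OF y' w(1)] .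
        have "(2::int) ^ fst q' \<le> 2 ^ k" using Q(2)[OF q'(1)] by (intro power_increasing) auto
        then have near: "\<bar>y' - y\<bar> \<le> 2 ^ Suc k" using dw w(2) unfolding power_Suc by linarith
        have ps: "(2::int) ^ fst q' \<le> 2 ^ s" using q'(2) by (intro power_increasing) auto
        have "\<bar>G k (y' - y) - G k (w - y)\<bar> \<le> C * real_of_int \<bar>(y' - y) - (w - y)\<bar> / 4 ^ k"
          by (rule G_lipschitz[OF k])
        also have "\<dots> \<le> C * 2 ^ s / 4 ^ k"
        proof (intro divide_right_mono mult_left_mono)
          have "\<bar>(y' - y) - (w - y)\<bar> \<le> 2 ^ s" using dw ps by linarith
          then have "real_of_int \<bar>(y' - y) - (w - y)\<bar> \<le> real_of_int (2 ^ s)" by (simp only: of_int_le_iff)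
          then show "real_of_int \<bar>(y' - y) - (w - y)\<bar> \<le> 2 ^ s" by simp
        qed (use C0 in auto)
        also have "\<dots> = C * u4 s (y' - y)" using near by (simp add: u4_def)
        finally show "\<bar>b q' y' * (G k (y' - y) - G k (w - y))\<bar> \<le> \<bar>b q' y'\<bar> * (C * u4 s (y' - y))"
          by (simp add: abs_mult mult_left_mono)
      qed
      finally show ?thesis .
    next
      case False
      then have "(\<Sum>y'\<in>dyadic q'. b q' y' * G k (y' - y)) = 0"
        by (intro sum.neutral) (auto simp: G_supp not_less)
      then show ?thesis using C0 by (auto intro!: sum_nonneg simp: u4_def)
    qed
    finally show ?thesis by (simp add: U algebra_simps flip: sum.distrib)
  qed
  \<comment> \<open>On every interval the average of \<open>\<bar>b\<bar>\<close> is at most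
    \<open>4 * l\<close>, so its mass in a window is at most \<open>4 * l\<close> times the length
    of the slightly enlarged window.\<close>
  have collect: "(\<Sum>q'\<in>{q'\<in>Q. fst q' \<le> s}. \<Sum>y'\<in>dyadic q'. \<bar>b q' y'\<bar> * of_bool (\<bar>y' - y\<bar> \<le> r)) \<le> 4 * l * (2 * real_of_int r + 2 * 2 ^ s + 1)"
    if "0 \<le> r" for s y and r :: int
  proof -
    define N where "N = {q'\<in>Q. fst q' \<le> s \<and> (\<exists>z\<in>dyadic q'. \<bar>z - y\<bar> \<le> r)}"
    have "(\<Sum>q'\<in>{q'\<in>Q. fst q' \<le> s}. \<Sum>y'\<in>dyadic q'. \<bar>b q' y'\<bar> * of_bool (\<bar>y' - y\<bar> \<le> r)) = 
      (\<Sum>q'\<in>N. \<Sum>y'\<in>dyadic q'. \<bar>b q' y'\<bar> * of_bool (\<bar>y' - y\<bar> \<le> r))"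
      using Q(1) by (intro sum.mono_neutral_right) (auto simp: N_def intro!: sum.neutral)
    also have "\<dots> \<le> (\<Sum>q'\<in>N. \<Sum>y'\<in>dyadic q'. \<bar>b q' y'\<bar>)"
      by (intro sum_mono) auto
    also have "\<dots> \<le> (\<Sum>q'\<in>N. 4 * l * 2 ^ fst q')" by (intro sum_mono b1) (auto simp: N_def)
    also have "\<dots> = 4 * l * (\<Sum>q'\<in>N. 2 ^ fst q')" by (simp add: sum_distrib_left)
    also have "\<dots> \<le> 4 * l * (2 * real_of_int r + 2 * 2 ^ s + 1)"
      using Q l that by (intro mult_left_mono sum_sizes_of_near_dyadics[where y = y]) (auto simp: N_def)
    finally show ?thesis .
  qed
  have u0: "0 \<le> u1 z" "0 \<le> u2 z" "0 \<le> u3 z" "0 \<le> u4 s z" for z s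
    using Wp \<delta>_nonneg[OF k] by (auto simp: u1_def u2_def u3_def u4_def)
  have far: "(\<Sum>q'\<in>{q'\<in>Q. fst q' \<le> s}. \<Sum>y'\<in>dyadic q'. \<bar>b q' y'\<bar> * (u2 (y' - y) + u3 (y' - y) + u4 s (y' - y))) 
     \<le> 36 * l * (2 ^ s / 2 ^ k + X k / 2 ^ k + \<delta> k)" if s: "s < k" for s y
  proof -
    let ?S = "\<lambda>r::int. \<Sum>q'\<in>{q'\<in>Q. fst q' \<le> s}. \<Sum>y'\<in>dyadic q'. \<bar>b q' y'\<bar> * of_bool (\<bar>y' - y\<bar> \<le> r)"
    define r where "r = \<lfloor>X k\<rfloor>"
    have X1: "1 \<le> X k" using X_ge k by auto
    have r: "0 \<le> r" "real_of_int r \<le> X k" using X1 by (auto simp: r_def)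
    have s2: "(2::real) ^ s \<le> 2 ^ k" using s by (intro power_increasing) auto
    have k1: "(1::real) \<le> 2 ^ k" by simp
    have "(\<Sum>q'\<in>{q'\<in>Q. fst q' \<le> s}. \<Sum>y'\<in>dyadic q'. \<bar>b q' y'\<bar> * (u2 (y' - y) + u3 (y' - y) + u4 s (y' - y)))
      \<le> (\<Sum>q'\<in>{q'\<in>Q. fst q' \<le> s}. \<Sum>y'\<in>dyadic q'. \<bar>b q' y'\<bar> * (of_bool (\<bar>y' - y\<bar> \<le> r) / 2 ^ k + 
            of_bool (\<bar>y' - y\<bar> \<le> 2 ^ k) * (\<delta> k / 2 ^ k) + of_bool (\<bar>y' - y\<bar> \<le> 2 ^ Suc k) * (2 ^ s / 4 ^ k)))"
    proof (intro sum_mono mult_left_mono add_mono)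
      fix y'
      show "u2 (y' - y) \<le> of_bool (\<bar>y' - y\<bar> \<le> r) / 2 ^ k"
        unfolding u2_def r_def by (auto simp: le_floor_iff)
      show "u3 (y' - y) \<le> of_bool (\<bar>y' - y\<bar> \<le> 2 ^ k) * (\<delta> k / 2 ^ k)"
        using \<delta>_nonneg[OF k] unfolding u3_def by auto
      show "u4 s (y' - y) \<le> of_bool (\<bar>y' - y\<bar> \<le> 2 ^ Suc k) * (2 ^ s / 4 ^ k)" unfolding u4_def by auto
    qed auto
    also have "\<dots> = ?S r / 2 ^ k + ?S (2 ^ k) * (\<delta> k / 2 ^ k) + ?S (2 ^ Suc k) * (2 ^ s / 4 ^ k)"
      by (simp only: distrib_left sum.distrib sum_divide_distrib sum_distrib_right times_divide_eq_right mult.assoc)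
    also have "\<dots> \<le> 4 * l * (2 * real_of_int r + 2 * 2 ^ s + 1) / 2 ^ k + 
       4 * l * (2 * real_of_int (2 ^ k) + 2 * 2 ^ s + 1) * (\<delta> k / 2 ^ k) + 
       4 * l * (2 * real_of_int (2 ^ Suc k) + 2 * 2 ^ s + 1) * (2 ^ s / 4 ^ k)"
      using \<delta>_nonneg[OF k] r by (intro add_mono mult_right_mono divide_right_mono collect) auto
    also have "\<dots> \<le> 4 * l * (3 * X k + 2 * 2 ^ s) / 2 ^ k + 
       4 * l * (5 * 2 ^ k) * (\<delta> k / 2 ^ k) + 4 * l * (7 * 2 ^ k) * (2 ^ s / 4 ^ k)"
    proof (intro add_mono)
      have "2 * real_of_int r + 2 * 2 ^ s + 1 \<le> 3 * X k + 2 * 2 ^ s" using r X1 by linarith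
      then show "4 * l * (2 * real_of_int r + 2 * 2 ^ s + 1) / 2 ^ k \<le> 4 * l * (3 * X k + 2 * 2 ^ s) / 2 ^ k"
        using l by (intro divide_right_mono mult_left_mono) simp_all
      have "2 * real_of_int (2 ^ k) + 2 * 2 ^ s + 1 \<le> 5 * 2 ^ k"
        using s2 k1 unfolding of_int_power of_int_numeral by linarith
      then show "4 * l * (2 * real_of_int (2 ^ k) + 2 * 2 ^ s + 1) * (\<delta> k / 2 ^ k) \<le> 4 * l * (5 * 2 ^ k) * (\<delta> k / 2 ^ k)"
        using l \<delta>_nonneg[OF k] by (intro mult_right_mono mult_left_mono) simp_all
      have "2 * real_of_int (2 ^ Suc k) + 2 * 2 ^ s + 1 \<le> 7 * 2 ^ k"
        using s2 k1 unfolding power_Suc of_int_mult of_int_power of_int_numeral by linarith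
      then show "4 * l * (2 * real_of_int (2 ^ Suc k) + 2 * 2 ^ s + 1) * (2 ^ s / 4 ^ k) \<le> 4 * l * (7 * 2 ^ k) * (2 ^ s / 4 ^ k)"
        using l by (intro mult_right_mono mult_left_mono) simp_all
    qed
    also have "\<dots> = 12 * l * (X k / 2 ^ k) + 20 * l * \<delta> k + 36 * l * (2 ^ s / 2 ^ k)"
    proof -
      have "(4::real) ^ k = 2 ^ k * 2 ^ k" by (simp flip: power_mult_distrib)
      then show ?thesis by (simp add: field_simps)
    qed
    also have "\<dots> \<le> 36 * l * (X k / 2 ^ k) + 36 * l * \<delta> k + 36 * l * (2 ^ s / 2 ^ k)"
      using l \<delta>_nonneg[OF k] X1 by (intro add_mono mult_right_mono) auto
    finally show ?thesis by (simp add: algebra_simps)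
  qed
  have half: "(\<Sum>q'\<in>{q'\<in>Q. fst q' \<le> fst q}. \<bar>\<beta> q q'\<bar>) \<le> 
      C * (\<Sum>y\<in>dyadic q. \<Sum>q'\<in>Q. \<Sum>y'\<in>dyadic q'. \<bar>b q y\<bar> * \<bar>b q' y'\<bar> * u1 (y' - y)) +
      36 * C * l * ((\<Sum>y\<in>dyadic q. \<bar>b q y\<bar>) * (2 ^ fst q / 2 ^ k + X k / 2 ^ k + \<delta> k))" if q: "q \<in> Q" for q
  proof -
    let ?Q = "{q'\<in>Q. fst q' \<le> fst q}"
    have "(\<Sum>q'\<in>?Q. \<bar>\<beta> q q'\<bar>) \<le> (\<Sum>q'\<in>?Q. \<Sum>y\<in>dyadic q. \<bar>b q y\<bar> * 
        (\<Sum>y'\<in>dyadic q'. \<bar>b q' y'\<bar> * (C * (u1 (y' - y) + u2 (y' - y) + u3 (y' - y) + u4 (fst q) (y' - y)))))"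
    proof (rule sum_mono)
      fix q' assume q': "q' \<in> ?Q"
      have "\<beta> q q' = (\<Sum>y\<in>dyadic q. b q y * (\<Sum>y'\<in>dyadic q'. b q' y' * R k (y' - y)))"
        by (simp add: \<beta>_def sum_distrib_left mult.assoc)
      also have "\<bar>\<dots>\<bar> \<le> (\<Sum>y\<in>dyadic q. \<bar>b q y\<bar> * \<bar>\<Sum>y'\<in>dyadic q'. b q' y' * R k (y' - y)\<bar>)"
        by (rule order_trans[OF sum_abs]) (simp add: abs_mult)
      also have "\<dots> \<le> (\<Sum>y\<in>dyadic q. \<bar>b q y\<bar> * 
        (\<Sum>y'\<in>dyadic q'. \<bar>b q' y'\<bar> * (C * (u1 (y' - y) + u2 (y' - y) + u3 (y' - y) + u4 (fst q) (y' - y)))))"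
        using q' by (intro sum_mono mult_left_mono inner) auto
      finally show "\<bar>\<beta> q q'\<bar> \<le> \<dots>" .
    qed
    also have "\<dots> = (\<Sum>y\<in>dyadic q. \<Sum>q'\<in>?Q. \<bar>b q y\<bar> * 
        (\<Sum>y'\<in>dyadic q'. \<bar>b q' y'\<bar> * (C * (u1 (y' - y) + u2 (y' - y) + u3 (y' - y) + u4 (fst q) (y' - y)))))"
      by (rule sum.swap)
    also have "\<dots> = (\<Sum>y\<in>dyadic q. C * (\<Sum>q'\<in>?Q. \<Sum>y'\<in>dyadic q'. \<bar>b q y\<bar> * \<bar>b q' y'\<bar> * u1 (y' - y)) + 
        C * \<bar>b q y\<bar> * (\<Sum>q'\<in>?Q. \<Sum>y'\<in>dyadic q'. \<bar>b q' y'\<bar> * (u2 (y' - y) + u3 (y' - y) + u4 (fst q) (y' - y))))"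
      by (intro sum.cong refl) (simp add: sum_distrib_left algebra_simps flip: sum.distrib)
    also have "\<dots> \<le> (\<Sum>y\<in>dyadic q. C * (\<Sum>q'\<in>Q. \<Sum>y'\<in>dyadic q'. \<bar>b q y\<bar> * \<bar>b q' y'\<bar> * u1 (y' - y)) + 
        C * \<bar>b q y\<bar> * (36 * l * (2 ^ fst q / 2 ^ k + X k / 2 ^ k + \<delta> k)))"
    proof (intro sum_mono add_mono mult_left_mono)
      fix y
      show "(\<Sum>q'\<in>?Q. \<Sum>y'\<in>dyadic q'. \<bar>b q y\<bar> * \<bar>b q' y'\<bar> * u1 (y' - y)) \<le> 
          (\<Sum>q'\<in>Q. \<Sum>y'\<in>dyadic q'. \<bar>b q y\<bar> * \<bar>b q' y'\<bar> * u1 (y' - y))"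
        using Q(1) u0 by (intro sum_mono2 sum_nonneg) auto
      show "(\<Sum>q'\<in>?Q. \<Sum>y'\<in>dyadic q'. \<bar>b q' y'\<bar> * (u2 (y' - y) + u3 (y' - y) + u4 (fst q) (y' - y))) \<le>
         36 * l * (2 ^ fst q / 2 ^ k + X k / 2 ^ k + \<delta> k)" using far Q(2)[OF q] by auto
    qed (use C0 in auto)
    also have "\<dots> = C * (\<Sum>y\<in>dyadic q. \<Sum>q'\<in>Q. \<Sum>y'\<in>dyadic q'. \<bar>b q y\<bar> * \<bar>b q' y'\<bar> * u1 (y' - y)) +
      (\<Sum>y\<in>dyadic q. \<bar>b q y\<bar> * (36 * C * l * (2 ^ fst q / 2 ^ k + X k / 2 ^ k + \<delta> k)))"
      by (simp add: sum.distrib sum_distrib_left mult_ac)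
    finally show ?thesis unfolding sum_distrib_right[symmetric] by (simp only: mult_ac)
  qed
  have \<beta>_sym: "\<beta> q q' = \<beta> q' q" for q q'
  proof -
    have "\<beta> q q' = (\<Sum>y'\<in>dyadic q'. \<Sum>y\<in>dyadic q. b q y * b q' y' * R k (- (y - y')))"
      unfolding \<beta>_def by (subst sum.swap) simp
    then show ?thesis unfolding R_even by (simp add: \<beta>_def mult_ac)
  qed
  have "(\<Sum>q\<in>Q. \<Sum>y\<in>dyadic q. \<Sum>q'\<in>Q. \<Sum>y'\<in>dyadic q'. b q y * b q' y' * R k (y' - y)) = (\<Sum>q\<in>Q. \<Sum>q'\<in>Q. \<beta> q q')"
    unfolding \<beta>_def by (intro sum.cong refl) (rule sum.swap)
  \<comment> \<open>Pairs of intervals of equal level are counted in both halves, which does no harm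
    to an upper bound.\<close>
  also have "\<dots> \<le> (\<Sum>q\<in>Q. \<Sum>q'\<in>Q. of_bool (fst q' \<le> fst q) * \<bar>\<beta> q q'\<bar> + of_bool (fst q \<le> fst q') * \<bar>\<beta> q' q\<bar>)"
    using \<beta>_sym by (intro sum_mono) (auto simp: of_bool_def intro: order_trans[OF abs_ge_self])
  also have "\<dots> = (\<Sum>q\<in>Q. \<Sum>q'\<in>Q. of_bool (fst q' \<le> fst q) * \<bar>\<beta> q q'\<bar>) + (\<Sum>q\<in>Q. \<Sum>q'\<in>Q. of_bool (fst q \<le> fst q') * \<bar>\<beta> q' q\<bar>)"
    by (simp add: sum.distrib)
  also have "(\<Sum>q\<in>Q. \<Sum>q'\<in>Q. of_bool (fst q \<le> fst q') * \<bar>\<beta> q' q\<bar>) = (\<Sum>q\<in>Q. \<Sum>q'\<in>Q. of_bool (fst q' \<le> fst q) * \<bar>\<beta> q q'\<bar>)"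
    by (rule sum.swap)
  also have "(\<Sum>q\<in>Q. \<Sum>q'\<in>Q. of_bool (fst q' \<le> fst q) * \<bar>\<beta> q q'\<bar>) = (\<Sum>q\<in>Q. \<Sum>q'\<in>{q'\<in>Q. fst q' \<le> fst q}. \<bar>\<beta> q q'\<bar>)"
    using Q(1) by (intro sum.cong refl sum.mono_neutral_cong_right) auto
  also have "\<dots> \<le> (\<Sum>q\<in>Q. C * (\<Sum>y\<in>dyadic q. \<Sum>q'\<in>Q. \<Sum>y'\<in>dyadic q'. \<bar>b q y\<bar> * \<bar>b q' y'\<bar> * u1 (y' - y)) +
      36 * C * l * ((\<Sum>y\<in>dyadic q. \<bar>b q y\<bar>) * (2 ^ fst q / 2 ^ k + X k / 2 ^ k + \<delta> k)))"
    by (intro sum_mono half)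
  also have "\<dots> = C * (\<Sum>q\<in>Q. \<Sum>y\<in>dyadic q. \<Sum>q'\<in>Q. \<Sum>y'\<in>dyadic q'. \<bar>b q y\<bar> * \<bar>b q' y'\<bar> * u1 (y' - y)) +
      36 * C * l * (\<Sum>q\<in>Q. (\<Sum>y\<in>dyadic q. \<bar>b q y\<bar>) * (2 ^ fst q / 2 ^ k + X k / 2 ^ k + \<delta> k))"
    by (simp add: sum.distrib sum_distrib_left)
  also have "(\<Sum>q\<in>Q. \<Sum>y\<in>dyadic q. \<Sum>q'\<in>Q. \<Sum>y'\<in>dyadic q'. \<bar>b q y\<bar> * \<bar>b q' y'\<bar> * u1 (y' - y)) \<le> 
      8 / W k * (\<Sum>q\<in>Q. \<Sum>y\<in>dyadic q. (b q y)\<^sup>2)"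
  proof -
    \<comment> \<open>The intervals are disjoint, so the positions are distinct integers and the row
      sums of \<open>u1\<close> are at most \<open>8 / W k\<close>; Schur's test then bounds the
      peak by the square sum of \<open>b\<close>.\<close>
    let ?P = "SIGMA q:Q. dyadic q"
    have P: "finite ?P" using Q(1) by auto
    have "(\<Sum>p\<in>?P. \<Sum>p'\<in>?P. \<bar>b (fst p) (snd p)\<bar> * \<bar>b (fst p') (snd p')\<bar> * u1 (snd p' - snd p)) \<le>
      8 / W k * (\<Sum>p\<in>?P. (b (fst p) (snd p))\<^sup>2)"
    proof (rule sum_weighted_products_le[OF P])
      show "0 \<le> u1 (snd p' - snd p) \<and> u1 (snd p' - snd p) = u1 (snd p - snd p')" for p p' :: "(nat \<times> int) \<times> int"
        using u0(1)[of "snd p' - snd p"] by (auto simp: u1_def power2_commute)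
      fix p
      have inj: "inj_on snd ?P" using Q(3) by (auto simp: inj_on_def)
      have "(\<Sum>p'\<in>?P. u1 (snd p' - snd p)) = (\<Sum>y'\<in>snd ` ?P. u1 (y' - snd p))"
        by (subst sum.reindex[OF inj]) simp
      also have "\<dots> = 1 / W k * (\<Sum>y'\<in>snd ` ?P. 1 / (1 + (of_int (y' - snd p))\<^sup>2))"
        unfolding sum_distrib_left by (simp add: u1_def)
      also have "\<dots> \<le> 1 / W k * 8"
        using P Wp by (intro mult_left_mono sum_inverse_one_plus_square_int) auto
      finally show "(\<Sum>p'\<in>?P. u1 (snd p' - snd p)) \<le> 8 / W k" by simp
    qed
    then show ?thesis unfolding sum_Sigma_dyadic[OF Q(1)] fst_conv snd_conv .
  qed
  finally show ?thesis using C0 by (simp add: algebra_simps)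
qed

text \<open>Three exceptional sets are removed: \<open>Om\<close> for intervals at least as long as
  the scale, \<open>Hv\<close> for values of \<open>f\<close> above \<open>l * W k\<close>, and
  \<open>L\<close> for large convolutions with the functions of mean zero. Elsewhere the good part
  contributes at most \<open>2 * l * C\<close> and the bad part at most \<open>l\<close>.\<close>

theorem weak_type:
  fixes f :: "int \<Rightarrow> real"
  assumes f: "\<And>y. 0 \<le> f y" "\<And>y. y \<notin> Y \<Longrightarrow> f y = 0" "finite Y" and l: "0 < l"
    and I: "finite I" "I \<subseteq> {k0..}" and Z: "finite Z"
  shows "real (card {x\<in>Z. \<exists>k\<in>I. (2 * C + 1) * l < (\<Sum>n\<in>A k. f (x + n)) / W k}) \<le> 400 * C\<^sup>2 * sum f Y / l"
proof -
  obtain Q where finQ: "finite Q" 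
    and disj: "\<And>q q' y. q \<in> Q \<Longrightarrow> q' \<in> Q \<Longrightarrow> y \<in> dyadic q \<Longrightarrow> y \<in> dyadic q' \<Longrightarrow> q = q'"
    and Q_ge: "\<And>q. q \<in> Q \<Longrightarrow> l * 2 ^ fst q \<le> sum f (dyadic q)"
    and Q_le: "\<And>q. q \<in> Q \<Longrightarrow> sum f (dyadic q) \<le> 2 * l * 2 ^ fst q"
    and off: "\<And>y. y \<notin> (\<Union>q\<in>Q. dyadic q) \<Longrightarrow> f y \<le> l"
    by (rule calderon_zygmund_stopping[of f Y l, OF f l], assumption, rule that, assumption+)
  define S where "S = sum f Y"
  have S0: "0 \<le> S" unfolding S_def using f by (intro sum_nonneg) auto
  have C0: "0 < C" using C_ge by simp
  have Ik: "k0 \<le> k" if "k \<in> I" for k using I that by auto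
  have sumQ: "(\<Sum>q\<in>Q'. \<Sum>y\<in>dyadic q. g y) \<le> sum g Y"
    if "Q' \<subseteq> Q" "\<And>y. 0 \<le> g y" "\<And>y. y \<notin> Y \<Longrightarrow> g y = 0" for Q' and g :: "int \<Rightarrow> real"
  proof -
    have fin: "finite Q'" using that(1) finQ by (rule finite_subset)
    have "(\<Sum>q\<in>Q'. \<Sum>y\<in>dyadic q. g y) = sum g (\<Union>q\<in>Q'. dyadic q)"
    proof (intro sum.UNION_disjoint[symmetric] ballI impI)
      show "dyadic q \<inter> dyadic q' = {}" if "q \<in> Q'" "q' \<in> Q'" "q \<noteq> q'" for q q'
        using disj[of q q'] that \<open>Q' \<subseteq> Q\<close> by blast
    qed (use fin in auto)
    also have "\<dots> = sum g ((\<Union>q\<in>Q'. dyadic q) \<inter> Y)" using fin that by (intro sum.mono_neutral_right) auto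
    also have "\<dots> \<le> sum g Y" using f(3) that by (intro sum_mono2) auto
    finally show ?thesis .
  qed
  \<comment> \<open>A shift \<open>n\<close> from block \<open>k\<close> is positive and less than
    \<open>2 * 2 ^ fst q\<close> as soon as \<open>k\<close> does not exceed the level of
    \<open>q\<close>; hence the extension to the left by two lengths.\<close>
  define Om where "Om = (\<Union>q\<in>Q. {snd q * 2 ^ fst q - 2 * 2 ^ fst q..<(snd q + 1) * 2 ^ fst q})"
  have Om: "finite Om" "real (card Om) \<le> 3 * S / l"
  proof -
    show "finite Om" using finQ by (auto simp: Om_def)
    have "card Om \<le> (\<Sum>q\<in>Q. card {snd q * 2 ^ fst q - 2 * 2 ^ fst q..<(snd q + 1) * 2 ^ fst q})"
      unfolding Om_def by (rule card_UN_le) fact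
    also have "\<dots> = (\<Sum>q\<in>Q. 3 * 2 ^ fst q)" 
    proof (intro sum.cong refl)
      fix q :: "nat \<times> int"
      have "nat ((snd q + 1) * 2 ^ fst q - (snd q * 2 ^ fst q - 2 * 2 ^ fst q)) = nat (3 * 2 ^ fst q)"
        by (simp add: algebra_simps)
      then show "card {snd q * 2 ^ fst q - 2 * 2 ^ fst q..<(snd q + 1) * 2 ^ fst q} = 3 * 2 ^ fst q"
        by (simp add: nat_mult_distrib nat_power_eq)
    qed
    finally have "real (card Om) \<le> real (\<Sum>q\<in>Q. 3 * 2 ^ fst q)" by (simp only: of_nat_le_iff)
    also have "\<dots> = 3 / l * (\<Sum>q\<in>Q. l * 2 ^ fst q)" using l by (simp add: sum_distrib_left)
    also have "\<dots> \<le> 3 / l * (\<Sum>q\<in>Q. sum f (dyadic q))" using l by (intro mult_left_mono sum_mono Q_ge) auto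
    also have "\<dots> \<le> 3 / l * S" unfolding S_def using f l by (intro mult_left_mono sumQ) auto
    finally show "real (card Om) \<le> 3 * S / l" by simp
  qed
  \<comment> \<open>A value \<open>f y\<close> spoils at most \<open>C * W k\<close> places at scale
    \<open>k\<close>, and only at scales with \<open>W k < f y / l\<close>. The sum over these
    scales is geometric and of order \<open>f y / l\<close>.\<close>
  define Hv where "Hv = (\<lambda>k. \<Union>n\<in>A k. (\<lambda>y. y - n) ` {y\<in>Y. l * W k < f y})"
  have finA: "finite (A k)" for k using A_subset[of k] finite_subset by blast
  have Hv_fin: "finite (Hv k)" for k using finA f(3) by (auto simp: Hv_def)
  have Hv: "(\<Sum>k\<in>I. real (card (Hv k))) \<le> 5 * C * S / l"
  proof -
    have "(\<Sum>k\<in>I. real (card (Hv k))) \<le> (\<Sum>k\<in>I. C * W k * real (card {y\<in>Y. l * W k < f y}))"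
    proof (rule sum_mono)
      fix k assume k: "k \<in> I"
      have "card (Hv k) \<le> (\<Sum>n\<in>A k. card ((\<lambda>y. y - n) ` {y\<in>Y. l * W k < f y}))"
        unfolding Hv_def by (rule card_UN_le) (rule finA)
      also have "\<dots> \<le> (\<Sum>n\<in>A k. card {y\<in>Y. l * W k < f y})"
        using f(3) by (intro sum_mono card_image_le) auto
      also have "\<dots> = card (A k) * card {y\<in>Y. l * W k < f y}" by simp
      finally have "real (card (Hv k)) \<le> real (card (A k)) * real (card {y\<in>Y. l * W k < f y})"
        by (metis of_nat_le_iff of_nat_mult)
      also have "\<dots> \<le> (C * W k) * real (card {y\<in>Y. l * W k < f y})"
        using A_card Ik[OF k] by (intro mult_right_mono) auto
      finally show "real (card (Hv k)) \<le> C * W k * real (card {y\<in>Y. l * W k < f y})" .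
    qed
    also have "\<dots> = (\<Sum>k\<in>I. \<Sum>y\<in>Y. of_bool (W k < f y / l) * (C * W k))"
    proof (intro sum.cong refl)
      fix k
      have "(\<Sum>y\<in>Y. of_bool (W k < f y / l) * (C * W k)) = (\<Sum>y | y \<in> Y \<and> l * W k < f y. C * W k)"
        using f(3) l by (intro sum.mono_neutral_cong_right) (auto simp: field_simps)
      then show "C * W k * real (card {y\<in>Y. l * W k < f y}) = (\<Sum>y\<in>Y. of_bool (W k < f y / l) * (C * W k))"
        by simp
    qed
    also have "\<dots> = (\<Sum>y\<in>Y. \<Sum>k\<in>I. of_bool (W k < f y / l) * (C * W k))" by (rule sum.swap)
    also have "\<dots> \<le> (\<Sum>y\<in>Y. C * (5 * (f y / l)))"
    proof (rule sum_mono)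
      fix y
      have "(\<Sum>k\<in>I. of_bool (W k < f y / l) * (C * W k)) = C * (\<Sum>k | k \<in> I \<and> W k < f y / l. W k)"
        unfolding sum_distrib_left using I(1) by (intro sum.mono_neutral_cong_right) auto
      also have "\<dots> \<le> C * (5 * (f y / l))"
      proof (cases "f y = 0")
        case True
        then have "{k \<in> I. W k < f y / l} = {}" using W_pos Ik by (force simp: not_less)
        then show ?thesis using True by (simp only:) simp
      next
        case False
        then have "0 < f y / l" using f(1)[of y] l by simp
        then show ?thesis using C0 I W_pos W_growth
          by (intro mult_left_mono geometric_tail_sums(2)[of k0]) auto
      qed
      finally show "(\<Sum>k\<in>I. of_bool (W k < f y / l) * (C * W k)) \<le> C * (5 * (f y / l))" .
    qed
    also have "\<dots> = 5 * C * S / l" 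
      unfolding S_def sum_distrib_left sum_divide_distrib by (intro sum.cong refl) simp
    finally show ?thesis .
  qed
  \<comment> \<open>The cutoff varies with the scale while the intervals remain those of
    \<open>f\<close>; since \<open>fk k y \<le> f y\<close>, the means \<open>m k q\<close> inherit
    the bound \<open>2 * l\<close>.\<close>
  define fk where "fk = (\<lambda>k y. if f y \<le> l * W k then f y else 0)"
  define Qk where "Qk = (\<lambda>k. {q\<in>Q. fst q < k})"
  define m where "m = (\<lambda>k q. sum (fk k) (dyadic q) / 2 ^ fst q)"
  define b where "b = (\<lambda>k q y. fk k y - m k q)"
  define KB where "KB = (\<lambda>k x. \<Sum>q\<in>Qk k. \<Sum>y\<in>dyadic q. K k (y - x) * b k q y)"
  \<comment> \<open>Enlarged by all places that the convolutions can reach, so that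
    \<open>convolution_square\<close> applies.\<close>
  define Z' where "Z' = Z \<union> (\<Union>k\<in>I. \<Union>q\<in>Q. \<Union>y\<in>dyadic q. (\<lambda>i. y - i) ` {2^k..<2^Suc k})"
  have Z': "finite Z'" "Z \<subseteq> Z'" using Z I finQ by (auto simp: Z'_def)
  define L where "L = (\<lambda>k. {x\<in>Z'. l < \<bar>KB k x\<bar>})"
  have fk: "0 \<le> fk k y" "fk k y \<le> f y" for k y using f(1) by (auto simp: fk_def)
  have Qk: "Qk k \<subseteq> Q" "finite (Qk k)" for k using finQ by (auto simp: Qk_def)
  have sumfk: "0 \<le> sum (fk k) (dyadic q)" "sum (fk k) (dyadic q) \<le> sum f (dyadic q)" for k q
    using fk by (auto intro: sum_nonneg sum_mono)
  have m: "0 \<le> m k q" "q \<in> Q \<Longrightarrow> m k q \<le> 2 * l" for k q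
    using sumfk[of k q] Q_le[of q] by (auto simp: m_def divide_le_eq mult_ac)
  have msum: "m k q * 2 ^ fst q = sum (fk k) (dyadic q)" for k q by (simp add: m_def)
  have b0: "(\<Sum>y\<in>dyadic q. b k q y) = 0" for k q
    by (simp add: b_def sum_subtractf card_dyadic msum mult.commute)
  have b1: "(\<Sum>y\<in>dyadic q. \<bar>b k q y\<bar>) \<le> 2 * sum f (dyadic q)" for k q
  proof -
    have "(\<Sum>y\<in>dyadic q. \<bar>b k q y\<bar>) \<le> (\<Sum>y\<in>dyadic q. fk k y + m k q)"
      using fk m by (intro sum_mono) (auto simp: b_def abs_le_iff add_increasing add_increasing2)
    also have "\<dots> = 2 * sum (fk k) (dyadic q)" by (simp add: sum.distrib card_dyadic msum mult.commute)
    finally show ?thesis using sumfk[of k q] by simp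
  qed
  have b2: "(\<Sum>y\<in>dyadic q. (b k q y)\<^sup>2) \<le> (\<Sum>y\<in>dyadic q. (fk k y)\<^sup>2)" for k q
  proof -
    have "(\<Sum>y\<in>dyadic q. (b k q y)\<^sup>2) = (\<Sum>y\<in>dyadic q. b k q y * fk k y) - m k q * (\<Sum>y\<in>dyadic q. b k q y)"
      unfolding sum_distrib_left sum_subtractf[symmetric]
      by (intro sum.cong refl) (simp add: b_def power2_eq_square algebra_simps)
    also have "\<dots> = (\<Sum>y\<in>dyadic q. (fk k y)\<^sup>2 - m k q * fk k y)"
      unfolding b0 by (simp add: b_def power2_eq_square algebra_simps)
    also have "\<dots> \<le> (\<Sum>y\<in>dyadic q. (fk k y)\<^sup>2)" using m(1) fk(1) by (intro sum_mono) simp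
    finally show ?thesis .
  qed
  have conv: "(\<Sum>x\<in>Z'. (KB k x)\<^sup>2) = (\<Sum>q\<in>Qk k. \<Sum>y\<in>dyadic q. \<Sum>q'\<in>Qk k. \<Sum>y'\<in>dyadic q'. b k q y * b k q' y' * R k (y' - y))"
    if k: "k \<in> I" for k
  proof -
    let ?P = "SIGMA q:Qk k. dyadic q"
    have P: "finite ?P" using Qk by auto
    have "(\<Sum>x\<in>Z'. (\<Sum>p\<in>?P. K k (snd p - x) * b k (fst p) (snd p))\<^sup>2) =
      (\<Sum>p\<in>?P. \<Sum>p'\<in>?P. b k (fst p) (snd p) * b k (fst p') (snd p') * R k (snd p' - snd p))"
    proof (rule convolution_square[OF Z'(1) P])
      fix p and i :: int assume p: "p \<in> ?P" and i: "i \<in> {2^k..<2^Suc k}"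
      have "fst p \<in> Q" "snd p \<in> dyadic (fst p)" using p Qk(1)[of k] by auto
      then show "snd p - i \<in> Z'" using k i unfolding Z'_def by blast
    qed
    then show ?thesis unfolding sum_Sigma_dyadic[OF Qk(2)] fst_conv snd_conv by (simp add: KB_def)
  qed
  have T: "(\<Sum>x\<in>Z'. (KB k x)\<^sup>2) \<le> 16 * C / W k * (\<Sum>y\<in>Y. (fk k y)\<^sup>2) +
     144 * C * l * (\<Sum>q\<in>Q. sum f (dyadic q) * (of_bool (fst q < k) * (2 ^ fst q / 2 ^ k) + (X k / 2 ^ k + \<delta> k)))"
    if k: "k \<in> I" for k
  proof -
    have Wp: "0 < W k" using W_pos Ik[OF k] by auto
    have Xp: "0 \<le> X k / 2 ^ k" "0 \<le> \<delta> k" using X_ge[OF Ik[OF k]] \<delta>_nonneg[OF Ik[OF k]] by simp_all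
    have "(\<Sum>x\<in>Z'. (KB k x)\<^sup>2) \<le> 16 * C / W k * (\<Sum>q\<in>Qk k. \<Sum>y\<in>dyadic q. (b k q y)\<^sup>2) +
     72 * C * l * (\<Sum>q\<in>Qk k. (\<Sum>y\<in>dyadic q. \<bar>b k q y\<bar>) * (2 ^ fst q / 2 ^ k + X k / 2 ^ k + \<delta> k))"
      unfolding conv[OF k]
    proof (rule bilinear_bound[OF Ik[OF k] _ _ _ b0 _ l])
      show "(\<Sum>y\<in>dyadic q. \<bar>b k q y\<bar>) \<le> 4 * l * 2 ^ fst q" if "q \<in> Qk k" for q
      proof -
        have "q \<in> Q" using that Qk(1)[of k] by blast
        then show ?thesis using b1[of k q] Q_le[of q] by linarith
      qed
    qed (use finQ disj in \<open>auto simp: Qk_def\<close>)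
    moreover have "16 * C / W k * (\<Sum>q\<in>Qk k. \<Sum>y\<in>dyadic q. (b k q y)\<^sup>2) \<le> 16 * C / W k * (\<Sum>y\<in>Y. (fk k y)\<^sup>2)"
    proof (rule mult_left_mono)
      have "(\<Sum>q\<in>Qk k. \<Sum>y\<in>dyadic q. (b k q y)\<^sup>2) \<le> (\<Sum>q\<in>Qk k. \<Sum>y\<in>dyadic q. (fk k y)\<^sup>2)"
        by (intro sum_mono b2)
      also have "\<dots> \<le> (\<Sum>y\<in>Y. (fk k y)\<^sup>2)" using Qk f(2) by (intro sumQ) (auto simp: fk_def)
      finally show "(\<Sum>q\<in>Qk k. \<Sum>y\<in>dyadic q. (b k q y)\<^sup>2) \<le> (\<Sum>y\<in>Y. (fk k y)\<^sup>2)" .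
    qed (use C0 Wp in simp)
    moreover have "72 * C * l * (\<Sum>q\<in>Qk k. (\<Sum>y\<in>dyadic q. \<bar>b k q y\<bar>) * (2 ^ fst q / 2 ^ k + X k / 2 ^ k + \<delta> k)) \<le> 
        72 * C * l * (2 * (\<Sum>q\<in>Q. sum f (dyadic q) * (of_bool (fst q < k) * (2 ^ fst q / 2 ^ k) + (X k / 2 ^ k + \<delta> k))))"
    proof (rule mult_left_mono)
      have "(\<Sum>q\<in>Qk k. (\<Sum>y\<in>dyadic q. \<bar>b k q y\<bar>) * (2 ^ fst q / 2 ^ k + X k / 2 ^ k + \<delta> k)) \<le> 
       (\<Sum>q\<in>Qk k. (2 * sum f (dyadic q)) * (2 ^ fst q / 2 ^ k + (X k / 2 ^ k + \<delta> k)))"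
        using Xp unfolding add.assoc by (intro sum_mono mult_right_mono b1 add_nonneg_nonneg) auto
      also have "\<dots> = (\<Sum>q\<in>Qk k. (2 * sum f (dyadic q)) * (of_bool (fst q < k) * (2 ^ fst q / 2 ^ k) + (X k / 2 ^ k + \<delta> k)))"
        by (intro sum.cong) (auto simp: Qk_def)
      also have "\<dots> \<le> (\<Sum>q\<in>Q. (2 * sum f (dyadic q)) * (of_bool (fst q < k) * (2 ^ fst q / 2 ^ k) + (X k / 2 ^ k + \<delta> k)))"
        using finQ Qk f(1) Xp by (intro sum_mono2 mult_nonneg_nonneg add_nonneg_nonneg sum_nonneg) auto
      also have "\<dots> = 2 * (\<Sum>q\<in>Q. sum f (dyadic q) * (of_bool (fst q < k) * (2 ^ fst q / 2 ^ k) + (X k / 2 ^ k + \<delta> k)))"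
        by (simp only: mult.assoc sum_distrib_left[symmetric])
      finally show "(\<Sum>q\<in>Qk k. (\<Sum>y\<in>dyadic q. \<bar>b k q y\<bar>) * (2 ^ fst q / 2 ^ k + X k / 2 ^ k + \<delta> k)) \<le> \<dots>" .
    qed (use C0 l in simp)
    ultimately show ?thesis by simp
  qed
  have L: "(\<Sum>k\<in>I. real (card (L k))) \<le> (80 * C + 144 * C * (1 + C)) * S / l"
  proof -
    have "l\<^sup>2 * (\<Sum>k\<in>I. real (card (L k))) \<le> (\<Sum>k\<in>I. \<Sum>x\<in>Z'. (KB k x)\<^sup>2)"
      unfolding sum_distrib_left
    proof (rule sum_mono)
      fix k
      have "l\<^sup>2 * real (card (L k)) = (\<Sum>x\<in>L k. l\<^sup>2)" by simp
      also have "\<dots> \<le> (\<Sum>x\<in>L k. (KB k x)\<^sup>2)"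
      proof (rule sum_mono)
        fix x assume "x \<in> L k"
        then have "l\<^sup>2 \<le> \<bar>KB k x\<bar>\<^sup>2" using l by (intro power_mono) (auto simp: L_def)
        then show "l\<^sup>2 \<le> (KB k x)\<^sup>2" by simp
      qed
      also have "\<dots> \<le> (\<Sum>x\<in>Z'. (KB k x)\<^sup>2)" using Z' by (intro sum_mono2) (auto simp: L_def)
      finally show "l\<^sup>2 * real (card (L k)) \<le> (\<Sum>x\<in>Z'. (KB k x)\<^sup>2)" .
    qed
    also have "\<dots> \<le> (\<Sum>k\<in>I. 16 * C / W k * (\<Sum>y\<in>Y. (fk k y)\<^sup>2) +
     144 * C * l * (\<Sum>q\<in>Q. sum f (dyadic q) * (of_bool (fst q < k) * (2 ^ fst q / 2 ^ k) + (X k / 2 ^ k + \<delta> k))))"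
      by (intro sum_mono T)
    also have "\<dots> = 16 * C * (\<Sum>y\<in>Y. \<Sum>k\<in>I. (fk k y)\<^sup>2 * (1 / W k)) + 
      144 * C * l * (\<Sum>q\<in>Q. \<Sum>k\<in>I. sum f (dyadic q) * (of_bool (fst q < k) * (2 ^ fst q / 2 ^ k) + (X k / 2 ^ k + \<delta> k)))"
    proof -
      have "(\<Sum>k\<in>I. 16 * C / W k * (\<Sum>y\<in>Y. (fk k y)\<^sup>2)) = 16 * C * (\<Sum>k\<in>I. \<Sum>y\<in>Y. (fk k y)\<^sup>2 * (1 / W k))"
        by (simp add: sum_distrib_left sum_divide_distrib)
      also have "(\<Sum>k\<in>I. \<Sum>y\<in>Y. (fk k y)\<^sup>2 * (1 / W k)) = (\<Sum>y\<in>Y. \<Sum>k\<in>I. (fk k y)\<^sup>2 * (1 / W k))" by (rule sum.swap)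
      finally show ?thesis
        unfolding sum.distrib sum_distrib_left[symmetric, of "144 * C * l"] sum.swap[of _ Q I] by simp
    qed
    also have "\<dots> \<le> 16 * C * (\<Sum>y\<in>Y. 5 * l * f y) + 144 * C * l * (\<Sum>q\<in>Q. sum f (dyadic q) * (1 + C))"
    proof (intro add_mono mult_left_mono sum_mono)
      fix y
      \<comment> \<open>Only the scales with \<open>W k \<ge> f y / l\<close> keep the value
        \<open>f y\<close>, and over these \<open>1 / W k\<close> adds up to at most
        \<open>5 * l / f y\<close>. This is where the cutoff pays for the peak.\<close>
      show "(\<Sum>k\<in>I. (fk k y)\<^sup>2 * (1 / W k)) \<le> 5 * l * f y"
      proof (cases "f y = 0")
        case True
        then have "fk k y = 0" for k by (simp add: fk_def)
        then show ?thesis using True by simp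
      next
        case False
        then have fy: "0 < f y" using f(1)[of y] by simp
        have "(\<Sum>k\<in>I. (fk k y)\<^sup>2 * (1 / W k)) = (\<Sum>k | k \<in> I \<and> f y / l \<le> W k. (f y)\<^sup>2 * (1 / W k))"
          using I(1) l by (intro sum.mono_neutral_cong_right) (auto simp: fk_def field_simps)
        also have "\<dots> = (f y)\<^sup>2 * (\<Sum>k | k \<in> I \<and> f y / l \<le> W k. 1 / W k)" by (simp only: sum_distrib_left)
        also have "\<dots> \<le> (f y)\<^sup>2 * (5 / (f y / l))"
          using I W_pos W_growth fy l by (intro mult_left_mono geometric_tail_sums(1)[of k0]) auto
        also have "\<dots> = 5 * l * f y" using fy by (simp add: power2_eq_square)
        finally show ?thesis .
      qed
    next
      fix q assume q: "q \<in> Q"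
      have "(\<Sum>k\<in>I. of_bool (fst q < k) * (2 ^ fst q / 2 ^ k) :: real) \<le> 1"
      proof -
        obtain M where M: "I \<subseteq> {..<M}" using I(1) finite_nat_bounded by auto
        have "(\<Sum>k\<in>I. of_bool (fst q < k) * (2 ^ fst q / 2 ^ k) :: real) \<le> (\<Sum>k<M. of_bool (fst q < k) * (2 ^ fst q / 2 ^ k))"
          using M by (intro sum_mono2) auto
        \<comment> \<open>The bound is the exact value of the geometric sum, so that the induction
          closes.\<close>
        also have "\<dots> \<le> (if fst q < M then 1 - 2 * (2 ^ fst q / 2 ^ M) else 0)"
        proof (induction M)
          case (Suc M)
          have e: "(2::real) ^ fst q / 2 ^ Suc M = (2 ^ fst q / 2 ^ M) / 2" by simp
          show ?case
          proof (cases "fst q < M")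
            case True
            then show ?thesis using Suc.IH unfolding e sum.lessThan_Suc by simp
          next
            case False
            then show ?thesis using Suc.IH by (auto simp: less_Suc_eq)
          qed
        qed simp
        also have "\<dots> \<le> 1" by simp
        finally show ?thesis .
      qed
      then have "(\<Sum>k\<in>I. of_bool (fst q < k) * (2 ^ fst q / 2 ^ k) + (X k / 2 ^ k + \<delta> k)) \<le> 1 + C"
        using X\<delta>_sum[OF I] by (simp add: sum.distrib)
      then show "(\<Sum>k\<in>I. sum f (dyadic q) * (of_bool (fst q < k) * (2 ^ fst q / 2 ^ k) + (X k / 2 ^ k + \<delta> k))) 
          \<le> sum f (dyadic q) * (1 + C)"
        unfolding sum_distrib_left[symmetric] using f(1) by (intro mult_left_mono sum_nonneg)
    qed (use C0 l in auto)
    also have "(\<Sum>q\<in>Q. sum f (dyadic q) * (1 + C)) \<le> S * (1 + C)"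
      unfolding sum_distrib_right[symmetric] S_def using sumQ[OF _ f(1,2)] C0 by (intro mult_right_mono) auto
    also have "(\<Sum>y\<in>Y. 5 * l * f y) = 5 * l * S" by (simp add: S_def sum_distrib_left)
    finally have "l\<^sup>2 * (\<Sum>k\<in>I. real (card (L k))) \<le> l * ((80 * C + 144 * C * (1 + C)) * S)"
      using C0 l by (simp add: algebra_simps mult_left_mono)
    then have "l * (l * (\<Sum>k\<in>I. real (card (L k)))) \<le> l * ((80 * C + 144 * C * (1 + C)) * S)"
      by (simp add: power2_eq_square mult.assoc)
    then have "l * (\<Sum>k\<in>I. real (card (L k))) \<le> (80 * C + 144 * C * (1 + C)) * S"
      using l by (rule mult_left_le_imp_le)
    then show ?thesis using l by (simp add: field_simps)
  qed
  have "{x\<in>Z. \<exists>k\<in>I. (2 * C + 1) * l < (\<Sum>n\<in>A k. f (x + n)) / W k} \<subseteq> Om \<union> (\<Union>k\<in>I. Hv k) \<union> (\<Union>k\<in>I. L k)"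
  proof (rule ccontr)
    assume "\<not> ?thesis"
    then obtain x k where x: "x \<in> Z" "k \<in> I" "(2 * C + 1) * l < (\<Sum>n\<in>A k. f (x + n)) / W k"
      and nx: "x \<notin> Om" "x \<notin> Hv k" "x \<notin> L k" by blast
    let ?J = "{2^k..<2^Suc k} :: int set"
    have k: "k0 \<le> k" using Ik x by auto
    have Wp: "0 < W k" using W_pos k by auto
    define \<beta> where "\<beta> = (\<lambda>y. \<Sum>q\<in>Qk k. if y \<in> dyadic q then b k q y else 0)"
    have "(\<Sum>n\<in>A k. f (x + n)) / W k = (\<Sum>n\<in>A k. 1 / W k * fk k (x + n))"
    proof -
      have "f (x + n) = fk k (x + n)" if n: "n \<in> A k" for n
      proof (rule ccontr)
        assume "f (x + n) \<noteq> fk k (x + n)"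
        then have "l * W k < f (x + n)" "f (x + n) \<noteq> 0" by (auto simp: fk_def split: if_splits)
        then have "x + n \<in> {y\<in>Y. l * W k < f y}" using f(2) by auto
        then have "x \<in> (\<lambda>y. y - n) ` {y\<in>Y. l * W k < f y}" by (intro image_eqI[of _ _ "x + n"]) auto
        then show False using nx(2) n by (auto simp: Hv_def)
      qed
      then show ?thesis by (simp add: sum_divide_distrib)
    qed
    also have "\<dots> \<le> (\<Sum>n\<in>A k. K k n * fk k (x + n))"
      using K_ge[OF k] fk by (intro sum_mono mult_right_mono) auto
    also have "\<dots> \<le> (\<Sum>n\<in>?J. K k n * fk k (x + n))"
      using A_subset K_nonneg fk by (intro sum_mono2) (auto simp del: power_Suc)
    also have "\<dots> \<le> (\<Sum>n\<in>?J. K k n * (2 * l + \<beta> (x + n)))"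
    proof (intro sum_mono mult_left_mono K_nonneg)
      fix n assume n: "n \<in> ?J"
      show "fk k (x + n) \<le> 2 * l + \<beta> (x + n)"
      proof (cases "\<exists>q\<in>Q. x + n \<in> dyadic q")
        case True
        then obtain q where q: "q \<in> Q" "x + n \<in> dyadic q" by auto
        have "fst q < k"
        proof (rule ccontr)
          assume "\<not> fst q < k"
          then have "(2::int) ^ k \<le> 2 ^ fst q" by (intro power_increasing) auto
          moreover have "(0::int) < 2 ^ k" by simp
          ultimately have "0 < n" "n < 2 * 2 ^ fst q"
            using n unfolding atLeastLessThan_iff power_Suc by linarith+
          then have "x \<in> {snd q * 2 ^ fst q - 2 * 2 ^ fst q..<(snd q + 1) * 2 ^ fst q}"
            using q(2) unfolding dyadic_eq by auto
          then show False using nx(1) q(1) by (auto simp: Om_def)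
        qed
        then have qk: "q \<in> Qk k" using q by (auto simp: Qk_def)
        have "\<beta> (x + n) = (\<Sum>q'\<in>Qk k. if q' = q then b k q (x + n) else 0)"
          unfolding \<beta>_def
        proof (rule sum.cong[OF refl])
          fix q' assume "q' \<in> Qk k"
          then show "(if x + n \<in> dyadic q' then b k q' (x + n) else 0) = (if q' = q then b k q (x + n) else 0)"
            using disj[of q' q "x + n"] q Qk(1)[of k] by (cases "q' = q") auto
        qed
        then have "\<beta> (x + n) = fk k (x + n) - m k q" using qk Qk(2)[of k] by (simp add: b_def)
        then show ?thesis using m(2)[OF q(1), of k] by simp
      next
        case False
        then have "\<beta> (x + n) = 0" unfolding \<beta>_def using Qk by (intro sum.neutral) auto
        moreover have "f (x + n) \<le> l" using False by (intro off) auto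
        ultimately show ?thesis using fk(2)[of k "x + n"] l by linarith
      qed
    qed
    also have "\<dots> = 2 * l * (\<Sum>n\<in>?J. K k n) + (\<Sum>n\<in>?J. K k n * \<beta> (x + n))"
      by (simp add: distrib_left sum.distrib sum_distrib_left mult_ac)
    also have "(\<Sum>n\<in>?J. K k n * \<beta> (x + n)) = KB k x"
    proof -
      have "(\<Sum>n\<in>?J. K k n * \<beta> (x + n)) = (\<Sum>q\<in>Qk k. \<Sum>n\<in>?J. K k n * (if x + n \<in> dyadic q then b k q (x + n) else 0))"
        unfolding \<beta>_def sum_distrib_left by (rule sum.swap)
      also have "\<dots> = KB k x" unfolding KB_def
      proof (rule sum.cong[OF refl])
        fix q assume "q \<in> Qk k"
        have "(\<Sum>n\<in>?J. K k n * (if x + n \<in> dyadic q then b k q (x + n) else 0)) = 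
          (\<Sum>n\<in>?J \<inter> {n. x + n \<in> dyadic q}. K k n * b k q (x + n))"
          by (intro sum.mono_neutral_cong_right) auto
        also have "\<dots> = (\<Sum>y\<in>dyadic q \<inter> {y. y - x \<in> ?J}. K k (y - x) * b k q y)"
          by (rule sum.reindex_bij_witness[of _ "\<lambda>y. y - x" "\<lambda>n. x + n"]) auto
        also have "\<dots> = (\<Sum>y\<in>dyadic q. K k (y - x) * b k q y)"
          by (intro sum.mono_neutral_left) (auto simp: K_supp simp del: power_Suc)
        finally show "(\<Sum>n\<in>?J. K k n * (if x + n \<in> dyadic q then b k q (x + n) else 0)) = (\<Sum>y\<in>dyadic q. K k (y - x) * b k q y)" .
      qed
      finally show ?thesis .
    qed
    also have "2 * l * (\<Sum>n\<in>?J. K k n) + KB k x \<le> 2 * l * C + l"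
      using K_sum[OF k] l nx(3) x Z' by (intro add_mono mult_left_mono) (auto simp: L_def)
    finally show False using x(3) by (simp add: algebra_simps)
  qed
  then have "card {x\<in>Z. \<exists>k\<in>I. (2 * C + 1) * l < (\<Sum>n\<in>A k. f (x + n)) / W k} \<le> 
      card (Om \<union> (\<Union>k\<in>I. Hv k) \<union> (\<Union>k\<in>I. L k))"
    using Om Hv_fin I Z' by (intro card_mono) (auto simp: L_def)
  also have "\<dots> \<le> card Om + card (\<Union>k\<in>I. Hv k) + card (\<Union>k\<in>I. L k)"
    by (meson add_mono card_Un_le order_refl order_trans)
  also have "\<dots> \<le> card Om + (\<Sum>k\<in>I. card (Hv k)) + (\<Sum>k\<in>I. card (L k))"
    using I by (intro add_mono card_UN_le) auto
  finally have "real (card {x\<in>Z. \<exists>k\<in>I. (2 * C + 1) * l < (\<Sum>n\<in>A k. f (x + n)) / W k}) \<le> 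
    real (card Om + (\<Sum>k\<in>I. card (Hv k)) + (\<Sum>k\<in>I. card (L k)))"
    by (simp only: of_nat_le_iff)
  also have "\<dots> = real (card Om) + (\<Sum>k\<in>I. real (card (Hv k))) + (\<Sum>k\<in>I. real (card (L k)))" by simp
  also have "\<dots> \<le> 3 * S / l + 5 * C * S / l + (80 * C + 144 * C * (1 + C)) * S / l"
    by (intro add_mono Om Hv L)
  also have "\<dots> = (3 + 229 * C + 144 * C\<^sup>2) * S / l" using l by (simp add: field_simps power2_eq_square)
  also have "\<dots> \<le> 400 * C\<^sup>2 * S / l"
  proof (intro divide_right_mono mult_right_mono)
    have "C \<le> C\<^sup>2" "1 \<le> C\<^sup>2" using C_ge by (auto simp: power2_eq_square mult_le_cancel_left1 intro: order_trans)
    then show "3 + 229 * C + 144 * C\<^sup>2 \<le> 400 * C\<^sup>2" by linarith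
  qed (use S0 l in auto)
  finally show ?thesis by (simp add: S_def)
qed

end

section \<open>The dyadic blocks of the set and their Fejer majorants satisfy the kernel
  hypotheses\<close>

context regular_floor_set
begin

text \<open>The half-open interval from \<open>\<phi> n\<close> to \<open>\<phi> (Suc n)\<close> is
  shorter than 1 and contains at most one integer; the difference of ceilings counts it.\<close>

lemma indicator_E:
  assumes "n0 \<le> n"
  shows "of_bool (n \<in> E) = \<lceil>\<phi> (Suc n)\<rceil> - \<lceil>\<phi> n\<rceil>"
proof -
  have d: "0 < d n" "d n \<le> 1 / 8" using d_pos d_le assms by auto
  have le: "\<lceil>\<phi> n\<rceil> \<le> \<lceil>\<phi> (Suc n)\<rceil>" using d by (intro ceiling_mono) (simp add: phi_Suc)
  have "\<phi> (Suc n) \<le> of_int \<lceil>\<phi> n\<rceil> + 1" using d le_of_int_ceiling[of "\<phi> n"] unfolding phi_Suc by linarith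
  then have le': "\<lceil>\<phi> (Suc n)\<rceil> \<le> \<lceil>\<phi> n\<rceil> + 1" by (simp add: ceiling_le_iff)
  have "n \<in> E \<longleftrightarrow> \<lceil>\<phi> n\<rceil> < \<lceil>\<phi> (Suc n)\<rceil>"
  proof
    assume "n \<in> E"
    then obtain m :: int where m: "\<phi> n \<le> of_int m" "of_int m < \<phi> (Suc n)" using mem_E[OF assms] by auto
    then have "\<lceil>\<phi> n\<rceil> \<le> m" "m < \<lceil>\<phi> (Suc n)\<rceil>" by (simp_all add: ceiling_le_iff less_ceiling_iff)
    then show "\<lceil>\<phi> n\<rceil> < \<lceil>\<phi> (Suc n)\<rceil>" by simp
  next
    assume "\<lceil>\<phi> n\<rceil> < \<lceil>\<phi> (Suc n)\<rceil>"
    then have "of_int \<lceil>\<phi> n\<rceil> < \<phi> (Suc n)" by (simp only: less_ceiling_iff)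
    then show "n \<in> E" using mem_E[OF assms] le_of_int_ceiling[of "\<phi> n"] by blast
  qed
  then show ?thesis using le le' by auto
qed

lemma card_E:
  assumes "n0 \<le> p" "p \<le> q"
  shows "int (card (E \<inter> {p..<q})) = \<lceil>\<phi> q\<rceil> - \<lceil>\<phi> p\<rceil>"
proof -
  have "int (card (E \<inter> {p..<q})) = (\<Sum>n\<in>{p..<q}. of_bool (n \<in> E))"
    by (subst sum.mono_neutral_cong_right[of _ "E \<inter> {p..<q}" _ "\<lambda>_. 1"]) auto
  also have "\<dots> = (\<Sum>n\<in>{p..<q}. \<lceil>\<phi> (Suc n)\<rceil> - \<lceil>\<phi> n\<rceil>)"
    using assms by (intro sum.cong indicator_E) auto
  also have "\<dots> = \<lceil>\<phi> q\<rceil> - \<lceil>\<phi> p\<rceil>" using assms(2) by (rule sum_Suc_diff')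
  finally show ?thesis .
qed

lemma phi_pos: "n0 \<le> n \<Longrightarrow> 0 < \<phi> n"
  using phi_lower[of n] d_pos[of n] n0_pos by (smt (verit) divide_pos_pos mult_pos_pos of_nat_0_less_iff order.strict_trans2 less_numeral_extra(1) le_eq_less_or_eq)

lemma phi_doubling:
  assumes "n0 \<le> N"
  shows "5 / 4 * \<phi> N \<le> \<phi> (2 * N)" "\<phi> (2 * N) \<le> 5 * \<phi> N"
proof -
  have "real N * d N / 2 \<le> \<phi> (2 * N) - \<phi> N" "\<phi> (2 * N) - \<phi> N \<le> real N * d N"
    using phi_diff_bounds[OF assms, of N N, unfolded mult_2[symmetric]] by auto
  then show "5 / 4 * \<phi> N \<le> \<phi> (2 * N)" "\<phi> (2 * N) \<le> 5 * \<phi> N"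
    using phi_upper[OF assms] phi_lower[OF assms] by auto
qed

lemma N_d_ge:
  assumes "n0 \<le> N"
  shows "1 \<le> real N * d N"
proof -
  have "1 / d N \<le> real N" using inverse_d_power_le[OF assms, of 1] powr_le_self[OF assms, of "1/30"] by simp
  then show ?thesis using d_pos[OF assms] by (simp add: field_simps)
qed

theorem discrete_weak_type:
  "\<exists>D k0. 1 \<le> D \<and> n0 \<le> 2 ^ k0 \<and> (\<forall>(f :: int \<Rightarrow> real) Y l I Z.
     (\<forall>y. 0 \<le> f y) \<longrightarrow> (\<forall>y. y \<notin> Y \<longrightarrow> f y = 0) \<longrightarrow> finite Y \<longrightarrow> 0 < l \<longrightarrow> finite I \<longrightarrow> I \<subseteq> {k0..} \<longrightarrow> finite Z \<longrightarrow>
       real (card {x\<in>Z. \<exists>k\<in>I. D * l < (\<Sum>n\<in>E \<inter> {2^k..<2^Suc k}. f (x + int n)) / \<phi> (2^k)}) \<le> D * sum f Y / l)"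
proof -
  define k0 where "k0 = n0"
  have k0: "n0 \<le> 2 ^ k" if "k0 \<le> k" for k
  proof -
    have "n0 \<le> k" using that by (simp add: k0_def)
    also have "k \<le> 2 ^ k" by (rule less_imp_le) (rule less_exp)
    finally show ?thesis .
  qed
  \<comment> \<open>The largest order with \<open>H * d \<le> 1 / 8\<close>, as
    \<open>fejer_phi_ge\<close> demands; \<open>H * d\<close> then also stays above 1/16.\<close>
  define H where "H = (\<lambda>k. nat \<lfloor>1 / (8 * d (2 ^ k))\<rfloor>)"
  define W where "W = (\<lambda>k. \<phi> (2 ^ k))"
  \<comment> \<open>Chosen such that \<open>s k * (H k / 2)\<close> is \<open>1 / W k\<close>, the
    value that the kernel has to reach on \<open>A k\<close>.\<close>
  define s where "s = (\<lambda>k. 2 / (real (H k) * W k))"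
  define K where "K = (\<lambda>k (i::int). if k0 \<le> k \<and> 2 ^ k \<le> i \<and> i < 2 ^ Suc k then s k * fejer (H k) (\<phi> (nat i)) else 0)"
  define A where "A = (\<lambda>k. int ` (E \<inter> {2^k..<2^Suc k}))"
  \<comment> \<open>In terms of \<open>N = 2 ^ k\<close>, \<open>X\<close> is the threshold
    \<open>N powr (3/4)\<close> of \<open>corr_far\<close> and \<open>\<delta>\<close> its relative
    error \<open>N powr (19/20 - 1)\<close>.\<close>
  define X where "X = (\<lambda>k. (2 powr (3/4)) ^ k :: real)"
  define \<delta> where "\<delta> = (\<lambda>k. (2 powr (-(1/20))) ^ k :: real)"
  \<comment> \<open>The tent counts the \<open>n\<close> for which \<open>n\<close> and
    \<open>n + z\<close> both lie in the block; this is the main term in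
    \<open>corr_far\<close>.\<close>
  define G where "G = (\<lambda>k (z::int). (s k)\<^sup>2 * max 0 (2 ^ k - \<bar>real_of_int z\<bar>))"
  define r1 r2 :: real where "r1 = 2 powr (-(1/4))" and "r2 = 2 powr (-(1/20))"
  have r12: "0 < r1" "r1 < 1" "0 < r2" "r2 < 1" by (auto simp: r1_def r2_def powr_less_one)
  \<comment> \<open>640 is 128 times 5 and bounds the mass of the kernel, the two fractions are the
    geometric series of \<open>X\<close> and \<open>\<delta>\<close>, and 4000000 leaves room for
    the correlation bounds.\<close>
  define C where "C = 640 + 1 / (1 - r1) + 1 / (1 - r2) + 4000000 / a"
  have C: "640 \<le> C" "4000000 / a \<le> C" "1 / (1 - r1) + 1 / (1 - r2) \<le> C"
    using r12 a_pos by (auto simp: C_def add_increasing add_increasing2)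
  have dN: "0 < d (2 ^ k)" "d (2 ^ k) \<le> 1 / 8" if "k0 \<le> k" for k using d_pos d_le k0[OF that] by auto
  have H: "1 \<le> H k" "real (H k) * d (2 ^ k) \<le> 1 / 8" "1 / 16 \<le> real (H k) * d (2 ^ k)" if k: "k0 \<le> k" for k
  proof -
    define t where "t = 1 / (8 * d (2 ^ k))"
    have t: "1 \<le> t" using dN[OF k] by (simp add: t_def)
    then have "1 \<le> \<lfloor>t\<rfloor>" by simp
    then have Ht: "real (H k) = of_int \<lfloor>t\<rfloor>" "1 \<le> H k" unfolding H_def t_def[symmetric] by linarith+
    show "1 \<le> H k" by fact
    have "real (H k) \<le> t" "t / 2 \<le> real (H k)" unfolding Ht(1) using t \<open>1 \<le> \<lfloor>t\<rfloor>\<close> by linarith+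
    then have "real (H k) * d (2 ^ k) \<le> t * d (2 ^ k)" "t / 2 * d (2 ^ k) \<le> real (H k) * d (2 ^ k)"
      using dN[OF k] by (auto intro: mult_right_mono)
    then show "real (H k) * d (2 ^ k) \<le> 1 / 8" "1 / 16 \<le> real (H k) * d (2 ^ k)"
      using dN[OF k] by (simp_all add: t_def)
  qed
  have W: "0 < W k" "2 ^ k * d (2 ^ k) / 4 \<le> W k" "W k \<le> 2 * 2 ^ k * d (2 ^ k)" if "k0 \<le> k" for k
    using phi_pos[OF k0[OF that]] phi_lower[OF k0[OF that]] phi_upper[OF k0[OF that]] by (simp_all add: W_def)
  have s: "0 < s k" "s k \<le> 128 / 2 ^ k" if k: "k0 \<le> k" for k
  proof -
    show "0 < s k" using H[OF k] W[OF k] by (auto simp: s_def)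
    have "1 / 16 * (2 ^ k / 4) \<le> (real (H k) * d (2 ^ k)) * (2 ^ k / 4)" using H[OF k] by (intro mult_right_mono) auto
    also have "\<dots> = real (H k) * (2 ^ k * d (2 ^ k) / 4)" by simp
    also have "\<dots> \<le> real (H k) * W k" using W[OF k] by (intro mult_left_mono) auto
    finally have "2 ^ k / 64 \<le> real (H k) * W k" by simp
    then have "2 / (real (H k) * W k) \<le> 2 / (2 ^ k / 64)" by (intro divide_left_mono) (use H[OF k] W[OF k] in auto)
    then show "s k \<le> 128 / 2 ^ k" by (simp add: s_def)
  qed
  have s2: "(s k)\<^sup>2 \<le> 16384 / (2 ^ k)\<^sup>2" if k: "k0 \<le> k" for k
    using power_mono[OF s(2)[OF k], of 2] s(1)[OF k] by (simp add: power_divide)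
  have Knat: "K k (int n) = (if k0 \<le> k \<and> 2 ^ k \<le> n \<and> n < 2 ^ Suc k then s k * fejer (H k) (\<phi> n) else 0)" for k n
  proof -
    have "(2 ^ k \<le> int n) = (2 ^ k \<le> n)" "(int n < 2 ^ Suc k) = (n < 2 ^ Suc k)"
      by (metis of_nat_le_iff of_nat_numeral of_nat_power) (metis of_nat_less_iff of_nat_numeral of_nat_power)
    then show ?thesis by (simp add: K_def)
  qed
  have int_ivl: "{2^k..<2^Suc k} = int ` {2^k..<2^Suc k}" for k
    by (metis image_int_atLeastLessThan of_nat_numeral of_nat_power)
  have corr: "(\<Sum>i\<in>{2^k..<2^Suc k}. K k i * K k (i + int z)) = 
      (s k)\<^sup>2 * (\<Sum>n\<in>{2^k..<2^Suc k - z}. fejer (H k) (\<phi> n) * fejer (H k) (\<phi> (n + z)))" if k: "k0 \<le> k" for k z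
  proof -
    have "(\<Sum>i\<in>{2^k..<2^Suc k}. K k i * K k (i + int z)) = (\<Sum>n\<in>{2^k..<2^Suc k}. K k (int n) * K k (int (n + z)))"
      unfolding int_ivl by (subst sum.reindex) auto
    also have "\<dots> = (\<Sum>n\<in>{2^k..<2^Suc k - z}. K k (int n) * K k (int (n + z)))"
      by (rule sum.mono_neutral_right) (auto simp: Knat simp del: of_nat_add)
    also have "\<dots> = (\<Sum>n\<in>{2^k..<2^Suc k - z}. (s k)\<^sup>2 * (fejer (H k) (\<phi> n) * fejer (H k) (\<phi> (n + z))))"
      using k by (intro sum.cong refl) (auto simp: Knat power2_eq_square simp del: of_nat_add)
    finally show ?thesis by (simp only: sum_distrib_left)
  qed
  interpret sp: sparse_kernels A K W X \<delta> G C k0 "\<lambda>k z. \<Sum>i\<in>{2^k..<2^Suc k}. K k i * K k (i + z)"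
  proof (unfold_locales; (rule reflexive)?)
    show "1 \<le> C" using C by simp
    show "0 \<le> K k i" for k i using s[of k] fejer_nonneg by (auto simp: K_def)
    show "i \<notin> {2^k..<2^Suc k} \<Longrightarrow> K k i = 0" for k i by (auto simp: K_def)
    show "A k \<subseteq> {2^k..<2^Suc k}" for k unfolding int_ivl by (auto simp: A_def)
    show "0 < W k" if "k0 \<le> k" for k using W[OF that] by simp
    show "5 / 4 * W k \<le> W (Suc k)" if "k0 \<le> k" for k using phi_doubling(1)[OF k0[OF that]] by (simp add: W_def)
    show "1 \<le> X k" for k unfolding X_def by (rule one_le_power) (simp add: ge_one_powr_ge_zero)
    show "0 \<le> \<delta> k" for k by (simp add: \<delta>_def)
    show "G k (- z) = G k z" for k z by (simp add: G_def)
    show "G k z = 0" if "2 ^ k \<le> \<bar>z\<bar>" for k z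
    proof -
      have "real_of_int (2 ^ k) \<le> real_of_int \<bar>z\<bar>" using that by (simp only: of_int_le_iff)
      then show ?thesis by (simp add: G_def)
    qed
    show "real (card (A k)) \<le> C * W k" if k: "k0 \<le> k" for k
    proof -
      have "card (A k) = card (E \<inter> {2^k..<2^Suc k})" unfolding A_def by (rule card_image) simp
      then have "int (card (A k)) = \<lceil>\<phi> (2 ^ Suc k)\<rceil> - \<lceil>\<phi> (2 ^ k)\<rceil>" using card_E[OF k0[OF k], of "2 ^ Suc k"] by simp
      then have "real (card (A k)) \<le> \<phi> (2 ^ Suc k) - \<phi> (2 ^ k) + 1" by linarith
      also have "\<dots> \<le> 5 * W k + 1" using phi_doubling(2)[OF k0[OF k]] W(1)[OF k] by (simp add: W_def)
      also have "1 \<le> 4 * W k" using W(2)[OF k] N_d_ge[OF k0[OF k]] by simp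
      finally have "real (card (A k)) \<le> 9 * W k" by simp
      also have "\<dots> \<le> C * W k" using C(1) W(1)[OF k] by (intro mult_right_mono) auto
      finally show ?thesis .
    qed
    show "1 / W k \<le> K k i" if k: "k0 \<le> k" and i: "i \<in> A k" for k i
    proof -
      obtain n where n: "i = int n" "n \<in> E" "2 ^ k \<le> n" "n < 2 ^ Suc k" using i by (auto simp: A_def)
      have "1 / W k = s k * (real (H k) / 2)" using H[OF k] W[OF k] by (simp add: s_def)
      also have "\<dots> \<le> s k * fejer (H k) (\<phi> n)"
        using fejer_phi_ge[OF k0[OF k] n(3,2) H(2)[OF k]] s(1)[OF k] by (intro mult_left_mono) auto
      also have "\<dots> = K k i" using n k by (simp add: Knat)
      finally show ?thesis .
    qed
    show "(\<Sum>i\<in>{2^k..<2^Suc k}. K k i) \<le> C" if k: "k0 \<le> k" for k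
    proof -
      have "(\<Sum>i\<in>{2^k..<2^Suc k}. K k i) = (\<Sum>n\<in>{2^k..<2^Suc k}. K k (int n))"
        unfolding int_ivl by (subst sum.reindex) auto
      also have "\<dots> = (\<Sum>n\<in>{2^k..<2^Suc k}. s k * fejer (H k) (\<phi> n))"
        using k by (intro sum.cong refl) (auto simp: Knat)
      also have "\<dots> = s k * (\<Sum>n\<in>{2^k..<2^Suc k}. fejer (H k) (\<phi> n))" by (simp only: sum_distrib_left)
      also have "\<dots> \<le> (128 / 2 ^ k) * (5 * real (2 ^ k))"
        using s[OF k] H[OF k] k0[OF k] by (intro mult_mono fejer_sum_le sum_nonneg fejer_nonneg) auto
      also have "\<dots> \<le> C" using C by simp
      finally show ?thesis .
    qed
    show "(\<Sum>k\<in>F. X k / 2 ^ k + \<delta> k) \<le> C" if "finite F" "F \<subseteq> {k0..}" for F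
    proof -
      have "X k / 2 ^ k = r1 ^ k" for k
      proof -
        have "X k / 2 ^ k = (2 powr (3/4) / 2 powr 1) ^ k" by (simp add: X_def power_divide)
        also have "2 powr (3/4) / 2 powr 1 = r1" unfolding r1_def powr_diff[symmetric] by simp
        finally show ?thesis .
      qed
      moreover have "\<delta> k = r2 ^ k" for k by (simp add: \<delta>_def r2_def)
      ultimately have "(\<Sum>k\<in>F. X k / 2 ^ k + \<delta> k) = (\<Sum>k\<in>F. r1 ^ k) + (\<Sum>k\<in>F. r2 ^ k)" by (simp add: sum.distrib)
      also have "\<dots> \<le> (\<Sum>k. r1 ^ k) + (\<Sum>k. r2 ^ k)"
        using r12 that by (intro add_mono sum_le_suminf) (auto intro: summable_geometric)
      also have "\<dots> = 1 / (1 - r1) + 1 / (1 - r2)" using r12 by (simp add: suminf_geometric)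
      finally show ?thesis using C(3) by simp
    qed
    show "\<bar>G k z - G k z'\<bar> \<le> C * real_of_int \<bar>z - z'\<bar> / 4 ^ k" if k: "k0 \<le> k" for k z z'
    proof -
      have "\<bar>G k z - G k z'\<bar> = (s k)\<^sup>2 * \<bar>max 0 (2 ^ k - \<bar>real_of_int z\<bar>) - max 0 (2 ^ k - \<bar>real_of_int z'\<bar>)\<bar>"
        by (simp add: G_def abs_mult flip: right_diff_distrib)
      also have "\<dots> \<le> (16384 / (2 ^ k)\<^sup>2) * real_of_int \<bar>z - z'\<bar>"
        by (intro mult_mono s2 k) (auto simp: max_def)
      also have "\<dots> \<le> (C / (2 ^ k)\<^sup>2) * real_of_int \<bar>z - z'\<bar>"
      proof (intro mult_right_mono divide_right_mono)
        have "16384 \<le> 4000000 / a" using a_pos a_le by (simp add: field_simps)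
        then show "16384 \<le> C" using C(2) by linarith
      qed auto
      also have "(2 ^ k)\<^sup>2 = (4::real) ^ k" by (simp add: power2_eq_square flip: power_mult_distrib)
      finally show ?thesis by simp
    qed
    fix k and z :: int assume k: "k0 \<le> k" and z: "0 \<le> z"
    define N :: nat where "N = 2 ^ k"
    have N: "n0 \<le> N" "real N = 2 ^ k" "1 \<le> real N" using k0[OF k] by (auto simp: N_def)
    define z' where "z' = nat z"
    have zz: "z = int z'" using z by (simp add: z'_def)
    let ?S = "\<Sum>n\<in>{N..<2 * N - z'}. fejer (H k) (\<phi> n) * fejer (H k) (\<phi> (n + z'))"
    have R: "(\<Sum>i\<in>{2^k..<2^Suc k}. K k i * K k (i + z)) = (s k)\<^sup>2 * ?S"
      unfolding zz corr[OF k] by (simp add: N_def)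
    have Xk: "X k = real N powr (3/4)" 
      by (simp add: X_def N_def powr_power powr_powr mult.commute flip: powr_realpow)
    have \<delta>k: "\<delta> k = real N powr (-(1/20))" 
      by (simp add: \<delta>_def N_def powr_power powr_powr mult.commute flip: powr_realpow)
    have S0: "0 \<le> ?S" by (intro sum_nonneg mult_nonneg_nonneg fejer_nonneg)
    have U0: "0 \<le> 1 / (W k * (1 + (real_of_int z)\<^sup>2))" using W(1)[OF k] by simp
    let ?U = "1 / (W k * (1 + (real_of_int z)\<^sup>2)) + of_bool (real_of_int z < X k) / 2 ^ k + of_bool (z < 2 ^ k) * \<delta> k / 2 ^ k"
    show "\<bar>(\<Sum>i\<in>{2^k..<2^Suc k}. K k i * K k (i + z)) - G k z\<bar> \<le> C * ?U"
    proof (cases "z' < N")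
      case False
      then have "G k z = 0" using N by (simp add: G_def zz N_def max_def)
      moreover have "{N..<2 * N - z'} = {}" using False by auto
      then have "?S = 0" by (simp only: sum.empty)
      ultimately show ?thesis unfolding R using C U0 \<open>\<And>k. 0 \<le> \<delta> k\<close> by simp
    next
      case True
      then have zlt: "z < 2 ^ k" "real z' < real N" by (simp_all add: zz N_def)
      have G: "G k z = (s k)\<^sup>2 * (real N - real z')" using zlt N by (simp add: G_def zz)
      show ?thesis
      proof (cases "real_of_int z < X k")
        case False
        have "\<bar>?S - (real (2 * N - z') - real N)\<bar> \<le> 2 / a * real N powr (19/20)"
          using False True H[OF k] N by (intro corr_far) (auto simp: Xk zz N_def)
        moreover have "real (2 * N - z') - real N = real N - real z'" using True by (simp add: of_nat_diff)
        ultimately have far: "\<bar>?S - (real N - real z')\<bar> \<le> 2 / a * real N powr (19/20)" by simp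
        have "\<bar>(s k)\<^sup>2 * ?S - G k z\<bar> = (s k)\<^sup>2 * \<bar>?S - (real N - real z')\<bar>"
          unfolding G right_diff_distrib[symmetric] abs_mult by simp
        also have "\<dots> \<le> (16384 / (2 ^ k)\<^sup>2) * (2 / a * real N powr (19/20))"
          by (intro mult_mono s2 k far) auto
        also have "\<dots> = (32768 / a) * (real N powr (19/20) / real N powr 1) / 2 ^ k"
          using N by (simp add: power2_eq_square)
        also have "real N powr (19/20) / real N powr 1 = \<delta> k" unfolding \<delta>k powr_diff[symmetric] by simp
        also have "32768 / a * \<delta> k / 2 ^ k \<le> C * \<delta> k / 2 ^ k"
        proof (intro divide_right_mono mult_right_mono)
          have "32768 / a \<le> 4000000 / a" using a_pos by (intro divide_right_mono) auto
          then show "32768 / a \<le> C" using C(2) by linarith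
        qed (auto simp: \<delta>_def)
        also have "\<dots> \<le> C * ?U" using C U0 zlt by (simp add: algebra_simps add_increasing)
        finally show ?thesis unfolding R .
      next
        case zX: True
        \<comment> \<open>For short shifts no cancellation between \<open>R\<close> and
          \<open>G\<close> is used. Away from the peak each of them is of order
          \<open>1 / N\<close>, and this is charged to the term with \<open>X k\<close>.\<close>
        have nr: "?S \<le> 60 / a * real N + 64 * real N / (d N * (1 + (real z')\<^sup>2))"
        proof (rule corr_near)
          have "real (4 * H k * z') = 4 * (real (H k) * d N) * (1 / d N) * real z'"
            using dN[OF k] by (simp add: N_def)
          also have "\<dots> \<le> 4 * (1 / 8) * real N powr (real 1 / 30) * real N powr (3/4)"
            using H[OF k] dN[OF k] zX inverse_d_power_le[OF N(1), of 1]
            by (intro mult_mono) (auto simp: Xk zz N_def)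
          also have "\<dots> = 1 / 2 * real N powr (47/60)" by (simp flip: powr_add)
          also have "\<dots> \<le> real N" using powr_le_self[OF N(1), of "47/60"] by simp
          finally show "4 * H k * z' \<le> N" by (simp only: of_nat_le_iff)
        qed (use H[OF k] N True in \<open>auto simp: N_def\<close>)
        have "1 / (real N * d N) \<le> 2 / W k"
          using W[OF k] dN[OF k] N by (simp add: N_def field_simps)
        then have b1: "64 * real N / (d N * (1 + (real z')\<^sup>2)) \<le> 128 * (real N)\<^sup>2 * (1 / (W k * (1 + (real z')\<^sup>2)))"
        proof -
          assume h: "1 / (real N * d N) \<le> 2 / W k"
          have "64 * real N / (d N * (1 + (real z')\<^sup>2)) = 64 * (real N)\<^sup>2 * (1 / (real N * d N)) * (1 / (1 + (real z')\<^sup>2))"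
            using N by (simp add: power2_eq_square)
          also have "\<dots> \<le> 64 * (real N)\<^sup>2 * (2 / W k) * (1 / (1 + (real z')\<^sup>2))"
            using h by (intro mult_right_mono mult_left_mono) auto
          finally show ?thesis by simp
        qed
        have Np: "0 < real N" using N by simp
        have "(s k)\<^sup>2 * ?S \<le> (16384 / (real N)\<^sup>2) * (60 / a * real N + 128 * (real N)\<^sup>2 * (1 / (W k * (1 + (real z')\<^sup>2))))"
          using s2[OF k] nr b1 S0 by (intro mult_mono) (auto simp: N(2))
        also have "\<dots> = 983040 / a / real N + 2097152 * (1 / (W k * (1 + (real z')\<^sup>2)))"
          using Np by (simp add: distrib_left power2_eq_square)
        finally have RS: "(s k)\<^sup>2 * ?S \<le> 983040 / a / real N + 2097152 * (1 / (W k * (1 + (real z')\<^sup>2)))" .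
        have "G k z \<le> (16384 / (real N)\<^sup>2) * real N" unfolding G using s2[OF k] zlt by (intro mult_mono) (auto simp: N(2))
        also have "\<dots> = 16384 / real N" using Np by (simp add: power2_eq_square)
        finally have GS: "G k z \<le> 16384 / real N" .
        have a1: "1 \<le> 1 / a" using a_pos a_le by simp
        have w0: "0 \<le> 1 / (W k * (1 + (real z')\<^sup>2))" using W(1)[OF k] by simp
        have G0: "0 \<le> G k z" "0 \<le> (s k)\<^sup>2 * ?S" using S0 by (auto simp: G_def)
        have "\<bar>(s k)\<^sup>2 * ?S - G k z\<bar> \<le> (s k)\<^sup>2 * ?S + G k z" using G0 by linarith
        also have "\<dots> \<le> 983040 / a / real N + 2097152 * (1 / (W k * (1 + (real z')\<^sup>2))) + 16384 / real N"
          using RS GS by linarith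
        also have "\<dots> \<le> C / real N + C * (1 / (W k * (1 + (real z')\<^sup>2)))"
        proof -
          have "983040 / a + 16384 \<le> C" "2097152 \<le> C" using C(2) a1 by (auto simp: field_simps)
          then have "(983040 / a + 16384) / real N \<le> C / real N" 
            "2097152 * (1 / (W k * (1 + (real z')\<^sup>2))) \<le> C * (1 / (W k * (1 + (real z')\<^sup>2)))"
            using w0 by (auto intro!: divide_right_mono mult_right_mono)
          then show ?thesis by (simp add: add_divide_distrib)
        qed
        also have "\<dots> \<le> C * ?U"
        proof -
          have "0 \<le> C * (\<delta> k / 2 ^ k)" using C by (simp add: \<delta>_def)
          then show ?thesis using zX zlt by (simp add: zz N(2) distrib_left add.commute)
        qed
        finally show ?thesis unfolding R .
      qed
    qed
  qed
  define D where "D = 400 * C\<^sup>2 + 2 * C + 1"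
  show ?thesis
  proof (intro exI[of _ D] exI[of _ k0] conjI allI impI)
    show "1 \<le> D" using C by (simp add: D_def)
    show "n0 \<le> 2 ^ k0" using k0 by simp
    fix f :: "int \<Rightarrow> real" and Y and l :: real and I :: "nat set" and Z :: "int set"
    assume f': "\<forall>y. 0 \<le> f y" "\<forall>y. y \<notin> Y \<longrightarrow> f y = 0" "finite Y" and l: "0 < l"
    then have f: "\<And>y. 0 \<le> f y" "\<And>y. y \<notin> Y \<Longrightarrow> f y = 0" "finite Y" by auto
    assume I: "finite I" "I \<subseteq> {k0..}" "finite Z"
    have eq: "(\<Sum>n\<in>A k. f (x + n)) = (\<Sum>n\<in>E \<inter> {2^k..<2^Suc k}. f (x + int n))" for x k
      unfolding A_def by (subst sum.reindex) auto
    have "card {x\<in>Z. \<exists>k\<in>I. D * l < (\<Sum>n\<in>E \<inter> {2^k..<2^Suc k}. f (x + int n)) / \<phi> (2^k)} \<le>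
      card {x\<in>Z. \<exists>k\<in>I. (2 * C + 1) * l < (\<Sum>n\<in>A k. f (x + n)) / W k}"
    proof (rule card_mono)
      have "(2 * C + 1) * l \<le> D * l" using l by (intro mult_right_mono) (auto simp: D_def)
      then show "{x\<in>Z. \<exists>k\<in>I. D * l < (\<Sum>n\<in>E \<inter> {2^k..<2^Suc k}. f (x + int n)) / \<phi> (2^k)} \<subseteq>
        {x\<in>Z. \<exists>k\<in>I. (2 * C + 1) * l < (\<Sum>n\<in>A k. f (x + n)) / W k}"
        unfolding eq W_def by (auto intro: le_less_trans)
    qed (use I in auto)
    then have "real (card {x\<in>Z. \<exists>k\<in>I. D * l < (\<Sum>n\<in>E \<inter> {2^k..<2^Suc k}. f (x + int n)) / \<phi> (2^k)}) \<le>
      real (card {x\<in>Z. \<exists>k\<in>I. (2 * C + 1) * l < (\<Sum>n\<in>A k. f (x + n)) / W k})" by (simp only: of_nat_le_iff)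
    also have "\<dots> \<le> 400 * C\<^sup>2 * sum f Y / l" by (rule sp.weak_type[OF f l I])
    also have "\<dots> \<le> D * sum f Y / l"
      using l f C by (intro divide_right_mono mult_right_mono sum_nonneg) (auto simp: D_def)
    finally show "real (card {x\<in>Z. \<exists>k\<in>I. D * l < (\<Sum>n\<in>E \<inter> {2^k..<2^Suc k}. f (x + int n)) / \<phi> (2^k)}) \<le> D * sum f Y / l" .
  qed
qed

end

section \<open>Transference\<close>

locale measure_preserving =
  fixes M :: "'a measure" and T :: "'a \<Rightarrow> 'a"
  assumes T_meas [measurable]: "T \<in> measurable M M" and T_distr: "distr M M T = M"
begin

lemma funpow_meas [measurable]: "(T ^^ n) \<in> measurable M M"
  by (induction n) (auto simp: measurable_ident intro: measurable_comp T_meas)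

lemma funpow_distr: "distr M M (T ^^ n) = M"
proof (induction n)
  case 0
  then show ?case by (simp add: distr_id2 id_def)
next
  case (Suc n)
  have "distr M M (T \<circ> (T ^^ n)) = distr (distr M M (T ^^ n)) M T"
    by (rule distr_distr[symmetric]) auto
  then show ?case using Suc T_distr by (simp add: comp_def)
qed

lemma funpow_space: "x \<in> space M \<Longrightarrow> (T ^^ n) x \<in> space M"
  using measurable_space[OF funpow_meas] .

lemma integral_funpow:
  fixes g :: "'a \<Rightarrow> 'b::{banach, second_countable_topology}"
  assumes [measurable]: "g \<in> borel_measurable M"
  shows "(\<integral> x. g ((T ^^ n) x) \<partial>M) = (\<integral> x. g x \<partial>M)"
  using integral_distr[OF funpow_meas[of n], of g] by (simp add: funpow_distr)

lemma integrable_funpow: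
  fixes g :: "'a \<Rightarrow> 'b::{banach, second_countable_topology}"
  assumes "integrable M g"
  shows "integrable M (\<lambda>x. g ((T ^^ n) x))"
  using integrable_distr[OF funpow_meas[of n], of g] assms by (simp add: funpow_distr)

lemma emeasure_funpow:
  assumes [measurable]: "S \<in> sets M"
  shows "emeasure M ((T ^^ n) -` S \<inter> space M) = emeasure M S"
  using emeasure_distr[OF funpow_meas[of n] assms] by (simp add: funpow_distr)

text \<open>Calderon's transference: the hypothesis is summed over orbit segments of length \<open>J\<close>, and \<open>J \<rightarrow> \<infinity>\<close>.\<close>

lemma transference:
  fixes S :: "'a set" and g :: "'a \<Rightarrow> real"
  assumes [measurable]: "S \<in> sets M" "integrable M g" and "0 \<le> D"
    and orbit: "\<And>x J. x \<in> space M \<Longrightarrow>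
      real (card {i. i < J \<and> (T ^^ i) x \<in> S}) \<le> D * (\<Sum>i<J + P. g ((T ^^ i) x))"
    and g: "\<And>x. 0 \<le> g x"
  shows "emeasure M S \<le> ennreal (D * (\<integral>x. g x \<partial>M))"
proof -
  define G where "G = (\<integral>x. g x \<partial>M)"
  have G0: "0 \<le> G" unfolding G_def using g by simp
  have J: "of_nat J * emeasure M S \<le> ennreal (D * (real (J + P) * G))" for J
  proof -
    have "of_nat J * emeasure M S = (\<Sum>i<J. emeasure M ((T ^^ i) -` S \<inter> space M))"
      by (simp add: emeasure_funpow)
    also have "\<dots> = (\<Sum>i<J. \<integral>\<^sup>+ x. indicator ((T ^^ i) -` S \<inter> space M) x \<partial>M)"
      by (intro sum.cong refl nn_integral_indicator[symmetric]) simp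
    also have "\<dots> = (\<integral>\<^sup>+ x. (\<Sum>i<J. indicator ((T ^^ i) -` S \<inter> space M) x) \<partial>M)"
      by (intro nn_integral_sum[symmetric]) simp
    also have "\<dots> \<le> (\<integral>\<^sup>+ x. ennreal (D * (\<Sum>i<J + P. g ((T ^^ i) x))) \<partial>M)"
    proof (rule nn_integral_mono)
      fix x assume x: "x \<in> space M"
      have "(\<Sum>i<J. indicator ((T ^^ i) -` S \<inter> space M) x :: ennreal) = (\<Sum>i\<in>{i. i < J \<and> (T ^^ i) x \<in> S}. 1)"
        using x by (intro sum.mono_neutral_cong_right) (auto simp: indicator_def)
      also have "\<dots> = ennreal (real (card {i. i < J \<and> (T ^^ i) x \<in> S}))" by (simp add: ennreal_of_nat_eq_real_of_nat)
      also have "\<dots> \<le> ennreal (D * (\<Sum>i<J + P. g ((T ^^ i) x)))" using orbit[OF x] by (rule ennreal_leI)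
      finally show "(\<Sum>i<J. indicator ((T ^^ i) -` S \<inter> space M) x) \<le> ennreal (D * (\<Sum>i<J + P. g ((T ^^ i) x)))" .
    qed
    also have "\<dots> = ennreal (\<integral> x. D * (\<Sum>i<J + P. g ((T ^^ i) x)) \<partial>M)"
      using assms(2,3) g by (intro nn_integral_eq_integral integrable_mult_right Bochner_Integration.integrable_sum integrable_funpow AE_I2 mult_nonneg_nonneg sum_nonneg) auto
    also have "(\<integral> x. D * (\<Sum>i<J + P. g ((T ^^ i) x)) \<partial>M) = D * (\<Sum>i<J + P. \<integral> x. g ((T ^^ i) x) \<partial>M)"
      using assms(2) by (simp add: integrable_funpow)
    also have "(\<Sum>i<J + P. \<integral> x. g ((T ^^ i) x) \<partial>M) = real (J + P) * G"
      using assms(2) by (simp add: integral_funpow G_def)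
    finally show ?thesis .
  qed
  \<comment> \<open>Taking \<open>J = 1\<close> already shows that \<open>S\<close> has finite
    measure, so the inequalities for larger \<open>J\<close> can be read in the reals and divided by
    \<open>J\<close>.\<close>
  have "emeasure M S \<le> ennreal (D * (real (1 + P) * G))" using J[of 1] by simp
  then have fin: "emeasure M S \<noteq> \<infinity>" by (auto simp: top_unique)
  define m where "m = measure M S"
  have m: "emeasure M S = ennreal m" using fin by (simp add: m_def emeasure_eq_ennreal_measure)
  have Jr: "real J * m \<le> D * (real (J + P) * G)" for J
  proof -
    have "ennreal (real J * m) \<le> ennreal (D * (real (J + P) * G))"
      using J[of J] by (simp add: m ennreal_of_nat_eq_real_of_nat ennreal_mult'' m_def)
    then show ?thesis using assms(3) G0 by (subst (asm) ennreal_le_iff) auto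
  qed
  have "m \<le> D * G"
  proof (rule tendsto_lowerbound)
    show "(\<lambda>J. D * G + D * real P * G / real (Suc J)) \<longlonglongrightarrow> D * G"
      using tendsto_add[OF tendsto_const[of "D * G"] LIMSEQ_Suc[OF lim_const_over_n[of "D * real P * G"]]] by simp
    show "\<forall>\<^sub>F J in sequentially. m \<le> D * G + D * real P * G / real (Suc J)"
    proof (intro always_eventually allI)
      fix J
      define r where "r = real (Suc J)"
      have r: "0 < r" "real (Suc J + P) = r + real P" by (simp_all add: r_def)
      have "(D * G + D * real P * G / r) * r = D * ((r + real P) * G)" using r(1) by (simp add: field_simps)
      then have "m * r \<le> (D * G + D * real P * G / r) * r"
        using Jr[of "Suc J"] unfolding r r_def[symmetric] by (simp only: mult.commute)
      then have "m * real (Suc J) \<le> (D * G + D * real P * G / real (Suc J)) * real (Suc J)" unfolding r_def .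
      then show "m \<le> D * G + D * real P * G / real (Suc J)" by (rule mult_right_le_imp_le) simp
    qed
  qed simp
  then show ?thesis unfolding m G_def by (rule ennreal_leI)
qed

end

section \<open>The maximal inequality on the measure space\<close>

context regular_floor_set
begin

text \<open>\<open>\<phi> (2 ^ k)\<close> replaces the number of terms, to which it is comparable
  for large \<open>k\<close>; unlike that number it has the doubling property at hand.\<close>

definition block_average :: "('a \<Rightarrow> 'a) \<Rightarrow> ('a \<Rightarrow> real) \<Rightarrow> nat \<Rightarrow> 'a \<Rightarrow> real" where
  "block_average T g k x = (\<Sum>n\<in>E \<inter> {2^k..<2^Suc k}. g ((T ^^ n) x)) / \<phi> (2 ^ k)"

text \<open>Along an orbit \<open>g\<close> becomes a function on the integers, and an average at a
  scale below \<open>K\<close> looks ahead by less than \<open>2 ^ Suc K\<close> steps. Finitely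
  many scales are transferred first, and continuity from below removes the restriction. The
  constants are found before \<open>M\<close> and \<open>T\<close> are given.\<close>

lemma maximal_inequality:
  "\<exists>D k0. 1 \<le> D \<and> n0 \<le> 2 ^ k0 \<and> (\<forall>(M :: 'a measure) T g l. measure_preserving M T \<longrightarrow> integrable M g \<longrightarrow> (\<forall>x. 0 \<le> g x) \<longrightarrow> 0 < l \<longrightarrow>
       emeasure M {x \<in> space M. \<exists>k\<ge>k0. D * l < block_average T g k x} \<le> ennreal (D / l * (\<integral>x. g x \<partial>M)))"
proof -
  obtain D k0 where D: "1 \<le> D" "n0 \<le> 2 ^ k0" and weak: 
    "\<forall>(f :: int \<Rightarrow> real) Y l I Z.
     (\<forall>y. 0 \<le> f y) \<longrightarrow> (\<forall>y. y \<notin> Y \<longrightarrow> f y = 0) \<longrightarrow> finite Y \<longrightarrow> 0 < l \<longrightarrow> finite I \<longrightarrow> I \<subseteq> {k0..} \<longrightarrow> finite Z \<longrightarrow>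
       real (card {x\<in>Z. \<exists>k\<in>I. D * l < (\<Sum>n\<in>E \<inter> {2^k..<2^Suc k}. f (x + int n)) / \<phi> (2^k)}) \<le> D * sum f Y / l"
    using discrete_weak_type by blast
  show ?thesis
  proof (intro exI[of _ D] exI[of _ k0] conjI allI impI)
    fix M :: "'a measure" and T and g :: "'a \<Rightarrow> real" and l :: real
    assume "measure_preserving M T" and g': "integrable M g" "\<forall>x. 0 \<le> g x" and l: "0 < l"
    then have g: "integrable M g" "\<And>x. 0 \<le> g x" by auto
    from \<open>measure_preserving M T\<close> interpret measure_preserving M T by simp
    have gm [measurable]: "g \<in> borel_measurable M" using g by simp
    define S where "S = (\<lambda>K. {x \<in> space M. \<exists>k\<in>{k0..<K}. D * l < block_average T g k x})"
    have S_meas [measurable]: "S K \<in> sets M" for K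
      unfolding S_def block_average_def by measurable
    have S: "emeasure M (S K) \<le> ennreal (D / l * (\<integral>x. g x \<partial>M))" for K
    proof (rule transference[where P = "2 ^ Suc K"])
      fix x J assume x: "x \<in> space M"
      \<comment> \<open>The orbit segment is continued by zero; it is long enough that no block
        starting before \<open>J\<close> leaves it.\<close>
      define f where "f = (\<lambda>y::int. if 0 \<le> y \<and> y < int (J + 2 ^ Suc K) then g ((T ^^ nat y) x) else 0)"
      have eq: "(\<Sum>n\<in>E \<inter> {2^k..<2^Suc k}. f (int i + int n)) / \<phi> (2^k) = block_average T g k ((T ^^ i) x)"
        if "i < J" "k < K" for i k
      proof -
        have "(\<Sum>n\<in>E \<inter> {2^k..<2^Suc k}. f (int i + int n)) = (\<Sum>n\<in>E \<inter> {2^k..<2^Suc k}. g ((T ^^ n) ((T ^^ i) x)))"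
        proof (rule sum.cong[OF refl])
          fix n assume n: "n \<in> E \<inter> {2^k..<2^Suc k}"
          have "(2::nat) ^ Suc k \<le> 2 ^ Suc K" using that by (intro power_increasing) auto
          then have lt: "i + n < J + 2 ^ Suc K" using n that(1) unfolding Int_iff atLeastLessThan_iff by linarith
          have "int i + int n = int (i + n)" by simp
          then have "f (int i + int n) = g ((T ^^ (i + n)) x)" unfolding f_def using lt by (simp only: nat_int of_nat_less_iff) simp
          also have "(T ^^ (i + n)) x = (T ^^ n) ((T ^^ i) x)" by (simp add: funpow_add add.commute[of i n])
          finally show "f (int i + int n) = g ((T ^^ n) ((T ^^ i) x))" .
        qed
        then show ?thesis by (simp add: block_average_def)
      qed
      have sum_int: "sum f {0..<int L} = (\<Sum>i<L. f (int i))" for L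
        by (rule sum.reindex_bij_witness[of _ int nat]) auto
      define large where "large = (\<lambda>y. \<exists>k\<in>{k0..<K}. D * l < (\<Sum>n\<in>E \<inter> {2^k..<2^Suc k}. f (y + int n)) / \<phi> (2^k))"
      have seteq: "{i. i < J \<and> (T ^^ i) x \<in> S K} = {i. i < J \<and> large (int i)}"
      proof (intro Collect_cong conj_cong refl)
        fix i assume i: "i < J"
        have "(T ^^ i) x \<in> S K \<longleftrightarrow> (\<exists>k\<in>{k0..<K}. D * l < block_average T g k ((T ^^ i) x))"
          using funpow_space[OF x] by (simp add: S_def)
        also have "\<dots> \<longleftrightarrow> large (int i)" unfolding large_def
          by (intro bex_cong refl) (simp only: eq[OF i] atLeastLessThan_iff)
        finally show "(T ^^ i) x \<in> S K \<longleftrightarrow> \<dots>" .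
      qed
      have "card {i. i < J \<and> (T ^^ i) x \<in> S K} = card (int ` {i. i < J \<and> large (int i)})"
        unfolding seteq by (rule card_image[symmetric]) simp
      also have "\<dots> \<le> card {y\<in>{0..<int J}. large y}"
        by (rule card_mono, rule finite_subset[of _ "{0..<int J}"]) auto
      finally have "real (card {i. i < J \<and> (T ^^ i) x \<in> S K}) \<le> 
          real (card {y\<in>{0..<int J}. large y})"
        by (simp only: of_nat_le_iff)
      also have "\<dots> \<le> D * sum f {0..<int (J + 2 ^ Suc K)} / l"
        unfolding large_def using l g(2) by (intro weak[rule_format]) (auto simp: f_def simp del: power_Suc)
      also have "sum f {0..<int (J + 2 ^ Suc K)} = (\<Sum>i<J + 2 ^ Suc K. f (int i))" by (rule sum_int)
      also have "\<dots> = (\<Sum>i<J + 2 ^ Suc K. g ((T ^^ i) x))"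
        by (intro sum.cong refl) (simp add: f_def del: of_nat_add)
      finally show "real (card {i. i < J \<and> (T ^^ i) x \<in> S K}) \<le> D / l * (\<Sum>i<J + 2 ^ Suc K. g ((T ^^ i) x))" by simp
    qed (use g l D in auto)
    have SI: "x \<in> S K" if "x \<in> space M" "k0 \<le> k" "k < K" "D * l < block_average T g k x" for x k K
      unfolding S_def using that by (intro CollectI conjI bexI[of _ k]) simp_all
    have SE: "\<exists>k. x \<in> space M \<and> k0 \<le> k \<and> k < K \<and> D * l < block_average T g k x" if "x \<in> S K" for x K
      using that unfolding S_def by auto
    have "{x \<in> space M. \<exists>k\<ge>k0. D * l < block_average T g k x} = (\<Union>K. S K)"
      using SI SE lessI by blast
    also have "emeasure M \<dots> = (SUP K. emeasure M (S K))"
    proof (rule SUP_emeasure_incseq[symmetric])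
      show "range S \<subseteq> sets M" using S_meas by blast
      show "incseq S" by (intro incseq_SucI subsetI) (use SI SE less_SucI in blast)
    qed
    also have "\<dots> \<le> ennreal (D / l * (\<integral>x. g x \<partial>M))" by (rule SUP_least) (rule S)
    finally show "emeasure M {x \<in> space M. \<exists>k\<ge>k0. D * l < block_average T g k x} \<le> ennreal (D / l * (\<integral>x. g x \<partial>M))" .
  qed (use D in auto)
qed

end

section \<open>Discrepancy of the set along orbits\<close>

lemma double_sum_diagonals:
  fixes F :: "nat \<Rightarrow> nat \<Rightarrow> 'b::comm_monoid_add"
  shows "(\<Sum>n\<in>{p..<q}. \<Sum>m\<in>{p..<q}. F n m) = 
    (\<Sum>n\<in>{p..<q}. F n n) + (\<Sum>x\<in>{1..<q-p}. \<Sum>m\<in>{p..<q-x}. F (m + x) m) + (\<Sum>x\<in>{1..<q-p}. \<Sum>m\<in>{p..<q-x}. F m (m + x))"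
proof -
  let ?I = "{p..<q}"
  let ?S = "SIGMA x:{1..<q-p}. {p..<q-x}"
  have "(\<Sum>n\<in>?I. \<Sum>m\<in>?I. F n m) = (\<Sum>(n,m)\<in>?I \<times> ?I. F n m)" by (rule sum.cartesian_product)
  also have "?I \<times> ?I = ({z\<in>?I \<times> ?I. fst z = snd z} \<union> {z\<in>?I \<times> ?I. snd z < fst z}) \<union> {z\<in>?I \<times> ?I. fst z < snd z}"
    by auto
  also have "(\<Sum>(n,m)\<in>\<dots>. F n m) = (\<Sum>(n,m)\<in>{z\<in>?I \<times> ?I. fst z = snd z}. F n m) + 
     (\<Sum>(n,m)\<in>{z\<in>?I \<times> ?I. snd z < fst z}. F n m) + (\<Sum>(n,m)\<in>{z\<in>?I \<times> ?I. fst z < snd z}. F n m)"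
    by (subst sum.union_disjoint; (subst sum.union_disjoint)?) auto
  also have "(\<Sum>(n,m)\<in>{z\<in>?I \<times> ?I. fst z = snd z}. F n m) = (\<Sum>n\<in>?I. F n n)"
    by (rule sum.reindex_bij_witness[of _ "\<lambda>n. (n,n)" fst]) auto
  also have "(\<Sum>(n,m)\<in>{z\<in>?I \<times> ?I. snd z < fst z}. F n m) = (\<Sum>(x,m)\<in>?S. F (m + x) m)"
    by (rule sum.reindex_bij_witness[of _ "\<lambda>(x,m). (m+x,m)" "\<lambda>(n,m). (n-m,m)"]) auto
  also have "\<dots> = (\<Sum>x\<in>{1..<q-p}. \<Sum>m\<in>{p..<q-x}. F (m + x) m)" by (rule sum.Sigma[symmetric]) auto
  also have "(\<Sum>(n,m)\<in>{z\<in>?I \<times> ?I. fst z < snd z}. F n m) = (\<Sum>(x,m)\<in>?S. F m (m + x))"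
    by (rule sum.reindex_bij_witness[of _ "\<lambda>(x,m). (m,m+x)" "\<lambda>(n,m). (m-n,n)"]) auto
  also have "\<dots> = (\<Sum>x\<in>{1..<q-p}. \<Sum>m\<in>{p..<q-x}. F m (m + x))" by (rule sum.Sigma[symmetric]) auto
  finally show ?thesis .
qed

text \<open>The bound in van der Corput's inequality with all shifts used: the diagonal and twice
  the moduli of the autocorrelations.\<close>

definition correlation_sum :: "nat \<Rightarrow> nat \<Rightarrow> (nat \<Rightarrow> complex) \<Rightarrow> real" where
  "correlation_sum p q c = (\<Sum>n\<in>{p..<q}. (norm (c n))\<^sup>2) + 2 * (\<Sum>x\<in>{1..<q-p}. norm (\<Sum>m\<in>{p..<q-x}. c (m + x) * cnj (c m)))"

text \<open>A Toeplitz kernel is constant along diagonals and leaves the autocorrelations of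
  \<open>c\<close> intact. The constant kernel gives van der Corput's inequality; the inner products
  of \<open>f\<close> along the orbit give its \<open>L\<^sup>2\<close> analogue without any
  spectral theory.\<close>

lemma stationary_form_bound:
  fixes r :: "nat \<Rightarrow> nat \<Rightarrow> complex" and \<rho> :: "nat \<Rightarrow> complex"
  assumes r: "\<And>m x. r (m + x) m = \<rho> x" "\<And>m x. r m (m + x) = cnj (\<rho> x)" and \<rho>: "\<And>x. norm (\<rho> x) \<le> B"
  shows "norm (\<Sum>n\<in>{p..<q}. \<Sum>m\<in>{p..<q}. c n * cnj (c m) * r n m) \<le> B * correlation_sum p q c"
proof -
  let ?A = "\<lambda>x. \<Sum>m\<in>{p..<q-x}. c (m + x) * cnj (c m)"
  have 1: "norm (\<Sum>n\<in>{p..<q}. c n * cnj (c n) * r n n) \<le> B * (\<Sum>n\<in>{p..<q}. (norm (c n))\<^sup>2)"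
  proof -
    have "norm (\<Sum>n\<in>{p..<q}. c n * cnj (c n) * r n n) \<le> (\<Sum>n\<in>{p..<q}. B * (norm (c n))\<^sup>2)"
    proof (rule sum_norm_le)
      fix n
      have "norm (c n * cnj (c n) * r n n) = (norm (c n))\<^sup>2 * norm (\<rho> 0)"
        using r(1)[of n 0] by (simp add: norm_mult power2_eq_square)
      also have "\<dots> \<le> (norm (c n))\<^sup>2 * B" using \<rho> by (intro mult_left_mono) auto
      finally show "norm (c n * cnj (c n) * r n n) \<le> B * (norm (c n))\<^sup>2" by (simp add: mult.commute)
    qed
    then show ?thesis by (simp add: sum_distrib_left)
  qed
  have 2: "norm (\<Sum>x\<in>{1..<q-p}. \<Sum>m\<in>{p..<q-x}. c (m + x) * cnj (c m) * r (m + x) m) \<le> (\<Sum>x\<in>{1..<q-p}. B * norm (?A x))"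
  proof (rule sum_norm_le)
    fix x
    have "norm (\<Sum>m\<in>{p..<q-x}. c (m + x) * cnj (c m) * r (m + x) m) = norm (?A x) * norm (\<rho> x)"
      unfolding r(1) by (simp add: norm_mult flip: sum_distrib_right)
    also have "\<dots> \<le> norm (?A x) * B" using \<rho> by (intro mult_left_mono) auto
    finally show "norm (\<Sum>m\<in>{p..<q-x}. c (m + x) * cnj (c m) * r (m + x) m) \<le> B * norm (?A x)" by (simp add: mult.commute)
  qed
  have 3: "norm (\<Sum>x\<in>{1..<q-p}. \<Sum>m\<in>{p..<q-x}. c m * cnj (c (m + x)) * r m (m + x)) \<le> (\<Sum>x\<in>{1..<q-p}. B * norm (?A x))"
  proof (rule sum_norm_le)
    fix x
    have "(\<Sum>m\<in>{p..<q-x}. c m * cnj (c (m + x)) * r m (m + x)) = cnj (?A x * \<rho> x)"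
      unfolding r(2) by (simp add: sum_distrib_left mult_ac)
    then have "norm (\<Sum>m\<in>{p..<q-x}. c m * cnj (c (m + x)) * r m (m + x)) = norm (?A x) * norm (\<rho> x)"
      by (simp only: complex_mod_cnj norm_mult)
    also have "\<dots> \<le> norm (?A x) * B" using \<rho> by (intro mult_left_mono) auto
    finally show "norm (\<Sum>m\<in>{p..<q-x}. c m * cnj (c (m + x)) * r m (m + x)) \<le> B * norm (?A x)" by (simp add: mult.commute)
  qed
  have "norm (\<Sum>n\<in>{p..<q}. \<Sum>m\<in>{p..<q}. c n * cnj (c m) * r n m) \<le> 
     B * (\<Sum>n\<in>{p..<q}. (norm (c n))\<^sup>2) + (\<Sum>x\<in>{1..<q-p}. B * norm (?A x)) + (\<Sum>x\<in>{1..<q-p}. B * norm (?A x))"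
    unfolding double_sum_diagonals by (intro order_trans[OF norm_triangle_ineq] add_mono 1 2 3)
  also have "\<dots> = B * correlation_sum p q c"
    by (simp add: correlation_sum_def distrib_left sum_distrib_left mult.left_commute)
  finally show ?thesis .
qed

lemma van_der_corput: "(norm (\<Sum>n\<in>{p..<q}. c n))\<^sup>2 \<le> correlation_sum p q c"
proof -
  have "complex_of_real ((norm (\<Sum>n\<in>{p..<q}. c n))\<^sup>2) = (\<Sum>n\<in>{p..<q}. \<Sum>m\<in>{p..<q}. c n * cnj (c m) * 1)"
    unfolding complex_norm_square by (simp add: sum_product)
  then have "norm (complex_of_real ((norm (\<Sum>n\<in>{p..<q}. c n))\<^sup>2)) = norm (\<Sum>n\<in>{p..<q}. \<Sum>m\<in>{p..<q}. c n * cnj (c m) * 1)"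
    by (rule arg_cong)
  also have "\<dots> \<le> 1 * correlation_sum p q c"
    by (rule stationary_form_bound[where \<rho> = "\<lambda>_. 1"]) auto
  finally show ?thesis by (simp add: norm_power)
qed

context measure_preserving
begin

text \<open>Invariance of the measure makes the inner product of \<open>f\<close> composed with two
  iterates depend on the difference of the exponents only, and none of these products exceeds the
  square norm of \<open>f\<close>.\<close>

lemma L2_van_der_corput:
  fixes f :: "'a \<Rightarrow> real"
  assumes [measurable]: "f \<in> borel_measurable M" and f2: "integrable M (\<lambda>x. (f x)\<^sup>2)"
  shows "integrable M (\<lambda>x. (norm (\<Sum>n\<in>{p..<q}. c n * complex_of_real (f ((T ^^ n) x))))\<^sup>2)"
    and "(\<integral>x. (norm (\<Sum>n\<in>{p..<q}. c n * complex_of_real (f ((T ^^ n) x))))\<^sup>2 \<partial>M) \<le> (\<integral>x. (f x)\<^sup>2 \<partial>M) * correlation_sum p q c"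
proof -
  define v where "v = (\<lambda>n x. f ((T ^^ n) x))"
  have [measurable]: "v n \<in> borel_measurable M" for n unfolding v_def by measurable
  have v2: "integrable M (\<lambda>x. (v n x)\<^sup>2)" for n
    using integrable_funpow[OF f2, of n] by (simp add: v_def)
  have vv: "integrable M (\<lambda>x. v n x * v m x)" for n m
  proof (rule Bochner_Integration.integrable_bound)
    show "integrable M (\<lambda>x. (v n x)\<^sup>2 + (v m x)\<^sup>2)" using v2 by simp
    show "AE x in M. norm (v n x * v m x) \<le> norm ((v n x)\<^sup>2 + (v m x)\<^sup>2)"
    proof (intro AE_I2)
      fix x
      have "2 * (\<bar>v n x\<bar> * \<bar>v m x\<bar>) \<le> (v n x)\<^sup>2 + (v m x)\<^sup>2" 
        using zero_le_power2[of "\<bar>v n x\<bar> - \<bar>v m x\<bar>"] by (simp add: power2_eq_square algebra_simps)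
      moreover have "0 \<le> \<bar>v n x\<bar> * \<bar>v m x\<bar>" by simp
      ultimately have "\<bar>v n x\<bar> * \<bar>v m x\<bar> \<le> (v n x)\<^sup>2 + (v m x)\<^sup>2" by linarith
      then show "norm (v n x * v m x) \<le> norm ((v n x)\<^sup>2 + (v m x)\<^sup>2)" by (simp add: abs_mult)
    qed
  qed simp
  define r where "r = (\<lambda>n m. complex_of_real (\<integral>x. v n x * v m x \<partial>M))"
  define \<rho> where "\<rho> = (\<lambda>x. complex_of_real (\<integral>y. v x y * v 0 y \<partial>M))"
  have r1: "r (m + x) m = \<rho> x" for m x
  proof -
    have "(\<integral>y. v (m + x) y * v m y \<partial>M) = (\<integral>y. (\<lambda>y. v x y * v 0 y) ((T ^^ m) y) \<partial>M)"
      by (simp add: v_def funpow_add add.commute[of m x])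
    also have "\<dots> = (\<integral>y. v x y * v 0 y \<partial>M)" by (rule integral_funpow) measurable
    finally show ?thesis by (simp add: r_def \<rho>_def)
  qed
  have r2: "r m (m + x) = cnj (\<rho> x)" for m x
  proof -
    have "r m (m + x) = r (m + x) m" by (simp add: r_def mult.commute)
    then show ?thesis using r1[of m x] by (simp add: \<rho>_def)
  qed
  have \<rho>: "norm (\<rho> x) \<le> (\<integral>x. (f x)\<^sup>2 \<partial>M)" for x
  proof -
    have iv: "(\<integral>y. (v n y)\<^sup>2 \<partial>M) = (\<integral>x. (f x)\<^sup>2 \<partial>M)" for n
      using integral_funpow[of "\<lambda>x. (f x)\<^sup>2" n] by (simp add: v_def)
    have "norm (\<rho> x) = \<bar>\<integral>y. v x y * v 0 y \<partial>M\<bar>" by (simp add: \<rho>_def)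
    also have "\<dots> \<le> (\<integral>y. \<bar>v x y * v 0 y\<bar> \<partial>M)" using integral_norm_bound[of M "\<lambda>y. v x y * v 0 y"] by simp
    also have "\<dots> \<le> (\<integral>y. (v x y)\<^sup>2 / 2 + (v 0 y)\<^sup>2 / 2 \<partial>M)"
    proof (intro integral_mono)
      fix y
      show "\<bar>v x y * v 0 y\<bar> \<le> (v x y)\<^sup>2 / 2 + (v 0 y)\<^sup>2 / 2"
        using zero_le_power2[of "\<bar>v x y\<bar> - \<bar>v 0 y\<bar>"] by (simp add: power2_eq_square algebra_simps abs_mult)
    qed (use vv v2 in \<open>auto intro!: integrable_abs\<close>)
    also have "\<dots> = (\<integral>x. (f x)\<^sup>2 \<partial>M)" using v2 by (simp add: iv)
    finally show ?thesis .
  qed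
  have sq: "complex_of_real ((norm (\<Sum>n\<in>{p..<q}. c n * complex_of_real (v n x)))\<^sup>2) = 
    (\<Sum>n\<in>{p..<q}. \<Sum>m\<in>{p..<q}. c n * cnj (c m) * complex_of_real (v n x * v m x))" for x
    unfolding complex_norm_square by (simp add: sum_product mult_ac)
  have "integrable M (\<lambda>x. complex_of_real ((norm (\<Sum>n\<in>{p..<q}. c n * complex_of_real (v n x)))\<^sup>2))"
    unfolding sq by (intro Bochner_Integration.integrable_sum integrable_mult_right integrable_of_real vv)
  then show "integrable M (\<lambda>x. (norm (\<Sum>n\<in>{p..<q}. c n * complex_of_real (f ((T ^^ n) x))))\<^sup>2)"
    using complex_of_real_integrable_eq unfolding v_def by blast
  have "complex_of_real (\<integral>x. (norm (\<Sum>n\<in>{p..<q}. c n * complex_of_real (v n x)))\<^sup>2 \<partial>M) = 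
     (\<integral>x. (\<Sum>n\<in>{p..<q}. \<Sum>m\<in>{p..<q}. c n * cnj (c m) * complex_of_real (v n x * v m x)) \<partial>M)"
    unfolding sq[symmetric] by (rule integral_complex_of_real[symmetric])
  also have "\<dots> = (\<Sum>n\<in>{p..<q}. \<Sum>m\<in>{p..<q}. c n * cnj (c m) * r n m)"
    unfolding r_def integral_complex_of_real[symmetric]
    by (subst Bochner_Integration.integral_sum | subst integral_mult_right_zero | rule sum.cong[OF refl] | 
        intro Bochner_Integration.integrable_sum integrable_mult_right integrable_of_real vv | rule refl)+
  finally have "norm (complex_of_real (\<integral>x. (norm (\<Sum>n\<in>{p..<q}. c n * complex_of_real (v n x)))\<^sup>2 \<partial>M)) 
     \<le> (\<integral>x. (f x)\<^sup>2 \<partial>M) * correlation_sum p q c"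
    using stationary_form_bound[of r \<rho>, OF r1 r2 \<rho>] by simp
  then show "(\<integral>x. (norm (\<Sum>n\<in>{p..<q}. c n * complex_of_real (f ((T ^^ n) x))))\<^sup>2 \<partial>M) \<le> (\<integral>x. (f x)\<^sup>2 \<partial>M) * correlation_sum p q c"
    by (simp add: v_def)
qed

end

section \<open>The sawtooth function and its Fejer means\<close>

definition sawtooth :: "real \<Rightarrow> real" where
  "sawtooth t = of_int \<lceil>t\<rceil> - t - 1 / 2"

text \<open>The Fejer mean of order \<open>H\<close> of the Fourier series of the sawtooth function.\<close>

definition fejer_sawtooth :: "nat \<Rightarrow> real \<Rightarrow> real" where
  "fejer_sawtooth H t = (\<Sum>(j,l)\<in>{z\<in>{..<H} \<times> {..<H}. fst z \<noteq> snd z}.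
     sin (2 * pi * (real_of_int (int j - int l) * t)) / (2 * pi * real_of_int (int j - int l))) / H"

lemma fejer_cos:
  assumes "1 \<le> H"
  shows "fejer H t = 1 + (\<Sum>(j,l)\<in>{z\<in>{..<H} \<times> {..<H}. fst z \<noteq> snd z}. cos (2 * pi * (real_of_int (int j - int l) * t))) / H"
proof -
  let ?Q = "{..<H} \<times> {..<H}" and ?N = "{z\<in>{..<H} \<times> {..<H}. fst z \<noteq> snd z}" and ?D = "{z\<in>{..<H} \<times> {..<H}. fst z = snd z}"
  have "fejer H t * real H = Re (complex_of_real (fejer H t) * of_nat H)" by simp
  also have "\<dots> = (\<Sum>(j,l)\<in>?Q. cos (2 * pi * (real_of_int (int j - int l) * t)))"
    using assms by (subst of_real_fejer) (auto simp: case_prod_unfold unit_exp_def)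
  also have "?Q = ?N \<union> ?D" by auto
  also have "(\<Sum>(j,l)\<in>?N \<union> ?D. cos (2 * pi * (real_of_int (int j - int l) * t))) = 
     (\<Sum>(j,l)\<in>?N. cos (2 * pi * (real_of_int (int j - int l) * t))) + (\<Sum>(j,l)\<in>?D. cos (2 * pi * (real_of_int (int j - int l) * t)))"
    by (rule sum.union_disjoint) auto
  also have "(\<Sum>(j,l)\<in>?D. cos (2 * pi * (real_of_int (int j - int l) * t))) = (\<Sum>j<H. 1)"
    by (rule sum.reindex_bij_witness[of _ "\<lambda>j. (j,j)" fst]) auto
  finally show ?thesis using assms by (simp add: field_simps)
qed

text \<open>The substitute for Fourier series: between integers the sawtooth has slope -1, so its
  difference from the mean has derivative \<open>- fejer H t\<close> and is monotone.\<close>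

lemma fejer_sawtooth_deriv:
  assumes "1 \<le> H"
  shows "(fejer_sawtooth H has_real_derivative (fejer H t - 1)) (at t)"
proof -
  have d: "((\<lambda>t. sin (2 * pi * (i * t)) / (2 * pi * i)) has_real_derivative cos (2 * pi * (i * t))) (at t)"
    if "i \<noteq> 0" for i :: real
    using that by (auto intro!: derivative_eq_intros simp: field_simps)
  have "(fejer_sawtooth H has_real_derivative 
     (\<Sum>z\<in>{z\<in>{..<H} \<times> {..<H}. fst z \<noteq> snd z}. cos (2 * pi * (real_of_int (int (fst z) - int (snd z)) * t))) / H) (at t)"
    unfolding fejer_sawtooth_def[abs_def] case_prod_unfold
    by (intro DERIV_cdivide DERIV_sum d) auto
  then show ?thesis unfolding fejer_cos[OF assms] case_prod_unfold by simp
qed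

lemma fejer_sawtooth_minus: "fejer_sawtooth H (- t) = - fejer_sawtooth H t"
  by (simp add: fejer_sawtooth_def case_prod_unfold sum_negf flip: minus_divide_left)

lemma fejer_sawtooth_add_int: "fejer_sawtooth H (t + of_int m) = fejer_sawtooth H t"
proof -
  have "sin (2 * pi * (real_of_int i * (t + of_int m))) = sin (2 * pi * (real_of_int i * t))" for i
  proof -
    have "2 * pi * (real_of_int i * (t + of_int m)) = 2 * pi * (real_of_int i * t) + 2 * pi * of_int (i * m)"
      by (simp add: algebra_simps)
    then show ?thesis by (simp add: sin_add del: of_int_mult)
  qed
  then show ?thesis by (simp only: fejer_sawtooth_def)
qed

lemma fejer_sawtooth_half: "fejer_sawtooth H (1 / 2) = 0" "fejer_sawtooth H 0 = 0"
proof -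
  have "sin (2 * pi * (real_of_int i * (1 / 2))) = 0" for i
    using sin_zero_iff_int2[of "2 * pi * (real_of_int i * (1 / 2))"] by auto
  then show "fejer_sawtooth H (1 / 2) = 0" by (simp only: fejer_sawtooth_def) simp
  show "fejer_sawtooth H 0 = 0" by (simp add: fejer_sawtooth_def)
qed

text \<open>The difference decreases from 1/2 at 0 to 0 at 1/2. Since \<open>fejer H x\<close> is at
  most \<open>1 / (4 * H * x\<^sup>2)\<close>, subtracting \<open>1 / (4 * H * u)\<close> makes it
  increasing, and the result is negative at 1/2.\<close>

lemma sawtooth_approx_aux:
  assumes H: "1 \<le> H" and u: "0 < u" "u \<le> 1 / 2"
  shows "0 \<le> 1 / 2 - u - fejer_sawtooth H u" "1 / 2 - u - fejer_sawtooth H u \<le> 1 / 2"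
    "1 / 2 - u - fejer_sawtooth H u \<le> 1 / (4 * real H * u)"
proof -
  define D where "D = (\<lambda>u. 1 / 2 - u - fejer_sawtooth H u)"
  have D': "(D has_real_derivative - fejer H t) (at t)" for t
    unfolding D_def[abs_def] by (rule derivative_eq_intros fejer_sawtooth_deriv[OF H] refl | simp)+
  have mono: "D t \<le> D s" if "s \<le> t" for s t
    by (rule DERIV_nonpos_imp_nonincreasing[OF that]) (use D' fejer_nonneg in fastforce)
  have "D (1 / 2) \<le> D u" "D u \<le> D 0" using u by (auto intro: mono)
  then show "0 \<le> 1 / 2 - u - fejer_sawtooth H u" "1 / 2 - u - fejer_sawtooth H u \<le> 1 / 2"
    by (simp_all add: D_def fejer_sawtooth_half)
  have "D u - 1 / (4 * real H * u) \<le> D (1/2) - 1 / (4 * real H * (1/2))"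
  proof (rule DERIV_nonneg_imp_nondecreasing[OF u(2)])
    fix x assume x: "u \<le> x" "x \<le> 1 / 2"
    then have x0: "0 < x" using u by simp
    have "4 * x \<le> norm (unit_exp x - 1)" using norm_unit_exp_minus_1_ge[of x] x x0 by simp
    then have "norm (\<Sum>j\<in>{0..<H}. unit_exp (real j * x)) \<le> 2 / (4 * x)"
      by (rule geometric_unit_exp_bound) (use x0 in simp)
    then have "(norm (\<Sum>j\<in>{0..<H}. unit_exp (real j * x)))\<^sup>2 \<le> (2 / (4 * x))\<^sup>2" by (intro power_mono) auto
    then have "fejer H x \<le> (2 / (4 * x))\<^sup>2 / real H"
      unfolding fejer_def lessThan_atLeast0 by (intro divide_right_mono) auto
    also have "\<dots> = 1 / (4 * real H * x\<^sup>2)" by (simp add: power2_eq_square)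
    finally have fb: "fejer H x \<le> 1 / (4 * real H * x\<^sup>2)" .
    have "((\<lambda>u. D u - 1 / (4 * real H * u)) has_real_derivative (- fejer H x + 1 / (4 * real H * x\<^sup>2))) (at x)"
      using x0 H by (auto intro!: derivative_eq_intros D' simp: power2_eq_square field_simps)
    then show "\<exists>y. ((\<lambda>u. D u - 1 / (4 * real H * u)) has_real_derivative y) (at x) \<and> 0 \<le> y"
      using fb by (intro exI[of _ "- fejer H x + 1 / (4 * real H * x\<^sup>2)"]) simp
  qed
  also have "\<dots> \<le> 0" using H by (simp add: D_def fejer_sawtooth_half)
  finally show "1 / 2 - u - fejer_sawtooth H u \<le> 1 / (4 * real H * u)" by (simp add: D_def)
qed

text \<open>The part of a period beyond 1/2 is reflected. The jump excludes a uniformly small bound,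
  so near the integers only the first estimate is available and its uses have to be counted.\<close>

lemma sawtooth_approx:
  assumes H: "1 \<le> H"
  shows "\<bar>sawtooth t - fejer_sawtooth H t\<bar> \<le> 1 / 2"
    and "0 < \<delta> \<Longrightarrow> (\<And>m::int. \<delta> \<le> \<bar>t - of_int m\<bar>) \<Longrightarrow> \<bar>sawtooth t - fejer_sawtooth H t\<bar> \<le> 1 / (4 * real H * \<delta>)"
proof -
  define u where "u = frac t"
  have u: "0 \<le> u" "u < 1" by (auto simp: u_def frac_lt_1)
  have t: "t = u + of_int \<lfloor>t\<rfloor>" by (simp add: u_def frac_def)
  have s: "fejer_sawtooth H t = fejer_sawtooth H u" using fejer_sawtooth_add_int[of H u "\<lfloor>t\<rfloor>"] t by simp
  have du: "(\<And>m::int. \<delta> \<le> \<bar>t - of_int m\<bar>) \<Longrightarrow> \<delta> \<le> u \<and> \<delta> \<le> 1 - u" for \<delta>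
  proof -
    assume h: "\<And>m::int. \<delta> \<le> \<bar>t - of_int m\<bar>"
    show "\<delta> \<le> u \<and> \<delta> \<le> 1 - u" using h[of "\<lfloor>t\<rfloor>"] h[of "\<lfloor>t\<rfloor> + 1"] u t by auto
  qed
  have saw: "sawtooth t = (if u = 0 then - 1 / 2 else 1 / 2 - u)"
  proof (cases "u = 0")
    case True
    then show ?thesis using t by (simp add: sawtooth_def) (metis ceiling_of_int diff_0 diff_self)
  next
    case False
    then have "\<lceil>t\<rceil> = \<lfloor>t\<rfloor> + 1" using u t by (intro ceiling_unique) auto
    then show ?thesis using False t by (simp add: sawtooth_def)
  qed
  have inv: "1 / (4 * real H * w) \<le> 1 / (4 * real H * \<delta>)" if "0 < \<delta>" "\<delta> \<le> w" for w \<delta>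
    using that H by (intro divide_left_mono mult_left_mono) auto
  consider "u = 0" | "0 < u" "u \<le> 1 / 2" | "1 / 2 < u" using u by linarith
  then show "\<bar>sawtooth t - fejer_sawtooth H t\<bar> \<le> 1 / 2"
  proof cases
    case 1
    then show ?thesis by (simp add: saw s fejer_sawtooth_half)
  next
    case 2
    then show ?thesis using sawtooth_approx_aux[OF H 2] by (simp add: saw s)
  next
    case 3
    have "fejer_sawtooth H (1 - u) = - fejer_sawtooth H u"
      using fejer_sawtooth_add_int[of H "- u" 1] by (simp add: fejer_sawtooth_minus)
    then show ?thesis using sawtooth_approx_aux[OF H, of "1 - u"] 3 u by (simp add: saw s)
  qed
  assume \<delta>: "0 < \<delta>" "\<And>m::int. \<delta> \<le> \<bar>t - of_int m\<bar>"
  from du[OF \<delta>(2)] have du': "\<delta> \<le> u" "\<delta> \<le> 1 - u" by auto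
  consider "u \<le> 1 / 2" | "1 / 2 < u" by linarith
  then show "\<bar>sawtooth t - fejer_sawtooth H t\<bar> \<le> 1 / (4 * real H * \<delta>)"
  proof cases
    case 1
    have "0 < u" using du' \<delta> by simp
    then show ?thesis using sawtooth_approx_aux[OF H _ 1] inv[OF \<delta>(1) du'(1)] by (simp add: saw s)
  next
    case 2
    have "fejer_sawtooth H (1 - u) = - fejer_sawtooth H u"
      using fejer_sawtooth_add_int[of H "- u" 1] by (simp add: fejer_sawtooth_minus)
    then show ?thesis using sawtooth_approx_aux[OF H, of "1 - u"] 2 u inv[OF \<delta>(1) du'(2)] by (simp add: saw s)
  qed
qed

lemma harm_le_ln:
  assumes "1 \<le> n"
  shows "harm n \<le> 1 + ln (real n)"
proof -
  have "harm (Suc (n - 1)) - ln (real (Suc (n - 1))) \<le> harm (Suc 0) - ln (real (Suc 0))"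
    using decseq_harm_diff_ln unfolding decseq_def by blast
  then show ?thesis using assms by (simp add: harm_expand)
qed

section \<open>Exponential sums and smoothing errors over short blocks\<close>

context regular_floor_set
begin

text \<open>The diagonal contributes \<open>L\<close>, the shift \<open>x\<close> a multiple of
  \<open>N / (d N * x)\<close>, and summation over \<open>x\<close> produces the harmonic
  number.\<close>

definition block_bound :: "nat \<Rightarrow> nat \<Rightarrow> real" where
  "block_bound N L = real L + 4 * real N / (a\<^sup>2 * d N) * harm L"

lemma block_bound_nonneg:
  assumes "n0 \<le> N"
  shows "0 \<le> block_bound N L"
  using d_pos[OF assms] harm_nonneg[of L, where 'a = real] by (simp add: block_bound_def)

text \<open>\<open>j\<close> is 0 or 1 because the sawtooth is taken at both ends of the interval
  from \<open>\<phi> n\<close> to \<open>\<phi> (Suc n)\<close>. The bound is uniform in the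
  frequency: a larger \<open>h\<close> helps as long as the increments stay below 1/2.\<close>

lemma block_correlation:
  assumes N: "n0 \<le> N" "N \<le> p" "p \<le> q" "q + 1 \<le> 2 * N" "2 * (q - p) \<le> N" "j \<le> 1"
    and h: "1 \<le> h" "h * real (q - p) / N \<le> 1 / 2"
  shows "correlation_sum p q (\<lambda>n. unit_exp (h * \<phi> (n + j))) \<le> block_bound N (q - p)"
proof -
  have dN: "0 < d N" using d_pos N by auto
  have x: "norm (\<Sum>m\<in>{p..<q-x}. unit_exp (h * \<phi> (m + x + j)) * cnj (unit_exp (h * \<phi> (m + j)))) \<le> 
     2 * real N / (a\<^sup>2 * d N) * (1 / real x)" if x: "x \<in> {1..<q-p}" for x
  proof -
    have "(\<Sum>m\<in>{p..<q-x}. unit_exp (h * \<phi> (m + x + j)) * cnj (unit_exp (h * \<phi> (m + j)))) = 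
      (\<Sum>m\<in>{p..<q-x}. unit_exp (h * (\<phi> (m + j + x) - \<phi> (m + j))))"
      by (simp add: cnj_unit_exp right_diff_distrib add.commute add.left_commute flip: unit_exp_add)
    also have "\<dots> = (\<Sum>n\<in>{p+j..<q-x+j}. unit_exp (h * (\<phi> (n + x) - \<phi> n)))"
      by (rule sum.shift_bounds_nat_ivl[symmetric])
    also have "norm \<dots> \<le> 2 * real N / (a\<^sup>2 * h * real x * d N)"
    proof (rule phase_sum_shift)
      have "h * real x / N \<le> h * real (q - p) / N" using x h by (intro divide_right_mono mult_left_mono) auto
      then show "h * real x / N \<le> 1 / 2" using h(2) by (rule order_trans)
    qed (use N x h in auto)
    also have "\<dots> \<le> 2 * real N / (a\<^sup>2 * 1 * real x * d N)"
      using x h dN a_pos by (intro divide_left_mono mult_right_mono mult_left_mono) auto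
    also have "\<dots> = 2 * real N / (a\<^sup>2 * d N) * (1 / real x)" by (simp add: mult_ac)
    finally show ?thesis .
  qed
  have "correlation_sum p q (\<lambda>n. unit_exp (h * \<phi> (n + j))) \<le> real (q - p) + 2 * (\<Sum>x\<in>{1..<q-p}. 2 * real N / (a\<^sup>2 * d N) * (1 / real x))"
    unfolding correlation_sum_def using x by (intro add_mono mult_left_mono sum_mono) auto
  also have "(\<Sum>x\<in>{1..<q-p}. 2 * real N / (a\<^sup>2 * d N) * (1 / real x)) = 2 * real N / (a\<^sup>2 * d N) * (\<Sum>x\<in>{1..<q-p}. 1 / real x)"
    by (rule sum_distrib_left[symmetric])
  also have "2 * real N / (a\<^sup>2 * d N) * (\<Sum>x\<in>{1..<q-p}. 1 / real x) \<le> 2 * real N / (a\<^sup>2 * d N) * harm (q - p)"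
  proof (rule mult_left_mono)
    show "(\<Sum>x\<in>{1..<q-p}. 1 / real x) \<le> harm (q - p)"
      unfolding harm_def inverse_eq_divide by (intro sum_mono2) auto
  qed (use dN in auto)
  finally show ?thesis by (simp add: block_bound_def)
qed

lemma block_sum_bound:
  assumes N: "n0 \<le> N" "N \<le> p" "p \<le> q" "q + 1 \<le> 2 * N" "2 * (q - p) \<le> N" "j \<le> 1"
    and h: "1 \<le> h" "h * real (q - p) / N \<le> 1 / 2"
  shows "norm (\<Sum>n\<in>{p..<q}. unit_exp (h * \<phi> (n + j))) \<le> sqrt (block_bound N (q - p))"
  by (intro real_le_rsqrt order_trans[OF van_der_corput] block_correlation assms)

text \<open>At the points counted the Fejer kernel is at least \<open>H / 2\<close>, so the count is
  at most \<open>2 / H\<close> times the sum of the kernel. Its constant term gives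
  \<open>q - p\<close>, the other frequencies give exponential sums.\<close>

lemma near_integer_count:
  assumes N: "n0 \<le> N" "N \<le> p" "p \<le> q" "q + 1 \<le> 2 * N" "2 * (q - p) \<le> N" "j \<le> 1"
    and H: "1 \<le> H" "real H * real (q - p) / N \<le> 1 / 2" "8 * real H * \<delta> \<le> 1"
  shows "real (card {n\<in>{p..<q}. \<exists>m::int. \<bar>\<phi> (n + j) - of_int m\<bar> < \<delta>}) \<le> 2 * real (q - p) / H + 2 * sqrt (block_bound N (q - p))"
proof -
  let ?S = "\<Sum>n\<in>{p..<q}. fejer H (\<phi> (n + j))"
  let ?Q = "{..<H} \<times> {..<H}"
  let ?D = "{z\<in>?Q. fst z = snd z}"
  let ?e = "\<lambda>z n. unit_exp (real_of_int (int (fst z) - int (snd z)) * \<phi> (n + j))"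
  let ?B = "sqrt (block_bound N (q - p))"
  have B0: "0 \<le> ?B" using block_bound_nonneg[OF N(1)] by simp
  have "complex_of_real (?S * real H) = (\<Sum>n\<in>{p..<q}. complex_of_real (fejer H (\<phi> (n + j))) * of_nat H)"
    by (simp add: sum_distrib_right)
  also have "\<dots> = (\<Sum>n\<in>{p..<q}. \<Sum>z\<in>?Q. ?e z n)"
    using H by (intro sum.cong) (auto simp: of_real_fejer case_prod_unfold)
  also have "\<dots> = (\<Sum>z\<in>?Q. \<Sum>n\<in>{p..<q}. ?e z n)" by (rule sum.swap)
  also have "\<dots> = (\<Sum>z\<in>?Q - ?D. \<Sum>n\<in>{p..<q}. ?e z n) + (\<Sum>z\<in>?D. \<Sum>n\<in>{p..<q}. ?e z n)"
    by (rule sum.subset_diff) auto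
  finally have eq: "complex_of_real (?S * real H) = \<dots>" .
  have S0: "0 \<le> ?S" by (intro sum_nonneg fejer_nonneg)
  have "?S * real H = norm (complex_of_real (?S * real H))" using S0 by (simp only: norm_of_real) simp
  also have "\<dots> \<le> norm (\<Sum>z\<in>?Q - ?D. \<Sum>n\<in>{p..<q}. ?e z n) + norm (\<Sum>z\<in>?D. \<Sum>n\<in>{p..<q}. ?e z n)"
    unfolding eq by (rule norm_triangle_ineq)
  also have "\<dots> \<le> (\<Sum>z\<in>?Q - ?D. ?B) + (\<Sum>z\<in>?D. real (q - p))"
  proof (intro add_mono sum_norm_le)
    fix z assume z: "z \<in> ?Q - ?D"
    define h where "h = real_of_int \<bar>int (fst z) - int (snd z)\<bar>"
    have h: "1 \<le> h" "h \<le> real H" using z by (auto simp: h_def)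
    have "h * real (q - p) / N \<le> real H * real (q - p) / N" using h by (intro divide_right_mono mult_right_mono) auto
    then have b: "norm (\<Sum>n\<in>{p..<q}. unit_exp (h * \<phi> (n + j))) \<le> ?B"
      using H h by (intro block_sum_bound N order_trans[OF _ H(2)]) simp_all
    show "norm (\<Sum>n\<in>{p..<q}. ?e z n) \<le> ?B"
    proof (cases "snd z \<le> fst z")
      case True
      then show ?thesis using b by (simp add: h_def)
    next
      case False
      then have "(\<Sum>n\<in>{p..<q}. ?e z n) = cnj (\<Sum>n\<in>{p..<q}. unit_exp (h * \<phi> (n + j)))"
        by (simp add: h_def cnj_unit_exp algebra_simps)
      then show ?thesis using b by (simp only: complex_mod_cnj)
    qed
  next
    fix z assume z: "z \<in> ?D"
    have "norm (\<Sum>n\<in>{p..<q}. ?e z n) \<le> real (card {p..<q}) * 1"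
      by (rule sum_norm_bound) auto
    then show "norm (\<Sum>n\<in>{p..<q}. ?e z n) \<le> real (q - p)" by simp
  qed
  also have "\<dots> \<le> (real H)\<^sup>2 * ?B + real H * real (q - p)"
  proof -
    have "card (?Q - ?D) \<le> card ?Q" by (intro card_mono) auto
    also have "card ?Q = H\<^sup>2" by (simp add: power2_eq_square)
    finally have 1: "real (card (?Q - ?D)) \<le> (real H)\<^sup>2" unfolding of_nat_power[symmetric] of_nat_le_iff .
    have "card ?D \<le> card ((\<lambda>j. (j,j)) ` {..<H})" by (intro card_mono) (auto simp: image_iff)
    also have "\<dots> \<le> card {..<H}" by (rule card_image_le) simp
    finally have 2: "real (card ?D) \<le> real H" by simp
    show ?thesis unfolding sum_constant using 1 2 B0 by (intro add_mono mult_right_mono) auto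
  qed
  also have "\<dots> = (real H * ?B + real (q - p)) * real H" by (simp add: algebra_simps power2_eq_square)
  finally have S: "?S \<le> real H * ?B + real (q - p)" by (rule mult_right_le_imp_le) (use H in simp)
  let ?C = "{n\<in>{p..<q}. \<exists>m::int. \<bar>\<phi> (n + j) - of_int m\<bar> < \<delta>}"
  have "real (card ?C) * (real H / 2) = (\<Sum>n\<in>?C. real H / 2)" by simp
  also have "\<dots> \<le> (\<Sum>n\<in>?C. fejer H (\<phi> (n + j)))"
  proof (rule sum_mono)
    fix n assume "n \<in> ?C"
    then obtain m :: int where m: "\<bar>\<phi> (n + j) - of_int m\<bar> < \<delta>" by auto
    have "8 * real H * \<bar>\<phi> (n + j) - of_int m\<bar> \<le> 8 * real H * \<delta>" using m by (intro mult_left_mono) auto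
    then show "real H / 2 \<le> fejer H (\<phi> (n + j))" using H(3) by (intro fejer_ge[where m = m]) linarith
  qed
  also have "\<dots> \<le> ?S" by (intro sum_mono2 fejer_nonneg) auto
  finally have "real (card ?C) * (real H / 2) \<le> real H * ?B + real (q - p)" using S by linarith
  then show ?thesis using H(1) by (simp add: field_simps)
qed

text \<open>The order of the mean is \<open>H\<^sup>2\<close>, whereas the integers are avoided by
  \<open>1 / (8 * H)\<close> only. Then the error away from the integers and the main part of the
  proportion of points near them are both of order \<open>1 / H\<close>.\<close>

lemma sawtooth_error:
  assumes N: "n0 \<le> N" "N \<le> p" "p \<le> q" "q + 1 \<le> 2 * N" "2 * (q - p) \<le> N" "j \<le> 1"
    and H: "1 \<le> H" "real H * real (q - p) / N \<le> 1 / 2"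
  shows "(\<Sum>n\<in>{p..<q}. \<bar>sawtooth (\<phi> (n + j)) - fejer_sawtooth (H\<^sup>2) (\<phi> (n + j))\<bar>) \<le> 3 * real (q - p) / H + sqrt (block_bound N (q - p))"
proof -
  define \<delta> where "\<delta> = 1 / (8 * real H)"
  have \<delta>: "0 < \<delta>" "8 * real H * \<delta> \<le> 1" using H by (auto simp: \<delta>_def)
  let ?C = "{n\<in>{p..<q}. \<exists>m::int. \<bar>\<phi> (n + j) - of_int m\<bar> < \<delta>}"
  have H2: "1 \<le> H\<^sup>2" using H by simp
  have "(\<Sum>n\<in>{p..<q}. \<bar>sawtooth (\<phi> (n + j)) - fejer_sawtooth (H\<^sup>2) (\<phi> (n + j))\<bar>) \<le> 
     (\<Sum>n\<in>{p..<q}. 2 / H + of_bool (n \<in> ?C) * (1 / 2))"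
  proof (rule sum_mono)
    fix n assume n: "n \<in> {p..<q}"
    show "\<bar>sawtooth (\<phi> (n + j)) - fejer_sawtooth (H\<^sup>2) (\<phi> (n + j))\<bar> \<le> 2 / H + of_bool (n \<in> ?C) * (1 / 2)"
    proof (cases "n \<in> ?C")
      case True
      then show ?thesis using sawtooth_approx(1)[OF H2, of "\<phi> (n + j)"] by (simp add: add_increasing)
    next
      case False
      then have "\<bar>sawtooth (\<phi> (n + j)) - fejer_sawtooth (H\<^sup>2) (\<phi> (n + j))\<bar> \<le> 1 / (4 * real (H\<^sup>2) * \<delta>)"
        using n by (intro sawtooth_approx(2)[OF H2 \<delta>(1)]) (auto simp: not_less)
      also have "\<dots> = 2 / H" by (simp add: \<delta>_def power2_eq_square)
      finally show ?thesis by simp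
    qed
  qed
  also have "\<dots> = 2 * real (q - p) / H + real (card ?C) / 2"
  proof -
    have "(\<Sum>n\<in>{p..<q}. of_bool (n \<in> ?C) * (1 / 2) :: real) = (\<Sum>n\<in>?C. 1 / 2)"
      by (intro sum.mono_neutral_cong_right) auto
    then show ?thesis by (simp add: sum.distrib)
  qed
  also have "\<dots> \<le> 2 * real (q - p) / H + (2 * real (q - p) / H + 2 * sqrt (block_bound N (q - p))) / 2"
    by (intro add_left_mono divide_right_mono near_integer_count N H \<delta>) auto
  also have "\<dots> = 3 * real (q - p) / H + sqrt (block_bound N (q - p))" using H by (simp add: field_simps)
  finally show ?thesis .
qed

text \<open>Every frequency is handled by \<open>L2_van_der_corput\<close>. At most
  \<open>H\<^sup>2\<close> pairs with coefficients bounded by \<open>1 / H\<close> are then combined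
  by the Cauchy-Schwarz inequality; the resulting power of \<open>H\<close> is affordable since the
  order will be a small power of \<open>N\<close>.\<close>

lemma trig_block_L2:
  fixes f :: "'b \<Rightarrow> real"
  assumes "measure_preserving M T" and [measurable]: "f \<in> borel_measurable M" and f2: "integrable M (\<lambda>x. (f x)\<^sup>2)"
    and N: "n0 \<le> N" "N \<le> p" "p \<le> q" "q + 1 \<le> 2 * N" "2 * (q - p) \<le> N"
    and H: "1 \<le> H" "real H * real (q - p) / N \<le> 1 / 2"
  shows "(\<integral>\<^sup>+ x. ennreal ((\<Sum>n\<in>{p..<q}. (fejer_sawtooth H (\<phi> (Suc n)) - fejer_sawtooth H (\<phi> n)) * f ((T ^^ n) x))\<^sup>2) \<partial>M)
     \<le> ennreal (4 * (real H)\<^sup>2 * ((\<integral>x. (f x)\<^sup>2 \<partial>M) * block_bound N (q - p)))"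
proof -
  interpret measure_preserving M T by fact
  let ?Z = "{z\<in>{..<H} \<times> {..<H}. fst z \<noteq> snd z}"
  define h where "h = (\<lambda>z::nat \<times> nat. real_of_int \<bar>int (fst z) - int (snd z)\<bar>)"
  define S where "S = (\<lambda>j z x. \<Sum>n\<in>{p..<q}. unit_exp (h z * \<phi> (n + j)) * complex_of_real (f ((T ^^ n) x)))"
  define R where "R = (\<lambda>j x. \<Sum>n\<in>{p..<q}. fejer_sawtooth H (\<phi> (n + j)) * f ((T ^^ n) x))"
  have cardZ: "real (card ?Z) \<le> (real H)\<^sup>2"
  proof -
    have "card ?Z \<le> card ({..<H} \<times> {..<H})" by (intro card_mono) auto
    also have "\<dots> = H\<^sup>2" by (simp add: power2_eq_square)
    finally show ?thesis unfolding of_nat_power[symmetric] of_nat_le_iff .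
  qed
  have hz: "1 \<le> h z" "h z \<le> real H" if "z \<in> ?Z" for z using that by (auto simp: h_def)
  have Rb: "(R j x)\<^sup>2 \<le> (\<Sum>z\<in>?Z. (norm (S j z x))\<^sup>2)" for j x
  proof -
    have "R j x = (\<Sum>n\<in>{p..<q}. \<Sum>z\<in>?Z. sin (2 * pi * (h z * \<phi> (n + j))) / (2 * pi * h z) / H * f ((T ^^ n) x))"
    proof -
      have s: "sin (2 * pi * (real_of_int (int (fst z) - int (snd z)) * t)) / (2 * pi * real_of_int (int (fst z) - int (snd z)))
          = sin (2 * pi * (h z * t)) / (2 * pi * h z)" for z t
      proof -
        have "sin (2 * pi * (i * t)) / (2 * pi * i) = sin (2 * pi * (\<bar>i\<bar> * t)) / (2 * pi * \<bar>i\<bar>)" for i :: real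
          by (cases "0 \<le> i") auto
        then show ?thesis by (simp only: h_def of_int_abs)
      qed
      show ?thesis unfolding R_def fejer_sawtooth_def case_prod_unfold s
        by (simp only: sum_distrib_right sum_divide_distrib)
    qed
    also have "\<dots> = (\<Sum>z\<in>?Z. \<Sum>n\<in>{p..<q}. sin (2 * pi * (h z * \<phi> (n + j))) / (2 * pi * h z) / H * f ((T ^^ n) x))"
      by (rule sum.swap)
    also have "\<dots> = (\<Sum>z\<in>?Z. 1 / (2 * pi * h z) / H * Im (S j z x))"
      by (intro sum.cong refl) (simp add: S_def unit_exp_def sum_distrib_left mult_ac)
    finally have R: "R j x = (\<Sum>z\<in>?Z. 1 / (2 * pi * h z) / H * Im (S j z x))" .
    have "\<bar>R j x\<bar> \<le> (\<Sum>z\<in>?Z. 1 / real H * norm (S j z x))" unfolding R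
    proof (intro order_trans[OF sum_abs] sum_mono)
      fix z assume z: "z \<in> ?Z"
      have "1 * 1 \<le> (2 * pi) * h z" using hz[OF z] pi_gt3 by (intro mult_mono) auto
      then have "1 / (2 * pi * h z) \<le> 1" by simp
      then have "1 / (2 * pi * h z) / H \<le> 1 / real H" by (intro divide_right_mono) auto
      then show "\<bar>1 / (2 * pi * h z) / H * Im (S j z x)\<bar> \<le> 1 / real H * norm (S j z x)"
        using hz[OF z] unfolding abs_mult by (intro mult_mono abs_Im_le_cmod) auto
    qed
    then have "\<bar>R j x\<bar>\<^sup>2 \<le> (\<Sum>z\<in>?Z. 1 / real H * norm (S j z x))\<^sup>2" by (intro power_mono) auto
    also have "\<dots> = (1 / real H)\<^sup>2 * (\<Sum>z\<in>?Z. norm (S j z x))\<^sup>2"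
      unfolding sum_distrib_left[symmetric] by (rule power_mult_distrib)
    also have "\<dots> \<le> (1 / real H)\<^sup>2 * ((\<Sum>z\<in>?Z. (norm (S j z x))\<^sup>2) * real (card ?Z))"
      by (intro mult_left_mono sum_squared_le_sum_of_squares) auto
    also have "\<dots> \<le> (1 / real H)\<^sup>2 * ((\<Sum>z\<in>?Z. (norm (S j z x))\<^sup>2) * (real H)\<^sup>2)"
      using cardZ by (intro mult_left_mono sum_nonneg) auto
    also have "\<dots> = (\<Sum>z\<in>?Z. (norm (S j z x))\<^sup>2)" using H by (simp add: power_divide)
    finally show ?thesis by simp
  qed
  have Sint: "integrable M (\<lambda>x. (norm (S j z x))\<^sup>2)" for j z
    unfolding S_def by (rule L2_van_der_corput(1)) (use f2 in auto)
  have Sb: "(\<integral>x. (norm (S j z x))\<^sup>2 \<partial>M) \<le> (\<integral>x. (f x)\<^sup>2 \<partial>M) * block_bound N (q - p)" if z: "z \<in> ?Z" and j: "j \<le> 1" for j z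
  proof -
    have "h z * real (q - p) / N \<le> real H * real (q - p) / N" using hz[OF z] by (intro divide_right_mono mult_right_mono) auto
    then have "correlation_sum p q (\<lambda>n. unit_exp (h z * \<phi> (n + j))) \<le> block_bound N (q - p)"
      using H hz[OF z] by (intro block_correlation N j order_trans[OF _ H(2)]) simp_all
    then have "(\<integral>x. (f x)\<^sup>2 \<partial>M) * correlation_sum p q (\<lambda>n. unit_exp (h z * \<phi> (n + j))) \<le> (\<integral>x. (f x)\<^sup>2 \<partial>M) * block_bound N (q - p)"
      by (rule mult_left_mono) simp
    then show ?thesis unfolding S_def using L2_van_der_corput(2)[OF _ f2, where p = p and q = q and c = "\<lambda>n. unit_exp (h z * \<phi> (n + j))"] by simp
  qed
  have "(\<integral>\<^sup>+ x. ennreal ((\<Sum>n\<in>{p..<q}. (fejer_sawtooth H (\<phi> (Suc n)) - fejer_sawtooth H (\<phi> n)) * f ((T ^^ n) x))\<^sup>2) \<partial>M)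
     \<le> (\<integral>\<^sup>+ x. ennreal (2 * (\<Sum>z\<in>?Z. (norm (S 1 z x))\<^sup>2 + (norm (S 0 z x))\<^sup>2)) \<partial>M)"
  proof (intro nn_integral_mono ennreal_leI)
    fix x
    have "(\<Sum>n\<in>{p..<q}. (fejer_sawtooth H (\<phi> (Suc n)) - fejer_sawtooth H (\<phi> n)) * f ((T ^^ n) x)) = R 1 x - R 0 x"
      by (simp add: R_def left_diff_distrib sum_subtractf)
    moreover have "(R 1 x - R 0 x)\<^sup>2 \<le> 2 * ((R 1 x)\<^sup>2 + (R 0 x)\<^sup>2)"
      using zero_le_power2[of "R 1 x + R 0 x"] by (simp add: power2_eq_square algebra_simps)
    ultimately show "(\<Sum>n\<in>{p..<q}. (fejer_sawtooth H (\<phi> (Suc n)) - fejer_sawtooth H (\<phi> n)) * f ((T ^^ n) x))\<^sup>2 \<le> 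
        2 * (\<Sum>z\<in>?Z. (norm (S 1 z x))\<^sup>2 + (norm (S 0 z x))\<^sup>2)"
      using Rb[of 1 x] Rb[of 0 x] by (simp add: sum.distrib)
  qed
  also have "\<dots> = ennreal (\<integral>x. 2 * (\<Sum>z\<in>?Z. (norm (S 1 z x))\<^sup>2 + (norm (S 0 z x))\<^sup>2) \<partial>M)"
    using Sint by (intro nn_integral_eq_integral integrable_mult_right Bochner_Integration.integrable_sum Bochner_Integration.integrable_add AE_I2) (auto intro!: sum_nonneg)
  also have "(\<integral>x. 2 * (\<Sum>z\<in>?Z. (norm (S 1 z x))\<^sup>2 + (norm (S 0 z x))\<^sup>2) \<partial>M) = 
     2 * (\<Sum>z\<in>?Z. (\<integral>x. (norm (S 1 z x))\<^sup>2 \<partial>M) + (\<integral>x. (norm (S 0 z x))\<^sup>2 \<partial>M))"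
    using Sint by simp
  also have "\<dots> \<le> 2 * (\<Sum>z\<in>?Z. (\<integral>x. (f x)\<^sup>2 \<partial>M) * block_bound N (q - p) + (\<integral>x. (f x)\<^sup>2 \<partial>M) * block_bound N (q - p))"
    by (intro mult_left_mono sum_mono add_mono Sb) auto
  also have "\<dots> = 4 * real (card ?Z) * ((\<integral>x. (f x)\<^sup>2 \<partial>M) * block_bound N (q - p))" by simp
  also have "\<dots> \<le> 4 * (real H)\<^sup>2 * ((\<integral>x. (f x)\<^sup>2 \<partial>M) * block_bound N (q - p))"
    using cardZ block_bound_nonneg[OF N(1)] by (intro mult_right_mono mult_nonneg_nonneg) auto
  finally show ?thesis by (simp add: ennreal_leI)
qed

end

section \<open>Almost everywhere decay of the block discrepancies\<close>

lemma AE_tendsto_0_of_square_summable: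
  fixes D :: "nat \<Rightarrow> 'a \<Rightarrow> real"
  assumes [measurable]: "\<And>k. D k \<in> borel_measurable M"
    and b: "\<And>k. (\<integral>\<^sup>+ x. ennreal ((D k x)\<^sup>2) \<partial>M) \<le> ennreal (b k)" and "summable b" "\<And>k. 0 \<le> b k"
  shows "AE x in M. (\<lambda>k. D k x) \<longlonglongrightarrow> 0"
proof -
  have "(\<integral>\<^sup>+ x. (\<Sum>k. ennreal ((D k x)\<^sup>2)) \<partial>M) = (\<Sum>k. \<integral>\<^sup>+ x. ennreal ((D k x)\<^sup>2) \<partial>M)"
    by (rule nn_integral_suminf) simp
  also have "\<dots> \<le> (\<Sum>k. ennreal (b k))" by (intro suminf_le b) auto
  also have "\<dots> = ennreal (\<Sum>k. b k)" using assms(3,4) by (rule suminf_ennreal2[rotated])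
  finally have "(\<integral>\<^sup>+ x. (\<Sum>k. ennreal ((D k x)\<^sup>2)) \<partial>M) \<noteq> \<infinity>" by (auto simp: top_unique)
  then have "AE x in M. (\<Sum>k. ennreal ((D k x)\<^sup>2)) \<noteq> \<infinity>" by (intro nn_integral_PInf_AE) auto
  then show ?thesis
  proof (rule AE_mp, intro AE_I2 impI)
    fix x assume "(\<Sum>k. ennreal ((D k x)\<^sup>2)) \<noteq> \<infinity>"
    then have "summable (\<lambda>k. (D k x)\<^sup>2)" by (intro summable_suminf_not_top) auto
    then have "(\<lambda>k. (D k x)\<^sup>2) \<longlonglongrightarrow> 0" by (rule summable_LIMSEQ_zero)
    then have "(\<lambda>k. sqrt ((D k x)\<^sup>2)) \<longlonglongrightarrow> sqrt 0" by (rule tendsto_real_sqrt)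
    then show "(\<lambda>k. D k x) \<longlonglongrightarrow> 0" by (simp add: tendsto_rabs_zero_iff)
  qed
qed

context regular_floor_set
begin

text \<open>The sum of \<open>d\<close> over the block, hence up to rounding its number of elements
  of \<open>E\<close>. Blocks between sixth powers are long enough for the exponential sums and
  still negligible against what precedes them.\<close>

definition block_weight :: "nat \<Rightarrow> real" where
  "block_weight k = \<phi> (Suc k ^ 6) - \<phi> (k ^ 6)"

text \<open>The indicator is a difference of ceilings; this is why the sawtooth is built with the
  ceiling.\<close>

lemma E_minus_d:
  assumes "n0 \<le> n"
  shows "of_bool (n \<in> E) - d n = sawtooth (\<phi> (Suc n)) - sawtooth (\<phi> n)"
proof -
  have "of_bool (n \<in> E) = real_of_int (of_bool (n \<in> E))" by simp
  then show ?thesis unfolding indicator_E[OF assms] by (simp add: sawtooth_def d_def)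
qed

text \<open>Only the smoothed part is left for the \<open>L\<^sup>2\<close> estimate. The smoothing
  error depends on the points \<open>\<phi> n\<close> but not on the orbit, and the bound
  \<open>B\<close> on \<open>g\<close> lets it be summed in absolute value.\<close>

lemma block_discrepancy:
  fixes g :: "nat \<Rightarrow> real"
  assumes N: "n0 \<le> N" "N \<le> p" "p \<le> q" "q + 1 \<le> 2 * N" "2 * (q - p) \<le> N"
    and H: "1 \<le> H" "real H * real (q - p) / N \<le> 1 / 2" and g: "\<And>n. \<bar>g n\<bar> \<le> B"
  shows "\<bar>\<Sum>n\<in>{p..<q}. (of_bool (n \<in> E) - d n) * g n\<bar> \<le> 
    \<bar>\<Sum>n\<in>{p..<q}. (fejer_sawtooth (H\<^sup>2) (\<phi> (Suc n)) - fejer_sawtooth (H\<^sup>2) (\<phi> n)) * g n\<bar> + 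
    2 * B * (3 * real (q - p) / H + sqrt (block_bound N (q - p)))"
proof -
  define e where "e = (\<lambda>j n. sawtooth (\<phi> (n + j)) - fejer_sawtooth (H\<^sup>2) (\<phi> (n + j)))"
  define u where "u = (\<lambda>n. fejer_sawtooth (H\<^sup>2) (\<phi> (Suc n)) - fejer_sawtooth (H\<^sup>2) (\<phi> n))"
  have B: "0 \<le> B" using g[of 0] by simp
  have "(of_bool (n \<in> E) - d n) * g n = u n * g n + (e 1 n - e 0 n) * g n" if "n0 \<le> n" for n
    unfolding E_minus_d[OF that] u_def e_def by (simp add: algebra_simps)
  then have "(\<Sum>n\<in>{p..<q}. (of_bool (n \<in> E) - d n) * g n) = (\<Sum>n\<in>{p..<q}. u n * g n + (e 1 n - e 0 n) * g n)"
    using N by (intro sum.cong refl) simp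
  then have eq: "(\<Sum>n\<in>{p..<q}. (of_bool (n \<in> E) - d n) * g n) = (\<Sum>n\<in>{p..<q}. u n * g n) + (\<Sum>n\<in>{p..<q}. (e 1 n - e 0 n) * g n)"
    by (simp only: sum.distrib)
  have "\<bar>\<Sum>n\<in>{p..<q}. (e 1 n - e 0 n) * g n\<bar> \<le> (\<Sum>n\<in>{p..<q}. \<bar>(e 1 n - e 0 n) * g n\<bar>)"
    by (rule sum_abs)
  also have "\<dots> \<le> (\<Sum>n\<in>{p..<q}. (\<bar>e 1 n\<bar> + \<bar>e 0 n\<bar>) * B)"
  proof (rule sum_mono)
    fix n
    show "\<bar>(e 1 n - e 0 n) * g n\<bar> \<le> (\<bar>e 1 n\<bar> + \<bar>e 0 n\<bar>) * B"
      unfolding abs_mult by (rule mult_mono[OF abs_triangle_ineq4 g]) simp_all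
  qed
  also have "\<dots> = ((\<Sum>n\<in>{p..<q}. \<bar>e 1 n\<bar>) + (\<Sum>n\<in>{p..<q}. \<bar>e 0 n\<bar>)) * B"
    by (simp only: sum_distrib_right[symmetric] sum.distrib)
  also have "\<dots> \<le> ((3 * real (q - p) / H + sqrt (block_bound N (q - p))) + (3 * real (q - p) / H + sqrt (block_bound N (q - p)))) * B"
    unfolding e_def by (intro mult_right_mono add_mono sawtooth_error N H B) simp_all
  finally have "\<bar>\<Sum>n\<in>{p..<q}. (e 1 n - e 0 n) * g n\<bar> \<le> 2 * B * (3 * real (q - p) / H + sqrt (block_bound N (q - p)))"
    by (simp only: mult_2[symmetric] mult_ac)
  then have "\<bar>\<Sum>n\<in>{p..<q}. (of_bool (n \<in> E) - d n) * g n\<bar> \<le> 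
      \<bar>\<Sum>n\<in>{p..<q}. u n * g n\<bar> + 2 * B * (3 * real (q - p) / H + sqrt (block_bound N (q - p)))"
    unfolding eq by linarith
  then show ?thesis by (simp only: u_def)
qed

text \<open>The exponent 1/4 obeys two constraints: \<open>1 / m k\<close> must be of smaller order
  than the density, which is at least \<open>k powr (- (1/5))\<close>, and
  \<open>(m k)\<^sup>2\<close> times the relative block length of about \<open>6 / k\<close> must
  stay below 1/2.\<close>

lemma eventually_block_parameters:
  defines "m \<equiv> \<lambda>k. nat \<lfloor>real k powr (1/4)\<rfloor>"
  shows "eventually (\<lambda>k. 1 \<le> k \<and> n0 \<le> k ^ 6 \<and> Suc k ^ 6 + 1 \<le> 2 * k ^ 6 \<and> 2 * (Suc k ^ 6 - k ^ 6) \<le> k ^ 6 \<and>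
      1 \<le> m k \<and> real ((m k)\<^sup>2) * real (Suc k ^ 6 - k ^ 6) / real (k ^ 6) \<le> 1 / 2) sequentially"
proof -
  have "eventually (\<lambda>k::nat. (real k + 1) ^ 6 + 1 \<le> 2 * real k ^ 6) sequentially" by real_asymp
  moreover have "eventually (\<lambda>k::nat. 2 * ((real k + 1) ^ 6 - real k ^ 6) \<le> real k ^ 6) sequentially" by real_asymp
  moreover have "eventually (\<lambda>k::nat. real k powr (1/2) * ((real k + 1) ^ 6 - real k ^ 6) / real k ^ 6 \<le> 1 / 2) sequentially" by real_asymp
  moreover have "eventually (\<lambda>k::nat. 1 \<le> real k powr (1/4)) sequentially" by real_asymp
  moreover have "eventually (\<lambda>k. n0 \<le> k) sequentially" "eventually (\<lambda>k::nat. 1 \<le> k) sequentially" by (auto simp: eventually_ge_at_top)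
  ultimately show ?thesis
  proof eventually_elim
    case (elim k)
    have sub: "real (Suc k ^ 6 - k ^ 6) = (real k + 1) ^ 6 - real k ^ 6"
      by (simp add: of_nat_diff power_mono add.commute)
    have "k ^ 1 \<le> k ^ 6" using elim by (intro power_increasing) auto
    then have 1: "n0 \<le> k ^ 6" using elim by simp
    have "real (Suc k ^ 6 + 1) \<le> real (2 * k ^ 6)" using elim(1) by (simp add: add.commute)
    then have 2: "Suc k ^ 6 + 1 \<le> 2 * k ^ 6" by (simp only: of_nat_le_iff)
    have "real (2 * (Suc k ^ 6 - k ^ 6)) \<le> real (k ^ 6)" using elim(2) sub by simp
    then have 3: "2 * (Suc k ^ 6 - k ^ 6) \<le> k ^ 6" by (simp only: of_nat_le_iff)
    have 4: "1 \<le> m k" using elim(4) by (simp add: m_def le_nat_iff)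
    have mle: "real (m k) \<le> real k powr (1/4)" using elim(4) by (simp add: m_def)
    have "real ((m k)\<^sup>2) \<le> (real k powr (1/4))\<^sup>2" using mle by (simp add: power_mono)
    also have "\<dots> = real k powr (1/2)" unfolding power2_eq_square powr_add[symmetric] by simp
    finally have "real ((m k)\<^sup>2) * real (Suc k ^ 6 - k ^ 6) / real (k ^ 6) \<le> real k powr (1/2) * real (Suc k ^ 6 - k ^ 6) / real (k ^ 6)"
      by (intro divide_right_mono mult_right_mono) auto
    moreover have "\<dots> \<le> 1 / 2" using elim(3) unfolding sub of_nat_power .
    ultimately have 5: "real ((m k)\<^sup>2) * real (Suc k ^ 6 - k ^ 6) / real (k ^ 6) \<le> 1 / 2" by (rule order_trans)
    show ?case using 1 2 3 4 5 elim by blast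
  qed
qed

text \<open>The exponents come from \<open>(k ^ 6) powr (- (1/30)) = k powr (- (1/5))\<close> and a
  block length of at least \<open>6 * k ^ 5\<close>.\<close>

lemma block_weight_ge:
  assumes "n0 \<le> k ^ 6" "Suc k ^ 6 + 1 \<le> 2 * k ^ 6" "1 \<le> k"
  shows "real (Suc k ^ 6 - k ^ 6) * real k powr (-(1/5)) / 2 \<le> block_weight k" "3 * real k powr (24/5) \<le> block_weight k"
    "real k powr (-(1/5)) \<le> d (k ^ 6)"
proof -
  have sub: "real (Suc k ^ 6 - k ^ 6) = (real k + 1) ^ 6 - real k ^ 6"
    by (simp add: of_nat_diff power_mono add.commute)
  have "real (k ^ 6) = real k powr 6" using assms(3) by simp
  then have "real (k ^ 6) powr (- (1/30)) = (real k powr 6) powr (- (1/30))" by (simp only:)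
  also have "\<dots> = real k powr (6 * - (1/30))" by (rule powr_powr)
  also have "6 * - (1/30) = -(1/5 :: real)" by simp
  finally show dk: "real k powr (-(1/5)) \<le> d (k ^ 6)" using d_lower[OF assms(1)] by simp
  have le: "k ^ 6 \<le> Suc k ^ 6" by (intro power_mono) auto
  have "real (Suc k ^ 6 - k ^ 6) * d (k ^ 6) / 2 \<le> \<phi> (k ^ 6 + (Suc k ^ 6 - k ^ 6)) - \<phi> (k ^ 6)"
    using assms le by (intro phi_diff_bounds) auto
  also have "k ^ 6 + (Suc k ^ 6 - k ^ 6) = Suc k ^ 6" using le by simp
  finally have "real (Suc k ^ 6 - k ^ 6) * d (k ^ 6) / 2 \<le> block_weight k" by (simp add: block_weight_def)
  moreover have "real (Suc k ^ 6 - k ^ 6) * real k powr (-(1/5)) / 2 \<le> real (Suc k ^ 6 - k ^ 6) * d (k ^ 6) / 2"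
    using dk by (intro divide_right_mono mult_left_mono) auto
  ultimately show 1: "real (Suc k ^ 6 - k ^ 6) * real k powr (-(1/5)) / 2 \<le> block_weight k" by linarith
  have "(real k + 1) ^ 6 - real k ^ 6 = 6 * real k ^ 5 + (15 * real k ^ 4 + 20 * real k ^ 3 + 15 * real k ^ 2 + 6 * real k + 1)"
    by (simp add: eval_nat_numeral algebra_simps)
  then have "6 * real k ^ 5 \<le> real (Suc k ^ 6 - k ^ 6)" unfolding sub by simp
  then have "(6 * real k ^ 5) * real k powr (-(1/5)) / 2 \<le> real (Suc k ^ 6 - k ^ 6) * real k powr (-(1/5)) / 2"
    by (intro divide_right_mono mult_right_mono) auto
  also have "(6 * real k ^ 5) * real k powr (-(1/5)) / 2 = 3 * (real k powr 5 * real k powr (-(1/5)))"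
    using assms(3) by (simp add: powr_numeral)
  also have "real k powr 5 * real k powr (-(1/5)) = real k powr (5 + - (1/5))" by (rule powr_add[symmetric])
  finally show "3 * real k powr (24/5) \<le> block_weight k" using 1 by simp
qed

text \<open>63 is \<open>2 ^ 6 - 1\<close>, the sum of the binomial coefficients in
  \<open>(k + 1) ^ 6 - k ^ 6\<close>, and 31/5 is \<open>6 + 1/5\<close>.\<close>

definition block_bound_explicit :: "nat \<Rightarrow> real" where
  "block_bound_explicit k = 63 * real k ^ 5 + 4 / a\<^sup>2 * (real k powr (31/5)) * (1 + ln (63 * real k ^ 5))"

lemma block_bound_le:
  assumes "n0 \<le> k ^ 6" "Suc k ^ 6 + 1 \<le> 2 * k ^ 6" "1 \<le> k"
  shows "block_bound (k ^ 6) (Suc k ^ 6 - k ^ 6) \<le> block_bound_explicit k"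
proof -
  have sub: "real (Suc k ^ 6 - k ^ 6) = (real k + 1) ^ 6 - real k ^ 6"
    by (simp add: of_nat_diff power_mono add.commute)
  have k1: "1 \<le> real k" using assms by simp
  have pw: "real k ^ i \<le> real k ^ 5" if "i \<le> 5" for i using k1 that by (intro power_increasing) auto
  have "(real k + 1) ^ 6 - real k ^ 6 = 6 * real k ^ 5 + (15 * real k ^ 4 + 20 * real k ^ 3 + 15 * real k ^ 2 + 6 * real k ^ 1 + real k ^ 0)"
    by (simp add: eval_nat_numeral algebra_simps)
  also have "\<dots> \<le> 63 * real k ^ 5" using pw[of 4] pw[of 3] pw[of 2] pw[of 1] pw[of 0] by linarith
  finally have L: "real (Suc k ^ 6 - k ^ 6) \<le> 63 * real k ^ 5" unfolding sub .
  have "k ^ 6 < Suc k ^ 6" by (intro power_strict_mono) auto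
  then have L1: "1 \<le> Suc k ^ 6 - k ^ 6" by simp
  have Lp: "0 < real (Suc k ^ 6 - k ^ 6)" using L1 by (simp only: of_nat_0_less_iff)
  have "harm (Suc k ^ 6 - k ^ 6) \<le> 1 + ln (real (Suc k ^ 6 - k ^ 6))" using L1 by (rule harm_le_ln)
  also have "\<dots> \<le> 1 + ln (63 * real k ^ 5)" using L Lp by (intro add_left_mono ln_mono) (assumption | linarith)+
  finally have h: "harm (Suc k ^ 6 - k ^ 6) \<le> 1 + ln (63 * real k ^ 5)" .
  have dk: "real k powr (-(1/5)) \<le> d (k ^ 6)" by (rule block_weight_ge(3)[OF assms])
  have "4 * real (k ^ 6) / (a\<^sup>2 * d (k ^ 6)) \<le> 4 * real (k ^ 6) / (a\<^sup>2 * real k powr (-(1/5)))"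
    using dk k1 a_pos by (intro divide_left_mono mult_left_mono mult_pos_pos) (auto simp: d_pos[OF assms(1)])
  also have "\<dots> = 4 / a\<^sup>2 * (real k powr 6 / real k powr (-(1/5)))" using k1 by (simp add: powr_numeral)
  also have "real k powr 6 / real k powr (-(1/5)) = real k powr (6 - - (1/5))" by (rule powr_diff[symmetric])
  finally have c: "4 * real (k ^ 6) / (a\<^sup>2 * d (k ^ 6)) \<le> 4 / a\<^sup>2 * (real k powr (31/5))" by simp
  have "4 * real (k ^ 6) / (a\<^sup>2 * d (k ^ 6)) * harm (Suc k ^ 6 - k ^ 6) \<le> 4 / a\<^sup>2 * (real k powr (31/5)) * (1 + ln (63 * real k ^ 5))"
    using c h by (intro mult_mono) (auto simp: harm_nonneg)
  then show ?thesis using L by (simp add: block_bound_def block_bound_explicit_def)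
qed

text \<open>Up to logarithms the first quotient decays with exponent
  \<open>1 + 31/5 - 48/5 = - 12/5\<close>, and the two summands of the second with exponents -1/20
  and -17/10.\<close>

lemma block_asymptotics:
  shows "eventually (\<lambda>k. 4 * real k * block_bound_explicit k / (3 * real k powr (24/5))\<^sup>2 \<le> 1 / real k ^ 2) sequentially"
    "(\<lambda>k. 6 * real k powr (1/5) / (real k powr (1/4) - 1) + sqrt (block_bound_explicit k) / (3 * real k powr (24/5))) \<longlonglongrightarrow> 0"
proof -
  define A where "A = 4 / a\<^sup>2"
  have A: "A > 0" using a_pos by (simp add: A_def)
  have eq: "block_bound_explicit k = 63 * real k ^ 5 + A * (real k powr (31/5)) * (1 + ln (63 * real k ^ 5))" for k
    by (simp add: block_bound_explicit_def A_def)
  show "eventually (\<lambda>k. 4 * real k * block_bound_explicit k / (3 * real k powr (24/5))\<^sup>2 \<le> 1 / real k ^ 2) sequentially"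
    unfolding eq using A by real_asymp
  show "(\<lambda>k. 6 * real k powr (1/5) / (real k powr (1/4) - 1) + sqrt (block_bound_explicit k) / (3 * real k powr (24/5))) \<longlonglongrightarrow> 0"
    unfolding eq using A by real_asymp
qed

lemma block_errors_tendsto_0:
  fixes f :: "'b \<Rightarrow> real"
  assumes mp: "measure_preserving M T" and f: "integrable M f" "\<And>x. \<bar>f x\<bar> \<le> B"
  shows "AE x in M. (\<lambda>k. (\<Sum>n\<in>{k ^ 6..<Suc k ^ 6}. (of_bool (n \<in> E) - d n) * f ((T ^^ n) x)) / block_weight k) \<longlonglongrightarrow> 0"
proof -
  interpret measure_preserving M T by fact
  have fm [measurable]: "f \<in> borel_measurable M" using f by simp
  have B: "0 \<le> B" using f(2) abs_ge_zero order_trans by blast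
  have f2: "integrable M (\<lambda>x. (f x)\<^sup>2)"
  proof (rule Bochner_Integration.integrable_bound)
    show "integrable M (\<lambda>x. B * f x)" using f by simp
    show "AE x in M. norm ((f x)\<^sup>2) \<le> norm (B * f x)"
    proof (intro AE_I2)
      fix x
      have "\<bar>f x\<bar> * \<bar>f x\<bar> \<le> B * \<bar>f x\<bar>" using f(2) by (rule mult_right_mono) simp
      then show "norm ((f x)\<^sup>2) \<le> norm (B * f x)" using B by (simp add: abs_mult power2_eq_square)
    qed
  qed simp
  define m where "m = (\<lambda>k. nat \<lfloor>real k powr (1/4)\<rfloor>)"
  have "eventually (\<lambda>k. 1 \<le> k \<and> n0 \<le> k ^ 6 \<and> Suc k ^ 6 + 1 \<le> 2 * k ^ 6 \<and> 2 * (Suc k ^ 6 - k ^ 6) \<le> k ^ 6 \<and>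
      1 \<le> m k \<and> real ((m k)\<^sup>2) * real (Suc k ^ 6 - k ^ 6) / real (k ^ 6) \<le> 1 / 2) sequentially"
    unfolding m_def by (rule eventually_block_parameters)
  moreover note block_asymptotics(1)
  moreover have "eventually (\<lambda>k::nat. 1 < real k powr (1/4)) sequentially" by real_asymp
  ultimately have "eventually (\<lambda>k. (1 \<le> k \<and> n0 \<le> k ^ 6 \<and> Suc k ^ 6 + 1 \<le> 2 * k ^ 6 \<and> 2 * (Suc k ^ 6 - k ^ 6) \<le> k ^ 6 \<and>
      1 \<le> m k \<and> real ((m k)\<^sup>2) * real (Suc k ^ 6 - k ^ 6) / real (k ^ 6) \<le> 1 / 2) \<and>
      4 * real k * block_bound_explicit k / (3 * real k powr (24/5))\<^sup>2 \<le> 1 / real k ^ 2 \<and> 1 < real k powr (1/4)) sequentially"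
    by eventually_elim blast
  then obtain K where K: "\<And>k. K \<le> k \<Longrightarrow> (1 \<le> k \<and> n0 \<le> k ^ 6 \<and> Suc k ^ 6 + 1 \<le> 2 * k ^ 6 \<and> 2 * (Suc k ^ 6 - k ^ 6) \<le> k ^ 6 \<and>
      1 \<le> m k \<and> real ((m k)\<^sup>2) * real (Suc k ^ 6 - k ^ 6) / real (k ^ 6) \<le> 1 / 2) \<and>
      4 * real k * block_bound_explicit k / (3 * real k powr (24/5))\<^sup>2 \<le> 1 / real k ^ 2 \<and> 1 < real k powr (1/4)"
    unfolding eventually_sequentially by blast
  define t where "t = (\<lambda>k x. \<Sum>n\<in>{k ^ 6..<Suc k ^ 6}. (fejer_sawtooth ((m k)\<^sup>2) (\<phi> (Suc n)) - fejer_sawtooth ((m k)\<^sup>2) (\<phi> n)) * f ((T ^^ n) x))"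
  \<comment> \<open>Zero for the finitely many \<open>k\<close> at which the estimates are not yet
    valid, so that the summable bound holds for all \<open>k\<close>.\<close>
  define D where "D = (\<lambda>k x. if K \<le> k then t k x / block_weight k else 0)"
  define F where "F = (\<integral>x. (f x)\<^sup>2 \<partial>M)"
  have F0: "0 \<le> F" unfolding F_def by simp
  have wpos: "0 < block_weight k" if k: "K \<le> k" for k
  proof -
    have "0 < 3 * real k powr (24/5)" using K[OF k] by simp
    then show ?thesis using block_weight_ge(2)[of k] K[OF k] by linarith
  qed
  have m4: "(real ((m k)\<^sup>2))\<^sup>2 \<le> real k" if k: "K \<le> k" for k
  proof -
    have "real (m k) \<le> real k powr (1/4)" by (simp add: m_def)
    then have "real (m k) ^ 4 \<le> (real k powr (1/4)) ^ 4" by (intro power_mono) auto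
    also have "\<dots> = real k" using K[OF k] by (simp add: powr_power)
    finally show ?thesis by (simp add: power_mult[symmetric])
  qed
  have AE1: "AE x in M. (\<lambda>k. D k x) \<longlonglongrightarrow> 0"
  proof (rule AE_tendsto_0_of_square_summable)
    show "D k \<in> borel_measurable M" for k unfolding D_def t_def by measurable
    show "summable (\<lambda>k. F * (1 / real k ^ 2))"
      using inverse_power_summable[of 2, where 'a = real] by (intro summable_mult) (simp add: inverse_eq_divide)
    show "0 \<le> F * (1 / real k ^ 2)" for k using F0 by simp
    fix k
    show "(\<integral>\<^sup>+ x. ennreal ((D k x)\<^sup>2) \<partial>M) \<le> ennreal (F * (1 / real k ^ 2))"
    proof (cases "K \<le> k")
      case False
      then show ?thesis by (simp add: D_def)
    next
      case True
      let ?w = "block_weight k"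
      let ?Q = "block_bound (k ^ 6) (Suc k ^ 6 - k ^ 6)"
      have w: "0 < ?w" using wpos[OF True] .
      have Kk: "1 \<le> k" "n0 \<le> k ^ 6" "Suc k ^ 6 + 1 \<le> 2 * k ^ 6" "2 * (Suc k ^ 6 - k ^ 6) \<le> k ^ 6"
        "1 \<le> m k" "real ((m k)\<^sup>2) * real (Suc k ^ 6 - k ^ 6) / real (k ^ 6) \<le> 1 / 2"
        "4 * real k * block_bound_explicit k / (3 * real k powr (24/5))\<^sup>2 \<le> 1 / real k ^ 2"
        using K[OF True] by blast+
      have Q: "0 \<le> ?Q" "?Q \<le> block_bound_explicit k" using block_bound_nonneg block_bound_le Kk by auto
      have tm [measurable]: "t k \<in> borel_measurable M" unfolding t_def by measurable
      have "(\<integral>\<^sup>+ x. ennreal ((D k x)\<^sup>2) \<partial>M) = (\<integral>\<^sup>+ x. ennreal (1 / ?w\<^sup>2) * ennreal ((t k x)\<^sup>2) \<partial>M)"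
        using True by (intro nn_integral_cong) (simp add: D_def power_divide ennreal_mult[symmetric])
      also have "\<dots> = ennreal (1 / ?w\<^sup>2) * (\<integral>\<^sup>+ x. ennreal ((t k x)\<^sup>2) \<partial>M)" by (rule nn_integral_cmult) simp
      also have "(\<integral>\<^sup>+ x. ennreal ((t k x)\<^sup>2) \<partial>M) \<le> ennreal (4 * (real ((m k)\<^sup>2))\<^sup>2 * (F * ?Q))"
        unfolding t_def F_def using Kk by (intro trig_block_L2 mp f2) auto
      also have "ennreal (1 / ?w\<^sup>2) * ennreal (4 * (real ((m k)\<^sup>2))\<^sup>2 * (F * ?Q)) = ennreal (F * (4 * (real ((m k)\<^sup>2))\<^sup>2 * ?Q / ?w\<^sup>2))"
        using F0 Q by (subst ennreal_mult[symmetric]) (auto simp: mult_ac)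
      also have "\<dots> \<le> ennreal (F * (1 / real k ^ 2))"
      proof (intro ennreal_leI mult_left_mono F0)
        have "4 * (real ((m k)\<^sup>2))\<^sup>2 * ?Q / ?w\<^sup>2 \<le> 4 * real k * block_bound_explicit k / ?w\<^sup>2"
          using m4[OF True] Q by (intro divide_right_mono mult_mono) auto
        also have "\<dots> \<le> 4 * real k * block_bound_explicit k / (3 * real k powr (24/5))\<^sup>2"
          using block_weight_ge(2)[OF Kk(2,3,1)] Kk(1) Q w by (intro divide_left_mono power_mono mult_nonneg_nonneg mult_pos_pos) auto
        also have "\<dots> \<le> 1 / real k ^ 2" by (rule Kk)
        finally show "4 * (real ((m k)\<^sup>2))\<^sup>2 * ?Q / ?w\<^sup>2 \<le> 1 / real k ^ 2" .
      qed
      finally show ?thesis by (simp add: mult_left_mono)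
    qed
  qed
  \<comment> \<open>The smoothing error of \<open>block_discrepancy\<close> divided by the weight;
    it is the same for all orbits.\<close>
  define r where "r = (\<lambda>k. 2 * B * (6 * real k powr (1/5) / (real k powr (1/4) - 1) + sqrt (block_bound_explicit k) / (3 * real k powr (24/5))))"
  have r0: "r \<longlonglongrightarrow> 0" unfolding r_def using tendsto_mult_left[OF block_asymptotics(2), of "2 * B"] by simp
  show ?thesis
    using AE1
  proof (rule AE_mp, intro AE_I2 impI)
    fix x assume D0: "(\<lambda>k. D k x) \<longlonglongrightarrow> 0"
    let ?e = "\<lambda>k. (\<Sum>n\<in>{k ^ 6..<Suc k ^ 6}. (of_bool (n \<in> E) - d n) * f ((T ^^ n) x)) / block_weight k"
    show "?e \<longlonglongrightarrow> 0"
    proof (rule Lim_null_comparison)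
      show "(\<lambda>k. \<bar>D k x\<bar> + r k) \<longlonglongrightarrow> 0"
        using tendsto_add[OF tendsto_rabs_zero[OF D0] r0] by simp
      show "eventually (\<lambda>k. norm (?e k) \<le> \<bar>D k x\<bar> + r k) sequentially"
        using eventually_ge_at_top[of K]
      proof eventually_elim
        case (elim k)
        let ?w = "block_weight k"
        let ?Q = "block_bound (k ^ 6) (Suc k ^ 6 - k ^ 6)"
        define L where "L = real (Suc k ^ 6 - k ^ 6)"
        have w: "0 < ?w" using wpos[OF elim] .
        have Kk: "1 \<le> k" "n0 \<le> k ^ 6" "Suc k ^ 6 + 1 \<le> 2 * k ^ 6" "2 * (Suc k ^ 6 - k ^ 6) \<le> k ^ 6"
          "1 \<le> m k" "real ((m k)\<^sup>2) * L / real (k ^ 6) \<le> 1 / 2" "1 < real k powr (1/4)"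
          using K[OF elim] unfolding L_def by blast+
        have "real (m k) * L / real (k ^ 6) \<le> real ((m k)\<^sup>2) * L / real (k ^ 6)"
          using Kk(5) by (intro divide_right_mono mult_right_mono) (auto simp: power2_eq_square L_def)
        then have mL: "real (m k) * L / real (k ^ 6) \<le> 1 / 2" using Kk(6) by (rule order_trans)
        have le: "k ^ 6 \<le> Suc k ^ 6" by (intro power_mono) auto
        have "\<bar>\<Sum>n\<in>{k ^ 6..<Suc k ^ 6}. (of_bool (n \<in> E) - d n) * f ((T ^^ n) x)\<bar> \<le> \<bar>t k x\<bar> + 2 * B * (3 * L / m k + sqrt ?Q)"
          unfolding t_def L_def by (rule block_discrepancy[where N = "k ^ 6"]) (use Kk le mL[unfolded L_def] f(2) in \<open>simp_all only: order_refl\<close>)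
        then have "norm (?e k) \<le> (\<bar>t k x\<bar> + 2 * B * (3 * L / m k + sqrt ?Q)) / ?w"
          using w by (simp add: divide_right_mono)
        also have "\<dots> = \<bar>D k x\<bar> + 2 * B * (3 * L / m k / ?w + sqrt ?Q / ?w)"
        proof -
          have "(u + 2 * B * (X + Y)) / ?w = u / ?w + 2 * B * (X / ?w + Y / ?w)" for u X Y :: real
            by (simp add: add_divide_distrib distrib_left)
          moreover have "\<bar>D k x\<bar> = \<bar>t k x\<bar> / ?w" using w elim by (simp add: D_def)
          ultimately show ?thesis by (simp only:)
        qed
        also have "\<dots> \<le> \<bar>D k x\<bar> + r k" unfolding r_def
        proof (intro add_left_mono mult_left_mono add_mono)
          have "sqrt ?Q / ?w \<le> sqrt (block_bound_explicit k) / ?w"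
            using block_bound_le[OF Kk(2,3,1)] w by (intro divide_right_mono) auto
          also have "\<dots> \<le> sqrt (block_bound_explicit k) / (3 * real k powr (24/5))"
            using block_weight_ge(2)[OF Kk(2,3,1)] w Kk(1) block_bound_le[OF Kk(2,3,1)] block_bound_nonneg[OF Kk(2), of "Suc k ^ 6 - k ^ 6"]
            by (intro divide_left_mono real_sqrt_ge_zero mult_pos_pos) auto
          finally show "sqrt ?Q / ?w \<le> sqrt (block_bound_explicit k) / (3 * real k powr (24/5))" .
          have "0 < Suc k ^ 6 - k ^ 6" using power_strict_mono[of k "Suc k" 6] by simp
          then have Lp: "0 < L" unfolding L_def by (simp only: of_nat_0_less_iff)
          have "real k powr (1/4) - 1 \<le> real (m k)" unfolding m_def by linarith
          then have "3 * L / m k / ?w \<le> 3 * L / (real k powr (1/4) - 1) / ?w"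
            using Kk(5,7) Lp w by (intro divide_right_mono divide_left_mono mult_pos_pos) auto
          also have "\<dots> \<le> 3 * L / (real k powr (1/4) - 1) / (L * real k powr (-(1/5)) / 2)"
            using block_weight_ge(1)[OF Kk(2,3,1), folded L_def] Kk(1,7) Lp w by (intro divide_left_mono mult_pos_pos divide_nonneg_nonneg divide_pos_pos) auto
          also have "\<dots> = 6 * (1 / real k powr (-(1/5))) / (real k powr (1/4) - 1)"
          proof -
            have "3 * L / Y / (L * z / 2) = 6 * (1 / z) / Y" for Y z
              using Lp by (cases "Y = 0"; cases "z = 0") (auto simp: field_simps)
            then show ?thesis .
          qed
          also have "1 / real k powr (-(1/5)) = real k powr (1/5)" by (simp add: powr_minus_divide)
          finally show "3 * L / m k / ?w \<le> 6 * real k powr (1/5) / (real k powr (1/4) - 1)" .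
        qed (use B in auto)
        finally show ?case .
      qed
    qed
  qed
qed

end

section \<open>Birkhoff's theorem for bounded functions\<close>

context measure_preserving
begin

text \<open>\<open>max_sum g N x\<close> is the maximum of the sums of \<open>g\<close> over the first \<open>0, \<dots>, N\<close> orbit points.\<close>

fun max_sum :: "('a \<Rightarrow> real) \<Rightarrow> nat \<Rightarrow> 'a \<Rightarrow> real" where
  "max_sum g 0 x = 0"
| "max_sum g (Suc N) x = max 0 (g x + max_sum g N (T x))"

definition orbit_sum :: "('a \<Rightarrow> real) \<Rightarrow> nat \<Rightarrow> 'a \<Rightarrow> real" where
  "orbit_sum g n x = (\<Sum>i<n. g ((T ^^ i) x))"

lemma orbit_sum_Suc: "orbit_sum g (Suc n) x = g x + orbit_sum g n (T x)"
  by (simp add: orbit_sum_def sum.lessThan_Suc_shift funpow_Suc_right del: sum.lessThan_Suc funpow.simps)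

lemma max_sum_nonneg: "0 \<le> max_sum g N x"
  by (cases N) auto

lemma max_sum_mono: "max_sum g N x \<le> max_sum g (Suc N) x"
proof (induction N arbitrary: x)
  case (Suc N)
  show ?case
    unfolding max_sum.simps(2)[of g N x] max_sum.simps(2)[of g "Suc N" x]
    by (intro max.mono order_refl add_left_mono Suc.IH)
qed simp

lemma orbit_sum_le_max_sum: "orbit_sum g n x \<le> max_sum g n x"
proof (induction n arbitrary: x)
  case (Suc n)
  show ?case
    unfolding orbit_sum_Suc max_sum.simps by (intro max.coboundedI2 add_left_mono Suc.IH)
qed (simp add: orbit_sum_def)

lemma integral_comp_T:
  fixes g :: "'a \<Rightarrow> real"
  assumes "integrable M g"
  shows "integrable M (\<lambda>x. g (T x))" "(\<integral>x. g (T x) \<partial>M) = (\<integral>x. g x \<partial>M)"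
  using integrable_funpow[OF assms, of 1] integral_funpow[of g 1] assms by auto

lemma integrable_max_sum:
  assumes "integrable M g"
  shows "integrable M (max_sum g N)"
proof (induction N)
  case 0
  have "max_sum g 0 = (\<lambda>x. 0)" by (rule ext) simp
  then show ?case by simp
next
  case (Suc N)
  have "max_sum g (Suc N) = (\<lambda>x. max 0 (g x + max_sum g N (T x)))" by (rule ext) simp
  then show ?case using assms integral_comp_T(1)[OF Suc] by simp
qed

text \<open>Garsia's argument on an invariant set: where \<open>max_sum g N\<close> is positive, it
  is at most \<open>g\<close> plus its own value at the image point. Under the integral the two
  maxima cancel by invariance, and dominated convergence lets \<open>N\<close> exhaust
  \<open>A\<close>.\<close>

lemma maximal_ergodic:
  assumes g: "integrable M g" and A [measurable]: "A \<in> sets M"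
    and inv: "\<And>x. x \<in> space M \<Longrightarrow> T x \<in> A \<longleftrightarrow> x \<in> A"
    and pos: "\<And>x. x \<in> A \<Longrightarrow> \<exists>n. 0 < orbit_sum g n x"
  shows "0 \<le> (\<integral>x. indicator A x * g x \<partial>M)"
proof -
  have gm [measurable]: "g \<in> borel_measurable M" using g by simp
  have mi: "integrable M (max_sum g N)" for N using g by (rule integrable_max_sum)
  have mm [measurable]: "max_sum g N \<in> borel_measurable M" for N using mi by simp
  define P where "P = (\<lambda>N. {x \<in> A. 0 < max_sum g N x})"
  have AM: "A \<subseteq> space M" using A by (rule sets.sets_into_space)
  have Peq: "P N = A \<inter> {x \<in> space M. 0 < max_sum g N x}" for N using AM by (auto simp: P_def)
  have Pm [measurable]: "P N \<in> sets M" for N unfolding Peq by measurable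
  have i1: "integrable M (\<lambda>x. indicator (P N) x * g x)" for N
    using integrable_mult_indicator[OF Pm g, of N] by simp
  have i2: "integrable M (\<lambda>x. indicator A x * max_sum g N x)" for N
    using integrable_mult_indicator[OF A mi, of N] by simp
  have step: "0 \<le> (\<integral>x. indicator (P N) x * g x \<partial>M)" for N
  proof -
    have "(\<integral>x. indicator A (T x) * max_sum g N (T x) \<partial>M) = (\<integral>x. indicator A x * max_sum g N x \<partial>M)"
      using integral_comp_T(2)[OF i2] .
    moreover have "(\<integral>x. indicator A x * max_sum g N x - indicator A (T x) * max_sum g N (T x) \<partial>M) \<le> (\<integral>x. indicator (P N) x * g x \<partial>M)"
    proof (rule integral_mono)
      show "integrable M (\<lambda>x. indicator A x * max_sum g N x - indicator A (T x) * max_sum g N (T x))"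
        using i2[of N] integral_comp_T(1)[OF i2, of N] by (rule Bochner_Integration.integrable_diff)
      show "integrable M (\<lambda>x. indicator (P N) x * g x)" by (rule i1)
      fix x assume x: "x \<in> space M"
      show "indicator A x * max_sum g N x - indicator A (T x) * max_sum g N (T x) \<le> indicator (P N) x * g x"
      proof (cases "x \<in> P N")
        case True
        then have xA: "x \<in> A" "0 < max_sum g N x" by (auto simp: P_def)
        then obtain N' where N': "N = Suc N'" by (cases N) auto
        have "max_sum g N x = g x + max_sum g N' (T x)" using xA by (auto simp: N' max_def split: if_splits)
        also have "\<dots> \<le> g x + max_sum g N (T x)" unfolding N' by (intro add_left_mono max_sum_mono)
        finally show ?thesis using True xA inv[OF x] by simp
      next
        case False
        then have "indicator A x * max_sum g N x = 0" using max_sum_nonneg[of g N x] by (auto simp: P_def indicator_def)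
        moreover have "0 \<le> indicator A (T x) * max_sum g N (T x)" using max_sum_nonneg by simp
        moreover have "indicator (P N) x * g x = 0" using False by simp
        ultimately show ?thesis by linarith
      qed
    qed
    ultimately show ?thesis using i2[of N] integral_comp_T(1)[OF i2, of N] by simp
  qed
  have "(\<lambda>N. \<integral>x. indicator (P N) x * g x \<partial>M) \<longlonglongrightarrow> (\<integral>x. indicator A x * g x \<partial>M)"
  proof (rule integral_dominated_convergence[where w = "\<lambda>x. \<bar>g x\<bar>"])
    show "AE x in M. (\<lambda>N. indicator (P N) x * g x) \<longlonglongrightarrow> indicator A x * g x"
    proof (intro AE_I2)
      fix x
      have "eventually (\<lambda>N. indicator (P N) x * g x = indicator A x * g x) sequentially"
      proof (cases "x \<in> A")
        case True
        obtain n where n: "0 < orbit_sum g n x" using pos[OF True] by auto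
        have "x \<in> P N" if "n \<le> N" for N
        proof -
          have "max_sum g n x \<le> max_sum g N x" using that
            by (induction N rule: dec_induct) (auto intro: order_trans[OF _ max_sum_mono] simp del: max_sum.simps)
          then show ?thesis using n True orbit_sum_le_max_sum[of g n x] by (auto simp: P_def)
        qed
        then show ?thesis using True by (auto simp: eventually_sequentially intro!: exI[of _ n])
      qed (simp add: P_def)
      then show "(\<lambda>N. indicator (P N) x * g x) \<longlonglongrightarrow> indicator A x * g x" by (rule tendsto_eventually)
    qed
    show "AE x in M. norm (indicator (P N) x * g x) \<le> \<bar>g x\<bar>" for N by (auto simp: indicator_def)
  qed (use g in auto)
  then show ?thesis using step by (intro LIMSEQ_le_const) auto
qed

definition time_average :: "('a \<Rightarrow> real) \<Rightarrow> nat \<Rightarrow> 'a \<Rightarrow> real" where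
  "time_average f n x = orbit_sum f n x / real n"

lemma time_average_shift:
  assumes "\<And>x. \<bar>f x\<bar> \<le> B"
  shows "(\<lambda>n. time_average f n (T x) - time_average f n x) \<longlonglongrightarrow> 0"
proof (rule Lim_null_comparison)
  show "(\<lambda>n. 2 * B / real n) \<longlonglongrightarrow> 0" by (rule lim_const_over_n)
  show "eventually (\<lambda>n. norm (time_average f n (T x) - time_average f n x) \<le> 2 * B / real n) sequentially"
  proof (intro always_eventually allI)
    fix n
    have "orbit_sum f n (T x) - orbit_sum f n x = f ((T ^^ n) x) - f x"
      using orbit_sum_Suc[of f n x] by (simp add: orbit_sum_def)
    then have "time_average f n (T x) - time_average f n x = (f ((T ^^ n) x) - f x) / real n"
      by (simp add: time_average_def flip: diff_divide_distrib)
    also have "norm \<dots> \<le> 2 * B / real n"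
      using assms[of x] assms[of "(T ^^ n) x"] by (simp add: divide_right_mono)
    finally show "norm (time_average f n (T x) - time_average f n x) \<le> 2 * B / real n" .
  qed
qed

text \<open>Taken in the extended reals, where the limit superior exists for every
  \<open>f\<close>.\<close>

definition upper_average :: "('a \<Rightarrow> real) \<Rightarrow> 'a \<Rightarrow> ereal" where
  "upper_average f x = limsup (\<lambda>n. ereal (time_average f n x))"

lemma upper_average_T:
  assumes "\<And>x. \<bar>f x\<bar> \<le> B"
  shows "upper_average f (T x) = upper_average f x"
proof -
  have "(\<lambda>n. ereal (time_average f n (T x) - time_average f n x)) \<longlonglongrightarrow> ereal 0"
    using time_average_shift[OF assms, where x = x] by (simp only: tendsto_ereal)
  then have "limsup (\<lambda>n. ereal (time_average f n (T x) - time_average f n x) + ereal (time_average f n x)) = 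
      ereal 0 + limsup (\<lambda>n. ereal (time_average f n x))"
    by (rule ereal_limsup_lim_add) simp
  then show ?thesis by (simp add: upper_average_def zero_ereal_def[symmetric])
qed

lemma upper_average_gt_imp:
  assumes "ereal b < upper_average f x"
  shows "\<exists>n\<ge>1. b < time_average f n x"
proof (rule ccontr)
  assume "\<not> ?thesis"
  then have "\<forall>n\<ge>1. ereal (time_average f n x) \<le> ereal b" by (auto simp: not_less)
  then have "upper_average f x \<le> ereal b" unfolding upper_average_def
    by (intro Limsup_bounded) (auto simp: eventually_sequentially)
  with assms show False by simp
qed

text \<open>\<open>g\<close> may be larger than \<open>f - b\<close>: in infinite measure a nonzero
  constant is not integrable, and \<open>b\<close> is subtracted only on a set of finite
  measure.\<close>

lemma orbit_sum_invariant_pos: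
  assumes inv: "\<And>x. x \<in> space M \<Longrightarrow> T x \<in> A \<longleftrightarrow> x \<in> A" and x: "x \<in> space M" "x \<in> A"
    and g: "\<And>y. y \<in> A \<Longrightarrow> f y - b \<le> g y" and avg: "ereal b < upper_average f x"
  shows "\<exists>n. 0 < orbit_sum g n x"
proof -
  obtain n where n: "1 \<le> n" "b < time_average f n x" using upper_average_gt_imp[OF avg] by auto
  have iA: "(T ^^ i) x \<in> A" for i
    by (induction i) (use x inv funpow_space[OF x(1)] in auto)
  have "0 < orbit_sum f n x - real n * b" using n by (simp add: time_average_def field_simps)
  also have "\<dots> = (\<Sum>i<n. f ((T ^^ i) x) - b)" by (simp add: orbit_sum_def sum_subtractf)
  also have "\<dots> \<le> orbit_sum g n x" unfolding orbit_sum_def using g iA by (intro sum_mono) auto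
  finally show ?thesis by blast
qed

text \<open>In infinite measure the usual comparison of integrals over \<open>A\<close> requires
  \<open>A\<close> to have finite measure first. This follows from \<open>0 < b\<close>: for each
  part \<open>S\<close> of finite measure \<open>maximal_ergodic\<close> gives
  \<open>measure M S * b \<le> F\<close>, and such parts exhaust \<open>A\<close>. Afterwards
  \<open>b * measure M A \<le> F \<le> a * measure M A\<close>.\<close>

lemma oscillation_null_aux:
  fixes f :: "'a \<Rightarrow> real"
  assumes sf: "sigma_finite_measure M" and f: "integrable M f" "\<And>x. \<bar>f x\<bar> \<le> B" and ab: "a < b" "0 < b"
  shows "{x \<in> space M. ereal (- a) < upper_average (\<lambda>x. - f x) x \<and> ereal b < upper_average f x} \<in> null_sets M"
proof -
  have fm [measurable]: "f \<in> borel_measurable M" using f by simp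
  define A where "A = {x \<in> space M. ereal (- a) < upper_average (\<lambda>x. - f x) x \<and> ereal b < upper_average f x}"
  have um [measurable]: "upper_average g \<in> borel_measurable M" if [measurable]: "g \<in> borel_measurable M" for g
    unfolding upper_average_def[abs_def] time_average_def orbit_sum_def by measurable
  have A [measurable]: "A \<in> sets M" unfolding A_def by measurable
  have AM: "A \<subseteq> space M" by (auto simp: A_def)
  have inv: "T x \<in> A \<longleftrightarrow> x \<in> A" if x: "x \<in> space M" for x
    using x measurable_space[OF T_meas x] upper_average_T[of f B x] upper_average_T[of "\<lambda>x. - f x" B x] f(2) by (simp add: A_def)
  have I: "integrable M (\<lambda>x. indicator A x * f x)" using integrable_mult_indicator[OF A f(1)] by simp
  define F where "F = (\<integral>x. indicator A x * f x \<partial>M)"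
  have fin_part: "measure M S * b \<le> F" if S: "S \<in> sets M" "S \<subseteq> A" "emeasure M S \<noteq> \<infinity>" for S
  proof -
    have iS: "integrable M (\<lambda>x. indicator S x * b)"
      using S by (intro integrable_mult_left) (auto simp: less_top)
    have "0 \<le> (\<integral>x. indicator A x * (f x - indicator S x * b) \<partial>M)"
    proof (rule maximal_ergodic[OF _ A inv])
      show "integrable M (\<lambda>x. f x - indicator S x * b)" using f(1) iS by (rule Bochner_Integration.integrable_diff)
      fix x assume x: "x \<in> A"
      show "\<exists>n. 0 < orbit_sum (\<lambda>x. f x - indicator S x * b) n x"
        by (rule orbit_sum_invariant_pos[OF inv _ x, of f b]) (use x ab in \<open>auto simp: A_def indicator_def\<close>)
    qed
    also have "(\<lambda>x. indicator A x * (f x - indicator S x * b)) = (\<lambda>x. indicator A x * f x - indicator S x * b)"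
      using S(2) by (auto simp: fun_eq_iff indicator_def)
    also have "(\<integral>x. indicator A x * f x - indicator S x * b \<partial>M) = F - measure M S * b"
      using I iS S by (simp add: F_def)
    finally show ?thesis by simp
  qed
  have finA: "emeasure M A \<noteq> \<infinity>"
  proof -
    interpret sigma_finite_measure M by fact
    obtain C :: "nat \<Rightarrow> 'a set" where C: "range C \<subseteq> sets M" "(\<Union>i. C i) = space M" "\<And>i. emeasure M (C i) \<noteq> \<infinity>" "incseq C"
      using sigma_finite_incseq by metis
    have bound: "emeasure M (A \<inter> C i) \<le> ennreal (F / b)" for i
    proof -
      have s: "A \<inter> C i \<in> sets M" using C A by auto
      have "emeasure M (A \<inter> C i) \<le> emeasure M (C i)" using C by (intro emeasure_mono) auto
      then have f': "emeasure M (A \<inter> C i) \<noteq> \<infinity>" using C(3)[of i] by (auto simp: top_unique)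
      have "measure M (A \<inter> C i) \<le> F / b" using fin_part[OF s _ f'] ab by (simp add: field_simps)
      then show ?thesis using f' by (simp add: emeasure_eq_ennreal_measure ennreal_leI)
    qed
    have "A = (\<Union>i. A \<inter> C i)" using C(2) AM by auto
    then have "emeasure M A = emeasure M (\<Union>i. A \<inter> C i)" by simp
    also have "\<dots> = (SUP i. emeasure M (A \<inter> C i))"
    proof (rule SUP_emeasure_incseq[symmetric])
      show "range (\<lambda>i. A \<inter> C i) \<subseteq> sets M" using C A by auto
      show "incseq (\<lambda>i. A \<inter> C i)" using C(4) unfolding incseq_def by blast
    qed
    also have "\<dots> \<le> ennreal (F / b)" by (rule SUP_least) (rule bound)
    finally show ?thesis by (auto simp: top_unique)
  qed
  have iA: "integrable M (\<lambda>x. indicator A x * c)" for c :: real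
    using A finA by (intro integrable_mult_left) (auto simp: less_top)
  have 1: "measure M A * b \<le> F" by (rule fin_part[OF A order_refl finA])
  have 2: "0 \<le> (\<integral>x. indicator A x * (indicator A x * a - f x) \<partial>M)"
  proof (rule maximal_ergodic[OF _ A inv])
    show "integrable M (\<lambda>x. indicator A x * a - f x)" using iA f(1) by (rule Bochner_Integration.integrable_diff)
    fix x assume x: "x \<in> A"
    show "\<exists>n. 0 < orbit_sum (\<lambda>x. indicator A x * a - f x) n x"
      by (rule orbit_sum_invariant_pos[OF inv _ x, of "\<lambda>x. - f x" "- a"]) (use x in \<open>auto simp: A_def indicator_def\<close>)
  qed
  have "(\<lambda>x. indicator A x * (indicator A x * a - f x)) = (\<lambda>x. indicator A x * a - indicator A x * f x)"
    by (auto simp: fun_eq_iff indicator_def)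
  then have "0 \<le> measure M A * a - F" using 2 iA I A AM by (simp add: F_def)
  with 1 have "measure M A * (b - a) \<le> 0" by (simp add: algebra_simps)
  then have "measure M A = 0" using ab by (simp add: mult_le_0_iff measure_nonneg antisym)
  then have "emeasure M A = 0" using finA by (simp add: emeasure_eq_ennreal_measure)
  then show ?thesis using A by (simp add: null_sets_def A_def)
qed

text \<open>If \<open>b\<close> is not positive, then \<open>- a\<close> is, and the argument
  applies to \<open>- f\<close> with the levels \<open>- b < - a\<close>.\<close>

lemma oscillation_null:
  fixes f :: "'a \<Rightarrow> real"
  assumes sf: "sigma_finite_measure M" and f: "integrable M f" "\<And>x. \<bar>f x\<bar> \<le> B" and ab: "a < b"
  shows "{x \<in> space M. ereal (- a) < upper_average (\<lambda>x. - f x) x \<and> ereal b < upper_average f x} \<in> null_sets M"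
proof (cases "0 < b")
  case True
  then show ?thesis using oscillation_null_aux[OF sf f ab] by simp
next
  case False
  have "{x \<in> space M. ereal (- (- b)) < upper_average (\<lambda>x. - (- f x)) x \<and> ereal (- a) < upper_average (\<lambda>x. - f x) x} \<in> null_sets M"
    using f ab False by (intro oscillation_null_aux[OF sf, of _ B]) auto
  then show ?thesis by (simp add: conj_commute)
qed

theorem birkhoff_bounded:
  fixes f :: "'a \<Rightarrow> real"
  assumes sf: "sigma_finite_measure M" and f: "integrable M f" "\<And>x. \<bar>f x\<bar> \<le> B"
  shows "AE x in M. convergent (\<lambda>n. time_average f n x)"
proof -
  have "AE x in M. \<forall>q::rat\<times>rat. fst q < snd q \<longrightarrow> \<not> (ereal (- of_rat (fst q)) < upper_average (\<lambda>x. - f x) x \<and> ereal (of_rat (snd q)) < upper_average f x)"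
    unfolding AE_all_countable
  proof
    fix q :: "rat \<times> rat"
    show "AE x in M. fst q < snd q \<longrightarrow> \<not> (ereal (- of_rat (fst q)) < upper_average (\<lambda>x. - f x) x \<and> ereal (of_rat (snd q)) < upper_average f x)"
    proof (cases "fst q < snd q")
      case True
      then have "of_rat (fst q) < (of_rat (snd q) :: real)" by (simp add: of_rat_less)
      from AE_not_in[OF oscillation_null[OF sf f this]] AE_space show ?thesis by eventually_elim auto
    qed simp
  qed
  then show ?thesis
  proof (rule AE_mp, intro AE_I2 impI)
    fix x
    assume h: "\<forall>q::rat\<times>rat. fst q < snd q \<longrightarrow> \<not> (ereal (- of_rat (fst q)) < upper_average (\<lambda>x. - f x) x \<and> ereal (of_rat (snd q)) < upper_average f x)"
    let ?a = "\<lambda>n. ereal (time_average f n x)"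
    have tb: "\<bar>time_average f n x\<bar> \<le> B" for n
    proof (cases "n = 0")
      case True
      then show ?thesis using f(2)[of x] by (simp add: time_average_def)
    next
      case False
      have "\<bar>orbit_sum f n x\<bar> \<le> (\<Sum>i<n. B)" unfolding orbit_sum_def using f(2) by (intro order_trans[OF sum_abs] sum_mono) auto
      then show ?thesis using False by (simp add: time_average_def field_simps)
    qed
    have neg: "upper_average (\<lambda>x. - f x) x = - liminf ?a"
      unfolding upper_average_def time_average_def orbit_sum_def by (simp add: sum_negf ereal_Limsup_uminus[symmetric] flip: uminus_ereal.simps(1))
    have "limsup ?a \<le> liminf ?a"
    proof (rule ccontr)
      assume "\<not> ?thesis"
      then have "liminf ?a < limsup ?a" by simp
      then obtain r1 where r1: "liminf ?a < ereal (of_rat r1)" "ereal (of_rat r1) < limsup ?a"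
        using ereal_dense3 by blast
      then obtain r2 where r2: "ereal (of_rat r1) < ereal (of_rat r2)" "ereal (of_rat r2) < limsup ?a"
        using ereal_dense3 by blast
      have "r1 < r2" using r2(1) by (simp add: of_rat_less)
      moreover have "ereal (- of_rat r1) < upper_average (\<lambda>x. - f x) x"
        unfolding neg using r1(1) by (simp add: ereal_less_uminus_reorder flip: uminus_ereal.simps(1))
      moreover have "ereal (of_rat r2) < upper_average f x" using r2(2) by (simp add: upper_average_def)
      ultimately show False using h[rule_format, of "(r1, r2)"] by simp
    qed
    then have eq: "liminf ?a = limsup ?a" by (intro antisym Liminf_le_Limsup) auto
    have "ereal (- B) \<le> liminf ?a" using tb by (intro Liminf_bounded always_eventually) (auto simp: abs_le_iff minus_le_iff)
    moreover have "limsup ?a \<le> ereal B" using tb by (intro Limsup_bounded always_eventually) (auto simp: abs_le_iff)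
    ultimately obtain r where r: "limsup ?a = ereal r" using eq by (cases "limsup ?a") auto
    have "?a \<longlonglongrightarrow> ereal r" using eq r by (intro iffD2[OF tendsto_iff_Liminf_eq_Limsup]) auto
    then have "(\<lambda>n. time_average f n x) \<longlonglongrightarrow> r" by (simp only: tendsto_ereal lim_ereal)
    then show "convergent (\<lambda>n. time_average f n x)" by (rule convergentI)
  qed
qed

end

section \<open>Convergence of the averages\<close>

lemma convergent_of_approx:
  fixes a :: "nat \<Rightarrow> real"
  assumes "\<And>\<epsilon>. 0 < \<epsilon> \<Longrightarrow> \<exists>b. convergent b \<and> eventually (\<lambda>N. \<bar>a N - b N\<bar> \<le> \<epsilon>) sequentially"
  shows "convergent a"
proof -
  have "Cauchy a"
  proof (rule metric_CauchyI)
    fix e :: real assume e: "0 < e"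
    obtain b where b: "convergent b" "eventually (\<lambda>N. \<bar>a N - b N\<bar> \<le> e / 4) sequentially"
      using assms[of "e / 4"] e by auto
    have "Cauchy b" using b(1) by (simp add: Cauchy_convergent_iff)
    then obtain M1 where M1: "\<And>m n. M1 \<le> m \<Longrightarrow> M1 \<le> n \<Longrightarrow> dist (b m) (b n) < e / 4"
      using e by (metis metric_CauchyD zero_less_divide_iff zero_less_numeral)
    obtain M2 where M2: "\<And>n. M2 \<le> n \<Longrightarrow> \<bar>a n - b n\<bar> \<le> e / 4"
      using b(2) unfolding eventually_sequentially by blast
    have "dist (a m) (a n) < e" if "max M1 M2 \<le> m" "max M1 M2 \<le> n" for m n
    proof -
      have mn: "M1 \<le> m" "M1 \<le> n" "M2 \<le> m" "M2 \<le> n" using that by simp_all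
      have "\<bar>b m - b n\<bar> < e / 4" using M1[OF mn(1,2)] by (simp only: dist_real_def)
      then show ?thesis using M2[OF mn(3)] M2[OF mn(4)] e unfolding dist_real_def by linarith
    qed
    then show "\<exists>M. \<forall>m\<ge>M. \<forall>n\<ge>M. dist (a m) (a n) < e" by blast
  qed
  then show ?thesis by (simp add: Cauchy_convergent_iff)
qed

text \<open>Toeplitz's argument: the terms where \<open>e\<close> is not yet small contribute the
  constant \<open>K\<close>, which the growth of \<open>F\<close> removes, and the others are small
  relative to the total weight.\<close>

lemma weighted_null_sum:
  fixes e v F :: "nat \<Rightarrow> real"
  assumes e: "e \<longlonglongrightarrow> 0" and v: "\<And>n. p \<le> n \<Longrightarrow> 0 \<le> v n"
    and C: "\<And>N. p \<le> N \<Longrightarrow> (\<Sum>n\<in>{p..<N}. v n) \<le> C * F N" and "0 < C" and F: "filterlim F at_top sequentially"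
  shows "(\<lambda>N. (\<Sum>n\<in>{p..<N}. v n * e n) / F N) \<longlonglongrightarrow> 0"
proof (rule tendstoI)
  fix r :: real assume r: "0 < r"
  define \<epsilon> where "\<epsilon> = r / (2 * C)"
  have \<epsilon>: "0 < \<epsilon>" using r \<open>0 < C\<close> by (simp add: \<epsilon>_def)
  have "eventually (\<lambda>n. \<bar>e n\<bar> < \<epsilon>) sequentially" using tendstoD[OF e \<epsilon>] by (simp add: dist_real_def)
  then obtain n1 where n1: "\<And>n. n1 \<le> n \<Longrightarrow> \<bar>e n\<bar> < \<epsilon>" unfolding eventually_sequentially by blast
  define n2 where "n2 = max n1 p"
  define K where "K = (\<Sum>n\<in>{p..<n2}. v n * \<bar>e n\<bar>)"
  have "((\<lambda>N. K / F N) \<longlongrightarrow> 0) sequentially" by (rule real_tendsto_divide_at_top[OF tendsto_const F])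
  then have "eventually (\<lambda>N. \<bar>K / F N\<bar> < r / 2) sequentially" using r by (auto dest!: tendstoD[of _ 0 _ "r / 2"] simp only: dist_real_def diff_0_right half_gt_zero_iff)
  moreover have "eventually (\<lambda>N. 0 < F N) sequentially" using F by (simp add: filterlim_at_top_dense)
  ultimately show "eventually (\<lambda>N. dist ((\<Sum>n\<in>{p..<N}. v n * e n) / F N) 0 < r) sequentially"
    using eventually_ge_at_top[of n2]
  proof eventually_elim
    case (elim N)
    have "\<bar>\<Sum>n\<in>{p..<N}. v n * e n\<bar> \<le> (\<Sum>n\<in>{p..<N}. v n * \<bar>e n\<bar>)"
      using v by (intro order_trans[OF sum_abs] sum_mono) (simp add: abs_mult)
    also have "\<dots> = K + (\<Sum>n\<in>{n2..<N}. v n * \<bar>e n\<bar>)"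
      unfolding K_def using elim(3) by (simp add: n2_def sum.atLeastLessThan_concat)
    also have "(\<Sum>n\<in>{n2..<N}. v n * \<bar>e n\<bar>) \<le> (\<Sum>n\<in>{n2..<N}. v n * \<epsilon>)"
    proof (rule sum_mono)
      fix n assume "n \<in> {n2..<N}"
      then have n: "n1 \<le> n" "p \<le> n" by (simp_all add: n2_def)
      show "v n * \<bar>e n\<bar> \<le> v n * \<epsilon>" by (rule mult_left_mono[OF less_imp_le[OF n1[OF n(1)]] v[OF n(2)]])
    qed
    also have "\<dots> \<le> (\<Sum>n\<in>{p..<N}. v n * \<epsilon>)"
      using v \<epsilon> by (intro sum_mono2) (auto simp: n2_def)
    also have "\<dots> = (\<Sum>n\<in>{p..<N}. v n) * \<epsilon>" by (rule sum_distrib_right[symmetric])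
    also have "\<dots> \<le> (C * F N) * \<epsilon>" using C[of N] \<epsilon> elim(3) by (intro mult_right_mono) (auto simp: n2_def)
    also have "\<dots> = F N * (r / 2)" using \<open>0 < C\<close> by (simp add: \<epsilon>_def)
    finally have "\<bar>\<Sum>n\<in>{p..<N}. v n * e n\<bar> / F N \<le> (K + F N * (r / 2)) / F N"
      using elim(2) by (intro divide_right_mono) auto
    also have "\<dots> = K / F N + r / 2" using elim(2) by (simp add: add_divide_distrib)
    also have "\<dots> < r" using elim(1) by linarith
    finally show ?case using elim(2) by (simp add: dist_real_def)
  qed
qed

section \<open>Passage from blocks and orbit averages to averages over the set\<close>

context regular_floor_set
begin

lemma phi_mono:
  assumes "n0 \<le> m" "m \<le> n"
  shows "\<phi> m \<le> \<phi> n"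
  using assms(2)
proof (induction n rule: dec_induct)
  case (step n)
  then show ?case using d_pos[of n] assms(1) by (simp add: phi_Suc)
qed simp

lemma phi_at_top: "filterlim \<phi> at_top sequentially"
proof (rule filterlim_at_top_mono)
  show "filterlim (\<lambda>n::nat. real n * real n powr (- (1/30)) / 4) at_top sequentially" by real_asymp
  show "eventually (\<lambda>n. real n * real n powr (- (1/30)) / 4 \<le> \<phi> n) sequentially"
    using eventually_ge_at_top[of n0]
  proof eventually_elim
    case (elim n)
    have "real n * real n powr (- (1/30)) / 4 \<le> real n * d n / 4"
      using d_lower[OF elim] by (intro divide_right_mono mult_left_mono) auto
    then show ?case using phi_lower[OF elim] by linarith
  qed
qed

lemma summation_by_parts:
  assumes "p \<le> N"
  shows "(\<Sum>n\<in>{p..<N}. d n * (t (Suc n) - t n)) = d N * t N - d p * t p + (\<Sum>n\<in>{p..<N}. (d n - d (Suc n)) * t (Suc n))"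
    "(\<Sum>n\<in>{p..<N}. (d n - d (Suc n)) * real (Suc n)) = real p * d p + (\<phi> N - \<phi> p) - real N * d N"
  using assms by (induction N rule: dec_induct) (simp_all add: algebra_simps phi_Suc)

text \<open>After subtraction of \<open>L\<close>, Abel summation expresses the sum through plain
  averages with the weights \<open>(d n - d (Suc n)) * Suc n\<close>. These are nonnegative and add
  up to at most a multiple of \<open>\<phi> N\<close>, and \<open>phi_lower\<close> controls the
  boundary term.\<close>

lemma weighted_average_tendsto:
  fixes c :: "nat \<Rightarrow> real"
  assumes p: "n0 \<le> p" and L: "(\<lambda>n. (\<Sum>i<n. c i) / real n) \<longlonglongrightarrow> L"
  shows "(\<lambda>N. (\<Sum>n\<in>{p..<N}. d n * c n) / \<phi> N) \<longlonglongrightarrow> L"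
proof -
  define t where "t = (\<lambda>n. (\<Sum>i<n. c i) - real n * L)"
  have tn: "(\<lambda>n. t n / real n) \<longlonglongrightarrow> 0"
  proof -
    have "(\<lambda>n. (\<Sum>i<n. c i) / real n - L) \<longlonglongrightarrow> L - L" using L by (intro tendsto_diff tendsto_const)
    moreover have "eventually (\<lambda>n. (\<Sum>i<n. c i) / real n - L = t n / real n) sequentially"
      using eventually_gt_at_top[of 0] by eventually_elim (simp add: t_def diff_divide_distrib)
    ultimately have "(\<lambda>n. t n / real n) \<longlonglongrightarrow> L - L" by (rule Lim_transform_eventually)
    then show ?thesis by simp
  qed
  have phip: "0 < \<phi> n" if "p \<le> n" for n using phi_pos that p by simp
  have c: "c n = (t (Suc n) - t n) + L" for n by (simp add: t_def algebra_simps)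
  have T1: "(\<lambda>N. d N * t N / \<phi> N) \<longlonglongrightarrow> 0"
  proof (rule Lim_null_comparison)
    show "(\<lambda>N. 4 * \<bar>t N / real N\<bar>) \<longlonglongrightarrow> 0"
      using tendsto_mult_left[OF tendsto_rabs_zero[OF tn], of 4] by simp
    show "eventually (\<lambda>N. norm (d N * t N / \<phi> N) \<le> 4 * \<bar>t N / real N\<bar>) sequentially"
      using eventually_ge_at_top[of p]
    proof eventually_elim
      case (elim N)
      have N: "n0 \<le> N" "0 < real N" using elim p n0_pos by auto
      have "norm (d N * t N / \<phi> N) = (real N * d N / \<phi> N) * \<bar>t N / real N\<bar>"
        using N d_pos[OF N(1)] phip[OF elim] by (simp add: abs_mult)
      also have "\<dots> \<le> 4 * \<bar>t N / real N\<bar>"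
        using phi_lower[OF N(1)] phip[OF elim] by (intro mult_right_mono) (auto simp: field_simps)
      finally show ?case .
    qed
  qed
  have T2: "(\<lambda>N. (d p * t p) / \<phi> N) \<longlonglongrightarrow> 0" 
    by (rule real_tendsto_divide_at_top[OF tendsto_const phi_at_top])
  have T3: "(\<lambda>N. (\<Sum>n\<in>{p..<N}. ((d n - d (Suc n)) * real (Suc n)) * (t (Suc n) / real (Suc n))) / \<phi> N) \<longlonglongrightarrow> 0"
  proof (rule weighted_null_sum[where C = 5])
    show "(\<lambda>n. t (Suc n) / real (Suc n)) \<longlonglongrightarrow> 0" using tn by (rule LIMSEQ_Suc)
    show "0 \<le> (d n - d (Suc n)) * real (Suc n)" if "p \<le> n" for n
      using d_antimono[of n "Suc n"] that p by (intro mult_nonneg_nonneg) auto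
    show "(\<Sum>n\<in>{p..<N}. (d n - d (Suc n)) * real (Suc n)) \<le> 5 * \<phi> N" if N: "p \<le> N" for N
    proof -
      have "real p * d p \<le> 4 * \<phi> p" using phi_lower[OF p] by simp
      moreover have "\<phi> p \<le> \<phi> N" using phi_mono p N by simp
      moreover have "0 \<le> real N * d N" using d_pos[of N] p N by simp
      ultimately show ?thesis unfolding summation_by_parts(2)[OF N] using phip[of p] by simp
    qed
  qed (use phi_at_top in auto)
  have T4: "(\<lambda>N. (L - (L * \<phi> p) / \<phi> N)) \<longlonglongrightarrow> L - 0"
    by (rule tendsto_diff[OF tendsto_const real_tendsto_divide_at_top[OF tendsto_const phi_at_top]])
  have "(\<lambda>N. d N * t N / \<phi> N - (d p * t p) / \<phi> N + 
      (\<Sum>n\<in>{p..<N}. ((d n - d (Suc n)) * real (Suc n)) * (t (Suc n) / real (Suc n))) / \<phi> N + (L - (L * \<phi> p) / \<phi> N)) \<longlonglongrightarrow> 0 - 0 + 0 + (L - 0)"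
    by (intro tendsto_add tendsto_diff T1 T2 T3 T4)
  moreover have "eventually (\<lambda>N. d N * t N / \<phi> N - (d p * t p) / \<phi> N + 
      (\<Sum>n\<in>{p..<N}. ((d n - d (Suc n)) * real (Suc n)) * (t (Suc n) / real (Suc n))) / \<phi> N + (L - (L * \<phi> p) / \<phi> N) 
      = (\<Sum>n\<in>{p..<N}. d n * c n) / \<phi> N) sequentially"
    using eventually_ge_at_top[of p]
  proof eventually_elim
    case (elim N)
    have "(\<Sum>n\<in>{p..<N}. d n) = \<phi> N - \<phi> p" unfolding d_def using elim by (rule sum_Suc_diff')
    moreover have "(\<Sum>n\<in>{p..<N}. d n * L) = (\<Sum>n\<in>{p..<N}. d n) * L" by (rule sum_distrib_right[symmetric])
    ultimately have sL: "(\<Sum>n\<in>{p..<N}. d n * L) = L * \<phi> N - L * \<phi> p" by (simp only:) (simp add: algebra_simps)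
    have "(\<Sum>n\<in>{p..<N}. d n * c n) = (\<Sum>n\<in>{p..<N}. d n * (t (Suc n) - t n)) + (\<Sum>n\<in>{p..<N}. d n * L)"
      unfolding c distrib_left by (rule sum.distrib)
    then have "(\<Sum>n\<in>{p..<N}. d n * c n) = d N * t N - d p * t p + 
       (\<Sum>n\<in>{p..<N}. ((d n - d (Suc n)) * real (Suc n)) * (t (Suc n) / real (Suc n))) + (L * \<phi> N - L * \<phi> p)"
      unfolding summation_by_parts(1)[OF elim] sL by (simp add: mult.assoc del: of_nat_Suc)
    then show ?case using phip[OF elim] by (simp add: add_divide_distrib diff_divide_distrib)
  qed
  ultimately show ?thesis by (simp add: tendsto_cong)
qed

lemma sixth_root:
  obtains \<kappa> :: "nat \<Rightarrow> nat" where "\<And>N. \<kappa> N ^ 6 \<le> N" "\<And>N. N < Suc (\<kappa> N) ^ 6" "filterlim \<kappa> at_top sequentially"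
proof -
  define \<kappa> where "\<kappa> = (\<lambda>N::nat. Max {k. k ^ 6 \<le> N})"
  have pw: "k \<le> k ^ 6" for k :: nat by (cases "k = 0") (auto intro: self_le_power)
  have fin: "finite {k. k ^ 6 \<le> N}" for N :: nat
    by (rule finite_subset[of _ "{..N}"]) (use pw order_trans in \<open>auto\<close>)
  have 1: "\<kappa> N ^ 6 \<le> N" for N
  proof -
    have "\<kappa> N \<in> {k. k ^ 6 \<le> N}" unfolding \<kappa>_def by (rule Max_in[OF fin]) (auto intro!: exI[of _ 0])
    then show ?thesis by simp
  qed
  have ge: "k \<le> \<kappa> N" if "k ^ 6 \<le> N" for k N unfolding \<kappa>_def using fin that by (intro Max_ge) auto
  have 2: "N < Suc (\<kappa> N) ^ 6" for N using ge[of "Suc (\<kappa> N)" N] by (meson not_less not_less_eq_eq order_refl)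
  have "filterlim \<kappa> at_top sequentially"
    unfolding filterlim_at_top eventually_sequentially using ge by (meson order_trans)
  then show ?thesis using that 1 2 by blast
qed

text \<open>By \<open>card_E_asymptotic\<close> the divisor \<open>\<phi> N\<close> is asymptotic to
  the number of terms, so convergence is not affected by the choice.\<close>

definition full_average :: "('a \<Rightarrow> 'a) \<Rightarrow> ('a \<Rightarrow> real) \<Rightarrow> nat \<Rightarrow> 'a \<Rightarrow> real" where
  "full_average T f N x = (\<Sum>n\<in>E \<inter> {..<N}. f ((T ^^ n) x)) / \<phi> N"

text \<open>The complete blocks form a mean of a null sequence with the weights
  \<open>block_weight k\<close>. The incomplete last block is estimated by its weight, which up to
  rounding is of order \<open>1 / K\<close> relative to \<open>\<phi> (K ^ 6)\<close>.\<close>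

lemma discrepancy_tendsto_0:
  fixes g :: "nat \<Rightarrow> real"
  assumes g: "\<And>n. \<bar>g n\<bar> \<le> B"
    and e: "(\<lambda>k. (\<Sum>n\<in>{k ^ 6..<Suc k ^ 6}. (of_bool (n \<in> E) - d n) * g n) / block_weight k) \<longlonglongrightarrow> 0"
  shows "(\<lambda>N. (\<Sum>n\<in>{n0 ^ 6..<N}. (of_bool (n \<in> E) - d n) * g n) / \<phi> N) \<longlonglongrightarrow> 0"
proof -
  define R where "R = (\<lambda>N. \<Sum>n\<in>{n0 ^ 6..<N}. (of_bool (n \<in> E) - d n) * g n)"
  define b where "b = (\<lambda>k. \<Sum>n\<in>{k ^ 6..<Suc k ^ 6}. (of_bool (n \<in> E) - d n) * g n)"
  have B: "0 \<le> B" using g[of 0] by simp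
  have pw: "k \<le> k ^ 6" for k :: nat by (cases "k = 0") (auto intro: self_le_power)
  have n06: "n0 \<le> k ^ 6" if "n0 \<le> k" for k using pw[of k] that by simp
  have le6: "k ^ 6 \<le> m ^ 6" if "k \<le> m" for k m :: nat using that by (rule power_mono) simp
  have w0: "0 < block_weight k" if "n0 \<le> k" for k
  proof -
    have "k ^ 6 < Suc k ^ 6" by (intro power_strict_mono) auto
    then have "\<phi> (Suc (k ^ 6)) \<le> \<phi> (Suc k ^ 6)" using n06[OF that] by (intro phi_mono) auto
    then show ?thesis using d_pos[OF n06[OF that]] by (simp add: block_weight_def phi_Suc)
  qed
  have RK: "R (K ^ 6) = (\<Sum>k\<in>{n0..<K}. b k)" if "n0 \<le> K" for K
    using that
  proof (induction K rule: dec_induct)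
    case (step K)
    have "R (Suc K ^ 6) = R (K ^ 6) + b K" unfolding R_def b_def
      using le6[of n0 K] le6[of K "Suc K"] step by (intro sum.atLeastLessThan_concat[symmetric]) auto
    then show ?case using step by simp
  qed (simp add: R_def)
  have sumw: "(\<Sum>k\<in>{n0..<K}. block_weight k) = \<phi> (K ^ 6) - \<phi> (n0 ^ 6)" if "n0 \<le> K" for K
    unfolding block_weight_def using sum_Suc_diff'[OF that, of "\<lambda>k. \<phi> (k ^ 6)"] .
  have top6: "filterlim (\<lambda>K. \<phi> (K ^ 6)) at_top sequentially"
    by (rule filterlim_compose[OF phi_at_top]) (rule filterlim_at_top_mono[OF filterlim_ident], use pw in auto)
  have Y: "(\<lambda>K. R (K ^ 6) / \<phi> (K ^ 6)) \<longlonglongrightarrow> 0"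
  proof -
    have "(\<lambda>K. (\<Sum>k\<in>{n0..<K}. block_weight k * (b k / block_weight k)) / \<phi> (K ^ 6)) \<longlonglongrightarrow> 0"
    proof (rule weighted_null_sum[where C = 1])
      show "(\<lambda>k. b k / block_weight k) \<longlonglongrightarrow> 0" using e by (simp add: b_def)
      show "0 \<le> block_weight k" if "n0 \<le> k" for k using w0[OF that] by simp
      show "(\<Sum>k\<in>{n0..<K}. block_weight k) \<le> 1 * \<phi> (K ^ 6)" if "n0 \<le> K" for K
        using sumw[OF that] phi_pos[OF n06[OF order_refl]] by simp
    qed (use top6 in auto)
    moreover have "eventually (\<lambda>K. (\<Sum>k\<in>{n0..<K}. block_weight k * (b k / block_weight k)) / \<phi> (K ^ 6) = R (K ^ 6) / \<phi> (K ^ 6)) sequentially"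
      using eventually_ge_at_top[of n0]
    proof eventually_elim
      case (elim K)
      have "(\<Sum>k\<in>{n0..<K}. block_weight k * (b k / block_weight k)) = (\<Sum>k\<in>{n0..<K}. b k)"
      proof (rule sum.cong[OF refl])
        fix k assume "k \<in> {n0..<K}"
        then show "block_weight k * (b k / block_weight k) = b k" using w0[of k] by simp
      qed
      then show ?case using RK[OF elim] by simp
    qed
    ultimately show ?thesis by (rule Lim_transform_eventually)
  qed
  define q where "q = (\<lambda>K. B * (2 * (4 * ((real K + 1) ^ 6 - real K ^ 6) / real K ^ 6) + 1 / \<phi> (K ^ 6)))"
  have q0: "q \<longlonglongrightarrow> 0"
  proof -
    have "(\<lambda>K::nat. 4 * ((real K + 1) ^ 6 - real K ^ 6) / real K ^ 6) \<longlonglongrightarrow> 0" by real_asymp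
    moreover have "(\<lambda>K. 1 / \<phi> (K ^ 6)) \<longlonglongrightarrow> 0" by (rule real_tendsto_divide_at_top[OF tendsto_const top6])
    ultimately have "q \<longlonglongrightarrow> B * (2 * 0 + 0)" unfolding q_def by (intro tendsto_intros)
    then show ?thesis by simp
  qed
  have wq: "(B * (2 * block_weight K + 1)) / \<phi> (K ^ 6) \<le> q K" if K: "n0 \<le> K" for K
  proof -
    have K1: "1 \<le> K" using K n0_pos by simp
    have sub: "real (Suc K ^ 6 - K ^ 6) = (real K + 1) ^ 6 - real K ^ 6"
      by (simp add: of_nat_diff power_mono add.commute)
    have ph: "0 < \<phi> (K ^ 6)" using phi_pos[OF n06[OF K]] .
    have "block_weight K = (\<Sum>n\<in>{K ^ 6..<Suc K ^ 6}. d n)"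
      unfolding block_weight_def d_def using le6[of K "Suc K"] by (intro sum_Suc_diff'[symmetric]) auto
    also have "\<dots> \<le> real (card {K ^ 6..<Suc K ^ 6}) * d (K ^ 6)"
      using n06[OF K] by (intro sum_bounded_above d_antimono) auto
    also have "\<dots> = ((real K + 1) ^ 6 - real K ^ 6) * d (K ^ 6)" unfolding sub[symmetric] by simp
    finally have w: "block_weight K \<le> ((real K + 1) ^ 6 - real K ^ 6) * d (K ^ 6)" .
    have dd: "d (K ^ 6) \<le> 4 * \<phi> (K ^ 6) / real K ^ 6" using phi_lower[OF n06[OF K]] K1 by (simp add: field_simps)
    have eq: "X * (4 * u / Y) = (4 * X / Y) * u" for X Y u :: real by simp
    have "0 \<le> (real K + 1) ^ 6 - real K ^ 6" unfolding sub[symmetric] by simp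
    then have "((real K + 1) ^ 6 - real K ^ 6) * d (K ^ 6) \<le> ((real K + 1) ^ 6 - real K ^ 6) * (4 * \<phi> (K ^ 6) / real K ^ 6)"
      by (rule mult_left_mono[OF dd])
    also have "\<dots> = (4 * ((real K + 1) ^ 6 - real K ^ 6) / real K ^ 6) * \<phi> (K ^ 6)" (is "?X * (4 * ?u / ?Y) = _")
      by (rule eq[of ?X ?u ?Y])
    finally have "block_weight K \<le> (4 * ((real K + 1) ^ 6 - real K ^ 6) / real K ^ 6) * \<phi> (K ^ 6)" by (rule order_trans[OF w])
    then have "block_weight K / \<phi> (K ^ 6) \<le> 4 * ((real K + 1) ^ 6 - real K ^ 6) / real K ^ 6" using ph by (simp only: pos_divide_le_eq)
    then have "B * (2 * (block_weight K / \<phi> (K ^ 6)) + 1 / \<phi> (K ^ 6)) \<le> q K" unfolding q_def by (intro mult_left_mono add_right_mono B) simp_all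
    moreover have "(B * (2 * w + 1)) / y = B * (2 * (w / y) + 1 / y)" for w y
      by (simp add: add_divide_distrib distrib_left)
    ultimately show ?thesis by (simp only:)
  qed
  obtain \<kappa> :: "nat \<Rightarrow> nat" where \<kappa>: "\<And>N. \<kappa> N ^ 6 \<le> N" "\<And>N. N < Suc (\<kappa> N) ^ 6" "filterlim \<kappa> at_top sequentially"
    using sixth_root by blast
  have "(\<lambda>N. R N / \<phi> N) \<longlonglongrightarrow> 0"
  proof (rule Lim_null_comparison)
    have "(\<lambda>K. \<bar>R (K ^ 6) / \<phi> (K ^ 6)\<bar> + q K) \<longlonglongrightarrow> 0 + 0" by (intro tendsto_add q0 tendsto_rabs_zero Y)
    from filterlim_compose[OF this \<kappa>(3)]
    show "(\<lambda>N. \<bar>R (\<kappa> N ^ 6) / \<phi> (\<kappa> N ^ 6)\<bar> + q (\<kappa> N)) \<longlonglongrightarrow> 0" by simp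
    have "eventually (\<lambda>N. n0 \<le> \<kappa> N) sequentially" using \<kappa>(3) by (simp add: filterlim_at_top)
    then show "eventually (\<lambda>N. norm (R N / \<phi> N) \<le> \<bar>R (\<kappa> N ^ 6) / \<phi> (\<kappa> N ^ 6)\<bar> + q (\<kappa> N)) sequentially"
    proof eventually_elim
      case (elim N)
      define K where "K = \<kappa> N"
      have K: "n0 \<le> K" "K ^ 6 \<le> N" "N < Suc K ^ 6" using elim \<kappa> by (auto simp: K_def)
      have ph: "0 < \<phi> (K ^ 6)" "\<phi> (K ^ 6) \<le> \<phi> N" using phi_pos[OF n06[OF K(1)]] phi_mono[OF n06[OF K(1)] K(2)] by auto
      have "R N = R (K ^ 6) + (\<Sum>n\<in>{K ^ 6..<N}. (of_bool (n \<in> E) - d n) * g n)"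
        unfolding R_def using le6[OF K(1)] K(2) by (intro sum.atLeastLessThan_concat[symmetric])
      moreover have "\<bar>\<Sum>n\<in>{K ^ 6..<N}. (of_bool (n \<in> E) - d n) * g n\<bar> \<le> B * (2 * block_weight K + 1)"
      proof -
        have "\<bar>\<Sum>n\<in>{K ^ 6..<N}. (of_bool (n \<in> E) - d n) * g n\<bar> \<le> (\<Sum>n\<in>{K ^ 6..<N}. (of_bool (n \<in> E) + d n) * B)"
        proof (intro order_trans[OF sum_abs] sum_mono)
          fix n assume n: "n \<in> {K ^ 6..<N}"
          have "0 < d n" using d_pos[of n] n n06[OF K(1)] by simp
          then show "\<bar>(of_bool (n \<in> E) - d n) * g n\<bar> \<le> (of_bool (n \<in> E) + d n) * B"
            unfolding abs_mult by (intro mult_mono g) auto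
        qed
        also have "\<dots> = B * (real (card (E \<inter> {K ^ 6..<N})) + (\<phi> N - \<phi> (K ^ 6)))"
        proof -
          have "(\<Sum>n\<in>{K ^ 6..<N}. of_bool (n \<in> E) :: real) = real (card (E \<inter> {K ^ 6..<N}))"
            by (subst sum.mono_neutral_cong_right[of _ "E \<inter> {K ^ 6..<N}" _ "\<lambda>_. 1"]) auto
          moreover have "(\<Sum>n\<in>{K ^ 6..<N}. d n) = \<phi> N - \<phi> (K ^ 6)" unfolding d_def using K(2) by (rule sum_Suc_diff')
          moreover have "(\<Sum>n\<in>{K ^ 6..<N}. (of_bool (n \<in> E) + d n) * B) = ((\<Sum>n\<in>{K ^ 6..<N}. of_bool (n \<in> E)) + (\<Sum>n\<in>{K ^ 6..<N}. d n)) * B"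
            unfolding sum.distrib[symmetric] by (rule sum_distrib_right[symmetric])
          ultimately show ?thesis by (simp only: mult.commute[of B])
        qed
        also have "\<dots> \<le> B * (2 * block_weight K + 1)"
        proof (rule mult_left_mono[OF _ B])
          have "real_of_int (int (card (E \<inter> {K ^ 6..<N}))) = of_int (\<lceil>\<phi> N\<rceil> - \<lceil>\<phi> (K ^ 6)\<rceil>)"
            unfolding card_E[OF n06[OF K(1)] K(2)] ..
          then have "real (card (E \<inter> {K ^ 6..<N})) \<le> \<phi> N - \<phi> (K ^ 6) + 1" by simp linarith
          moreover have "\<phi> N \<le> \<phi> (Suc K ^ 6)" using K n06[OF K(1)] by (intro phi_mono) auto
          ultimately show "real (card (E \<inter> {K ^ 6..<N})) + (\<phi> N - \<phi> (K ^ 6)) \<le> 2 * block_weight K + 1"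
            by (simp add: block_weight_def)
        qed
        finally show ?thesis .
      qed
      ultimately have "\<bar>R N\<bar> \<le> \<bar>R (K ^ 6)\<bar> + B * (2 * block_weight K + 1)" by linarith
      then have "\<bar>R N\<bar> / \<phi> N \<le> (\<bar>R (K ^ 6)\<bar> + B * (2 * block_weight K + 1)) / \<phi> (K ^ 6)"
        using ph by (intro frac_le) auto
      also have "\<dots> \<le> \<bar>R (K ^ 6) / \<phi> (K ^ 6)\<bar> + q K" using wq[OF K(1)] ph by (simp add: add_divide_distrib)
      finally show ?case using ph by (simp add: K_def)
    qed
  qed
  then show ?thesis by (simp add: R_def)
qed

theorem bounded_convergence:
  fixes f :: "'a \<Rightarrow> real"
  assumes mp: "measure_preserving M T" and sf: "sigma_finite_measure M" and f: "integrable M f" "\<And>x. \<bar>f x\<bar> \<le> B"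
  shows "AE x in M. convergent (\<lambda>N. full_average T f N x)"
proof -
  interpret measure_preserving M T by fact
  show ?thesis
    using birkhoff_bounded[OF sf f] block_errors_tendsto_0[OF mp f]
  proof eventually_elim
    case (elim x)
    define g where "g = (\<lambda>n. f ((T ^^ n) x))"
    obtain L where L: "(\<lambda>n. (\<Sum>i<n. g i) / real n) \<longlonglongrightarrow> L"
      using elim(1) unfolding convergent_def time_average_def orbit_sum_def g_def by blast
    define p where "p = n0 ^ 6"
    have p: "n0 \<le> p" unfolding p_def using n0_pos by (intro self_le_power) auto
    have A: "(\<lambda>N. (\<Sum>n\<in>{p..<N}. d n * g n) / \<phi> N) \<longlonglongrightarrow> L" by (rule weighted_average_tendsto[OF p L])
    have D: "(\<lambda>N. (\<Sum>n\<in>{p..<N}. (of_bool (n \<in> E) - d n) * g n) / \<phi> N) \<longlonglongrightarrow> 0"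
      unfolding p_def by (rule discrepancy_tendsto_0[of g B]) (use f(2) elim(2) in \<open>simp_all add: g_def\<close>)
    have I: "(\<lambda>N. (\<Sum>n\<in>E \<inter> {..<p}. g n) / \<phi> N) \<longlonglongrightarrow> 0" by (rule real_tendsto_divide_at_top[OF tendsto_const phi_at_top])
    have "(\<lambda>N. (\<Sum>n\<in>E \<inter> {..<p}. g n) / \<phi> N + (\<Sum>n\<in>{p..<N}. (of_bool (n \<in> E) - d n) * g n) / \<phi> N + 
       (\<Sum>n\<in>{p..<N}. d n * g n) / \<phi> N) \<longlonglongrightarrow> 0 + 0 + L" by (intro tendsto_add I D A)
    moreover have "eventually (\<lambda>N. (\<Sum>n\<in>E \<inter> {..<p}. g n) / \<phi> N + (\<Sum>n\<in>{p..<N}. (of_bool (n \<in> E) - d n) * g n) / \<phi> N + 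
       (\<Sum>n\<in>{p..<N}. d n * g n) / \<phi> N = full_average T f N x) sequentially"
      using eventually_ge_at_top[of p]
    proof eventually_elim
      case (elim N)
      have "(\<Sum>n\<in>{p..<N}. (of_bool (n \<in> E) - d n) * g n) + (\<Sum>n\<in>{p..<N}. d n * g n) = (\<Sum>n\<in>{p..<N}. of_bool (n \<in> E) * g n)"
        by (simp add: left_diff_distrib flip: sum.distrib)
      also have "\<dots> = (\<Sum>n\<in>E \<inter> {p..<N}. g n)" by (rule sum.mono_neutral_cong_right) auto
      finally have "(\<Sum>n\<in>E \<inter> {..<p}. g n) + (\<Sum>n\<in>{p..<N}. (of_bool (n \<in> E) - d n) * g n) + (\<Sum>n\<in>{p..<N}. d n * g n) = 
         (\<Sum>n\<in>E \<inter> {..<p}. g n) + (\<Sum>n\<in>E \<inter> {p..<N}. g n)" by simp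
      also have "\<dots> = (\<Sum>n\<in>(E \<inter> {..<p}) \<union> (E \<inter> {p..<N}). g n)" by (rule sum.union_disjoint[symmetric]) auto
      also have "(E \<inter> {..<p}) \<union> (E \<inter> {p..<N}) = E \<inter> {..<N}" using elim by auto
      finally show ?case by (simp add: full_average_def g_def flip: add_divide_distrib)
    qed
    ultimately have "(\<lambda>N. full_average T f N x) \<longlonglongrightarrow> 0 + 0 + L" by (rule Lim_transform_eventually)
    then show ?case by (rule convergentI)
  qed
qed

text \<open>The blocks form a geometric sum: \<open>\<phi>\<close> grows at least by 5/4 under
  doubling, so \<open>5 * c * \<phi> (2 ^ K)\<close> is at most
  \<open>4 * c * \<phi> (2 ^ Suc K)\<close> and the next block fits in.\<close>

lemma sum_le_of_block_average_le:
  fixes g :: "'a \<Rightarrow> real"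
  assumes g: "\<And>x. 0 \<le> g x" and k0: "n0 \<le> 2 ^ k0" and c: "0 \<le> c"
    and bl: "\<And>k. k0 \<le> k \<Longrightarrow> block_average T g k x \<le> c" and N: "2 ^ k0 \<le> N"
  shows "(\<Sum>n\<in>E \<inter> {2 ^ k0..<N}. g ((T ^^ n) x)) \<le> 5 * c * \<phi> N"
proof -
  define s where "s = (\<lambda>A. \<Sum>n\<in>E \<inter> A. g ((T ^^ n) x))"
  define u where "u = (\<lambda>k::nat. 2 ^ k :: nat)"
  have u_Suc: "u (Suc k) = 2 * u k" for k by (simp add: u_def)
  have u_mono: "u k \<le> u l" if "k \<le> l" for k l using that by (simp add: u_def)
  have pw: "n0 \<le> u k" if "k0 \<le> k" for k unfolding u_def by (rule order_trans[OF k0 u_mono[OF that, unfolded u_def]])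
  have blk: "s {u k..<u (Suc k)} \<le> c * \<phi> (u k)" if "k0 \<le> k" for k
    using bl[OF that] phi_pos[OF pw[OF that]] unfolding block_average_def s_def u_def by (simp only: pos_divide_le_eq)
  have main: "s {u k0..<u (Suc K)} \<le> 5 * c * \<phi> (u K)" if "k0 \<le> K" for K
    using that
  proof (induction K rule: dec_induct)
    case base
    have "0 \<le> c * \<phi> (u k0)" using c phi_pos[OF pw[of k0]] by simp
    then show ?case using blk[of k0] by simp
  next
    case (step K)
    have "s {u k0..<u (Suc (Suc K))} = s {u k0..<u (Suc K)} + s {u (Suc K)..<u (Suc (Suc K))}"
    proof -
      have "E \<inter> {u k0..<u (Suc (Suc K))} = (E \<inter> {u k0..<u (Suc K)}) \<union> (E \<inter> {u (Suc K)..<u (Suc (Suc K))})"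
        using u_mono[of k0 "Suc K"] u_mono[of "Suc K" "Suc (Suc K)"] step by auto
      then show ?thesis unfolding s_def by (simp only:) (rule sum.union_disjoint, auto)
    qed
    also have "\<dots> \<le> 5 * c * \<phi> (u K) + c * \<phi> (u (Suc K))" using step by (intro add_mono blk) auto
    also have "5 * c * \<phi> (u K) \<le> 4 * (c * \<phi> (u (Suc K)))"
      using mult_left_mono[OF phi_doubling(1)[OF pw[OF step(1)]] c] unfolding u_Suc by simp
    finally show ?case by simp
  qed
  have "1 \<le> N" using N by (meson one_le_numeral one_le_power order_trans)
  then obtain K where K: "u K \<le> N" "N < u (Suc K)" using ex_power_ivl1[of 2 N] by (auto simp: u_def)
  have "k0 \<le> K"
  proof (rule ccontr)
    assume "\<not> k0 \<le> K"
    then show False using u_mono[of "Suc K" k0] K N by (simp add: u_def)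
  qed
  have "s {u k0..<N} \<le> s {u k0..<u (Suc K)}" unfolding s_def using K g by (intro sum_mono2) auto
  also have "\<dots> \<le> 5 * c * \<phi> (u K)" by (rule main[OF \<open>k0 \<le> K\<close>])
  also have "\<dots> \<le> 5 * c * \<phi> N" using c phi_mono[OF pw[OF \<open>k0 \<le> K\<close>] K(1)] by (intro mult_left_mono) auto
  finally show ?thesis by (simp add: s_def u_def)
qed

lemma full_average_diff:
  assumes "n0 \<le> N"
  shows "\<bar>full_average T f N x - full_average T g N x\<bar> \<le> (\<Sum>n\<in>E \<inter> {..<N}. \<bar>f ((T ^^ n) x) - g ((T ^^ n) x)\<bar>) / \<phi> N"
proof -
  have "full_average T f N x - full_average T g N x = (\<Sum>n\<in>E \<inter> {..<N}. f ((T ^^ n) x) - g ((T ^^ n) x)) / \<phi> N"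
    by (simp only: full_average_def sum_subtractf diff_divide_distrib)
  then show ?thesis using phi_pos[OF assms] by (simp add: divide_right_mono sum_abs)
qed

lemma card_E_asymptotic: "(\<lambda>N. real (card (E \<inter> {..<N})) / \<phi> N) \<longlonglongrightarrow> 1"
proof -
  define K where "K = real (card (E \<inter> {..<n0})) + \<bar>\<phi> n0\<bar> + 2"
  have "(\<lambda>N. real (card (E \<inter> {..<N})) / \<phi> N - 1) \<longlonglongrightarrow> 0"
  proof (rule Lim_null_comparison)
    show "(\<lambda>N. K / \<phi> N) \<longlonglongrightarrow> 0" by (rule real_tendsto_divide_at_top[OF tendsto_const phi_at_top])
    show "eventually (\<lambda>N. norm (real (card (E \<inter> {..<N})) / \<phi> N - 1) \<le> K / \<phi> N) sequentially"
      using eventually_ge_at_top[of n0]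
    proof eventually_elim
      case (elim N)
      have split: "E \<inter> {..<N} = (E \<inter> {..<n0}) \<union> (E \<inter> {n0..<N})" using elim by auto
      have "card (E \<inter> {..<N}) = card (E \<inter> {..<n0}) + card (E \<inter> {n0..<N})"
        unfolding split by (rule card_Un_disjoint) auto
      moreover have "real_of_int (int (card (E \<inter> {n0..<N}))) = of_int (\<lceil>\<phi> N\<rceil> - \<lceil>\<phi> n0\<rceil>)"
        unfolding card_E[OF order_refl elim] ..
      ultimately have "\<bar>real (card (E \<inter> {..<N})) - \<phi> N\<bar> \<le> K" unfolding K_def by simp linarith
      then have "\<bar>real (card (E \<inter> {..<N})) - \<phi> N\<bar> / \<phi> N \<le> K / \<phi> N"
        using phi_pos[OF elim] by (intro divide_right_mono) auto
      moreover have "real (card (E \<inter> {..<N})) / \<phi> N - 1 = (real (card (E \<inter> {..<N})) - \<phi> N) / \<phi> N"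
        using phi_pos[OF elim] by (simp add: diff_divide_distrib)
      ultimately show ?case using phi_pos[OF elim] by simp
    qed
  qed
  then show ?thesis by (simp add: LIM_zero_iff)
qed

text \<open>The truncations \<open>h j\<close> approximate \<open>f\<close> in
  \<open>L\<^sup>1\<close>. For fixed \<open>l\<close> the measure of \<open>bad l j\<close> tends
  to 0 with \<open>j\<close>, so the intersection over \<open>j\<close> is null: almost every point
  admits a truncation whose error has small averages at all scales from \<open>k0\<close>
  on.\<close>

theorem integrable_convergence:
  fixes f :: "'a \<Rightarrow> real"
  assumes mp: "measure_preserving M T" and sf: "sigma_finite_measure M" and f: "integrable M f"
  shows "AE x in M. convergent (\<lambda>N. full_average T f N x)"
proof -
  interpret measure_preserving M T by fact
  define h where "h = (\<lambda>(j::nat) x. if \<bar>f x\<bar> \<le> real j then f x else 0)"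
  define r where "r = (\<lambda>j x. \<bar>f x - h j x\<bar>)"
  have [measurable]: "f \<in> borel_measurable M" using f by simp
  have h_meas [measurable]: "h j \<in> borel_measurable M" for j unfolding h_def by measurable
  have h_int: "integrable M (h j)" for j by (rule Bochner_Integration.integrable_bound[OF f]) (auto simp: h_def)
  have r_int: "integrable M (r j)" for j unfolding r_def using f h_int by auto
  then have [measurable]: "r j \<in> borel_measurable M" for j by simp
  have r_nn: "0 \<le> r j x" for j x by (simp add: r_def)
  have "(\<lambda>j. \<integral>x. r j x \<partial>M) \<longlonglongrightarrow> (\<integral>x. 0 \<partial>M)"
  proof (rule integral_dominated_convergence[where w = "\<lambda>x. \<bar>f x\<bar>"])
    show "AE x in M. (\<lambda>j. r j x) \<longlonglongrightarrow> 0"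
    proof (rule AE_I2)
      fix x
      obtain j0 :: nat where j0: "\<bar>f x\<bar> \<le> real j0" using real_arch_simple by blast
      have "eventually (\<lambda>j. r j x = 0) sequentially"
        using eventually_ge_at_top[of j0] by eventually_elim (use j0 in \<open>simp add: r_def h_def\<close>)
      then show "(\<lambda>j. r j x) \<longlonglongrightarrow> 0" by (rule tendsto_eventually)
    qed
  qed (use f in \<open>auto simp: r_def h_def\<close>)
  then have r0: "(\<lambda>j. \<integral>x. r j x \<partial>M) \<longlonglongrightarrow> 0" by simp
  obtain D k0 where D: "1 \<le> D" and k0: "n0 \<le> 2 ^ k0"
    and max: "\<forall>(M :: 'a measure) T g l. measure_preserving M T \<longrightarrow> integrable M g \<longrightarrow> (\<forall>x. 0 \<le> g x) \<longrightarrow> 0 < l \<longrightarrow>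
       emeasure M {x \<in> space M. \<exists>k\<ge>k0. D * l < block_average T g k x} \<le> ennreal (D / l * (\<integral>x. g x \<partial>M))"
    using maximal_inequality by blast
  define bad where "bad = (\<lambda>l j. {x \<in> space M. \<exists>k\<ge>k0. D * l < block_average T (r j) k x})"
  have bad_meas [measurable]: "bad l j \<in> sets M" for l j unfolding bad_def block_average_def by measurable
  have bad_le: "emeasure M (bad l j) \<le> ennreal (D / l * (\<integral>x. r j x \<partial>M))" if "0 < l" for l j
    using max[rule_format, OF mp r_int r_nn that] unfolding bad_def .
  have good: "AE x in M. \<exists>j. x \<notin> bad l j" if l: "0 < l" for l
  proof (rule AE_I')
    have "(\<lambda>j. D / l * (\<integral>x. r j x \<partial>M)) \<longlonglongrightarrow> D / l * 0" by (intro tendsto_mult_left r0)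
    then have "(\<lambda>j. ennreal (D / l * (\<integral>x. r j x \<partial>M))) \<longlonglongrightarrow> ennreal (D / l * 0)" by (rule tendsto_ennrealI)
    moreover have "emeasure M (\<Inter>j. bad l j) \<le> ennreal (D / l * (\<integral>x. r j x \<partial>M))" for j
      by (rule order_trans[OF emeasure_mono bad_le[OF l]]) auto
    ultimately have "emeasure M (\<Inter>j. bad l j) \<le> ennreal (D / l * 0)" by (intro LIMSEQ_le_const) auto
    then show "(\<Inter>j. bad l j) \<in> null_sets M" by (auto simp: null_sets_def)
  qed auto
  have g1: "AE x in M. \<forall>i. \<exists>j. x \<notin> bad (inverse (real (Suc i))) j"
    unfolding AE_all_countable by (intro allI good) simp
  have g2: "AE x in M. \<forall>j. convergent (\<lambda>N. full_average T (h j) N x)"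
    unfolding AE_all_countable
  proof
    fix j
    show "AE x in M. convergent (\<lambda>N. full_average T (h j) N x)"
      by (rule bounded_convergence[OF mp sf h_int, of _ "real j"]) (simp add: h_def)
  qed
  show ?thesis using g1 g2 AE_space
  proof eventually_elim
    case (elim x)
    show ?case
    proof (rule convergent_of_approx)
      fix \<epsilon> :: real assume \<epsilon>: "0 < \<epsilon>"
      \<comment> \<open>10 is twice the constant 5 of \<open>sum_le_of_block_average_le\<close>: the
        blocks from \<open>2 ^ k0\<close> on use one half of \<open>\<epsilon>\<close>, the finitely
        many earlier terms the other.\<close>
      have "0 < \<epsilon> / (10 * D)" using \<epsilon> D by simp
      then obtain i where i: "inverse (real (Suc i)) < \<epsilon> / (10 * D)" using reals_Archimedean by blast
      define l where "l = inverse (real (Suc i))"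
      have l: "0 < l" "5 * (D * l) < \<epsilon> / 2" using i D by (simp_all add: l_def field_simps)
      obtain j where "x \<notin> bad l j" using elim(1) unfolding l_def by blast
      then have bl: "block_average T (r j) k x \<le> D * l" if "k0 \<le> k" for k
        using that elim(3) unfolding bad_def by (simp add: not_less)
      define C where "C = (\<Sum>n\<in>E \<inter> {..<2 ^ k0}. r j ((T ^^ n) x))"
      have "(\<lambda>N. C / \<phi> N) \<longlonglongrightarrow> 0" by (rule real_tendsto_divide_at_top[OF tendsto_const phi_at_top])
      then have "eventually (\<lambda>N. C / \<phi> N < \<epsilon> / 2) sequentially" using \<epsilon> by (intro order_tendstoD(2)) auto
      then have "eventually (\<lambda>N. \<bar>full_average T f N x - full_average T (h j) N x\<bar> \<le> \<epsilon>) sequentially"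
        using eventually_ge_at_top[of "2 ^ k0"]
      proof eventually_elim
        case (elim N)
        have N: "n0 \<le> N" using k0 elim(2) by simp
        have split: "E \<inter> {..<N} = (E \<inter> {..<2 ^ k0}) \<union> (E \<inter> {2 ^ k0..<N})" using elim(2) by auto
        have "(\<Sum>n\<in>E \<inter> {..<N}. r j ((T ^^ n) x)) = C + (\<Sum>n\<in>E \<inter> {2 ^ k0..<N}. r j ((T ^^ n) x))"
          unfolding C_def split by (rule sum.union_disjoint) auto
        also have "\<dots> \<le> C + 5 * (D * l) * \<phi> N"
          using sum_le_of_block_average_le[OF r_nn k0 _ bl elim(2)] D l by simp
        finally have "(\<Sum>n\<in>E \<inter> {..<N}. r j ((T ^^ n) x)) / \<phi> N \<le> (C + 5 * (D * l) * \<phi> N) / \<phi> N"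
          using phi_pos[OF N] by (intro divide_right_mono) auto
        also have "\<dots> = C / \<phi> N + 5 * (D * l)" using phi_pos[OF N] by (simp add: add_divide_distrib)
        also have "\<dots> \<le> \<epsilon>" using l(2) elim(1) by linarith
        finally show ?case using full_average_diff[OF N, of T f x "h j"] by (simp add: r_def)
      qed
      then show "\<exists>b. convergent b \<and> eventually (\<lambda>N. \<bar>full_average T f N x - b N\<bar> \<le> \<epsilon>) sequentially"
        using elim(2) by (intro exI[of _ "\<lambda>N. full_average T (h j) N x"]) auto
    qed
  qed
qed

text \<open>The discarded values are uniformly small and change the averages by at most twice the
  cutoff for large \<open>N\<close>. The rest is integrable because
  \<open>t = Suc k * \<bar>f x\<bar>\<close> is at least 1 there, whence
  \<open>t \<le> t powr p\<close>.\<close>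

theorem Lp_convergence:
  fixes f :: "'a \<Rightarrow> real"
  assumes mp: "measure_preserving M T" and sf: "sigma_finite_measure M"
    and f [measurable]: "f \<in> borel_measurable M" and fp: "integrable M (\<lambda>x. \<bar>f x\<bar> powr p)" and p: "1 \<le> p"
  shows "AE x in M. convergent (\<lambda>N. full_average T f N x)"
proof -
  define h where "h = (\<lambda>(k::nat) x. if \<bar>f x\<bar> \<le> inverse (real (Suc k)) then 0 else f x)"
  have h_meas [measurable]: "h k \<in> borel_measurable M" for k unfolding h_def by measurable
  have h_int: "integrable M (h k)" for k
  proof (rule Bochner_Integration.integrable_bound)
    show "integrable M (\<lambda>x. real (Suc k) powr p * \<bar>f x\<bar> powr p)" using fp by (intro integrable_mult_right)
    show "AE x in M. norm (h k x) \<le> norm (real (Suc k) powr p * \<bar>f x\<bar> powr p)"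
    proof (rule AE_I2)
      fix x
      show "norm (h k x) \<le> norm (real (Suc k) powr p * \<bar>f x\<bar> powr p)"
      proof (cases "\<bar>f x\<bar> \<le> inverse (real (Suc k))")
        case False
        define t where "t = real (Suc k) * \<bar>f x\<bar>"
        have t: "1 \<le> t" using False by (simp add: t_def field_simps)
        have "1 * \<bar>f x\<bar> \<le> t" unfolding t_def by (intro mult_right_mono) auto
        also have "t \<le> t powr p" using powr_mono[OF p t] t by simp
        also have "t powr p = real (Suc k) powr p * \<bar>f x\<bar> powr p" unfolding t_def by (rule powr_mult)
        finally show ?thesis using False by (simp add: h_def)
      qed (simp add: h_def)
    qed
  qed simp
  have "AE x in M. \<forall>k. convergent (\<lambda>N. full_average T (h k) N x)"
    unfolding AE_all_countable by (intro allI integrable_convergence[OF mp sf h_int])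
  then show ?thesis
  proof eventually_elim
    case (elim x)
    show ?case
    proof (rule convergent_of_approx)
      fix \<epsilon> :: real assume \<epsilon>: "0 < \<epsilon>"
      obtain k where k: "inverse (real (Suc k)) < \<epsilon> / 2" using reals_Archimedean[of "\<epsilon> / 2"] \<epsilon> by auto
      define l where "l = inverse (real (Suc k))"
      have l: "0 < l" "2 * l \<le> \<epsilon>" using k by (simp_all add: l_def)
      have "eventually (\<lambda>N. real (card (E \<inter> {..<N})) / \<phi> N < 2) sequentially"
        by (rule order_tendstoD(2)[OF card_E_asymptotic]) simp
      then have "eventually (\<lambda>N. \<bar>full_average T f N x - full_average T (h k) N x\<bar> \<le> \<epsilon>) sequentially"
        using eventually_ge_at_top[of n0]
      proof eventually_elim
        case (elim N)
        have "(\<Sum>n\<in>E \<inter> {..<N}. \<bar>f ((T ^^ n) x) - h k ((T ^^ n) x)\<bar>) \<le> real (card (E \<inter> {..<N})) * l"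
          using l by (intro sum_bounded_above) (auto simp: h_def l_def)
        then have "(\<Sum>n\<in>E \<inter> {..<N}. \<bar>f ((T ^^ n) x) - h k ((T ^^ n) x)\<bar>) / \<phi> N \<le> real (card (E \<inter> {..<N})) * l / \<phi> N"
          using phi_pos[OF elim(2)] by (intro divide_right_mono) auto
        also have "\<dots> = (real (card (E \<inter> {..<N})) / \<phi> N) * l" by simp
        also have "\<dots> \<le> 2 * l" using elim(1) l by (intro mult_right_mono) auto
        finally show ?case using l full_average_diff[OF elim(2), of T f x "h k"] by linarith
      qed
      then show "\<exists>b. convergent b \<and> eventually (\<lambda>N. \<bar>full_average T f N x - b N\<bar> \<le> \<epsilon>) sequentially"
        using elim by (intro exI[of _ "\<lambda>N. full_average T (h k) N x"]) auto
    qed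
  qed
qed

end

section \<open>Functions of the family\<close>

lemma differentiable_on_deriv_on:
  fixes f :: "real \<Rightarrow> real"
  assumes "f differentiable_on {a..}" "a < x"
  shows "(f has_real_derivative deriv_on {a..} f x) (at x)"
proof -
  have "f differentiable (at x within {a..})" using assms by (auto simp: differentiable_on_def)
  then obtain D where D: "(f has_real_derivative D) (at x within {a..})" by (auto simp: real_differentiable_def)
  moreover have "at x within {a..} = at x" using assms(2) by (intro at_within_interior) simp
  ultimately show ?thesis using deriv_on_atLeast_eq[OF less_imp_le[OF assms(2)] D] by simp
qed

lemma C_on_differentiable: "C_on k S f \<Longrightarrow> i < k \<Longrightarrow> (deriv_on S ^^ i) f differentiable_on S"
  by (simp add: C_on_def)

text \<open>\<open>b\<close> is the logarithmic derivative \<open>y * \<phi>' / \<phi>\<close>, and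
  \<open>p\<close> and \<open>q\<close> arise from it by applying \<open>y * d/dy\<close> once and
  twice. In this scale the limits on \<open>\<theta>\<close> carry over to the inverse function,
  since \<open>y * d/dy\<close> corresponds to \<open>x * d/dx\<close> up to the bounded factor
  \<open>b\<close>.\<close>

lemma family_F_inverse:
  assumes c: "1 < c" and F: "family_F c x0 h"
  obtains \<phi> b p q :: "real \<Rightarrow> real" and y0 where
    "0 < y0" "\<And>y. y0 < y \<Longrightarrow> x0 < \<phi> y \<and> h (\<phi> y) = y" "\<And>y. y0 < y \<Longrightarrow> 0 < b y"
    "\<And>y. y0 < y \<Longrightarrow> (\<phi> has_real_derivative \<phi> y * b y / y) (at y)"
    "\<And>y. y0 < y \<Longrightarrow> (b has_real_derivative p y / y) (at y)"
    "\<And>y. y0 < y \<Longrightarrow> (p has_real_derivative q y / y) (at y)"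
    "(b \<longlongrightarrow> 1 / c) at_top" "(p \<longlongrightarrow> 0) at_top" "(q \<longlongrightarrow> 0) at_top"
    "\<And>x x'. x0 \<le> x \<Longrightarrow> x < x' \<Longrightarrow> h x < h x'"
proof -
  have x0: "1 \<le> x0" and h1: "\<And>x. x0 \<le> x \<Longrightarrow> 1 \<le> h x" and hC: "C_on 3 {x0..} h"
    and h'_pos: "\<And>x. x0 \<le> x \<Longrightarrow> 0 < deriv_on {x0..} h x"
    using F by (auto simp: family_F_def)
  have "\<exists>\<theta> C. C_on 3 {x0..} \<theta> \<and> C > 0 \<and>
        (\<forall>x\<ge>x0. h x = C * x powr c * exp (integral {x0..x} (\<lambda>t. \<theta> t / t))) \<and>
        (\<forall>i\<le>3. ((\<lambda>x. x ^ i * (deriv_on {x0..} ^^ i) \<theta> x) \<longlongrightarrow> 0) at_top)"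
    using F unfolding family_F_def by (elim conjE)
  then obtain \<theta> C where \<theta>C: "C_on 3 {x0..} \<theta>" and C: "0 < C"
    and h_eq': "\<forall>x\<ge>x0. h x = C * x powr c * exp (integral {x0..x} (\<lambda>t. \<theta> t / t))"
    and lim: "\<forall>i\<le>3. ((\<lambda>x. x ^ i * (deriv_on {x0..} ^^ i) \<theta> x) \<longlongrightarrow> 0) at_top"
    by (elim exE conjE) (rule that)
  have h_eq: "h x = C * x powr c * exp (integral {x0..x} (\<lambda>t. \<theta> t / t))" if "x0 \<le> x" for x
    using h_eq'[rule_format, OF that] .
  define \<theta>1 where "\<theta>1 = deriv_on {x0..} \<theta>"
  define \<theta>2 where "\<theta>2 = deriv_on {x0..} \<theta>1"
  have diff: "\<theta> differentiable_on {x0..}" "\<theta>1 differentiable_on {x0..}" "h differentiable_on {x0..}"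
    using C_on_differentiable[OF \<theta>C, of 0] C_on_differentiable[OF \<theta>C, of 1] C_on_differentiable[OF hC, of 0]
    by (simp_all add: \<theta>1_def)
  have d\<theta>: "(\<theta> has_real_derivative \<theta>1 x) (at x)" and d\<theta>1: "(\<theta>1 has_real_derivative \<theta>2 x) (at x)" if "x0 < x" for x
    unfolding \<theta>1_def \<theta>2_def using differentiable_on_deriv_on[OF _ that] diff by (auto simp: \<theta>1_def)
  have "((\<lambda>x. x ^ 0 * (deriv_on {x0..} ^^ 0) \<theta> x) \<longlongrightarrow> 0) at_top" "((\<lambda>x. x ^ 1 * (deriv_on {x0..} ^^ 1) \<theta> x) \<longlongrightarrow> 0) at_top"
    "((\<lambda>x. x ^ 2 * (deriv_on {x0..} ^^ 2) \<theta> x) \<longlongrightarrow> 0) at_top"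
    by (rule lim[rule_format], simp)+
  then have \<theta>_lim: "(\<theta> \<longlongrightarrow> 0) at_top" "((\<lambda>x. x * \<theta>1 x) \<longlongrightarrow> 0) at_top" "((\<lambda>x. x\<^sup>2 * \<theta>2 x) \<longlongrightarrow> 0) at_top"
    by (simp_all add: \<theta>1_def \<theta>2_def numeral_2_eq_2)
  have h_cont: "continuous_on {x0..} h" using diff(3) by (rule differentiable_imp_continuous_on)
  have h_mono: "h x < h x'" if "x0 \<le> x" "x < x'" for x x'
  proof (rule DERIV_pos_imp_increasing_open[OF that(2)])
    fix t assume "x < t" "t < x'"
    then have "x0 < t" using that by simp
    then show "\<exists>w. (h has_real_derivative w) (at t) \<and> 0 < w"
      using differentiable_on_deriv_on[OF diff(3)] h'_pos[of t] by (intro exI[of _ "deriv_on {x0..} h t"]) auto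
  next
    show "continuous_on {x..x'} h" by (rule continuous_on_subset[OF h_cont]) (use that in auto)
  qed
  have dh: "(h has_real_derivative h x * (c + \<theta> x) / x) (at x)" if x: "x0 < x" for x
  proof -
    define J where "J = (\<lambda>x. integral {x0..x} (\<lambda>t. \<theta> t / t))"
    have cont: "continuous_on {x0..x + 1} (\<lambda>t. \<theta> t / t)"
      using differentiable_imp_continuous_on[OF diff(1)] x0
      by (intro continuous_on_divide continuous_on_id) (auto elim: continuous_on_subset)
    have "(J has_real_derivative \<theta> x / x) (at x within {x0..x + 1})"
      unfolding J_def using x by (intro integral_has_real_derivative cont) auto
    then have dJ: "(J has_real_derivative \<theta> x / x) (at x)" using x by (simp add: at_within_Icc_at)
    have hx: "h x = C * x powr c * exp (J x)" using h_eq[of x] x by (simp add: J_def)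
    have px: "x powr (c - 1) = x powr c / x" using x x0 by (simp add: powr_diff)
    have "((\<lambda>x. C * x powr c * exp (J x)) has_real_derivative
        C * x powr c * (exp (J x) * (\<theta> x / x)) + C * (c * x powr (c - 1)) * exp (J x)) (at x)"
      using dJ has_real_derivative_powr[of x c] x x0
      by (intro DERIV_mult' DERIV_cmult DERIV_fun_exp) (simp_all add: mult_ac)
    also have "C * x powr c * (exp (J x) * (\<theta> x / x)) + C * (c * x powr (c - 1)) * exp (J x) = h x * (c + \<theta> x) / x"
      unfolding hx px using x x0 by (simp add: field_simps)
    finally show ?thesis
      by (rule has_field_derivative_transform_within_open[of _ _ _ "{x0<..}"]) (use x h_eq in \<open>auto simp: J_def\<close>)
  qed
  have c\<theta>_pos: "0 < c + \<theta> x" if x: "x0 < x" for x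
  proof -
    have "deriv_on {x0..} h x = h x * (c + \<theta> x) / x"
      using DERIV_unique[OF differentiable_on_deriv_on[OF diff(3) x] dh[OF x]] .
    then have "0 < h x * (c + \<theta> x) / x" using h'_pos[of x] x by simp
    then show ?thesis using h1[of x] x x0 by (simp add: zero_less_divide_iff zero_less_mult_iff)
  qed
  \<comment> \<open>Eventually \<open>c + \<theta> x\<close> exceeds 1, so \<open>h x / x\<close> is
    nondecreasing from some point on and \<open>h\<close> grows at least linearly.\<close>
  have h_unbounded: "\<exists>x>x0. y < h x" for y
  proof -
    have "eventually (\<lambda>x. 1 - c < \<theta> x) at_top" using c by (intro order_tendstoD(1)[OF \<theta>_lim(1)]) simp
    then have "eventually (\<lambda>x. 1 - c < \<theta> x \<and> x0 < x) at_top" by (intro eventually_conj eventually_gt_at_top)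
    then obtain x1 where x1: "\<And>x. x1 \<le> x \<Longrightarrow> 1 - c < \<theta> x \<and> x0 < x" unfolding eventually_at_top_linorder by blast
    have inc: "h x1 / x1 \<le> h x / x" if "x1 \<le> x" for x
    proof (rule DERIV_nonneg_imp_nondecreasing[OF that])
      fix t assume "x1 \<le> t" "t \<le> x"
      then have t: "1 - c < \<theta> t" "x0 < t" using x1[of t] by auto
      then have "((\<lambda>x. h x / x) has_real_derivative h t * (c + \<theta> t - 1) / t\<^sup>2) (at t)"
        using dh[OF t(2)] x0 by (auto intro!: derivative_eq_intros simp: field_simps power2_eq_square)
      moreover have "0 \<le> h t * (c + \<theta> t - 1) / t\<^sup>2" using h1[of t] t by simp
      ultimately show "\<exists>w. ((\<lambda>x. h x / x) has_real_derivative w) (at t) \<and> 0 \<le> w" by blast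
    qed
    define k where "k = h x1 / x1"
    have k: "0 < k" using h1[of x1] x1[of x1] x0 by (simp add: k_def)
    define x where "x = max x1 ((y + 1) / k)"
    have "x1 \<le> x" "(y + 1) / k \<le> x" by (simp_all add: x_def)
    then have "x0 < x" "y + 1 \<le> k * x" using x1[of x] k by (simp_all add: field_simps)
    moreover have "k * x \<le> h x" using inc[OF \<open>x1 \<le> x\<close>] \<open>x0 < x\<close> x0 by (simp add: k_def field_simps)
    ultimately show ?thesis by (intro exI[of _ x]) auto
  qed
  define y0 where "y0 = h x0"
  define \<phi> where "\<phi> = (\<lambda>y. SOME x. x0 < x \<and> h x = y)"
  have ex: "\<exists>x. x0 < x \<and> h x = y" if y: "y0 < y" for y
  proof -
    obtain X where X: "x0 < X" "y < h X" using h_unbounded by blast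
    have "\<exists>x\<ge>x0. x \<le> X \<and> h x = y"
      using X y by (intro IVT') (auto simp: y0_def intro: continuous_on_subset[OF h_cont])
    then obtain x where "x0 \<le> x" "h x = y" by blast
    moreover have "x \<noteq> x0" using y \<open>h x = y\<close> by (auto simp: y0_def)
    ultimately show ?thesis by (intro exI[of _ x]) auto
  qed
  have \<phi>: "x0 < \<phi> y" "h (\<phi> y) = y" if "y0 < y" for y
    using someI_ex[OF ex[OF that]] unfolding \<phi>_def by auto
  have \<phi>_h: "\<phi> (h x) = x" if x: "x0 < x" for x
  proof -
    have "y0 < h x" using h_mono[OF order_refl x] by (simp add: y0_def)
    then have "x0 < \<phi> (h x)" "h (\<phi> (h x)) = h x" using \<phi> by auto
    then show ?thesis using h_mono[of x "\<phi> (h x)"] h_mono[of "\<phi> (h x)" x] x by (metis less_imp_le less_irrefl linorder_neqE_linordered_idom)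
  qed
  have y0: "0 < y0" using h1[of x0] by (simp add: y0_def)
  have d\<phi>: "(\<phi> has_real_derivative \<phi> y * (1 / (c + \<theta> (\<phi> y))) / y) (at y)" if y: "y0 < y" for y
  proof -
    have cont: "isCont \<phi> (h (\<phi> y))"
    proof (rule isCont_inverse_function2[where f = h and g = \<phi> and a = "(x0 + \<phi> y) / 2" and b = "\<phi> y + 1" and x = "\<phi> y"])
      show "(x0 + \<phi> y) / 2 < \<phi> y" "\<phi> y < \<phi> y + 1" using \<phi>[OF y] by auto
      fix z assume "(x0 + \<phi> y) / 2 \<le> z"
      then have "x0 < z" using \<phi>[OF y] by auto
      then show "\<phi> (h z) = z" "isCont h z" using \<phi>_h dh by (auto intro: DERIV_isCont)
    qed
    have "(\<phi> has_real_derivative inverse (h (\<phi> y) * (c + \<theta> (\<phi> y)) / \<phi> y)) (at y)"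
    proof (rule DERIV_inverse_function[where f = h and g = \<phi> and x = y and a = y0 and b = "y + 1"])
      show "(h has_real_derivative h (\<phi> y) * (c + \<theta> (\<phi> y)) / \<phi> y) (at (\<phi> y))" by (rule dh[OF \<phi>(1)[OF y]])
      show "h (\<phi> y) * (c + \<theta> (\<phi> y)) / \<phi> y \<noteq> 0" using \<phi>[OF y] c\<theta>_pos[OF \<phi>(1)[OF y]] y y0 x0 by auto
      show "y0 < y" "y < y + 1" using y by auto
      show "h (\<phi> z) = z" if "y0 < z" for z using \<phi>[OF that] by simp
      show "isCont \<phi> y" using cont \<phi>[OF y] by simp
    qed
    then show ?thesis using \<phi>[OF y] by (simp add: mult.commute)
  qed
  have \<phi>_top: "filterlim \<phi> at_top at_top"
    unfolding filterlim_at_top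
  proof
    fix Z :: real
    define Z' where "Z' = max Z (x0 + 1)"
    have Z': "x0 < Z'" "Z \<le> Z'" by (auto simp: Z'_def)
    have "y0 < h Z'" using h_mono[of x0 Z'] Z' by (simp add: y0_def)
    have "Z \<le> \<phi> y" if y: "h Z' \<le> y" for y
    proof (rule ccontr)
      assume "\<not> Z \<le> \<phi> y"
      then have "\<phi> y < Z'" using Z' by simp
      moreover have "y0 < y" using y \<open>y0 < h Z'\<close> by simp
      ultimately have "h (\<phi> y) < h Z'" using \<phi>(1)[of y] by (intro h_mono) auto
      then show False using \<phi>(2)[OF \<open>y0 < y\<close>] y by simp
    qed
    then show "eventually (\<lambda>y. Z \<le> \<phi> y) at_top" unfolding eventually_at_top_linorder by blast
  qed
  \<comment> \<open>The computation is made in the variable \<open>x = \<phi> y\<close>, where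
    \<open>y * d/dy\<close> becomes \<open>x * \<kappa> x * d/dx\<close>; \<open>P\<close> and
    \<open>Q\<close> are its first and second application to \<open>\<kappa>\<close>.\<close>
  define \<kappa> where "\<kappa> = (\<lambda>x. 1 / (c + \<theta> x))"
  define P where "P = (\<lambda>x. - (x * \<theta>1 x) * \<kappa> x ^ 3)"
  define Q where "Q = (\<lambda>x. (- (x * \<theta>1 x) - x\<^sup>2 * \<theta>2 x) * \<kappa> x ^ 4 + 3 * (x * \<theta>1 x)\<^sup>2 * \<kappa> x ^ 5)"
  have d\<kappa>: "(\<kappa> has_real_derivative - \<theta>1 x * \<kappa> x ^ 2) (at x)" if x: "x0 < x" for x
    unfolding \<kappa>_def using d\<theta>[OF x] c\<theta>_pos[OF x]
    by (auto intro!: derivative_eq_intros simp: power2_eq_square)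
  have dP: "(P has_real_derivative (- \<theta>1 x - x * \<theta>2 x) * \<kappa> x ^ 3 + 3 * x * (\<theta>1 x)\<^sup>2 * \<kappa> x ^ 4) (at x)" if x: "x0 < x" for x
    unfolding P_def using d\<theta>1[OF x] d\<kappa>[OF x]
    by (auto intro!: derivative_eq_intros simp: power2_eq_square power3_eq_cube power4_eq_xxxx algebra_simps)
  have chain: "((\<lambda>y. G (\<phi> y)) has_real_derivative g * (\<phi> y * \<kappa> (\<phi> y) / y)) (at y)"
    if "y0 < y" "(G has_real_derivative g) (at (\<phi> y))" for G g y
    using DERIV_chain2[OF that(2) d\<phi>[OF that(1)]] by (simp add: \<kappa>_def)
  have "((\<lambda>x. 1 / (c + \<theta> x)) \<longlongrightarrow> 1 / (c + 0)) at_top" using c by (intro tendsto_intros \<theta>_lim) simp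
  then have \<kappa>_lim: "(\<kappa> \<longlongrightarrow> 1 / c) at_top" by (simp add: \<kappa>_def)
  have "(P \<longlongrightarrow> - 0 * (1 / c) ^ 3) at_top" unfolding P_def by (intro tendsto_intros \<theta>_lim \<kappa>_lim)
  then have P_lim: "(P \<longlongrightarrow> 0) at_top" by simp
  have "(Q \<longlongrightarrow> (- 0 - 0) * (1 / c) ^ 4 + 3 * 0\<^sup>2 * (1 / c) ^ 5) at_top"
    unfolding Q_def by (intro tendsto_intros \<theta>_lim \<kappa>_lim)
  then have Q_lim: "(Q \<longlongrightarrow> 0) at_top" by simp
  show ?thesis
  proof (rule that[of y0 \<phi> "\<lambda>y. \<kappa> (\<phi> y)" "\<lambda>y. P (\<phi> y)" "\<lambda>y. Q (\<phi> y)"])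
    show "0 < y0" by (rule y0)
    show "h x < h x'" if "x0 \<le> x" "x < x'" for x x' by (rule h_mono[OF that])
    show "((\<lambda>y. \<kappa> (\<phi> y)) \<longlongrightarrow> 1 / c) at_top" "((\<lambda>y. P (\<phi> y)) \<longlongrightarrow> 0) at_top" "((\<lambda>y. Q (\<phi> y)) \<longlongrightarrow> 0) at_top"
      using filterlim_compose[OF _ \<phi>_top] \<kappa>_lim P_lim Q_lim by blast+
  next
    fix y assume y: "y0 < y"
    note x = \<phi>(1)[OF y]
    show "x0 < \<phi> y \<and> h (\<phi> y) = y" using \<phi>[OF y] by simp
    show "0 < \<kappa> (\<phi> y)" using c\<theta>_pos[OF x] by (simp add: \<kappa>_def)
    show "(\<phi> has_real_derivative \<phi> y * \<kappa> (\<phi> y) / y) (at y)" using d\<phi>[OF y] by (simp add: \<kappa>_def)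
    have "- \<theta>1 x * \<kappa> x ^ 2 * (x * \<kappa> x / y) = P x / y" for x
      by (simp add: P_def power2_eq_square power3_eq_cube)
    then show "((\<lambda>y. \<kappa> (\<phi> y)) has_real_derivative P (\<phi> y) / y) (at y)" using chain[OF y d\<kappa>[OF x]] by simp
    have "((- \<theta>1 x - x * \<theta>2 x) * \<kappa> x ^ 3 + 3 * x * (\<theta>1 x)\<^sup>2 * \<kappa> x ^ 4) * (x * \<kappa> x) = Q x" for x
      unfolding Q_def by algebra
    then have "((- \<theta>1 x - x * \<theta>2 x) * \<kappa> x ^ 3 + 3 * x * (\<theta>1 x)\<^sup>2 * \<kappa> x ^ 4) * (x * \<kappa> x / y) = Q x / y" for x
      by (simp only: times_divide_eq_right)
    then show "((\<lambda>y. P (\<phi> y)) has_real_derivative Q (\<phi> y) / y) (at y)" using chain[OF y dP[OF x]] by (simp only:)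
  qed
qed

text \<open>\<open>D\<close> is the derivative of \<open>\<phi>\<close> and \<open>s\<close> its
  logarithmic rate of decay, so \<open>D\<close> behaves like \<open>y powr (- \<sigma>)\<close> up
  to a slowly varying factor. The hypotheses of the locale on differences are derived from
  statements about \<open>D\<close> by mean value theorems.\<close>

lemma regular_floor_set_of_decay:
  fixes \<phi> D s u v :: "real \<Rightarrow> real"
  assumes \<sigma>: "0 < \<sigma>" "\<sigma> < 1 / 30"
    and d\<phi>: "\<And>y. y0 < y \<Longrightarrow> (\<phi> has_real_derivative D y) (at y)"
    and dD: "\<And>y. y0 < y \<Longrightarrow> (D has_real_derivative - (D y * s y / y)) (at y)"
    and ds: "\<And>y. y0 < y \<Longrightarrow> (s has_real_derivative u y / y) (at y)"
    and D_pos: "\<And>y. y0 < y \<Longrightarrow> 0 < D y"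
    and \<phi>_eq: "\<And>y. y0 < y \<Longrightarrow> \<phi> y = y * D y * v y"
    and s_lim: "(s \<longlongrightarrow> \<sigma>) at_top" and u_lim: "(u \<longlongrightarrow> 0) at_top" and v_lim: "(v \<longlongrightarrow> 1 / (1 - \<sigma>)) at_top"
    and mem: "\<And>n. y0 < real n \<Longrightarrow> n \<in> E \<longleftrightarrow> (\<exists>m::int. \<phi> (real n) \<le> of_int m \<and> of_int m < \<phi> (real (Suc n)))"
  shows "\<exists>n0. regular_floor_set (\<lambda>n. \<phi> (real n)) (\<sigma> / 100) n0 E"
proof -
  \<comment> \<open>Strictly between \<open>\<sigma>\<close> and 1/30: \<open>s < \<tau>\<close>
    bounds \<open>D\<close> below by a constant times \<open>y powr (- \<tau>)\<close>, and the
    power left over absorbs the constant.\<close>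
  define \<tau> where "\<tau> = (\<sigma> + 1 / 30) / 2"
  have \<tau>: "\<sigma> < \<tau>" "\<tau> < 1 / 30" using \<sigma> by (simp_all add: \<tau>_def)
  have gt1: "1 < 1 / (1 - \<sigma>)" "1 / (1 - \<sigma>) < 3 / 2" using \<sigma> by (simp_all add: field_simps)
  have "eventually (\<lambda>y. \<sigma> / 2 < s y \<and> s y < \<tau> \<and> u y < \<sigma> / 4 \<and> 1 < v y \<and> v y < 3 / 2 \<and> y0 < y \<and> 1 < y) at_top"
    by (intro eventually_conj order_tendstoD[OF s_lim] order_tendstoD[OF u_lim] order_tendstoD[OF v_lim] eventually_gt_at_top)
       (use \<sigma> \<tau> gt1 in auto)
  then obtain Y where Y: "\<And>y. Y \<le> y \<Longrightarrow> \<sigma> / 2 < s y \<and> s y < \<tau> \<and> u y < \<sigma> / 4 \<and> 1 < v y \<and> v y < 3 / 2 \<and> y0 < y \<and> 1 < y"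
    unfolding eventually_at_top_linorder by blast
  have D0: "0 < D y" and y1: "1 < y" "y0 < y" "0 < y" and s_bd: "\<sigma> / 2 < s y" "s y < \<tau>" "s y < 1 / 30" and u_bd: "u y < \<sigma> / 4" if "Y \<le> y" for y
    using Y[OF that] \<tau> D_pos[of y] by auto
  have D_anti: "D z \<le> D y" if "Y \<le> y" "y \<le> z" for y z
  proof (rule DERIV_nonpos_imp_nonincreasing[OF that(2)])
    fix t assume t: "y \<le> t" "t \<le> z"
    then have "Y \<le> t" using that by simp
    then have "- (D t * s t / t) \<le> 0" using D0[of t] s_bd[of t] y1[of t] \<sigma> by simp
    then show "\<exists>w. (D has_real_derivative w) (at t) \<and> w \<le> 0" using dD[OF y1(2)[OF \<open>Y \<le> t\<close>]] by blast
  qed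
  have D_low: "D y * (1 - (z - y) / (30 * y)) \<le> D z" if "Y \<le> y" "y \<le> z" for y z
  proof -
    define c where "c = D y * (1 / 30) / y"
    have "D y + c * y \<le> D z + c * z"
    proof (rule DERIV_nonneg_imp_nondecreasing[OF that(2), of "\<lambda>t. D t + c * t"])
      fix t assume t: "y \<le> t" "t \<le> z"
      then have Yt: "Y \<le> t" using that by simp
      have "D t * s t / t \<le> c" unfolding c_def
        using D_anti[OF that(1) t(1)] D0[OF Yt] D0[OF that(1)] s_bd[OF Yt] y1[OF that(1)] t \<sigma>
        by (intro frac_le mult_mono mult_nonneg_nonneg) auto
      moreover have "((\<lambda>t. D t + c * t) has_real_derivative - (D t * s t / t) + c) (at t)"
        using dD[OF y1(2)[OF Yt]] by (auto intro!: derivative_eq_intros)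
      ultimately show "\<exists>w. ((\<lambda>t. D t + c * t) has_real_derivative w) (at t) \<and> 0 \<le> w"
        by (intro exI[of _ "- (D t * s t / t) + c"] conjI) auto
    qed
    moreover have "D y * (1 - (z - y) / (30 * y)) = D y + c * y - c * z"
      using y1[OF that(1)] by (simp add: c_def field_simps)
    ultimately show ?thesis by linarith
  qed
  have D_half: "D y / 2 \<le> D z" if "Y \<le> y" "y \<le> z" "z \<le> 6 * y" for y z
  proof -
    have "(z - y) / (30 * y) \<le> 1 / 2" using that y1[OF that(1)] by (simp add: field_simps)
    then have "D y * (1 / 2) \<le> D y * (1 - (z - y) / (30 * y))" using D0[OF that(1)] by (intro mult_left_mono) auto
    then show ?thesis using D_low[OF that(1,2)] by simp
  qed
  have D_29: "D y * (29 / 30) \<le> D z" if "Y \<le> y" "y \<le> z" "z \<le> y + 1" for y z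
  proof -
    have "(z - y) / (30 * y) \<le> 1 / 30" using that y1[OF that(1)] by (simp add: field_simps)
    then have "D y * (29 / 30) \<le> D y * (1 - (z - y) / (30 * y))" using D0[OF that(1)] by (intro mult_left_mono) auto
    then show ?thesis using D_low[OF that(1,2)] by simp
  qed
  have dln: "((\<lambda>t. ln (D t) + \<alpha> * ln t) has_real_derivative (\<alpha> - s t) / t) (at t)" if "Y \<le> t" for t \<alpha>
    using dD[OF y1(2)[OF that]] D0[OF that] y1[OF that]
    by (auto intro!: derivative_eq_intros simp: diff_divide_distrib)
  have ln_low: "ln (D Y) + \<tau> * ln Y \<le> ln (D y) + \<tau> * ln y" if "Y \<le> y" for y
  proof (rule DERIV_nonneg_imp_nondecreasing[OF that, of "\<lambda>t. ln (D t) + \<tau> * ln t"])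
    fix t assume "Y \<le> t" "t \<le> y"
    then have "0 \<le> (\<tau> - s t) / t" using s_bd[of t] y1[of t] by simp
    then show "\<exists>w. ((\<lambda>t. ln (D t) + \<tau> * ln t) has_real_derivative w) (at t) \<and> 0 \<le> w" using dln[OF \<open>Y \<le> t\<close>] by blast
  qed
  have ln_up: "ln (D y) + \<sigma> / 2 * ln y \<le> ln (D Y) + \<sigma> / 2 * ln Y" if "Y \<le> y" for y
  proof (rule DERIV_nonpos_imp_nonincreasing[OF that, of "\<lambda>t. ln (D t) + \<sigma> / 2 * ln t"])
    fix t assume "Y \<le> t" "t \<le> y"
    then have "(\<sigma> / 2 - s t) / t \<le> 0" using s_bd[of t] y1[of t] by (simp add: divide_nonpos_pos)
    then show "\<exists>w. ((\<lambda>t. ln (D t) + \<sigma> / 2 * ln t) has_real_derivative w) (at t) \<and> w \<le> 0" using dln[OF \<open>Y \<le> t\<close>] by blast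
  qed
  define K1 where "K1 = ln (D Y) + \<tau> * ln Y"
  define K2 where "K2 = ln (D Y) + \<sigma> / 2 * ln Y"
  \<comment> \<open>The first threshold on \<open>ln n\<close> secures the lower bound
    \<open>n powr (- (1/30))\<close> for \<open>d n\<close>, the second its upper bound 1/8.\<close>
  have "eventually (\<lambda>n::nat. Y \<le> real n \<and> (\<tau> - K1) / (1 / 30 - \<tau>) \<le> ln (real n) \<and> (K2 + ln 8) / (\<sigma> / 2) \<le> ln (real n)) sequentially"
  proof (intro eventually_conj)
    have "filterlim (\<lambda>n::nat. ln (real n)) at_top sequentially"
      by (rule filterlim_compose[OF ln_at_top filterlim_real_sequentially])
    then show "eventually (\<lambda>n::nat. (\<tau> - K1) / (1 / 30 - \<tau>) \<le> ln (real n)) sequentially"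
      "eventually (\<lambda>n::nat. (K2 + ln 8) / (\<sigma> / 2) \<le> ln (real n)) sequentially"
      by (simp_all add: filterlim_at_top)
    show "eventually (\<lambda>n::nat. Y \<le> real n) sequentially"
      using filterlim_real_sequentially by (simp add: filterlim_at_top)
  qed
  then obtain n0 :: nat where n0: "\<And>n. n0 \<le> n \<Longrightarrow> Y \<le> real n \<and> (\<tau> - K1) / (1 / 30 - \<tau>) \<le> ln (real n) \<and> (K2 + ln 8) / (\<sigma> / 2) \<le> ln (real n)"
    unfolding eventually_sequentially by blast
  have nY: "Y \<le> real n" "0 < real n" "1 < real n" if "n0 \<le> n" for n using n0[OF that] y1[of "real n"] by auto
  define d where "d = (\<lambda>n. \<phi> (real (Suc n)) - \<phi> (real n))"
  have d_mvt: "\<exists>\<xi>. real n < \<xi> \<and> \<xi> < real n + 1 \<and> d n = D \<xi>" if n: "n0 \<le> n" for n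
  proof -
    have "\<exists>\<xi>>real n. \<xi> < real n + 1 \<and> \<phi> (real n + 1) - \<phi> (real n) = (real n + 1 - real n) * D \<xi>"
    proof (rule MVT2)
      fix t assume "real n \<le> t"
      then have "Y \<le> t" using nY[OF n] by simp
      then show "(\<phi> has_real_derivative D t) (at t)" by (intro d\<phi> y1)
    qed simp
    then show ?thesis by (auto simp: d_def add.commute)
  qed
  have d_bounds: "D (real n + 1) \<le> d n" "d n \<le> D (real n)" "0 < d n" if n: "n0 \<le> n" for n
  proof -
    obtain \<xi> where \<xi>: "real n < \<xi>" "\<xi> < real n + 1" "d n = D \<xi>" using d_mvt[OF n] by blast
    then show "D (real n + 1) \<le> d n" "d n \<le> D (real n)" "0 < d n"
      using D_anti[of "real n" \<xi>] D_anti[of \<xi> "real n + 1"] D0[of \<xi>] nY[OF n] by auto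
  qed
  have D_le_d: "D (real n) * (29 / 30) \<le> d n" if n: "n0 \<le> n" for n
    using D_29[OF nY(1)[OF n], of "real n + 1"] d_bounds[OF n] by simp
  have dd: "\<exists>w. real n < w \<and> w < real n + 2 \<and> d n - d (Suc n) = D w * s w / w" if n: "n0 \<le> n" for n
  proof -
    have "\<exists>z>real n. z < real n + 1 \<and> (\<phi> (real n + 1 + 1) - \<phi> (real n + 1)) - (\<phi> (real n + 1) - \<phi> (real n)) = (real n + 1 - real n) * (D (z + 1) - D z)"
    proof (rule MVT2[of "real n" "real n + 1" "\<lambda>t. \<phi> (t + 1) - \<phi> t"])
      fix t assume "real n \<le> t"
      then have t: "Y \<le> t" "Y \<le> t + 1" using nY[OF n] by auto
      have "((\<lambda>t. \<phi> (t + 1)) has_real_derivative D (t + 1)) (at t)"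
        using d\<phi>[OF y1(2)[OF t(2)]] by (simp add: DERIV_shift)
      then show "((\<lambda>t. \<phi> (t + 1) - \<phi> t) has_real_derivative D (t + 1) - D t) (at t)"
        using d\<phi>[OF y1(2)[OF t(1)]] by (intro DERIV_diff)
    qed simp
    then obtain z where z: "real n < z" "z < real n + 1" "d (Suc n) - d n = D (z + 1) - D z"
      by (auto simp: d_def add_ac)
    have "\<exists>w>z. w < z + 1 \<and> D (z + 1) - D z = (z + 1 - z) * (- (D w * s w / w))"
    proof (rule MVT2)
      fix t assume "z \<le> t"
      then have "Y \<le> t" using nY[OF n] z by simp
      then show "(D has_real_derivative - (D t * s t / t)) (at t)" by (intro dD y1)
    qed simp
    then obtain w where "z < w" "w < z + 1" "D (z + 1) - D z = - (D w * s w / w)" by auto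
    then show ?thesis using z by (intro exI[of _ w]) auto
  qed
  \<comment> \<open>The right hand side is the logarithmic derivative of
    \<open>D (t + x) / D t\<close>. It is bounded below because \<open>s r / r\<close> has
    derivative \<open>(u r - s r) / r\<^sup>2\<close>, at most
    \<open>- \<sigma> / 4 / r\<^sup>2\<close>.\<close>
  have m_diff: "\<sigma> / 4 * x / (5 * N)\<^sup>2 \<le> s t / t - s (t + x) / (t + x)"
    if t: "Y \<le> t" "0 \<le> x" "t + x \<le> 5 * N" "0 < N" for t x N
  proof -
    define k where "k = \<sigma> / 4 / (5 * N)\<^sup>2"
    have "s t / t + k * t \<ge> s (t + x) / (t + x) + k * (t + x)"
    proof (rule DERIV_nonpos_imp_nonincreasing[of t "t + x" "\<lambda>r. s r / r + k * r"])
      fix r assume r: "t \<le> r" "r \<le> t + x"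
      then have Yr: "Y \<le> r" using t by simp
      note r1 = y1[OF Yr]
      have "k \<le> \<sigma> / 4 / r\<^sup>2" unfolding k_def using r r1 t \<sigma> by (intro divide_left_mono power_mono mult_pos_pos) auto
      also have "\<dots> \<le> (s r - u r) / r\<^sup>2" using s_bd[OF Yr] u_bd[OF Yr] by (intro divide_right_mono) auto
      finally have "(u r - s r) / r\<^sup>2 + k \<le> 0" by (simp add: diff_divide_distrib)
      moreover have "((\<lambda>r. s r / r + k * r) has_real_derivative (u r - s r) / r\<^sup>2 + k) (at r)"
        using ds[OF r1(2)] r1 by (auto intro!: derivative_eq_intros simp: field_simps power2_eq_square)
      ultimately show "\<exists>w. ((\<lambda>r. s r / r + k * r) has_real_derivative w) (at r) \<and> w \<le> 0" by blast
    qed (use t in simp)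
    moreover have "\<sigma> / 4 * x / (5 * N)\<^sup>2 = k * x" "k * x = k * (t + x) - k * t" by (simp add: k_def) (simp add: algebra_simps)
    ultimately show ?thesis by linarith
  qed
  \<comment> \<open>Cauchy's mean value theorem: numerator and denominator are increments over steps
    of length 1 and are evaluated at a common point.\<close>
  have ratio_mvt: "\<exists>\<xi>. real n < \<xi> \<and> \<xi> < real n + 1 \<and> d (n + x) / d n = D (\<xi> + real x) / D \<xi>" if n: "n0 \<le> n" for n x
  proof -
    have "\<exists>\<xi>>real n. \<xi> < real n + 1 \<and> (d n * \<phi> (real n + 1 + real x) - d (n + x) * \<phi> (real n + 1)) - (d n * \<phi> (real n + real x) - d (n + x) * \<phi> (real n))
       = (real n + 1 - real n) * (d n * D (\<xi> + real x) - d (n + x) * D \<xi>)"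
    proof (rule MVT2[of "real n" "real n + 1" "\<lambda>t. d n * \<phi> (t + real x) - d (n + x) * \<phi> t"])
      fix t assume "real n \<le> t"
      then have t: "Y \<le> t" "Y \<le> t + real x" using nY[OF n] by auto
      have "((\<lambda>t. \<phi> (t + real x)) has_real_derivative D (t + real x)) (at t)"
        using d\<phi>[OF y1(2)[OF t(2)]] by (simp add: DERIV_shift)
      then show "((\<lambda>t. d n * \<phi> (t + real x) - d (n + x) * \<phi> t) has_real_derivative d n * D (t + real x) - d (n + x) * D t) (at t)"
        using d\<phi>[OF y1(2)[OF t(1)]] by (intro DERIV_diff DERIV_cmult)
    qed simp
    then obtain \<xi> where \<xi>: "real n < \<xi>" "\<xi> < real n + 1"
      and eq: "(d n * \<phi> (real n + 1 + real x) - d (n + x) * \<phi> (real n + 1)) - (d n * \<phi> (real n + real x) - d (n + x) * \<phi> (real n))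
       = d n * D (\<xi> + real x) - d (n + x) * D \<xi>" by auto
    have "\<phi> (real n + 1 + real x) = \<phi> (real n + real x) + d (n + x)" "\<phi> (real n + 1) = \<phi> (real n) + d n"
      by (simp_all add: d_def add_ac)
    then have "d n * D (\<xi> + real x) = d (n + x) * D \<xi>" using eq by (simp add: algebra_simps)
    moreover have "0 < D \<xi>" using D0[of \<xi>] \<xi> nY[OF n] by simp
    ultimately have "d (n + x) / d n = D (\<xi> + real x) / D \<xi>" using d_bounds(3)[OF n] by (simp add: field_simps)
    then show ?thesis using \<xi> by blast
  qed
  have real_le: "real n \<le> 4 * real N" if "n \<le> 4 * N" for n N using that by linarith
  have "regular_floor_set (\<lambda>n. \<phi> (real n)) (\<sigma> / 100) n0 E"
    unfolding regular_floor_set_def d_def[THEN fun_cong, symmetric]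
  proof (intro conjI allI impI)
    show "1 \<le> n0" using nY(2)[OF order_refl] by simp
    show "0 < \<sigma> / 100" "\<sigma> / 100 \<le> 1" using \<sigma> by simp_all
  next
    fix n assume n: "n0 \<le> n"
    show "0 < d n" using d_bounds[OF n] by simp
    have "(K2 + ln 8) \<le> \<sigma> / 2 * ln (real n)" using n0[OF n] \<sigma> by (simp add: field_simps)
    then have "ln (D (real n)) \<le> ln (1 / 8)" using ln_up[OF nY(1)[OF n]] unfolding K2_def by (simp add: ln_div)
    then have "D (real n) \<le> 1 / 8" using D0[OF nY(1)[OF n]] by (subst (asm) ln_le_cancel_iff) auto
    then show "d n \<le> 1 / 8" using d_bounds[OF n] by simp
    have "\<tau> - K1 \<le> (1 / 30 - \<tau>) * ln (real n)" using n0[OF n] \<tau> by (simp add: field_simps)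
    moreover have "ln (real n + 1) \<le> ln (real n) + 1"
    proof -
      have "ln (real n + 1) - ln (real n) \<le> (real n + 1 - real n) / real n" using nY[OF n] by (intro ln_diff_le) auto
      also have "\<dots> \<le> 1" using nY[OF n] by simp
      finally show ?thesis by simp
    qed
    then have "\<tau> * ln (real n + 1) \<le> \<tau> * (ln (real n) + 1)" using \<sigma> \<tau> by (intro mult_left_mono) auto
    moreover have "K1 \<le> ln (D (real n + 1)) + \<tau> * ln (real n + 1)" unfolding K1_def using nY[OF n] by (intro ln_low) auto
    ultimately have "- (1 / 30) * ln (real n) \<le> ln (D (real n + 1))" by (simp add: algebra_simps)
    then have "exp (- (1 / 30) * ln (real n)) \<le> exp (ln (D (real n + 1)))" by simp
    moreover have "0 < D (real n + 1)" using D0[of "real n + 1"] nY[OF n] by simp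
    ultimately have "real n powr (- (1 / 30)) \<le> D (real n + 1)" using nY[OF n] by (simp add: powr_def)
    then show "real n powr (- (1 / 30)) \<le> d n" using d_bounds[OF n] by simp
    have v: "1 \<le> v (real n)" "v (real n) \<le> 3 / 2" using Y[OF nY(1)[OF n]] by auto
    have nD: "0 \<le> real n * D (real n)" using D0[OF nY(1)[OF n]] nY[OF n] by simp
    have eq: "\<phi> (real n) = real n * D (real n) * v (real n)" using nY[OF n] by (intro \<phi>_eq y1)
    have "real n * d n / 4 \<le> real n * d n" using d_bounds(3)[OF n] by simp
    also have "\<dots> \<le> real n * D (real n) * 1" using d_bounds(2)[OF n] by (simp add: mult_left_mono)
    also have "\<dots> \<le> \<phi> (real n)" unfolding eq using v nD by (intro mult_left_mono) auto
    finally show "real n * d n / 4 \<le> \<phi> (real n)" .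
    have "\<phi> (real n) \<le> real n * D (real n) * (3 / 2)" unfolding eq using v nD by (intro mult_left_mono) auto
    also have "\<dots> \<le> 2 * (real n * (D (real n) * (29 / 30)))" using nD by simp
    also have "\<dots> \<le> 2 * (real n * d n)" using D_le_d[OF n] by (intro mult_left_mono) auto
    finally show "\<phi> (real n) \<le> 2 * real n * d n" by simp
    show "n \<in> E \<longleftrightarrow> (\<exists>m::int. \<phi> (real n) \<le> of_int m \<and> of_int m < \<phi> (real (Suc n)))"
      using nY[OF n] by (intro mem y1)
  next
    fix N n assume N: "n0 \<le> N" and n: "N \<le> n" "n \<le> 4 * N"
    have n': "n0 \<le> n" using N n by simp
    note NY = nY[OF N]
    have "D (real N) / 2 \<le> D (real n + 1)" using D_half[OF NY(1), of "real n + 1"] real_le[OF n(2)] n NY by simp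
    then show "d N \<le> 2 * d n" using d_bounds(1)[OF n'] d_bounds(2)[OF N] by linarith
    obtain w where w: "real n < w" "w < real n + 2" "d n - d (Suc n) = D w * s w / w" using dd[OF n'] by blast
    have w': "real N \<le> w" "w \<le> 6 * real N" using w n real_le[OF n(2)] NY by auto
    have Yw: "Y \<le> w" using w' NY by simp
    have lo: "d N / 2 \<le> D w" using D_half[OF NY(1) w'] d_bounds(2)[OF N] by linarith
    have "\<sigma> / 100 * d N / real N \<le> (d N / 2 * (\<sigma> / 2)) / (6 * real N)" using \<sigma> NY d_bounds(3)[OF N] by (simp add: field_simps)
    also have "\<dots> \<le> D w * s w / w"
      using lo s_bd[OF Yw] w' \<sigma> d_bounds(3)[OF N] D0[OF Yw] y1[OF Yw] by (intro frac_le mult_mono mult_nonneg_nonneg) auto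
    finally show "\<sigma> / 100 * d N / real N \<le> d n - d (Suc n)" using w(3) by simp
    have "D w \<le> D (real N)" using D_anti[OF NY(1) w'(1)] .
    then have hi: "D w \<le> 2 * d N" using D_le_d[OF N] D0[OF NY(1)] by linarith
    have "D w * s w / w \<le> (2 * d N * (1 / 30)) / real N"
      using hi s_bd[OF Yw] w' \<sigma> d_bounds(3)[OF N] D0[OF Yw] y1[OF Yw] NY by (intro frac_le mult_mono mult_nonneg_nonneg) auto
    also have "\<dots> \<le> d N / real N" using d_bounds(3)[OF N] NY by (intro divide_right_mono) auto
    finally show "d n - d (Suc n) \<le> d N / real N" using w(3) by simp
  next
    fix N n n' x assume N: "n0 \<le> N" and n: "N \<le> n" "n < n'" "n' + x \<le> 4 * N"
    note NY = nY[OF N]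
    obtain \<xi> where \<xi>: "real n < \<xi>" "\<xi> < real n + 1" "d (n + x) / d n = D (\<xi> + real x) / D \<xi>"
      using ratio_mvt[of n x] N n by auto
    obtain \<xi>' where \<xi>': "real n' < \<xi>'" "\<xi>' < real n' + 1" "d (n' + x) / d n' = D (\<xi>' + real x) / D \<xi>'"
      using ratio_mvt[of n' x] N n by auto
    \<comment> \<open>The origin of \<open>\<sigma> / 100\<close>: it is \<open>\<sigma> / 4\<close>
      divided by \<open>5\<^sup>2\<close>, the points in question reaching up to
      \<open>5 * N\<close>.\<close>
    define k where "k = \<sigma> / 4 * real x / (5 * real N)\<^sup>2"
    have k: "0 \<le> k" "\<sigma> / 100 * real x / (real N)\<^sup>2 = k" using \<sigma> by (simp_all add: k_def power_mult_distrib)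
    have le: "\<xi> \<le> \<xi>'" using \<xi> \<xi>' n by linarith
    have top: "\<xi>' + real x \<le> 5 * real N"
    proof -
      have "real n' + real x \<le> 4 * real N" using real_le[OF n(3)] by simp
      then show ?thesis using \<xi>' NY by linarith
    qed
    have "ln (D (\<xi> + real x)) - ln (D \<xi>) - k * \<xi> \<le> ln (D (\<xi>' + real x)) - ln (D \<xi>') - k * \<xi>'"
    proof (rule DERIV_nonneg_imp_nondecreasing[OF le, of "\<lambda>t. ln (D (t + real x)) - ln (D t) - k * t"])
      fix t assume t: "\<xi> \<le> t" "t \<le> \<xi>'"
      have Yt: "Y \<le> t" "Y \<le> t + real x" using t \<xi> n NY by auto
      have ln_D: "((\<lambda>t. ln (D t)) has_real_derivative - (s t / t)) (at t)" if "Y \<le> t" for t using dln[OF that, of 0] by simp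
      have "((\<lambda>t. ln (D (t + real x))) has_real_derivative - (s (t + real x) / (t + real x))) (at t)"
        using ln_D[OF Yt(2)] by (simp add: DERIV_shift)
      then have "((\<lambda>t. ln (D (t + real x)) - ln (D t) - k * t) has_real_derivative - (s (t + real x) / (t + real x)) - (- (s t / t)) - k) (at t)"
        using DERIV_diff[OF DERIV_diff[OF _ ln_D[OF Yt(1)]] DERIV_cmult_Id] by blast
      moreover have "k \<le> s t / t - s (t + real x) / (t + real x)"
        unfolding k_def using Yt t top NY by (intro m_diff) auto
      ultimately show "\<exists>w. ((\<lambda>t. ln (D (t + real x)) - ln (D t) - k * t) has_real_derivative w) (at t) \<and> 0 \<le> w"
        by (intro exI[of _ "- (s (t + real x) / (t + real x)) - (- (s t / t)) - k"] conjI) auto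
    qed
    \<comment> \<open>The intermediate points are known only up to the unit intervals starting at
      \<open>n\<close> and \<open>n'\<close>; this is the 1 lost in \<open>ratio\<close>.\<close>
    moreover have "k * (real n' - real n - 1) \<le> k * (\<xi>' - \<xi>)" using \<xi> \<xi>' k by (intro mult_left_mono) auto
    ultimately have L: "k * (real n' - real n - 1) \<le> ln (D (\<xi>' + real x)) - ln (D \<xi>') - (ln (D (\<xi> + real x)) - ln (D \<xi>))"
      by (simp add: right_diff_distrib)
    have pos: "0 < D \<xi>" "0 < D \<xi>'" "0 < D (\<xi> + real x)" "0 < D (\<xi>' + real x)"
      using \<xi> \<xi>' n NY by (auto intro!: D0)
    have "1 + k * (real n' - real n - 1) \<le> exp (k * (real n' - real n - 1))" by (rule exp_ge_add_one_self)
    also have "\<dots> \<le> exp (ln (D (\<xi>' + real x)) - ln (D \<xi>') - (ln (D (\<xi> + real x)) - ln (D \<xi>)))" using L by simp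
    also have "\<dots> = (D (\<xi>' + real x) / D \<xi>') / (D (\<xi> + real x) / D \<xi>)" using pos by (simp add: exp_diff)
    finally have le: "1 + k * (real n' - real n - 1) \<le> (D (\<xi>' + real x) / D \<xi>') / (D (\<xi> + real x) / D \<xi>)" .
    have "0 < D (\<xi> + real x) / D \<xi>" using pos by simp
    from iffD1[OF pos_le_divide_eq[OF this] le]
    have "(D (\<xi> + real x) / D \<xi>) * (1 + k * (real n' - real n - 1)) \<le> D (\<xi>' + real x) / D \<xi>'"
      by (subst mult.commute)
    moreover have "\<sigma> / 100 * (real n' - real n - 1) * real x / (real N)\<^sup>2 = k * (real n' - real n - 1)"
      unfolding k(2)[symmetric] by simp
    ultimately show "d (n + x) / d n * (1 + \<sigma> / 100 * (real n' - real n - 1) * real x / (real N)\<^sup>2) \<le> d (n' + x) / d n'"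
      unfolding \<xi>(3) \<xi>'(3) by simp
  qed
  then show ?thesis ..
qed

text \<open>For \<open>D = \<phi> * b / y\<close> the quantity \<open>y * D' / D\<close> is
  \<open>b + p / b - 1\<close>, which is \<open>- s\<close> and tends to \<open>1 / c - 1\<close>.
  The bound \<open>c < 30 / 29\<close> says exactly that \<open>\<sigma> = 1 - 1 / c\<close> is
  below 1/30.\<close>

lemma regular_floor_set_floor_values:
  assumes c: "1 < c" "c < 30 / 29" and F: "family_F c x0 h"
  shows "\<exists>\<phi> a n0. regular_floor_set \<phi> a n0 (floor_values x0 h)"
proof -
  have x0: "1 \<le> x0" using F by (simp add: family_F_def)
  obtain y0 and \<phi> b p q :: "real \<Rightarrow> real" where y0: "0 < y0"
    and \<phi>: "\<And>y. y0 < y \<Longrightarrow> x0 < \<phi> y \<and> h (\<phi> y) = y" and b: "\<And>y. y0 < y \<Longrightarrow> 0 < b y"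
    and d\<phi>: "\<And>y. y0 < y \<Longrightarrow> (\<phi> has_real_derivative \<phi> y * b y / y) (at y)"
    and db: "\<And>y. y0 < y \<Longrightarrow> (b has_real_derivative p y / y) (at y)"
    and dp: "\<And>y. y0 < y \<Longrightarrow> (p has_real_derivative q y / y) (at y)"
    and lim: "(b \<longlongrightarrow> 1 / c) at_top" "(p \<longlongrightarrow> 0) at_top" "(q \<longlongrightarrow> 0) at_top"
    and h_mono: "\<And>x x'. x0 \<le> x \<Longrightarrow> x < x' \<Longrightarrow> h x < h x'"
    by (rule family_F_inverse[OF c(1) F], rule that)
  define \<sigma> where "\<sigma> = 1 - 1 / c"
  define D where "D = (\<lambda>y. \<phi> y * b y / y)"
  define s where "s = (\<lambda>y. 1 - b y - p y / b y)"
  define u where "u = (\<lambda>y. - p y - (q y * b y - p y * p y) / (b y * b y))"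
  have "\<exists>n0. regular_floor_set (\<lambda>n. \<phi> (real n)) (\<sigma> / 100) n0 (floor_values x0 h)"
  proof (rule regular_floor_set_of_decay[where ?y0.0 = y0 and D = D and s = s and u = u and v = "\<lambda>y. 1 / b y"])
    show "0 < \<sigma>" "\<sigma> < 1 / 30" using c by (simp_all add: \<sigma>_def field_simps)
    have "(s \<longlongrightarrow> 1 - 1 / c - 0 / (1 / c)) at_top" unfolding s_def using c by (intro tendsto_intros lim) auto
    then show "(s \<longlongrightarrow> \<sigma>) at_top" by (simp add: \<sigma>_def)
    have "(u \<longlongrightarrow> - 0 - (0 * (1 / c) - 0 * 0) / ((1 / c) * (1 / c))) at_top"
      unfolding u_def using c by (intro tendsto_intros lim) auto
    then show "(u \<longlongrightarrow> 0) at_top" by simp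
    have "((\<lambda>y. 1 / b y) \<longlongrightarrow> 1 / (1 / c)) at_top" using c by (intro tendsto_intros lim) auto
    then show "((\<lambda>y. 1 / b y) \<longlongrightarrow> 1 / (1 - \<sigma>)) at_top" by (simp add: \<sigma>_def)
  next
    fix y assume y: "y0 < y"
    have pos: "0 < y" "0 < b y" "0 < \<phi> y" using y y0 b[OF y] \<phi>[OF y] x0 by auto
    show "(\<phi> has_real_derivative D y) (at y)" unfolding D_def by (rule d\<phi>[OF y])
    show "0 < D y" using pos by (simp add: D_def)
    show "\<phi> y = y * D y * (1 / b y)" using pos by (simp add: D_def)
    have "(D has_real_derivative ((\<phi> y * b y / y * b y + p y / y * \<phi> y) * y - \<phi> y * b y * 1) / (y * y)) (at y)"
      unfolding D_def using pos by (intro DERIV_divide DERIV_mult d\<phi>[OF y] db[OF y] DERIV_ident) auto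
    moreover have "((\<phi> y * b y / y * b y + p y / y * \<phi> y) * y - \<phi> y * b y * 1) / (y * y) = - (D y * s y / y)"
      unfolding D_def s_def using pos by (simp add: field_simps)
    ultimately show "(D has_real_derivative - (D y * s y / y)) (at y)" by (simp only:)
    have "(s has_real_derivative 0 - p y / y - (q y / y * b y - p y * (p y / y)) / (b y * b y)) (at y)"
      unfolding s_def using pos by (intro DERIV_divide DERIV_diff dp[OF y] db[OF y] DERIV_const) auto
    moreover have "0 - p y / y - (q y / y * b y - p y * (p y / y)) / (b y * b y) = u y / y"
      unfolding u_def using pos by (simp add: field_simps)
    ultimately show "(s has_real_derivative u y / y) (at y)" by (simp only:)
  next
    fix n :: nat assume n: "y0 < real n"
    have n': "y0 < real (Suc n)" using n by simp
    have h_less: "h x < h x'" if "x < x'" "x0 \<le> x" for x x' using h_mono that by blast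
    have h_le: "h x \<le> h x'" if "x \<le> x'" "x0 \<le> x" for x x' using h_less[of x x'] that by (cases "x = x'") auto
    note \<phi>n = \<phi>[OF n, THEN conjunct1] \<phi>[OF n, THEN conjunct2]
    note \<phi>Sn = \<phi>[OF n', THEN conjunct1] \<phi>[OF n', THEN conjunct2]
    \<comment> \<open>\<open>n = \<lfloor>h m\<rfloor>\<close> means \<open>n \<le> h m\<close> and
      \<open>h m < n + 1\<close>, which the increasing inverse turns into
      \<open>\<phi> n \<le> m\<close> and \<open>m < \<phi> (n + 1)\<close>.\<close>
    show "n \<in> floor_values x0 h \<longleftrightarrow> (\<exists>m::int. \<phi> (real n) \<le> of_int m \<and> of_int m < \<phi> (real (Suc n)))"
    proof
      assume "n \<in> floor_values x0 h"
      then obtain m :: nat where m: "x0 \<le> real m" "int n = \<lfloor>h (real m)\<rfloor>" unfolding floor_values_def by blast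
      then have hm: "real n \<le> h (real m)" "h (real m) < real n + 1" by linarith+
      have "\<phi> (real n) \<le> real m" using h_less[of "real m" "\<phi> (real n)"] m hm \<phi>n by (cases "\<phi> (real n) \<le> real m") auto
      moreover have "real m < \<phi> (real (Suc n))"
        using h_le[of "\<phi> (real (Suc n))" "real m"] hm \<phi>Sn by (cases "real m < \<phi> (real (Suc n))") auto
      ultimately show "\<exists>m::int. \<phi> (real n) \<le> of_int m \<and> of_int m < \<phi> (real (Suc n))" by (intro exI[of _ "int m"]) simp
    next
      assume "\<exists>m::int. \<phi> (real n) \<le> of_int m \<and> of_int m < \<phi> (real (Suc n))"
      then obtain m :: int where m: "\<phi> (real n) \<le> of_int m" "of_int m < \<phi> (real (Suc n))" by blast
      define k where "k = nat m"
      have "0 < m" using m(1) \<phi>n(1) x0 by linarith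
      then have k: "real k = of_int m" "1 \<le> k" by (auto simp: k_def)
      have k0: "x0 \<le> real k" using m \<phi>n k by simp
      have "real n \<le> h (real k)" using h_le[of "\<phi> (real n)" "real k"] m \<phi>n k by simp
      moreover have "h (real k) < real n + 1" using h_less[of "real k" "\<phi> (real (Suc n))"] m \<phi>Sn k k0 by simp
      ultimately have "int n = \<lfloor>h (real k)\<rfloor>" by linarith
      moreover have "1 \<le> n" using n y0 by (cases n) auto
      ultimately show "n \<in> floor_values x0 h" unfolding floor_values_def using k(2) k0 by blast
    qed
  qed
  then show ?thesis by blast
qed

section \<open>Conclusion for complex functions and the averages over the floor values\<close>

lemma invertible_measure_preserving_measure_preserving:
  assumes "invertible_measure_preserving M T"
  shows "measure_preserving M T"
proof
  show T: "T \<in> measurable M M" using assms by (simp add: invertible_measure_preserving_def)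
  show "distr M M T = M"
  proof (rule measure_eqI)
    fix A assume "A \<in> sets (distr M M T)"
    then show "emeasure (distr M M T) A = emeasure M A"
      using assms T by (simp add: emeasure_distr invertible_measure_preserving_def)
  qed simp
qed

theorem theorem1p14:
  fixes c x0 p :: real and h :: "real \<Rightarrow> real"
    and M :: "'a measure" and T :: "'a \<Rightarrow> 'a" and f :: "'a \<Rightarrow> complex"
  assumes "1 < c" and "c < 30 / 29"
    and "family_F c x0 h"
    and "sigma_finite_measure M"
    and "invertible_measure_preserving M T"
    and "1 \<le> p"
    and "f \<in> Lp_functions M p"
  shows "AE x in M. convergent (\<lambda>N. ergodic_average (floor_values x0 h) T f N x)"
proof -
  define E where "E = floor_values x0 h"
  obtain \<phi> a n0 where "regular_floor_set \<phi> a n0 E"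
    using regular_floor_set_floor_values[OF assms(1-3)] unfolding E_def by blast
  then interpret regular_floor_set \<phi> a n0 E "\<lambda>n. \<phi> (Suc n) - \<phi> n" by simp
  note mp = invertible_measure_preserving_measure_preserving[OF assms(5)]
  have f [measurable]: "f \<in> borel_measurable M" and fp: "integrable M (\<lambda>x. norm (f x) powr p)"
    using assms(7) by (auto simp: Lp_functions_def)
  have part: "AE x in M. convergent (\<lambda>N. full_average T g N x)"
    if [measurable]: "g \<in> borel_measurable M" and g: "\<And>x. \<bar>g x\<bar> \<le> norm (f x)" for g
  proof (rule Lp_convergence[OF mp assms(4) _ _ assms(6)])
    show "integrable M (\<lambda>x. \<bar>g x\<bar> powr p)"
      by (rule Bochner_Integration.integrable_bound[OF fp]) (use g assms(6) in \<open>auto intro!: powr_mono2\<close>)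
  qed fact
  have re: "AE x in M. convergent (\<lambda>N. full_average T (\<lambda>x. Re (f x)) N x)" by (rule part) (auto intro: abs_Re_le_cmod)
  have im: "AE x in M. convergent (\<lambda>N. full_average T (\<lambda>x. Im (f x)) N x)" by (rule part) (auto intro: abs_Im_le_cmod)
  have ratio: "(\<lambda>N. \<phi> (Suc N) / real (card (E \<inter> {..<Suc N}))) \<longlonglongrightarrow> 1"
    using tendsto_inverse[OF LIMSEQ_Suc[OF card_E_asymptotic]] by simp
  show ?thesis using re im
  proof eventually_elim
    case (elim x)
    obtain L1 L2 where L: "(\<lambda>N. full_average T (\<lambda>x. Re (f x)) N x) \<longlonglongrightarrow> L1" "(\<lambda>N. full_average T (\<lambda>x. Im (f x)) N x) \<longlonglongrightarrow> L2"
      using elim unfolding convergent_def by blast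
    define A where "A = (\<lambda>N. Complex (full_average T (\<lambda>x. Re (f x)) (Suc N) x) (full_average T (\<lambda>x. Im (f x)) (Suc N) x))"
    have "A \<longlonglongrightarrow> Complex L1 L2" unfolding A_def by (intro tendsto_Complex LIMSEQ_Suc L)
    then have lim: "(\<lambda>N. A N * of_real (\<phi> (Suc N) / real (card (E \<inter> {..<Suc N})))) \<longlonglongrightarrow> Complex L1 L2 * of_real 1"
      by (intro tendsto_mult tendsto_of_real ratio)
    have "eventually (\<lambda>N. A N * of_real (\<phi> (Suc N) / real (card (E \<inter> {..<Suc N}))) = ergodic_average E T f N x) sequentially"
      using eventually_ge_at_top[of n0]
    proof eventually_elim
      case (elim N)
      have pos: "0 < \<phi> (Suc N)" using phi_pos elim by simp
      \<comment> \<open>Since 0 is not a floor value, the range from 1 to \<open>N\<close> can be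
        replaced by the numbers below \<open>Suc N\<close>; hence the shifted index in
        \<open>A\<close>.\<close>
      have "0 \<notin> E" by (simp add: E_def floor_values_def)
      then have eq: "E \<inter> {1..N} = E \<inter> {..<Suc N}" by (auto simp: Suc_le_eq intro!: gr0I)
      have "A N = (\<Sum>n\<in>E \<inter> {..<Suc N}. f ((T ^^ n) x)) / of_real (\<phi> (Suc N))"
        by (simp add: complex_eq_iff A_def full_average_def)
      then show ?case unfolding ergodic_average_def eq using pos by simp
    qed
    from convergentI[OF Lim_transform_eventually[OF lim this]] show ?case unfolding E_def .
  qed
qed

end
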